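(* The group $G_1=\langle a,t~\|~tat^{-1}=a^{-1}\rangle$ (the fundamental group of the Klein bottle) can be isomorphically embedded into a $2$-generated torsion-free group $Q$ having the property ($4$CC) in such a way that $t$ and $t^{-1}$ are not conjugate in $Q$.
   Context: A group has the property ($4$CC) if it has exactly $4$ conjugacy classes of elements (the class of the identity is counted). $\langle a,t~\|~\dots\rangle$ denotes a presentation of a group by generators and relations. *)

theory Defs
  imports "HOL-Algebra.Algebra"
begin

section \<open>Group presentations\<close>

text \<open>
  A letter \<open>(x, True)\<close> stands for the generator \<open>x\<close> and \<open>(x, False)\<close> for its formal inverse.
  The set of generators is the whole type \<open>'g\<close>.
\<close>

type_synonym 'g word = "('g \<times> bool) list"

definition inv_word :: "'g word \<Rightarrow> 'g word" where
  "inv_word w = rev (map (\<lambda>(x, b). (x, \<not> b)) w)"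

inductive free_equiv :: "'g word \<Rightarrow> 'g word \<Rightarrow> bool" where
  refl: "free_equiv w w"
| sym: "free_equiv u v \<Longrightarrow> free_equiv v u"
| trans: "free_equiv u v \<Longrightarrow> free_equiv v w \<Longrightarrow> free_equiv u w"
| cancel: "free_equiv (u @ [(x, b), (x, \<not> b)] @ v) (u @ v)"

definition free_class :: "'g word \<Rightarrow> 'g word set" where
  "free_class w = {v. free_equiv w v}"

definition free_group :: "'g word set monoid" where
  "free_group =
     \<lparr> carrier = range free_class,
       monoid.mult = (\<lambda>A B. {w. \<exists>u\<in>A. \<exists>v\<in>B. free_equiv (u @ v) w}),
       monoid.one = free_class [] \<rparr>"

definition normal_closure :: "('a, 'b) monoid_scheme \<Rightarrow> 'a set \<Rightarrow> 'a set" where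
  "normal_closure G S =
     generate G {g \<otimes>\<^bsub>G\<^esub> s \<otimes>\<^bsub>G\<^esub> inv\<^bsub>G\<^esub> g | g s. g \<in> carrier G \<and> s \<in> S}"

text \<open>A pair \<open>(u, v) \<in> R\<close> is the defining relation \<open>u = v\<close>, i.e. the relator \<open>u v\<^sup>-\<^sup>1\<close>.\<close>

definition relators :: "('g word \<times> 'g word) set \<Rightarrow> 'g word set set" where
  "relators R = (\<lambda>(u, v). free_class (u @ inv_word v)) ` R"

definition presented_group :: "('g word \<times> 'g word) set \<Rightarrow> 'g word set set monoid" where
  "presented_group R = free_group Mod normal_closure free_group (relators R)"

definition word_elem :: "('g word \<times> 'g word) set \<Rightarrow> 'g word \<Rightarrow> 'g word set set" where
  "word_elem R w = normal_closure free_group (relators R) #>\<^bsub>free_group\<^esub> free_class w"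


subsection \<open>Well-definedness and the universal property\<close>

lemma free_class_eq_iff: "free_class u = free_class v \<longleftrightarrow> free_equiv u v"
  unfolding free_class_def
  by (auto intro: free_equiv.intros dest: free_equiv.sym free_equiv.trans)

lemma free_equiv_append_left: "free_equiv u v \<Longrightarrow> free_equiv (w @ u) (w @ v)"
proof (induction rule: free_equiv.induct)
  case (cancel u x b v)
  show ?case using free_equiv.cancel[of "w @ u" x b v] by simp
qed (auto intro: free_equiv.intros)

lemma free_equiv_append_right: "free_equiv u v \<Longrightarrow> free_equiv (u @ w) (v @ w)"
proof (induction rule: free_equiv.induct)
  case (cancel u x b v)
  show ?case using free_equiv.cancel[of u x b "v @ w"] by simp
qed (auto intro: free_equiv.intros)

lemma free_equiv_append:
  "free_equiv u u' \<Longrightarrow> free_equiv v v' \<Longrightarrow> free_equiv (u @ v) (u' @ v')"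
  by (meson free_equiv.trans free_equiv_append_left free_equiv_append_right)

lemma free_class_mult [simp]:
  "free_class u \<otimes>\<^bsub>free_group\<^esub> free_class v = free_class (u @ v)"
proof -
  have "(\<exists>u'\<in>free_class u. \<exists>v'\<in>free_class v. free_equiv (u' @ v') w) \<longleftrightarrow> free_equiv (u @ v) w" for w
    unfolding free_class_def
    by (auto intro: free_equiv.refl dest: free_equiv_append intro: free_equiv.trans)
  then show ?thesis by (simp add: free_group_def free_class_def)
qed

lemma free_group_one [simp]: "\<one>\<^bsub>free_group\<^esub> = free_class []"
  by (simp add: free_group_def)

lemma free_class_carrier [simp]: "free_class w \<in> carrier free_group"
  by (simp add: free_group_def)

lemma free_group_cases:
  assumes "A \<in> carrier free_group" obtains w where "A = free_class w"
  using assms by (auto simp: free_group_def)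

lemma free_equiv_inv_word: "free_equiv (inv_word w @ w) []"
proof (induction w)
  case Nil
  show ?case by (simp add: inv_word_def free_equiv.refl)
next
  case (Cons l w)
  obtain x b where l: "l = (x, b)" by fastforce
  have "free_equiv (inv_word (l # w) @ l # w) (inv_word w @ w)"
    using free_equiv.cancel[of "inv_word w" x "\<not> b" w] by (simp add: inv_word_def l)
  then show ?case using Cons free_equiv.trans by blast
qed

theorem group_free_group: "group free_group"
proof (rule groupI)
  fix A assume "A \<in> carrier (free_group :: 'a word set monoid)"
  then obtain w where "A = free_class w" by (rule free_group_cases)
  then have "free_class (inv_word w) \<otimes>\<^bsub>free_group\<^esub> A = \<one>\<^bsub>free_group\<^esub>"
    by (simp add: free_class_eq_iff free_equiv_inv_word)
  then show "\<exists>B\<in>carrier free_group. B \<otimes>\<^bsub>free_group\<^esub> A = \<one>\<^bsub>free_group\<^esub>"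
    by (metis free_class_carrier)
qed (auto elim!: free_group_cases)

lemma (in group) normal_closure_normal:
  assumes "S \<subseteq> carrier G" shows "normal_closure G S \<lhd> G"
  unfolding normal_closure_def
proof (rule normal_generateI)
  let ?C = "{g \<otimes> s \<otimes> inv g | g s. g \<in> carrier G \<and> s \<in> S}"
  show "?C \<subseteq> carrier G" using assms by auto
  fix h g assume "h \<in> ?C" and g: "g \<in> carrier G"
  then obtain k s where k: "k \<in> carrier G" "s \<in> S" "h = k \<otimes> s \<otimes> inv k" by blast
  with assms g have "g \<otimes> h \<otimes> inv g = (g \<otimes> k) \<otimes> s \<otimes> inv (g \<otimes> k)"
    by (auto simp: m_assoc inv_mult_group subsetD)
  with k g show "g \<otimes> h \<otimes> inv g \<in> ?C" by blast
qed

lemma (in group) normal_closure_subset: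
  assumes "S \<subseteq> carrier G" shows "S \<subseteq> normal_closure G S"
proof
  fix s assume s: "s \<in> S"
  then have "s = \<one> \<otimes> s \<otimes> inv \<one>" using assms by auto
  with s show "s \<in> normal_closure G S"
    unfolding normal_closure_def by (intro generate.incl) blast
qed

lemma relators_carrier: "relators R \<subseteq> carrier free_group"
  by (auto simp: relators_def)

lemma normal_relators: "normal_closure free_group (relators R) \<lhd> free_group"
  by (rule group.normal_closure_normal[OF group_free_group relators_carrier])

theorem group_presented_group: "group (presented_group R)"
  unfolding presented_group_def by (rule normal.factorgroup_is_group[OF normal_relators])

lemma carrier_presented_group: "carrier (presented_group R) = range (word_elem R)"
  by (auto simp: presented_group_def FactGroup_def RCOSETS_def word_elem_def[abs_def] free_group_def)

lemma word_elem_mult [simp]: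
  "word_elem R u \<otimes>\<^bsub>presented_group R\<^esub> word_elem R v = word_elem R (u @ v)"
  using normal.rcos_sum[OF normal_relators, of "free_class u" "free_class v"]
  by (simp add: presented_group_def word_elem_def)

lemma word_elem_relation:
  fixes R :: "('g word \<times> 'g word) set"
  assumes "(u, v) \<in> R" shows "word_elem R u = word_elem R v"
proof -
  interpret F: group "free_group :: 'g word set monoid" by (rule group_free_group)
  let ?N = "normal_closure free_group (relators R)"
  interpret N: normal ?N free_group by (rule normal_relators)
  have inv: "inv\<^bsub>free_group\<^esub> free_class v = free_class (inv_word v)"
    by (rule F.inv_equality) (simp_all add: free_class_eq_iff free_equiv_inv_word)
  have "free_class (u @ inv_word v) \<in> ?N"
    using assms F.normal_closure_subset[OF relators_carrier] by (force simp: relators_def)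
  then have "free_class u \<in> ?N #>\<^bsub>free_group\<^esub> free_class v"
    using N.rcos_module_rev[of "free_class v" "free_class u"] F.is_group inv by simp
  then show ?thesis
    using F.repr_independence N.subgroup_axioms unfolding word_elem_def
    by (metis free_class_carrier)
qed

definition eval_word :: "('a, 'b) monoid_scheme \<Rightarrow> ('g \<Rightarrow> 'a) \<Rightarrow> 'g word \<Rightarrow> 'a" where
  "eval_word H f w =
     foldr (\<lambda>(x, b) y. (if b then f x else inv\<^bsub>H\<^esub> (f x)) \<otimes>\<^bsub>H\<^esub> y) w \<one>\<^bsub>H\<^esub>"

context
  fixes H (structure) and f :: "'g \<Rightarrow> 'a"
  assumes H: "group H" and f: "\<And>x. f x \<in> carrier H"
begin

interpretation group H by (rule H)

lemma eval_word_Nil [simp]: "eval_word H f [] = \<one>"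
  by (simp add: eval_word_def)

lemma eval_word_Cons [simp]:
  "eval_word H f ((x, b) # w) = (if b then f x else inv (f x)) \<otimes> eval_word H f w"
  by (simp add: eval_word_def)

lemma eval_word_closed [simp]: "eval_word H f w \<in> carrier H"
  by (induction w) (auto simp: f)

lemma eval_word_append [simp]: "eval_word H f (u @ v) = eval_word H f u \<otimes> eval_word H f v"
  by (induction u) (auto simp: f m_assoc)

lemma eval_word_inv: "eval_word H f (inv_word w) = inv (eval_word H f w)"
proof (induction w)
  case Nil
  show ?case by (simp add: inv_word_def)
next
  case (Cons l w)
  obtain x b where l: "l = (x, b)" by fastforce
  have "inv_word (l # w) = inv_word w @ [(x, \<not> b)]" by (simp add: inv_word_def l)
  then show ?case using Cons by (simp add: l f inv_mult_group)
qed

lemma eval_word_free_equiv: "free_equiv u v \<Longrightarrow> eval_word H f u = eval_word H f v"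
proof (induction rule: free_equiv.induct)
  case (cancel u x b v)
  have "eval_word H f [(x, b), (x, \<not> b)] = \<one>" by (simp add: f)
  then show ?case by (simp only: eval_word_append l_one eval_word_closed)
qed auto

lemma free_group_lift:
  obtains \<theta> where "\<theta> \<in> hom free_group H" and "\<And>w. \<theta> (free_class w) = eval_word H f w"
proof
  let ?\<theta> = "\<lambda>A. eval_word H f (SOME w. w \<in> A)"
  show eq: "?\<theta> (free_class w) = eval_word H f w" for w
  proof -
    have "(SOME v. v \<in> free_class w) \<in> free_class w"
      by (rule someI[of _ w]) (simp add: free_class_def free_equiv.refl)
    then show ?thesis by (metis eval_word_free_equiv free_class_def mem_Collect_eq)
  qed
  show "?\<theta> \<in> hom free_group H"
    by (rule homI) (auto elim!: free_group_cases simp: eq)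
qed

theorem presented_group_universal:
  fixes R :: "('g word \<times> 'g word) set"
  assumes R: "\<And>u v. (u, v) \<in> R \<Longrightarrow> eval_word H f u = eval_word H f v"
  shows "\<exists>\<theta>\<in>hom (presented_group R) H. \<forall>w. \<theta> (word_elem R w) = eval_word H f w"
proof -
  interpret F: group "free_group :: 'g word set monoid" by (rule group_free_group)
  let ?N = "normal_closure free_group (relators R)"
  interpret N: normal ?N free_group by (rule normal_relators)
  obtain \<theta> where \<theta>: "\<theta> \<in> hom free_group H" "\<And>w. \<theta> (free_class w) = eval_word H f w"
    using free_group_lift by blast
  interpret \<theta>: group_hom free_group H \<theta>
    using \<theta>(1) by (simp add: group_hom_def group_hom_axioms_def H F.is_group)
  have rel: "\<theta> s = \<one>" if "s \<in> relators R" for s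
    using that by (auto simp: relators_def \<theta>(2) eval_word_inv dest!: R)
  have N: "\<theta> n = \<one>" if "n \<in> ?N" for n
  proof -
    have "?N \<subseteq> kernel free_group H \<theta>"
      unfolding normal_closure_def
    proof (rule F.generate_subgroup_incl[OF _ \<theta>.subgroup_kernel], safe)
      fix g s :: "'g word set" assume g: "g \<in> carrier free_group" "s \<in> relators R"
      then have s: "s \<in> carrier free_group" using relators_carrier by blast
      show "g \<otimes>\<^bsub>free_group\<^esub> s \<otimes>\<^bsub>free_group\<^esub> inv\<^bsub>free_group\<^esub> g \<in> kernel free_group H \<theta>"
        using g s by (simp add: kernel_def rel)
    qed
    then show ?thesis using that by (auto simp: kernel_def)
  qed
  let ?\<psi> = "\<lambda>A. the_elem (\<theta> ` A)"
  have \<psi>: "?\<psi> (word_elem R w) = eval_word H f w" for w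
  proof -
    have "\<theta> ` word_elem R w = {eval_word H f w}"
    proof -
      have "\<theta> (n \<otimes>\<^bsub>free_group\<^esub> free_class w) = eval_word H f w" if "n \<in> ?N" for n
      proof -
        have "n \<in> carrier free_group" using that N.subset by blast
        then show ?thesis using N[OF that] by (simp add: \<theta>(2))
      qed
      moreover have "?N \<noteq> {}" using N.one_closed by blast
      ultimately show ?thesis unfolding word_elem_def r_coset_def by force
    qed
    then show ?thesis by simp
  qed
  moreover have "?\<psi> \<in> hom (presented_group R) H"
    by (rule homI) (auto simp: carrier_presented_group \<psi>)
  ultimately show ?thesis by (intro bexI[of _ ?\<psi>]) auto
qed

end


section \<open>The fundamental group of the Klein bottle\<close>

datatype klein_gen = Gen_a | Gen_t

definition klein_relations :: "(klein_gen word \<times> klein_gen word) set" where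
  "klein_relations = {([(Gen_t, True), (Gen_a, True), (Gen_t, False)], [(Gen_a, False)])}"

definition klein_group :: "klein_gen word set set monoid" where
  "klein_group = presented_group klein_relations"

definition klein_t :: "klein_gen word set set" where
  "klein_t = word_elem klein_relations [(Gen_t, True)]"


section \<open>Conjugacy, torsion, generation\<close>

definition conjugate :: "('a, 'b) monoid_scheme \<Rightarrow> 'a \<Rightarrow> 'a \<Rightarrow> bool" where
  "conjugate G x y \<longleftrightarrow> (\<exists>g\<in>carrier G. y = g \<otimes>\<^bsub>G\<^esub> x \<otimes>\<^bsub>G\<^esub> inv\<^bsub>G\<^esub> g)"

definition conjugacy_classes :: "('a, 'b) monoid_scheme \<Rightarrow> 'a set set" where
  "conjugacy_classes G = (\<lambda>x. {y. conjugate G x y}) ` carrier G"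

definition four_CC :: "('a, 'b) monoid_scheme \<Rightarrow> bool" where
  "four_CC G \<longleftrightarrow> card (conjugacy_classes G) = 4"

definition torsion_free :: "('a, 'b) monoid_scheme \<Rightarrow> bool" where
  "torsion_free G \<longleftrightarrow>
     (\<forall>x\<in>carrier G. \<forall>n::nat. 0 < n \<longrightarrow> x [^]\<^bsub>G\<^esub> n = \<one>\<^bsub>G\<^esub> \<longrightarrow> x = \<one>\<^bsub>G\<^esub>)"

definition two_generated :: "('a, 'b) monoid_scheme \<Rightarrow> bool" where
  "two_generated G \<longleftrightarrow> (\<exists>x\<in>carrier G. \<exists>y\<in>carrier G. generate G {x, y} = carrier G)"

text \<open>
  Every 2-generated group is countable, hence isomorphic to a group of type \<open>nat monoid\<close>
  (whose carrier may be any subset of the natural numbers), so quantifying over that type is no restriction.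
\<close>

end

theory Submission
  imports Defs "HOL-Library.Countable_Set"
begin

text \<open>
  The group is a direct limit of quotients and HNN extensions of a finitely generated group \<open>G\<close> that acts on
  infinitely many conjugacy classes of lines. Projections between lines satisfy Behrstock's inequality, as in
  the work of Bestvina, Bromberg and Fujiwara; this is the only form of negative curvature used, and no
  geodesics or van Kampen diagrams occur.

  An element \<open>R\<close> that translates its axis by a large amount generates, together with its conjugates, a spinning
  family. By a windmill argument every nontrivial element of the normal closure \<open>N\<close> of \<open>R\<close> moves the base point
  by about a nonzero multiple of the translation length along some line (Greendlinger's lemma). Hence \<open>G/N\<close>
  still acts on the remaining classes of lines, given elements survive, torsion-freeness passes to \<open>G/N\<close>, and so
  does the condition (I) that no positive power of \<open>t\<close> is conjugate to a nonpositive power of \<open>t\<close>.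

  Given \<open>u \<noteq> 1\<close>, let \<open>h\<close> be \<open>t\<close> if some positive power of \<open>u\<close> is conjugate to a positive power of \<open>t\<close>, \<open>t\<^sup>-\<^sup>1\<close>
  if this holds for \<open>u\<^sup>-\<^sup>1\<close>, and \<open>a\<close> otherwise. Then the HNN extension with a letter \<open>z\<close> conjugating \<open>u\<close> to \<open>h\<close>
  preserves torsion-freeness, (I) and the lines. To absorb \<open>z\<close>, one divides by \<open>R = V z\<^sup>-\<^sup>1\<close>, where \<open>V\<close> is a
  product of high powers of elements that translate lines of different classes; so \<open>z\<close> becomes redundant as a
  generator. The construction starts with the HNN extension with letter \<open>t\<close> of the free group on \<open>y\<close> and \<open>a\<close>
  that inverts \<open>a\<close>, where in addition \<open>a\<close> is identified with an element generated by \<open>y\<close> and \<open>t\<close>. In the limit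
  of the successive quotients every element is conjugate to 1, \<open>a\<close>, \<open>t\<close> or \<open>t\<^sup>-\<^sup>1\<close>.
\<close>

section \<open>Systems of lines with coherent projections\<close>

text \<open>The obstacle is iteration: every quotient worsens the constants of the projections, and
  the next step must start from them. The remedy is to keep infinitely many classes of lines at all
  times. A step may discard the finitely many classes that the elements at hand stabilise, and it
  spends a further block of \<open>k\<close> classes as pivots of the axis of \<open>R\<close>. The
  error of the surviving classes may grow arbitrarily, but the coordinate along the new axis counts
  pivots: its error is 6 and its translation length is \<open>k\<close>, whatever came before. So
  the spinning condition never depends on the history.

  Condition (I) is about powers because making \<open>u\<close> conjugate to \<open>h\<close> does
  the same to their powers; forbidding only that \<open>t\<close> is conjugate to its inverse would
  not be inherited. It also makes the choice of \<open>h\<close> consistent: as \<open>t\<close>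
  inverts \<open>a\<close>, no nonzero power of \<open>a\<close> can be conjugate to a nonzero power
  of \<open>t\<close>. In a quotient (I) survives because the powers of \<open>t\<close> have
  bounded orbits along the spinning lines, whereas nontrivial elements of \<open>N\<close> do
  not.\<close>

text \<open>\<open>\<delta> Y x y\<close> is the signed distance between the projections of the points \<open>x\<close> and \<open>y\<close> to the line \<open>Y\<close>.
  The point \<open>ob Y\<close> stands for the line \<open>Y\<close> itself: only its projections to the other lines matter (its position
  on \<open>Y\<close> is arbitrary, hence \<open>Z \<noteq> act g Y\<close> in \<open>ob_act\<close>). \<open>coh\<close> is Behrstock's inequality.\<close>

locale line_system = group G for G (structure) +
  fixes Ln :: "'l set" and act :: "'a \<Rightarrow> 'l \<Rightarrow> 'l"
    and Pt :: "'p set" and pact :: "'a \<Rightarrow> 'p \<Rightarrow> 'p"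
    and \<delta> :: "'l \<Rightarrow> 'p \<Rightarrow> 'p \<Rightarrow> int" and ob :: "'l \<Rightarrow> 'p" and e :: "'l \<Rightarrow> int"
  assumes act_closed [simp]: "\<lbrakk>g \<in> carrier G; Y \<in> Ln\<rbrakk> \<Longrightarrow> act g Y \<in> Ln"
    and act_one [simp]: "Y \<in> Ln \<Longrightarrow> act \<one> Y = Y"
    and act_mult: "\<lbrakk>g \<in> carrier G; h \<in> carrier G; Y \<in> Ln\<rbrakk> \<Longrightarrow> act (g \<otimes> h) Y = act g (act h Y)"
    and pact_closed [simp]: "\<lbrakk>g \<in> carrier G; x \<in> Pt\<rbrakk> \<Longrightarrow> pact g x \<in> Pt"
    and pact_one [simp]: "x \<in> Pt \<Longrightarrow> pact \<one> x = x"
    and pact_mult: "\<lbrakk>g \<in> carrier G; h \<in> carrier G; x \<in> Pt\<rbrakk> \<Longrightarrow> pact (g \<otimes> h) x = pact g (pact h x)"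
    and \<delta>_add: "\<delta> Y x z = \<delta> Y x y + \<delta> Y y z"
    and \<delta>_act: "\<lbrakk>g \<in> carrier G; Y \<in> Ln; x \<in> Pt; y \<in> Pt\<rbrakk>
       \<Longrightarrow> \<delta> (act g Y) (pact g x) (pact g y) = \<delta> Y x y"
    and ob_Pt [simp]: "Y \<in> Ln \<Longrightarrow> ob Y \<in> Pt"
    and ob_act: "\<lbrakk>g \<in> carrier G; Y \<in> Ln; Z \<in> Ln; Z \<noteq> act g Y\<rbrakk>
       \<Longrightarrow> \<delta> Z (ob (act g Y)) (pact g (ob Y)) = 0"
    and ob_at: "\<lbrakk>Y \<in> Ln; x \<in> Pt\<rbrakk> \<Longrightarrow> \<exists>b \<in> Pt. \<delta> Y x b = 0 \<and> (\<forall>Z \<in> Ln. Z \<noteq> Y \<longrightarrow> \<delta> Z b (ob Y) = 0)"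
    and e_nonneg: "Y \<in> Ln \<Longrightarrow> 0 \<le> e Y"
    and e_act [simp]: "\<lbrakk>g \<in> carrier G; Y \<in> Ln\<rbrakk> \<Longrightarrow> e (act g Y) = e Y"
    and coh: "\<lbrakk>Y \<in> Ln; Z \<in> Ln; Y \<noteq> Z; x \<in> Pt\<rbrakk>
       \<Longrightarrow> \<bar>\<delta> Y x (ob Z)\<bar> \<le> e Y \<or> \<bar>\<delta> Z x (ob Y)\<bar> \<le> e Z"
    and fin: "\<lbrakk>x \<in> Pt; y \<in> Pt\<rbrakk> \<Longrightarrow> finite {Y \<in> Ln. \<bar>\<delta> Y x y\<bar> > e Y}"
begin

abbreviation d where "d Y x y \<equiv> \<bar>\<delta> Y x y\<bar>"

lemma \<delta>_refl [simp]: "\<delta> Y x x = 0"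
  using \<delta>_add[of Y x x x] by simp

lemma \<delta>_sym: "\<delta> Y y x = - \<delta> Y x y"
  using \<delta>_add[of Y x x y] by simp

lemma d_sym: "d Y x y = d Y y x"
  by (simp add: \<delta>_sym[of Y x y])

lemma d_tri: "d Y x z \<le> d Y x y + d Y y z"
  using \<delta>_add[of Y x z y] by linarith

lemma d_le: "d Y x y \<le> a \<Longrightarrow> d Y y z \<le> c \<Longrightarrow> d Y x z \<le> a + c"
  using d_tri[of Y x z y] by linarith

lemma d_le': "d Y y x \<le> a \<Longrightarrow> d Y y z \<le> c \<Longrightarrow> d Y x z \<le> a + c"
  using d_le[of Y x y a z c] d_sym[of Y x y] by simp

lemma d_le'': "d Y x y \<le> a \<Longrightarrow> d Y z y \<le> c \<Longrightarrow> d Y x z \<le> a + c"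
  using d_le[of Y x y a z c] d_sym[of Y y z] by simp

lemma d_act: "\<lbrakk>g \<in> carrier G; Y \<in> Ln; x \<in> Pt; y \<in> Pt\<rbrakk> \<Longrightarrow> d (act g Y) (pact g x) (pact g y) = d Y x y"
  by (simp add: \<delta>_act)

lemma act_inv [simp]: "\<lbrakk>g \<in> carrier G; Y \<in> Ln\<rbrakk> \<Longrightarrow> act (inv g) (act g Y) = Y"
  by (metis act_mult act_one inv_closed l_inv)

lemma act_inv' [simp]: "\<lbrakk>g \<in> carrier G; Y \<in> Ln\<rbrakk> \<Longrightarrow> act g (act (inv g) Y) = Y"
  by (metis act_mult act_one inv_closed r_inv)

lemma act_eq_iff: "\<lbrakk>g \<in> carrier G; Y \<in> Ln; Z \<in> Ln\<rbrakk> \<Longrightarrow> act g Y = act g Z \<longleftrightarrow> Y = Z"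
  by (metis act_inv)

lemma pact_inv [simp]: "\<lbrakk>g \<in> carrier G; x \<in> Pt\<rbrakk> \<Longrightarrow> pact (inv g) (pact g x) = x"
  by (metis pact_mult pact_one inv_closed l_inv)

lemma pact_inv' [simp]: "\<lbrakk>g \<in> carrier G; x \<in> Pt\<rbrakk> \<Longrightarrow> pact g (pact (inv g) x) = x"
  by (metis pact_mult pact_one inv_closed r_inv)

lemma d_shift2: "\<lbrakk>g \<in> carrier G; Y \<in> Ln; x \<in> Pt; y \<in> Pt\<rbrakk> \<Longrightarrow> d Y (pact g x) (pact g y) = d (act (inv g) Y) x y"
  using d_act[of "inv g" Y "pact g x" "pact g y"] by simp

lemma d_ob_act:
  assumes "g \<in> carrier G" "Y \<in> Ln" "Z \<in> Ln" "act g Y \<noteq> Z"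
  shows "d Z (pact g (ob Y)) x = d Z (ob (act g Y)) x"
  using ob_act[of g Y Z] assms \<delta>_add[of Z "ob (act g Y)" x "pact g (ob Y)"] by auto

lemma d_ob_act':
  assumes "g \<in> carrier G" "Y \<in> Ln" "Z \<in> Ln" "act g Y \<noteq> Z"
  shows "d Z x (pact g (ob Y)) = d Z x (ob (act g Y))"
  using d_ob_act[OF assms, of x] by (simp add: d_sym)

text \<open>Blocking is extended on the side of \<open>x\<close>; this is why the error does not accumulate.\<close>

lemma block_trans:
  assumes "W \<in> Ln" "W' \<in> Ln" "V \<in> Ln" "W \<noteq> W'" "x \<in> Pt" "e W \<le> E" "e W' \<le> E" "0 \<le> E"
    and "d W x (ob W') > 4 * E" "d W' x (ob V) > 3 * E"
  shows "W \<noteq> V" and "d W x (ob V) > 3 * E"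
proof -
  have "d W' x (ob W) \<le> E" using coh[of W W' x] assms by linarith
  then have 1: "d W' (ob V) (ob W) > E"
    using d_tri[of W' x "ob V" "ob W"] assms d_sym[of W' "ob W" "ob V"] by linarith
  then show "W \<noteq> V" using \<open>0 \<le> E\<close> by auto
  have "d W (ob V) (ob W') \<le> E" using coh[of W W' "ob V"] 1 assms by force
  then show "d W x (ob V) > 3 * E" using d_tri[of W x "ob W'" "ob V"] assms by linarith
qed

end

text \<open>The line \<open>Y \<in> Sp\<close> is its own axis of rotation: \<open>r Y\<close> translates it by an amount \<open>k\<close> that is large
  compared with the error \<open>E\<close>.\<close>

locale spinning = line_system G Ln act Pt pact \<delta> ob e
  for G (structure) and Ln :: "'l set" and act :: "'a \<Rightarrow> 'l \<Rightarrow> 'l"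
    and Pt :: "'p set" and pact and \<delta> and ob and e +
  fixes Sp :: "'l set" and r :: "'l \<Rightarrow> 'a" and k E :: int
  assumes Sp_sub: "Sp \<subseteq> Ln"
    and Sp_act [simp]: "\<lbrakk>g \<in> carrier G; Y \<in> Sp\<rbrakk> \<Longrightarrow> act g Y \<in> Sp"
    and r_closed [simp]: "Y \<in> Sp \<Longrightarrow> r Y \<in> carrier G"
    and r_act: "\<lbrakk>g \<in> carrier G; Y \<in> Sp\<rbrakk> \<Longrightarrow> r (act g Y) = g \<otimes> r Y \<otimes> inv g"
    and r_fix: "Y \<in> Sp \<Longrightarrow> act (r Y) Y = Y"
    and r_rot: "\<lbrakk>Y \<in> Sp; x \<in> Pt\<rbrakk> \<Longrightarrow> \<delta> Y x (pact (r Y) x) = k"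
    and e_Sp: "Y \<in> Sp \<Longrightarrow> e Y = E" and E_pos: "1 \<le> E" and k_large: "200 * E \<le> k"
begin

lemma Sp_Ln [simp]: "Y \<in> Sp \<Longrightarrow> Y \<in> Ln"
  using Sp_sub by blast

lemma cohS: "\<lbrakk>Y \<in> Sp; Z \<in> Sp; Y \<noteq> Z; x \<in> Pt\<rbrakk> \<Longrightarrow> d Y x (ob Z) \<le> E \<or> d Z x (ob Y) \<le> E"
  using coh[of Y Z x] e_Sp by simp

lemma finS: "\<lbrakk>x \<in> Pt; y \<in> Pt\<rbrakk> \<Longrightarrow> finite {Y \<in> Sp. d Y x y > E}"
  by (rule finite_subset[OF _ fin[of x y]]) (auto simp: e_Sp)

lemma rot_nat: "\<lbrakk>Y \<in> Sp; x \<in> Pt\<rbrakk> \<Longrightarrow> \<delta> Y x (pact (r Y [^] (n::nat)) x) = int n * k"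
proof (induction n)
  case (Suc n)
  have "pact (r Y [^] Suc n) x = pact (r Y) (pact (r Y [^] n) x)"
    using Suc.prems by (metis nat_pow_Suc2 nat_pow_closed pact_mult r_closed)
  then show ?case
    using Suc r_rot[of Y "pact (r Y [^] n) x"] \<delta>_add[of Y x "pact (r Y [^] Suc n) x" "pact (r Y [^] n) x"]
    by (simp add: algebra_simps)
qed simp

lemma rot_pow: "\<lbrakk>Y \<in> Sp; x \<in> Pt\<rbrakk> \<Longrightarrow> \<delta> Y x (pact (r Y [^] (l::int)) x) = l * k"
proof -
  assume a: "Y \<in> Sp" "x \<in> Pt"
  show ?thesis
  proof (cases l rule: int_cases2)
    case (nonneg m)
    then show ?thesis using rot_nat[of Y x m] a by (simp only: int_pow_int)
  next
    case (nonpos m)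
    let ?y = "pact (r Y [^] l) x"
    have "r Y [^] l = inv (r Y [^] m)" using nonpos a by (simp only: int_pow_neg_int r_closed)
    then have "pact (r Y [^] m) ?y = x" using a by simp
    moreover have "\<delta> Y ?y (pact (r Y [^] m) ?y) = int m * k" using a by (intro rot_nat) auto
    ultimately show ?thesis using \<delta>_sym[of Y x ?y] nonpos by simp
  qed
qed

lemma act_r_pow: "Y \<in> Sp \<Longrightarrow> act (r Y [^] (l::int)) Y = Y"
proof -
  assume Y: "Y \<in> Sp"
  have n: "act (r Y [^] (n::nat)) Y = Y" for n
    by (induction n) (use Y in \<open>auto simp: act_mult r_fix\<close>)
  show ?thesis
  proof (cases l rule: int_cases2)
    case (nonneg m)
    then show ?thesis using n by (simp only: int_pow_int)
  next
    case (nonpos m)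
    have "act (inv (r Y [^] m)) (act (r Y [^] m) Y) = Y" using Y by (intro act_inv) auto
    then show ?thesis using nonpos n Y by (simp only: int_pow_neg_int r_closed)
  qed
qed

lemma r_act_pow: "\<lbrakk>g \<in> carrier G; Y \<in> Sp\<rbrakk> \<Longrightarrow> r (act g Y) [^] (l::int) \<otimes> g = g \<otimes> r Y [^] l"
proof -
  assume g: "g \<in> carrier G" and Y: "Y \<in> Sp"
  have "(g \<otimes> r Y \<otimes> inv g) [^] (n::nat) \<otimes> g = g \<otimes> r Y [^] n" for n
  proof (induction n)
    case (Suc n)
    have "(g \<otimes> r Y \<otimes> inv g) [^] Suc n \<otimes> g = (g \<otimes> r Y \<otimes> inv g) [^] n \<otimes> ((g \<otimes> r Y \<otimes> inv g) \<otimes> g)"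
      using g Y by (simp add: m_assoc del: m_closed add: m_closed)
    also have "(g \<otimes> r Y \<otimes> inv g) \<otimes> g = g \<otimes> r Y" using g Y by (simp add: m_assoc)
    also have "(g \<otimes> r Y \<otimes> inv g) [^] n \<otimes> (g \<otimes> r Y) = (g \<otimes> r Y \<otimes> inv g) [^] n \<otimes> g \<otimes> r Y"
      using g Y by (simp add: m_assoc)
    also have "\<dots> = g \<otimes> r Y [^] n \<otimes> r Y" by (simp only: Suc)
    also have "\<dots> = g \<otimes> r Y [^] Suc n" using g Y by (simp add: m_assoc)
    finally show ?case .
  qed (use g in auto)
  then have n: "r (act g Y) [^] n \<otimes> g = g \<otimes> r Y [^] n" for n :: nat using r_act[OF g Y] by simp
  have c: "r (act g Y) \<in> carrier G" "r Y \<in> carrier G" using g Y by auto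
  show ?thesis
  proof (cases l rule: int_cases2)
    case (nonneg m)
    then show ?thesis using n[of m] by (simp only: int_pow_int)
  next
    case (nonpos m)
    define A where "A = r (act g Y) [^] m"
    define B where "B = r Y [^] m"
    have AB: "A \<in> carrier G" "B \<in> carrier G" "A \<otimes> g = g \<otimes> B" using c n[of m] by (auto simp: A_def B_def)
    have "inv A \<otimes> g = inv A \<otimes> (g \<otimes> B) \<otimes> inv B" using AB g by (simp add: m_assoc)
    also have "\<dots> = g \<otimes> inv B" 
      by (metis AB g inv_closed l_inv l_one m_assoc m_closed r_inv r_one)
    finally show ?thesis using nonpos c by (simp only: int_pow_neg_int A_def B_def)
  qed
qed

lemma rot_reduce:
  assumes "Y \<in> Sp" "x \<in> Pt" "b \<in> Pt"
  obtains l :: int where "2 * d Y b (pact (r Y [^] l) x) \<le> k"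
proof -
  have "k > 0" using k_large E_pos by linarith
  define a where "a = \<delta> Y b x"
  \<comment> \<open>The quotient rounds \<open>a / k\<close> to the nearest integer, so the turned
    point ends within half a turn of \<open>b\<close>.\<close>
  define l where "l = - ((2 * a + k) div (2 * k))"
  have "2 * \<bar>a + l * k\<bar> \<le> k"
  proof -
    define q where "q = (2 * a + k) div (2 * k)"
    define M where "M = (2 * a + k) mod (2 * k)"
    have "2 * a + k = 2 * (q * k) + M"
      using div_mult_mod_eq[of "2 * a + k" "2 * k"] unfolding q_def M_def by (simp add: algebra_simps)
    moreover have "0 \<le> M" "M < 2 * k" using \<open>k > 0\<close> by (auto simp: M_def)
    moreover have "l * k = - (q * k)" by (simp add: l_def q_def)
    ultimately show ?thesis by arith
  qed
  moreover have "\<delta> Y b (pact (r Y [^] l) x) = a + l * k"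
    using \<delta>_add[of Y b "pact (r Y [^] l) x" x] rot_pow[of Y x l] assms by (simp add: a_def)
  ultimately show ?thesis using that[of l] by simp
qed

end

section \<open>Windmills\<close>

context spinning
begin

definition rotg :: "'l set \<Rightarrow> 'a set" where
  "rotg \<Omega> = generate G (r ` \<Omega>)"

lemma rotg_subgroup: "\<Omega> \<subseteq> Sp \<Longrightarrow> subgroup (rotg \<Omega>) G"
  unfolding rotg_def by (rule generate_is_subgroup) auto

lemma rotg_closed: "\<lbrakk>h \<in> rotg \<Omega>; \<Omega> \<subseteq> Sp\<rbrakk> \<Longrightarrow> h \<in> carrier G"
  by (rule subgroup.mem_carrier[OF rotg_subgroup])

lemma rotg_one: "\<one> \<in> rotg \<Omega>"
  unfolding rotg_def by (rule generate.one)

lemma rotg_mult: "\<lbrakk>g \<in> rotg \<Omega>; h \<in> rotg \<Omega>\<rbrakk> \<Longrightarrow> g \<otimes> h \<in> rotg \<Omega>"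
  unfolding rotg_def by (rule generate.eng)

lemma rotg_inv: "\<lbrakk>\<Omega> \<subseteq> Sp; g \<in> rotg \<Omega>\<rbrakk> \<Longrightarrow> inv g \<in> rotg \<Omega>"
  by (rule subgroup.m_inv_closed[OF rotg_subgroup])

lemma rotg_mono: "A \<subseteq> B \<Longrightarrow> rotg A \<subseteq> rotg B"
  unfolding rotg_def by (rule mono_generate) auto

lemma rotg_incl: "V \<in> \<Omega> \<Longrightarrow> r V \<in> rotg \<Omega>"
  unfolding rotg_def by (rule generate.incl) simp

lemma rotg_pow: "\<lbrakk>\<Omega> \<subseteq> Sp; V \<in> \<Omega>\<rbrakk> \<Longrightarrow> r V [^] (l::int) \<in> rotg \<Omega>"
  using subgroup_int_pow_closed[OF rotg_subgroup] generate.incl[of "r V" "r ` \<Omega>" G]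
  by (simp add: rotg_def)

text \<open>\<open>Vis b \<Omega>\<close> consists of the lines that no other line outside \<open>\<Omega>\<close> separates from the windmill \<open>\<Omega>\<close> with
  base point \<open>b\<close>. Turning the windmill around all of them at once gives a free product, and \<open>nxt b \<Omega>\<close> is again a
  windmill.\<close>

definition Ref :: "'p \<Rightarrow> 'l set \<Rightarrow> 'p set" where
  "Ref b \<Omega> = {pact h b | h. h \<in> rotg \<Omega>} \<union> ob ` \<Omega>"

definition Vis :: "'p \<Rightarrow> 'l set \<Rightarrow> 'l set" where
  "Vis b \<Omega> = {V \<in> Sp - \<Omega>. \<forall>V' \<in> Sp - \<Omega>. V' \<noteq> V \<longrightarrow> (\<exists>x \<in> Ref b \<Omega>. d V' x (ob V) \<le> 4 * E)}"

definition nxt :: "'p \<Rightarrow> 'l set \<Rightarrow> 'l set" where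
  "nxt b \<Omega> = {act g Y | g Y. g \<in> rotg (\<Omega> \<union> Vis b \<Omega>) \<and> Y \<in> \<Omega> \<union> Vis b \<Omega>}"

text \<open>These clauses reproduce themselves in \<open>nxt\<close> with the same constants. The
  bound 12E, by which outside lines see the windmill as a small set, is renewed in
  \<open>nxt_a\<close> as 6E + 6E. The clause on nontrivial elements becomes
  \<open>greendlinger\<close>, and the last one becomes \<open>good_lift\<close>.\<close>

definition windmill :: "'p \<Rightarrow> 'l set \<Rightarrow> bool" where
  "windmill b \<Omega> \<longleftrightarrow> \<Omega> \<subseteq> Sp \<and> (\<forall>h \<in> rotg \<Omega>. \<forall>U \<in> \<Omega>. act h U \<in> \<Omega>) \<and>
     (\<forall>V \<in> Sp - \<Omega>. \<forall>x \<in> Ref b \<Omega>. d V b x \<le> 12 * E) \<and>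
     (\<forall>h \<in> rotg \<Omega>. h \<noteq> \<one> \<longrightarrow> (\<exists>U \<in> \<Omega>. \<exists>l. l \<noteq> 0 \<and> \<bar>\<delta> U b (pact h b) - l * k\<bar> \<le> 40 * E)) \<and>
     (\<forall>x \<in> Pt. \<exists>h \<in> rotg \<Omega>. \<forall>U \<in> \<Omega>. 2 * d U b (pact h x) \<le> k + 40 * E)"

lemma Ref_b: "b \<in> Pt \<Longrightarrow> b \<in> Ref b \<Omega>"
  unfolding Ref_def using rotg_one[of \<Omega>] pact_one[of b] by (auto intro!: exI[of _ \<one>])

lemma Ref_Pt: "\<lbrakk>b \<in> Pt; \<Omega> \<subseteq> Sp; x \<in> Ref b \<Omega>\<rbrakk> \<Longrightarrow> x \<in> Pt"
  unfolding Ref_def using rotg_closed by auto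

lemma Vis_Sp: "Vis b \<Omega> \<subseteq> Sp - \<Omega>"
  unfolding Vis_def by auto

text \<open>Among the lines that block \<open>V\<close>, directly or through other blockers, a
  minimal one for \<open>R\<close> is visible. It exists because iterated blocking still separates
  by 3E (\<open>block_trans\<close>), which makes \<open>R\<close> acyclic, and because all these
  blockers separate \<open>b\<close> from \<open>V\<close>, so that they are finitely many.\<close>

lemma vis_exists:
  assumes b: "b \<in> Pt" and \<Omega>: "\<Omega> \<subseteq> Sp" and V: "V \<in> Sp - \<Omega>"
  shows "\<exists>V1 \<in> Vis b \<Omega>. V1 = V \<or> (\<forall>x \<in> Ref b \<Omega>. d V1 x (ob V) > 3 * E)"
proof -
  define R where "R = {(W, W'). W \<in> Sp - \<Omega> \<and> W' \<in> Sp - \<Omega> \<and> W \<noteq> W' \<and> (\<forall>x \<in> Ref b \<Omega>. d W x (ob W') > 4 * E)}"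
  have tr: "W \<in> Sp - \<Omega> \<and> W \<noteq> V' \<and> (\<forall>x \<in> Ref b \<Omega>. d W x (ob V') > 3 * E)" if "(W, V') \<in> R\<^sup>+" for W V'
    using that
  proof (induction rule: converse_trancl_induct)
    case (base W)
    then show ?case using E_pos unfolding R_def by force
  next
    case (step W W')
    then have 1: "W \<in> Sp - \<Omega>" "W' \<in> Sp - \<Omega>" "W \<noteq> W'" "\<forall>x \<in> Ref b \<Omega>. d W x (ob W') > 4 * E"
      unfolding R_def by auto
    have V': "V' \<in> Sp" using step(2) by (induction rule: trancl_induct) (auto simp: R_def)
    have "W \<noteq> V' \<and> d W x (ob V') > 3 * E" if "x \<in> Ref b \<Omega>" for x
      using block_trans[of W W' V' x E] 1 V' step.IH that Ref_Pt[OF b \<Omega> that] E_pos e_Sp by auto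
    then show ?case using 1 Ref_b[OF b] by blast
  qed
  define A where "A = {W. (W, V) \<in> R\<^sup>*}"
  have "A \<subseteq> insert V {W \<in> Sp. d W b (ob V) > E}"
    using tr Ref_b[OF b] E_pos unfolding A_def rtrancl_eq_or_trancl by fastforce
  then have "finite A" using finS[OF b, of "ob V"] V finite_subset by auto
  moreover have "acyclic R" using tr unfolding acyclic_def by blast
  ultimately have "finite (R \<inter> A \<times> A)" "acyclic (R \<inter> A \<times> A)"
    by (simp_all add: acyclic_subset[of R])
  then have "wf (R \<inter> A \<times> A)" by (rule finite_acyclic_wf)
  moreover have "V \<in> A" by (simp add: A_def)
  ultimately obtain V1 where V1: "V1 \<in> A" "\<And>W. (W, V1) \<in> R \<inter> A \<times> A \<Longrightarrow> W \<notin> A"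
    using wfE_min[of "R \<inter> A \<times> A" V A] by metis
  have min: "(W, V1) \<notin> R" for W
    using V1 converse_rtrancl_into_rtrancl[of W V1 R V] unfolding A_def by blast
  have "V1 = V \<or> (V1, V) \<in> R\<^sup>+" using V1(1) by (auto simp: A_def rtrancl_eq_or_trancl)
  moreover have "V1 \<in> Sp - \<Omega>" using calculation tr V by blast
  moreover have "V1 \<in> Vis b \<Omega>"
    using min calculation(2) unfolding Vis_def R_def by (auto simp: not_less)
  ultimately show ?thesis using tr by blast
qed

end

section \<open>One step of the windmill construction\<close>

locale windmill_step = spinning G Ln act Pt pact \<delta> ob e Sp r k E
  for G (structure) and Ln :: "'l set" and act and Pt :: "'p set" and pact and \<delta> and ob and e and Sp and r and k E :: int +
  fixes b :: 'p and \<Omega> :: "'l set"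
  assumes b [simp]: "b \<in> Pt" and wm: "windmill b \<Omega>"
begin

abbreviation "H \<equiv> rotg \<Omega>"
abbreviation "N' \<equiv> rotg (\<Omega> \<union> Vis b \<Omega>)"
abbreviation "VV \<equiv> Vis b \<Omega>"

lemma \<Omega>: "\<Omega> \<subseteq> Sp" and wb: "\<lbrakk>h \<in> H; U \<in> \<Omega>\<rbrakk> \<Longrightarrow> act h U \<in> \<Omega>"
  and wa: "\<lbrakk>V \<in> Sp; V \<notin> \<Omega>; x \<in> Ref b \<Omega>\<rbrakk> \<Longrightarrow> d V b x \<le> 12 * E"
  and wc: "\<lbrakk>h \<in> H; h \<noteq> \<one>\<rbrakk> \<Longrightarrow> \<exists>U \<in> \<Omega>. \<exists>l. l \<noteq> 0 \<and> \<bar>\<delta> U b (pact h b) - l * k\<bar> \<le> 40 * E"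
  and wd: "x \<in> Pt \<Longrightarrow> \<exists>h \<in> H. \<forall>U \<in> \<Omega>. 2 * d U b (pact h x) \<le> k + 40 * E"
  using wm unfolding windmill_def by blast+

lemma VV_Sp [simp]: "V \<in> VV \<Longrightarrow> V \<in> Sp" and VV_\<Omega>: "V \<in> VV \<Longrightarrow> V \<notin> \<Omega>"
  using Vis_Sp by auto

lemma \<Omega>VV: "\<Omega> \<union> VV \<subseteq> Sp"
  using \<Omega> by auto

lemma H_closed [simp]: "h \<in> H \<Longrightarrow> h \<in> carrier G"
  using rotg_closed \<Omega> by blast

lemma N'_closed [simp]: "h \<in> N' \<Longrightarrow> h \<in> carrier G"
  using rotg_closed \<Omega>VV by blast

lemma H_N': "h \<in> H \<Longrightarrow> h \<in> N'"
  using rotg_mono[of \<Omega> "\<Omega> \<union> VV"] by blast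

lemma out_act: "\<lbrakk>h \<in> H; V \<in> Sp; V \<notin> \<Omega>\<rbrakk> \<Longrightarrow> act h V \<notin> \<Omega>"
  using wb[of "inv h" "act h V"] rotg_inv[OF \<Omega>, of h] by auto

lemma near_hb: "\<lbrakk>h \<in> H; V \<in> Sp; V \<notin> \<Omega>\<rbrakk> \<Longrightarrow> d V b (pact h b) \<le> 12 * E"
  using wa unfolding Ref_def by blast

lemma near_U: "\<lbrakk>U \<in> \<Omega>; V \<in> Sp; V \<notin> \<Omega>\<rbrakk> \<Longrightarrow> d V b (ob U) \<le> 12 * E"
  using wa unfolding Ref_def by blast

lemma near_V: "\<lbrakk>V \<in> VV; V' \<in> Sp; V' \<notin> \<Omega>; V' \<noteq> V\<rbrakk> \<Longrightarrow> d V' b (ob V) \<le> 16 * E"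
proof -
  assume a: "V \<in> VV" "V' \<in> Sp" "V' \<notin> \<Omega>" "V' \<noteq> V"
  then obtain x where x: "x \<in> Ref b \<Omega>" "d V' x (ob V) \<le> 4 * E" unfolding Vis_def by blast
  show ?thesis using wa[OF a(2,3) x(1)] x(2) d_tri[of V' b "ob V" x] by linarith
qed

lemma Vis_act: "\<lbrakk>h \<in> H; V \<in> VV\<rbrakk> \<Longrightarrow> act h V \<in> VV"
proof -
  assume h: "h \<in> H" and V: "V \<in> VV"
  have hV: "act h V \<in> Sp - \<Omega>" using h V out_act VV_\<Omega> by auto
  have "\<exists>x \<in> Ref b \<Omega>. d V' x (ob (act h V)) \<le> 4 * E"
    if V': "V' \<in> Sp - \<Omega>" "V' \<noteq> act h V" for V'
  proof -
    let ?W = "act (inv h) V'"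
    have W: "?W \<in> Sp - \<Omega>" using h V' out_act[of "inv h" V'] rotg_inv[OF \<Omega>, of h] by auto
    have "?W \<noteq> V" using V' h by auto
    then obtain x where x: "x \<in> Ref b \<Omega>" "d ?W x (ob V) \<le> 4 * E" using V W unfolding Vis_def by blast
    have xP: "x \<in> Pt" using Ref_Pt[OF b \<Omega> x(1)] .
    have "d V' (pact h x) (pact h (ob V)) \<le> 4 * E"
      using d_shift2[of h V' x "ob V"] x xP h V V' by auto
    then have 1: "d V' (pact h x) (ob (act h V)) \<le> 4 * E"
      using d_ob_act'[of h V V' "pact h x"] V' h V by auto
    from x(1) consider h' where "h' \<in> H" "x = pact h' b" | U where "U \<in> \<Omega>" "x = ob U"
      unfolding Ref_def by blast
    then show ?thesis
    proof cases
      case 1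
      then have "pact h x \<in> Ref b \<Omega>"
        unfolding Ref_def using h rotg_mult[of h \<Omega> h'] pact_mult[of h h' b] by auto
      then show ?thesis using \<open>d V' (pact h x) (ob (act h V)) \<le> 4 * E\<close> by blast
    next
      case 2
      then have U: "act h U \<in> \<Omega>" using wb h by blast
      moreover have "U \<in> Ln" "act h U \<noteq> V'" using 2 \<Omega> U V' by auto
      ultimately have "d V' (ob (act h U)) (ob (act h V)) \<le> 4 * E"
        using d_ob_act[of h U V' "ob (act h V)"] 1 2 V' h by auto
      then show ?thesis using U unfolding Ref_def by blast
    qed
  qed
  then show ?thesis using hV unfolding Vis_def by blast
qed

text \<open>Reduced words of a free product: powers of rotations about visible lines, consecutive
  lines distinct, followed by one element of \<open>H\<close>. Since \<open>H\<close> permutes the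
  visible lines, its elements can always be moved to the right end (\<open>red_act\<close>). The
  indices record the leading syllable.\<close>

inductive red :: "'l \<Rightarrow> int \<Rightarrow> _ \<Rightarrow> bool" where
  base: "\<lbrakk>V \<in> VV; l \<noteq> 0; h \<in> H\<rbrakk> \<Longrightarrow> red V l (r V [^] l \<otimes> h)"
| step: "\<lbrakk>red V' l' g; V \<in> VV; V \<noteq> V'; l \<noteq> 0\<rbrakk> \<Longrightarrow> red V l (r V [^] l \<otimes> g)"

lemma red_VV: "red V l g \<Longrightarrow> V \<in> VV" and red_l: "red V l g \<Longrightarrow> l \<noteq> 0"
  by (induction rule: red.induct) auto

lemma red_N': "red V l g \<Longrightarrow> g \<in> N'"
  by (induction rule: red.induct) (auto intro: rotg_mult rotg_pow[OF \<Omega>VV] H_N')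

lemma red_act: "red V l g \<Longrightarrow> h \<in> H \<Longrightarrow> red (act h V) l (h \<otimes> g)"
proof (induction rule: red.induct)
  case (base V l h')
  have "h \<otimes> (r V [^] l \<otimes> h') = r (act h V) [^] l \<otimes> (h \<otimes> h')"
    using base r_act_pow[of h V l] by (simp add: m_assoc[symmetric])
  then show ?case using red.base[of "act h V" l "h \<otimes> h'"] base Vis_act rotg_mult by auto
next
  case (step V' l' g V l)
  have g: "g \<in> carrier G" using step red_N' by auto
  have "h \<otimes> (r V [^] l \<otimes> g) = r (act h V) [^] l \<otimes> (h \<otimes> g)"
    using step g r_act_pow[of h V l] by (simp add: m_assoc[symmetric])
  moreover have "act h V \<noteq> act h V'" using step red_VV act_eq_iff[of h V V'] by auto
  ultimately show ?case using red.step[of "act h V'" l' "h \<otimes> g" "act h V" l] step Vis_act by auto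
qed

abbreviation "NF \<equiv> {g. g \<in> H \<or> (\<exists>V l. red V l g)}"

lemma NF_N': "g \<in> NF \<Longrightarrow> g \<in> N'"
  using red_N' H_N' by auto

lemma NF_pow:
  assumes "V \<in> VV" "g \<in> NF" shows "r V [^] (n::int) \<otimes> g \<in> NF"
proof (cases "n = 0")
  case True
  then show ?thesis using assms NF_N' by simp
next
  case n: False
  show ?thesis
  proof (cases "g \<in> H")
    case True
    then show ?thesis using red.base[of V n g] n assms by blast
  next
    case False
    then obtain V' l where red: "red V' l g" using assms by blast
    show ?thesis
    proof (cases "V' = V")
      case False
      then show ?thesis using red.step[OF red, of V n] n assms by blast
    next
      case True
      from red have "red V l g" using True by simp
      then obtain g0 where g0: "g = r V [^] l \<otimes> g0" "g0 \<in> H \<or> (\<exists>V' l'. red V' l' g0 \<and> V \<noteq> V')"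
        by cases auto
      have g0c: "g0 \<in> carrier G" using g0 red_N' by auto
      have eq: "r V [^] n \<otimes> g = r V [^] (n + l) \<otimes> g0"
        using g0 g0c assms by (simp add: int_pow_mult m_assoc)
      show ?thesis
      proof (cases "n + l = 0")
        case True
        then have "r V [^] n \<otimes> g = g0" unfolding eq using g0c by simp
        then show ?thesis using g0 by auto
      next
        case False
        then show ?thesis using eq g0(2) red.base[of V "n + l" g0] red.step[of _ _ g0 V "n + l"] assms by auto
      qed
    qed
  qed
qed

lemma NF_H: "\<lbrakk>h \<in> H; g \<in> NF\<rbrakk> \<Longrightarrow> h \<otimes> g \<in> NF"
  using red_act rotg_mult by blast

lemma N'_NF: "g \<in> N' \<Longrightarrow> g \<in> NF"
proof -
  assume g: "g \<in> N'"
  \<comment> \<open>Left multiplication on all of \<open>NF\<close> is what the induction over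
    generators can prove; the claim itself is the case of the identity.\<close>
  have "\<forall>g' \<in> NF. g \<otimes> g' \<in> NF"
    using g[unfolded rotg_def]
  proof (induction rule: generate.induct)
    case one
    then show ?case using NF_N' by auto
  next
    case (incl h)
    then show ?case
    proof (elim imageE UnE)
      fix U assume "h = r U" "U \<in> \<Omega>"
      then show ?thesis using NF_H rotg_incl by blast
    next
      fix U assume "h = r U" "U \<in> VV"
      then show ?thesis using NF_pow[of U _ 1] by auto
    qed
  next
    case (inv h)
    then show ?case
    proof (elim imageE UnE)
      fix U assume U: "h = r U" "U \<in> \<Omega>"
      then have "inv h \<in> H" using rotg_incl rotg_inv[OF \<Omega>] by blast
      then show ?thesis using NF_H by blast
    next
      fix U assume "h = r U" "U \<in> VV"
      then show ?thesis using NF_pow[of U _ "-1"] by (auto simp: int_pow_neg)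
    qed
  next
    case (eng h1 h2)
    have c: "h1 \<in> carrier G" "h2 \<in> carrier G"
      using eng(1,2) N'_closed unfolding rotg_def by blast+
    show ?case
    proof
      fix g' assume g': "g' \<in> NF"
      then have "h1 \<otimes> (h2 \<otimes> g') \<in> NF" using eng by blast
      then show "h1 \<otimes> h2 \<otimes> g' \<in> NF" using c NF_N'[OF g'] by (simp add: m_assoc)
    qed
  qed
  then have "g \<otimes> \<one> \<in> NF" using rotg_one by blast
  then show ?thesis using g by simp
qed


lemma lk_ge: "l \<noteq> 0 \<Longrightarrow> \<bar>l * k\<bar> \<ge> k"
proof -
  assume "l \<noteq> 0"
  have k: "k > 0" using k_large E_pos by linarith
  have "1 * k \<le> \<bar>l\<bar> * k" using \<open>l \<noteq> 0\<close> k by (intro mult_right_mono) auto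
  then show ?thesis using k by (simp add: abs_mult)
qed

text \<open>All translates \<open>pact h x\<close> are covered because the element of
  \<open>H\<close> at the end of a reduced word acts first. Half a turn is what ping-pong tolerates:
  any nonzero power of a rotation still leaves the point about \<open>k / 2\<close> away from
  \<open>b\<close>.\<close>

definition weak :: "'p \<Rightarrow> bool" where
  "weak x \<longleftrightarrow> x \<in> Pt \<and> (\<forall>h \<in> H. \<forall>V \<in> VV. 2 * d V b (pact h x) \<le> k + 40 * E)"

lemma weak_b: "weak b"
proof -
  have "2 * d V b (pact h b) \<le> k + 40 * E" if "h \<in> H" "V \<in> VV" for h V
    using near_hb[of h V] that VV_\<Omega>[of V] VV_Sp[of V] k_large E_pos by linarith
  then show ?thesis by (simp add: weak_def)
qed

text \<open>17E = 16E + E: two visible lines see each other within 16E of \<open>b\<close>, and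
  Behrstock's inequality adds E. So at most one visible line separates \<open>b\<close> from
  \<open>x\<close>, which is the disjointness that ping-pong needs.\<close>

lemma sepa:
  assumes "V1 \<in> VV" "V \<in> VV" "V1 \<noteq> V" "x \<in> Pt" "d V1 b x > 17 * E"
  shows "d V b x \<le> 17 * E"
proof -
  have "d V1 b (ob V) \<le> 16 * E" "d V b (ob V1) \<le> 16 * E"
    using near_V[of V V1] near_V[of V1 V] assms VV_\<Omega> by auto
  moreover from this have "d V1 x (ob V) > E"
    using d_tri[of V1 b x "ob V"] d_sym[of V1 x "ob V"] assms by linarith
  then have "d V x (ob V1) \<le> E" using cohS[of V1 V x] assms by auto
  ultimately show ?thesis using d_le''[of V b "ob V1" "16 * E" x E] by simp
qed

lemma \<delta>_rot: "\<lbrakk>V \<in> Sp; g \<in> carrier G; x \<in> Pt\<rbrakk>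
    \<Longrightarrow> \<delta> V b (pact (r V [^] (l::int) \<otimes> g) x) = \<delta> V b (pact g x) + l * k"
  using \<delta>_add[of V b "pact (r V [^] l \<otimes> g) x" "pact g x"] rot_pow[of V "pact g x" l]
  by (simp add: pact_mult)

text \<open>Ping-pong. Only the innermost rotation may start half a turn away from \<open>b\<close>.
  Afterwards the previous line sees the point far away, so by \<open>sepa\<close> every later
  rotation starts within 17E of \<open>b\<close> and contributes its full multiple of
  \<open>k\<close>.\<close>

lemma red_far: "red V l g \<Longrightarrow> weak x \<Longrightarrow> 2 * d V b (pact g x) \<ge> k - 40 * E"
proof (induction rule: red.induct)
  case (base V l h)
  then have "2 * d V b (pact h x) \<le> k + 40 * E" "x \<in> Pt" by (auto simp: weak_def)
  moreover have "\<delta> V b (pact (r V [^] l \<otimes> h) x) = \<delta> V b (pact h x) + l * k"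
    using \<delta>_rot[of V h x l] base calculation by auto
  ultimately show ?case using lk_ge[OF base(2)] by linarith
next
  case (step V' l' g V l)
  have x: "x \<in> Pt" and g: "g \<in> carrier G" using step red_N' by (auto simp: weak_def)
  have "d V b (pact g x) \<le> 17 * E"
    using sepa[of V' V "pact g x"] step red_VV x g k_large E_pos by auto
  moreover have "\<delta> V b (pact (r V [^] l \<otimes> g) x) = \<delta> V b (pact g x) + l * k"
    using \<delta>_rot[of V g x l] step x g by auto
  ultimately show ?case using lk_ge[OF step(4)] k_large E_pos by linarith
qed

text \<open>With at least two syllables the starting position on \<open>V\<close> is within 17E by
  \<open>sepa\<close>, and the rotation is nearly exact. With a single syllable the position of
  \<open>pact h x\<close> on \<open>V\<close> is itself the error, hence the second
  alternative.\<close>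

lemma red_lat: "red V l g \<Longrightarrow> weak x \<Longrightarrow>
    \<bar>\<delta> V b (pact g x) - l * k\<bar> \<le> 17 * E \<or> (\<exists>h \<in> H. g = r V [^] l \<otimes> h \<and> d V b (pact h x) > 17 * E)"
proof (induction rule: red.cases)
  case (base V' l' h)
  then have "\<delta> V b (pact g x) = \<delta> V b (pact h x) + l * k"
    using \<delta>_rot[of V h x l] by (auto simp: weak_def)
  then show ?case using base by force
next
  case (step V' l' g' V'' l'')
  have x: "x \<in> Pt" and g: "g' \<in> carrier G" using step red_N' by (auto simp: weak_def)
  have "d V b (pact g' x) \<le> 17 * E"
    using sepa[of V' V "pact g' x"] red_far[of V' l' g' x] step red_VV x g k_large E_pos by auto
  moreover have "\<delta> V b (pact g x) = \<delta> V b (pact g' x) + l * k"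
    using \<delta>_rot[of V g' x l] step x g by auto
  ultimately show ?case by auto
qed

lemma \<delta>_ob_act:
  assumes "g \<in> carrier G" "Y \<in> Ln" "Z \<in> Ln" "act g Y \<noteq> Z"
  shows "\<delta> Z x (pact g (ob Y)) = \<delta> Z x (ob (act g Y))"
  using ob_act[of g Y Z] assms \<delta>_add[of Z x "pact g (ob Y)" "ob (act g Y)"] by auto

lemma red_line:
  assumes red: "red V l g" and Y: "Y \<in> \<Omega> \<union> VV" and ne: "act g Y \<noteq> V"
  shows "\<bar>\<delta> V b (ob (act g Y)) - l * k\<bar> \<le> 17 * E"
proof -
  have V: "V \<in> VV" and g: "g \<in> carrier G" using red red_VV red_N' by auto
  have YS: "Y \<in> Sp" using Y \<Omega> by auto
  \<comment> \<open>The position of \<open>ob Y\<close> on \<open>Y\<close> is arbitrary and may be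
    far from \<open>b\<close>. A power of \<open>r Y\<close> corrects it without changing the
    projections to the other lines, and so makes \<open>x\<close> weak.\<close>
  obtain n :: int where n: "2 * d Y b (pact (r Y [^] n) (ob Y)) \<le> k"
    using rot_reduce[of Y "ob Y" b] YS by auto
  define x where "x = pact (r Y [^] n) (ob Y)"
  have x: "x \<in> Pt" using YS by (simp add: x_def)
  have xd: "\<delta> Z y (pact h x) = \<delta> Z y (ob (act h Y))" if "h \<in> carrier G" "Z \<in> Ln" "act h Y \<noteq> Z" for h Z y
    using \<delta>_ob_act[of "h \<otimes> r Y [^] n" Y Z y] that YS
    by (simp add: x_def act_mult pact_mult act_r_pow)
  have near: "d V' b (pact h x) \<le> 17 * E" if "h \<in> H" "V' \<in> VV" "act h Y \<noteq> V'" for h V'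
  proof -
    have "d V' b (ob (act h Y)) \<le> 16 * E"
    proof (cases "Y \<in> \<Omega>")
      case True
      then show ?thesis using near_U[of "act h Y" V'] wb that VV_\<Omega> E_pos by force
    next
      case False
      then show ?thesis using near_V[of "act h Y" V'] Vis_act that VV_\<Omega> Y by auto
    qed
    then show ?thesis using xd[of h V' b] that E_pos by auto
  qed
  have "weak x"
  proof -
    have "2 * d V' b (pact h x) \<le> k + 40 * E" if "h \<in> H" "V' \<in> VV" for h V'
    proof (cases "act h Y = V'")
      case True
      have "d V' (pact h b) (pact h x) = d Y b x" using d_act[of h Y b x] that YS x True by auto
      then show ?thesis
        using n near_hb[of h V'] that VV_\<Omega> d_tri[of V' b "pact h x" "pact h b"] E_pos
        unfolding x_def[symmetric] by fastforce
    next
      case False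
      then show ?thesis using near[of h V'] that k_large E_pos by linarith
    qed
    then show ?thesis using x by (simp add: weak_def)
  qed
  then have "\<bar>\<delta> V b (pact g x) - l * k\<bar> \<le> 17 * E"
  proof (rule disjE[OF red_lat[OF red]])
    assume "\<exists>h \<in> H. g = r V [^] l \<otimes> h \<and> d V b (pact h x) > 17 * E"
    then obtain h where h: "h \<in> H" "g = r V [^] l \<otimes> h" "d V b (pact h x) > 17 * E" by blast
    then have "act h Y = V" using near[of h V] V by force
    then have "act g Y = V" using h V YS by (simp add: act_mult act_r_pow)
    then show ?thesis using ne by simp
  qed
  then show ?thesis using xd[of g V b] g V ne by simp
qed

lemma nxt_pos:
  assumes "W \<in> nxt b \<Omega>"
  shows "W \<in> \<Omega> \<union> VV \<or> (\<exists>V \<in> VV. \<exists>l. l \<noteq> 0 \<and> V \<noteq> W \<and> \<bar>\<delta> V b (ob W) - l * k\<bar> \<le> 17 * E)"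
proof -
  obtain g Y where W: "W = act g Y" "g \<in> N'" "Y \<in> \<Omega> \<union> VV" using assms unfolding nxt_def by blast
  consider "g \<in> H" | V l where "red V l g" using N'_NF[OF W(2)] by blast
  then show ?thesis
  proof cases
    case 1
    then show ?thesis using W wb Vis_act by blast
  next
    case 2
    then show ?thesis using red_line[OF 2 W(3)] red_VV[OF 2] red_l[OF 2] W by (metis UnI2)
  qed
qed

lemma nxt_pos_b: "g \<in> N' \<Longrightarrow> g \<in> H \<or> (\<exists>V \<in> VV. \<exists>l. l \<noteq> 0 \<and> \<bar>\<delta> V b (pact g b) - l * k\<bar> \<le> 17 * E)"
proof -
  assume "g \<in> N'"
  then consider "g \<in> H" | V l where "red V l g" using N'_NF by blast
  then show ?thesis
  proof cases
    case 2
    have "\<bar>\<delta> V b (pact g b) - l * k\<bar> \<le> 17 * E"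
      using red_lat[OF 2 weak_b] near_hb[of _ V] red_VV[OF 2] VV_\<Omega>[of V] E_pos by fastforce
    then show ?thesis using red_VV[OF 2] red_l[OF 2] by blast
  qed simp
qed

text \<open>Greedy descent: while some visible line sees the point more than half a turn away, turn
  around it. The products are reduced words. Pulled back by them, the lines used become distinct
  lines that separate \<open>b\<close> from \<open>x\<close>, and there are only finitely many of
  these.\<close>

lemma walk:
  assumes x: "x \<in> Pt"
  shows "\<exists>g \<in> N'. \<forall>V \<in> VV. 2 * d V b (pact g x) \<le> k"
proof (rule ccontr)
  assume "\<not> ?thesis"
  then have "\<forall>g. \<exists>V. g \<in> N' \<longrightarrow> V \<in> VV \<and> 2 * d V b (pact g x) > k" by force
  then obtain vf where vf: "\<And>g. g \<in> N' \<Longrightarrow> vf g \<in> VV \<and> 2 * d (vf g) b (pact g x) > k" by metis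
  have "\<forall>g. \<exists>l :: int. g \<in> N' \<longrightarrow> 2 * d (vf g) b (pact (r (vf g) [^] l) (pact g x)) \<le> k"
  proof
    fix g
    show "\<exists>l :: int. g \<in> N' \<longrightarrow> 2 * d (vf g) b (pact (r (vf g) [^] l) (pact g x)) \<le> k"
    proof (cases "g \<in> N'")
      case True
      then obtain l :: int where "2 * d (vf g) b (pact (r (vf g) [^] l) (pact g x)) \<le> k"
        using rot_reduce[of "vf g" "pact g x" b] vf[of g] x by auto
      then show ?thesis by blast
    qed simp
  qed
  then obtain lf :: "'a \<Rightarrow> int" where
    lf: "\<And>g. g \<in> N' \<Longrightarrow> 2 * d (vf g) b (pact (r (vf g) [^] lf g) (pact g x)) \<le> k" by metis
  define gs where "gs = rec_nat \<one> (\<lambda>_ g. r (vf g) [^] lf g \<otimes> g)"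
  have gs0: "gs 0 = \<one>" and gsS: "gs (Suc i) = r (vf (gs i)) [^] lf (gs i) \<otimes> gs i" for i
    by (simp_all add: gs_def)
  have gsN: "gs i \<in> N'" for i
  proof (induction i)
    case 0
    then show ?case by (simp add: gs0 rotg_one)
  next
    case (Suc i)
    then show ?case using vf[OF Suc] by (auto simp: gsS intro!: rotg_mult rotg_pow[OF \<Omega>VV])
  qed
  define V where "V i = vf (gs i)" for i
  define L where "L i = lf (gs i)" for i
  have V: "V i \<in> VV" and far: "2 * d (V i) b (pact (gs i) x) > k" for i
    using vf[OF gsN[of i]] by (auto simp: V_def)
  have [simp]: "gs i \<in> carrier G" for i using gsN by auto
  have gsS': "gs (Suc i) = r (V i) [^] L i \<otimes> gs i" for i by (simp add: gsS V_def L_def)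
  have close: "2 * d (V i) b (pact (gs (Suc i)) x) \<le> k" for i
    using lf[OF gsN[of i]] V[of i] x by (simp add: gsS V_def pact_mult)
  have VS: "V (Suc i) \<noteq> V i" for i using far[of "Suc i"] close[of i] by auto
  have L0: "L i \<noteq> 0" for i
    using far[of i] close[of i] V[of i] by (auto simp: gsS')
  have redn: "red (V (i + n)) (L (i + n)) (gs (Suc (i + n)) \<otimes> inv (gs i))" for i n
  proof (induction n)
    case 0
    then show ?case using red.base[OF V[of i] L0[of i] rotg_one] V[of i] by (simp add: gsS' m_assoc)
  next
    case (Suc n)
    then show ?case using red.step[OF Suc V VS L0] V[of "Suc (i + n)"]
      by (simp add: gsS'[of "Suc (i + n)"] m_assoc)
  qed
  define Z where "Z i = act (inv (gs i)) (V i)" for i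
  have ZS: "Z i \<in> Sp" for i using V by (simp add: Z_def)
  have Zfar: "d (Z i) b x > E" for i
  proof -
    have eq: "d (Z i) b x = d (V i) (pact (gs i) b) (pact (gs i) x)"
      using d_shift2[of "gs i" "V i" b x] V[of i] x by (simp add: Z_def)
    have "d (V i) b (pact (gs i) b) \<le> 17 * E"
    proof (cases i)
      case 0
      then show ?thesis using E_pos by (simp add: gs0)
    next
      case (Suc j)
      have "red (V j) (L j) (gs i)" using redn[of 0 j] Suc by (simp add: gs0)
      then have "d (V j) b (pact (gs i) b) > 17 * E" using red_far weak_b k_large E_pos by fastforce
      then show ?thesis using sepa[of "V j" "V i"] V VS[of j] Suc by auto
    qed
    then show ?thesis
      unfolding eq using far[of i] d_tri[of "V i" b "pact (gs i) x" "pact (gs i) b"] k_large E_pos by linarith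
  qed
  \<comment> \<open>Equality would make a reduced word led by \<open>V (j - 1)\<close> carry
    \<open>V i\<close> to \<open>V j\<close> (for \<open>n > 0\<close>). By \<open>red_line\<close>
    the line \<open>V (j - 1)\<close> would then see \<open>V j\<close> about a full turn or more
    from \<open>b\<close>, whereas visible lines see each other within 16E of
    \<open>b\<close>.\<close>
  have ne: "Z i \<noteq> Z (Suc (i + n))" for i n
  proof
    assume eq: "Z i = Z (Suc (i + n))"
    define j where "j = Suc (i + n)"
    have "act (gs j) (Z j) = V j" using V[of j] by (simp add: Z_def)
    then have "act (gs j) (Z i) = V j" using eq by (simp only: j_def)
    then have "act (gs j \<otimes> inv (gs i)) (V i) = V j" using V by (simp add: Z_def act_mult)
    moreover have "gs j \<otimes> inv (gs i) = (gs j \<otimes> inv (gs (Suc i))) \<otimes> (gs (Suc i) \<otimes> inv (gs i))"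
      by (simp add: m_assoc inv_solve_left)
    moreover have "gs (Suc i) \<otimes> inv (gs i) = r (V i) [^] L i" using V[of i] by (simp add: gsS' m_assoc)
    ultimately have act: "act (gs j \<otimes> inv (gs (Suc i))) (V i) = V j"
      using V[of i] by (simp add: act_mult act_r_pow)
    show False
    proof (cases n)
      case 0
      then show ?thesis using act V[of i] VS[of i] by (simp add: j_def)
    next
      case (Suc m)
      have red: "red (V (Suc i + m)) (L (Suc i + m)) (gs j \<otimes> inv (gs (Suc i)))"
        using redn[of "Suc i" m] Suc by (simp add: j_def)
      have j: "j = Suc (Suc i + m)" using Suc by (simp add: j_def)
      have neq: "V j \<noteq> V (Suc i + m)" unfolding j by (rule VS)
      have "\<bar>\<delta> (V (Suc i + m)) b (ob (V j)) - L (Suc i + m) * k\<bar> \<le> 17 * E"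
        using red_line[OF red, of "V i"] act neq V by auto
      moreover have "d (V (Suc i + m)) b (ob (V j)) \<le> 16 * E"
        by (rule near_V[OF V VV_Sp[OF V] VV_\<Omega>[OF V] neq[symmetric]])
      ultimately show ?thesis using lk_ge[OF L0[of "Suc i + m"]] k_large E_pos by linarith
    qed
  qed
  have "inj Z"
  proof (rule linorder_injI)
    fix i j :: nat assume "i < j"
    then obtain n where "j = Suc (i + n)" using less_imp_Suc_add by blast
    then show "Z i \<noteq> Z j" using ne by simp
  qed
  moreover have "finite (range Z)"
    by (rule finite_subset[OF _ finS[OF b x]]) (use ZS Zfar in auto)
  ultimately show False using finite_imageD[of Z UNIV] by simp
qed

lemma nxt_sup: "\<Omega> \<union> VV \<subseteq> nxt b \<Omega>"
proof
  fix Y assume Y: "Y \<in> \<Omega> \<union> VV"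
  then have "Y = act \<one> Y" using \<Omega>VV by auto
  then show "Y \<in> nxt b \<Omega>" using Y rotg_one unfolding nxt_def by blast
qed

lemma nxt_Sp: "nxt b \<Omega> \<subseteq> Sp"
  unfolding nxt_def using \<Omega>VV by auto

lemma rotg_nxt: "rotg (nxt b \<Omega>) = N'"
proof
  have "r W \<in> N'" if "W \<in> nxt b \<Omega>" for W
  proof -
    have "\<exists>g Y. W = act g Y \<and> g \<in> N' \<and> Y \<in> \<Omega> \<union> VV" using that unfolding nxt_def by blast
    then obtain g Y where W: "W = act g Y" "g \<in> N'" "Y \<in> \<Omega> \<union> VV" by blast
    then have "r Y \<in> N'" "Y \<in> Sp" using rotg_incl \<Omega>VV by blast+
    then have "r W = g \<otimes> r Y \<otimes> inv g" using W r_act by simp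
    then show ?thesis using W(2) \<open>r Y \<in> N'\<close> by (auto intro!: rotg_mult rotg_inv[OF \<Omega>VV])
  qed
  then have "r ` nxt b \<Omega> \<subseteq> N'" by blast
  then show "rotg (nxt b \<Omega>) \<subseteq> N'"
    unfolding rotg_def[of "nxt b \<Omega>"] by (rule generate_subgroup_incl[OF _ rotg_subgroup[OF \<Omega>VV]])
  show "N' \<subseteq> rotg (nxt b \<Omega>)" by (rule rotg_mono[OF nxt_sup])
qed

lemma nxt_act: "\<lbrakk>g \<in> N'; W \<in> nxt b \<Omega>\<rbrakk> \<Longrightarrow> act g W \<in> nxt b \<Omega>"
proof -
  assume g: "g \<in> N'" and "W \<in> nxt b \<Omega>"
  then obtain h Y where W: "W = act h Y" "h \<in> N'" "Y \<in> \<Omega> \<union> VV" unfolding nxt_def by blast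
  then have "act g W = act (g \<otimes> h) Y" using g \<Omega>VV by (auto simp: act_mult)
  then show ?thesis using W rotg_mult[OF g W(2)] unfolding nxt_def by blast
qed


text \<open>Such a \<open>W\<close> lies behind a visible \<open>V\<close>, which sees it almost a
  full turn from \<open>b\<close> and hence far from \<open>x\<close> too. So \<open>W\<close> sees
  both \<open>b\<close> and \<open>x\<close> within E of \<open>V\<close>.\<close>

lemma finish_pos:
  assumes x: "x \<in> Pt" and v: "\<And>V. V \<in> VV \<Longrightarrow> 2 * d V b x \<le> k + 24 * E"
    and W: "W \<in> nxt b \<Omega>" "W \<notin> \<Omega> \<union> VV"
  shows "d W b x \<le> 2 * E"
proof -
  obtain V l where V: "V \<in> VV" "l \<noteq> 0" "V \<noteq> W" "\<bar>\<delta> V b (ob W) - l * k\<bar> \<le> 17 * E"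
    using nxt_pos[OF W(1)] W(2) by blast
  have WS: "W \<in> Sp" using W nxt_Sp by blast
  have far: "d V b (ob W) \<ge> k - 17 * E" using lk_ge[OF V(2)] V(4) by linarith
  then have "d W b (ob V) \<le> E" using cohS[of V W b] V WS k_large E_pos by auto
  moreover have "d V x (ob W) > E"
    using far v[OF V(1)] d_tri[of V b "ob W" x] k_large E_pos by linarith
  then have "d W x (ob V) \<le> E" using cohS[of V W x] V WS x by auto
  ultimately show ?thesis using d_le''[of W b "ob V" E x E] by simp
qed

lemma nxt_d:
  assumes x: "x \<in> Pt"
  shows "\<exists>h \<in> N'. \<forall>U \<in> nxt b \<Omega>. 2 * d U b (pact h x) \<le> k + 40 * E"
proof -
  obtain g where g: "g \<in> N'" "\<And>V. V \<in> VV \<Longrightarrow> 2 * d V b (pact g x) \<le> k" using walk[OF x] by blast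
  obtain h where h: "h \<in> H" "\<And>U. U \<in> \<Omega> \<Longrightarrow> 2 * d U b (pact h (pact g x)) \<le> k + 40 * E"
    using wd[of "pact g x"] x g by auto
  define y where "y = pact (h \<otimes> g) x"
  have y: "y \<in> Pt" "y = pact h (pact g x)" using g h x by (auto simp: y_def pact_mult)
  \<comment> \<open>\<open>h\<close> permutes the visible lines and moves \<open>b\<close> by at
    most 12E along them; doubled, this is the loss of 24E.\<close>
  have yV: "2 * d V b y \<le> k + 24 * E" if V: "V \<in> VV" for V
  proof -
    have "d V (pact h b) y = d (act (inv h) V) b (pact g x)"
      unfolding y(2) using d_shift2[of h V b "pact g x"] h g x V by simp
    moreover have "act (inv h) V \<in> VV" using Vis_act[of "inv h" V] V h rotg_inv[OF \<Omega>] by blast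
    ultimately have "2 * d V (pact h b) y \<le> k" using g(2) by metis
    then show ?thesis
      using near_hb[of h V] h V VV_\<Omega>[OF V] d_tri[of V b y "pact h b"] by auto
  qed
  have "2 * d U b y \<le> k + 40 * E" if U: "U \<in> nxt b \<Omega>" for U
  proof -
    consider "U \<in> \<Omega>" | "U \<in> VV" | "U \<notin> \<Omega> \<union> VV" by blast
    then show ?thesis
    proof cases
      case 1
      then show ?thesis using h y by simp
    next
      case 2
      then show ?thesis using yV[of U] E_pos by linarith
    next
      case 3
      then show ?thesis using finish_pos[OF y(1) yV U] k_large E_pos by linarith
    qed
  qed
  then show ?thesis unfolding y_def using rotg_mult[OF H_N'[OF h(1)] g(1)] by blast
qed

text \<open>A visible line \<open>V1\<close> that hides \<open>V\<close> serves as a common landmark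
  on \<open>V\<close>. The old windmill projects within E of it, the visible lines within 5E, and
  whatever a nontrivial rotation has carried behind a visible line within 6E.\<close>

lemma nxt_a_aux:
  assumes V: "V \<in> Sp" "V \<notin> nxt b \<Omega>" and v: "\<And>V'. V' \<in> VV \<Longrightarrow> 2 * d V' b (ob V) \<le> k"
  shows "\<exists>V1. (\<forall>g \<in> N'. d V (pact g b) (ob V1) \<le> 6 * E) \<and> (\<forall>W \<in> nxt b \<Omega>. d V (ob W) (ob V1) \<le> 6 * E)"
proof -
  have V\<Omega>: "V \<notin> \<Omega>" "V \<notin> VV" using V nxt_sup by auto
  obtain V1 where V1: "V1 \<in> VV" "\<And>x. x \<in> Ref b \<Omega> \<Longrightarrow> d V1 x (ob V) > 3 * E"
    using vis_exists[OF b \<Omega>, of V] V V\<Omega> by blast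
  have ref: "d V x (ob V1) \<le> E" if "x \<in> Ref b \<Omega>" for x
  proof -
    have "V1 \<noteq> V" "V1 \<in> Sp" using V1(1) V\<Omega> by auto
    then show ?thesis using cohS[of V1 V x] V1(2)[OF that] V Ref_Pt[OF b \<Omega> that] E_pos by linarith
  qed
  have vis: "d V (ob V2) (ob V1) \<le> 5 * E" if V2: "V2 \<in> VV" for V2
  proof -
    have "V \<in> Sp - \<Omega>" "V \<noteq> V2" using V V\<Omega> V2 by auto
    then obtain x where x: "x \<in> Ref b \<Omega>" "d V x (ob V2) \<le> 4 * E"
      using V2 unfolding Vis_def by fast
    then show ?thesis using d_le'[OF x(2) ref[OF x(1)]] by simp
  qed
  have deep: "d V z (ob V1) \<le> 6 * E"
    if "z \<in> Pt" "V2 \<in> VV" "l \<noteq> 0" "\<bar>\<delta> V2 b z - l * k\<bar> \<le> 17 * E" for z V2 l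
  proof -
    have "d V2 z (ob V) > E"
      using lk_ge[OF that(3)] that(4) v[OF that(2)] d_tri[of V2 b z "ob V"] d_sym[of V2 z "ob V"]
        k_large E_pos by linarith
    then have "d V z (ob V2) \<le> E" using cohS[of V2 V z] that V V\<Omega> by auto
    then show ?thesis using d_le[OF _ vis[OF that(2)], of z E] by simp
  qed
  have 1: "d V (pact g b) (ob V1) \<le> 6 * E" if g: "g \<in> N'" for g
  proof (cases "g \<in> H")
    case True
    then have "pact g b \<in> Ref b \<Omega>" by (auto simp: Ref_def)
    then show ?thesis using ref[of "pact g b"] E_pos by auto
  next
    case False
    then obtain V2 l where "V2 \<in> VV" "l \<noteq> 0" "\<bar>\<delta> V2 b (pact g b) - l * k\<bar> \<le> 17 * E"
      using nxt_pos_b[OF g] by blast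
    then show ?thesis using deep[of "pact g b" V2 l] g by auto
  qed
  have 2: "d V (ob W) (ob V1) \<le> 6 * E" if W: "W \<in> nxt b \<Omega>" for W
  proof -
    have WS: "W \<in> Sp" using W nxt_Sp by blast
    consider "W \<in> \<Omega>" | "W \<in> VV" | V2 l where "V2 \<in> VV" "l \<noteq> 0" "\<bar>\<delta> V2 b (ob W) - l * k\<bar> \<le> 17 * E"
      using nxt_pos[OF W] by blast
    then show ?thesis
    proof cases
      case 1
      then have "ob W \<in> Ref b \<Omega>" by (auto simp: Ref_def)
      then show ?thesis using ref[of "ob W"] E_pos by auto
    next
      case 2
      then show ?thesis using vis[of W] E_pos by auto
    next
      case 3
      then show ?thesis using deep[of "ob W" V2 l] WS by auto
    qed
  qed
  show ?thesis using 1 2 by blast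
qed

text \<open>The element \<open>g\<close> from \<open>walk\<close> brings \<open>V\<close> within
  half a turn of \<open>b\<close> along all visible lines, as \<open>nxt_a_aux\<close> requires, and
  preserves the new windmill. The landmark then serves for both \<open>pact g b\<close> and
  \<open>pact g x\<close>.\<close>

lemma nxt_a:
  assumes V: "V \<in> Sp" "V \<notin> nxt b \<Omega>" and x: "x \<in> Ref b (nxt b \<Omega>)"
  shows "d V b x \<le> 12 * E"
proof -
  obtain g where g: "g \<in> N'" "\<And>V'. V' \<in> VV \<Longrightarrow> 2 * d V' b (pact g (ob V)) \<le> k"
    using walk[of "ob V"] V by auto
  define V2 where "V2 = act g V"
  have V2S: "V2 \<in> Sp" using V g by (simp add: V2_def)
  have V2n: "V2 \<notin> nxt b \<Omega>"
    using nxt_act[of "inv g" V2] rotg_inv[OF \<Omega>VV g(1)] V g by (auto simp: V2_def)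
  have "2 * d V' b (ob V2) \<le> k" if "V' \<in> VV" for V'
  proof -
    have "act g V \<noteq> V'" using that V2n nxt_sup unfolding V2_def by auto
    then show ?thesis using g(2)[OF that] d_ob_act'[of g V V' b] g V that by (simp add: V2_def)
  qed
  then obtain V1 where V1: "\<And>h. h \<in> N' \<Longrightarrow> d V2 (pact h b) (ob V1) \<le> 6 * E"
      "\<And>W. W \<in> nxt b \<Omega> \<Longrightarrow> d V2 (ob W) (ob V1) \<le> 6 * E"
    using nxt_a_aux[OF V2S V2n] by blast
  have xP: "x \<in> Pt" using Ref_Pt[OF b nxt_Sp x] .
  have "d V2 (pact g x) (ob V1) \<le> 6 * E"
  proof -
    from x consider h where "h \<in> N'" "x = pact h b" | W where "W \<in> nxt b \<Omega>" "x = ob W"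
      unfolding Ref_def rotg_nxt by blast
    then show ?thesis
    proof cases
      case 1
      then show ?thesis using V1(1)[OF rotg_mult[OF g(1) 1(1)]] g by (simp add: pact_mult)
    next
      case 2
      have W: "act g W \<in> nxt b \<Omega>" "W \<in> Sp" using nxt_act[OF g(1) 2(1)] 2 nxt_Sp by auto
      then have "act g W \<noteq> V2" using V2n by auto
      then show ?thesis using V1(2)[OF W(1)] 2 d_ob_act[of g W V2 "ob V1"] W g V2S by auto
    qed
  qed
  moreover have "d V2 (pact g b) (ob V1) \<le> 6 * E" using V1(1)[OF g(1)] .
  ultimately have "d V2 (pact g b) (pact g x) \<le> 12 * E"
    using d_le''[of V2 "pact g b" "ob V1" "6 * E" "pact g x" "6 * E"] by simp
  then show ?thesis using d_act[of g V b x] g V xP by (simp add: V2_def)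
qed

theorem windmill_nxt: "windmill b (nxt b \<Omega>)"
  unfolding windmill_def rotg_nxt
proof (intro conjI ballI impI)
  show "nxt b \<Omega> \<subseteq> Sp" by (rule nxt_Sp)
  show "\<And>h U. h \<in> N' \<Longrightarrow> U \<in> nxt b \<Omega> \<Longrightarrow> act h U \<in> nxt b \<Omega>" by (rule nxt_act)
  show "\<And>V x. V \<in> Sp - nxt b \<Omega> \<Longrightarrow> x \<in> Ref b (nxt b \<Omega>) \<Longrightarrow> d V b x \<le> 12 * E" using nxt_a by auto
  show "\<And>x. x \<in> Pt \<Longrightarrow> \<exists>h \<in> N'. \<forall>U \<in> nxt b \<Omega>. 2 * d U b (pact h x) \<le> k + 40 * E" by (rule nxt_d)
next
  fix h assume h: "h \<in> N'" "h \<noteq> \<one>"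
  show "\<exists>U \<in> nxt b \<Omega>. \<exists>l. l \<noteq> 0 \<and> \<bar>\<delta> U b (pact h b) - l * k\<bar> \<le> 40 * E"
  proof (cases "h \<in> H")
    case True
    then show ?thesis using wc[OF True h(2)] nxt_sup by blast
  next
    case False
    then obtain V l where "V \<in> VV" "l \<noteq> 0" "\<bar>\<delta> V b (pact h b) - l * k\<bar> \<le> 17 * E"
      using nxt_pos_b[OF h(1)] by blast
    then show ?thesis using nxt_sup E_pos by (intro bexI[of _ V] exI[of _ l]) auto
  qed
qed

end

section \<open>Exhaustion by windmills and Greendlinger's lemma\<close>

context spinning
begin

lemma windmill_empty: "b \<in> Pt \<Longrightarrow> windmill b {}"
proof -
  assume b: "b \<in> Pt"
  have "rotg {} = {\<one>}" unfolding rotg_def by (simp add: generate_empty)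
  then show ?thesis using b E_pos unfolding windmill_def Ref_def by auto
qed

primrec layer :: "'p \<Rightarrow> nat \<Rightarrow> 'l set" where
  "layer b 0 = {}"
| "layer b (Suc n) = nxt b (layer b n)"

lemma windmill_layer: "b \<in> Pt \<Longrightarrow> windmill b (layer b n)"
proof (induction n)
  case (Suc n)
  then interpret windmill_step G Ln act Pt pact \<delta> ob e Sp r k E b "layer b n"
    by unfold_locales auto
  show ?case using windmill_nxt by simp
qed (simp add: windmill_empty)

lemma layer_Suc: "b \<in> Pt \<Longrightarrow> layer b n \<union> Vis b (layer b n) \<subseteq> layer b (Suc n)"
proof -
  assume "b \<in> Pt"
  then interpret windmill_step G Ln act Pt pact \<delta> ob e Sp r k E b "layer b n"
    using windmill_layer by unfold_locales auto
  show ?thesis using nxt_sup by simp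
qed

lemma layer_mono: "b \<in> Pt \<Longrightarrow> m \<le> n \<Longrightarrow> layer b m \<subseteq> layer b n"
  by (rule lift_Suc_mono_le[of "layer b"]) (use layer_Suc[of b] in \<open>auto simp del: layer.simps\<close>)

lemma layer_Sp: "b \<in> Pt \<Longrightarrow> layer b n \<subseteq> Sp"
  using windmill_layer unfolding windmill_def by blast

text \<open>A line that is never reached is blocked from \<open>b\<close> at every stage by some
  visible line. These blockers are distinct, since each is absorbed by the next layer, and
  infinitely many lines cannot separate \<open>b\<close> from \<open>V\<close>.\<close>

lemma layer_exhaust:
  assumes b: "b \<in> Pt" and V: "V \<in> Sp"
  shows "\<exists>n. V \<in> layer b n"
proof (rule ccontr)
  assume no: "\<nexists>n. V \<in> layer b n"
  have "\<forall>n. \<exists>V1. V1 \<in> Vis b (layer b n) \<and> d V1 b (ob V) > E"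
  proof
    fix n
    obtain V1 where V1: "V1 \<in> Vis b (layer b n)"
        "V1 = V \<or> (\<forall>x \<in> Ref b (layer b n). d V1 x (ob V) > 3 * E)"
      using vis_exists[OF b layer_Sp[OF b], of V n] V no by blast
    then have "V1 \<noteq> V" using layer_Suc[OF b, of n] no by blast
    then have "d V1 b (ob V) > E" using V1 Ref_b[OF b, of "layer b n"] E_pos by force
    then show "\<exists>V1. V1 \<in> Vis b (layer b n) \<and> d V1 b (ob V) > E" using V1 by blast
  qed
  then obtain f where f: "\<And>n. f n \<in> Vis b (layer b n) \<and> d (f n) b (ob V) > E" by metis
  have "inj f"
  proof (rule linorder_injI)
    fix i j :: nat assume "i < j"
    then have "f i \<in> layer b j" using f[of i] layer_Suc[OF b, of i] layer_mono[OF b, of "Suc i" j] by auto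
    then show "f i \<noteq> f j" using f[of j] Vis_Sp[of b "layer b j"] by auto
  qed
  moreover have "finite (range f)"
  proof (rule finite_subset[OF _ finS[OF b, of "ob V"]])
    show "range f \<subseteq> {Y \<in> Sp. d Y b (ob V) > E}" using f Vis_Sp by blast
    show "ob V \<in> Pt" using V by simp
  qed
  ultimately show False using finite_imageD[of f UNIV] by simp
qed

lemma layer_rotg:
  assumes b: "b \<in> Pt" and n: "n \<in> rotg Sp"
  shows "\<exists>m. n \<in> rotg (layer b m)"
  using n[unfolded rotg_def]
proof (induction rule: generate.induct)
  case one
  then show ?case using rotg_one by blast
next
  case (incl h)
  then show ?case using layer_exhaust[OF b] rotg_incl by blast
next
  case (inv h)
  then show ?case using layer_exhaust[OF b] rotg_incl rotg_inv[OF layer_Sp[OF b]] by blast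
next
  case (eng h1 h2)
  then obtain m1 m2 where "h1 \<in> rotg (layer b m1)" "h2 \<in> rotg (layer b m2)" by blast
  then have "h1 \<in> rotg (layer b (max m1 m2))" "h2 \<in> rotg (layer b (max m1 m2))"
    using rotg_mono[OF layer_mono[OF b, of m1 "max m1 m2"]]
      rotg_mono[OF layer_mono[OF b, of m2 "max m1 m2"]] by auto
  then show ?case using rotg_mult by blast
qed

abbreviation "N \<equiv> rotg Sp"

theorem greendlinger:
  assumes b: "b \<in> Pt" and n: "n \<in> N" "n \<noteq> \<one>"
  obtains U l where "U \<in> Sp" "l \<noteq> 0" "\<bar>\<delta> U b (pact n b) - l * k\<bar> \<le> 40 * E"
proof -
  obtain m where "n \<in> rotg (layer b m)" using layer_rotg[OF b n(1)] by blast
  then obtain U l where "U \<in> layer b m" "l \<noteq> 0" "\<bar>\<delta> U b (pact n b) - l * k\<bar> \<le> 40 * E"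
    using windmill_layer[OF b, of m] n(2) unfolding windmill_def by blast
  then show ?thesis using that layer_Sp[OF b, of m] by blast
qed

text \<open>Only finitely many lines see \<open>b\<close> and \<open>x\<close> more than E apart, so
  a single layer contains them. The windmill of that layer brings \<open>x\<close> close to
  \<open>b\<close> along its own lines, and along any other line it adds only the 12E by which it is
  seen from outside.\<close>

theorem good_lift:
  assumes b: "b \<in> Pt" and x: "x \<in> Pt"
  obtains n where "n \<in> N" "\<And>U. U \<in> Sp \<Longrightarrow> 2 * d U b (pact n x) \<le> k + 40 * E"
proof -
  let ?F = "{Y \<in> Sp. d Y b x > E}"
  have "\<forall>Y. \<exists>m. Y \<in> ?F \<longrightarrow> Y \<in> layer b m" using layer_exhaust[OF b] by blast
  then obtain f where f: "\<And>Y. Y \<in> ?F \<Longrightarrow> Y \<in> layer b (f Y)" by metis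
  define m where "m = Max (insert 0 (f ` ?F))"
  have fin: "finite ?F" by (rule finS[OF b x])
  have Fm: "?F \<subseteq> layer b m"
  proof
    fix Y assume Y: "Y \<in> ?F"
    have "f Y \<le> m" unfolding m_def using Y fin by (intro Max_ge) auto
    then show "Y \<in> layer b m" using f[OF Y] layer_mono[OF b] by blast
  qed
  interpret windmill_step G Ln act Pt pact \<delta> ob e Sp r k E b "layer b m"
    using windmill_layer[OF b] b by unfold_locales auto
  obtain h where h: "h \<in> H" "\<And>U. U \<in> layer b m \<Longrightarrow> 2 * d U b (pact h x) \<le> k + 40 * E"
    using wd[OF x] by blast
  have "2 * d U b (pact h x) \<le> k + 40 * E" if U: "U \<in> Sp" for U
  proof (cases "U \<in> layer b m")
    case False
    have "act (inv h) U \<notin> layer b m"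
      using out_act[of "inv h" U] rotg_inv[OF \<Omega> h(1)] U False by blast
    moreover have "act (inv h) U \<in> Sp" using U h(1) by simp
    ultimately have "d (act (inv h) U) b x \<le> E" using Fm not_less by blast
    then have "d U (pact h b) (pact h x) \<le> E" using d_shift2[of h U b x] h U x by simp
    then show ?thesis
      using near_hb[OF h(1) U False] d_tri[of U b "pact h x" "pact h b"] k_large E_pos by linarith
  qed (use h in auto)
  moreover have "h \<in> N" using h(1) rotg_mono[OF \<Omega>] by blast
  ultimately show ?thesis using that by blast
qed

end

section \<open>Torsion and inversion in the quotient by a spinning family\<close>

text \<open>\<open>A i\<close> will be the position on a line of the \<open>i\<close>-th point of an
  orbit, and \<open>q\<close>, \<open>q'\<close> the positions of the images of that line under the
  element and its inverse; \<open>R\<close> is Behrstock's inequality. If \<open>q\<close> and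
  \<open>q'\<close> are far apart, the sequence passes once from \<open>q'\<close> to
  \<open>q\<close>, through at most one free value. If they are close, a value far from them has
  both neighbours close to them, which gives two large steps in succession.\<close>

lemma two_sided_sequence:
  fixes A :: "int \<Rightarrow> int"
  assumes R: "\<And>i. \<bar>A i - q\<bar> \<le> E \<or> \<bar>A (i - 1) - q'\<bar> \<le> E"
    and p: "p > 0" and far: "\<bar>A (int p) - A 0\<bar> \<ge> K" and K: "K > 20 * E" and E: "E \<ge> 0"
  shows "(\<exists>i. \<bar>A (i + 1) - A i\<bar> \<ge> K - 4 * E) \<or> (\<exists>i. \<bar>A (i + 1) - A (i - 1)\<bar> \<ge> K - 4 * E) \<or>
    (\<exists>i. 2 * \<bar>A i - A (i - 1)\<bar> \<ge> K - 8 * E \<and> 2 * \<bar>A (i + 1) - A i\<bar> \<ge> K - 8 * E)"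
proof (cases "\<bar>q - q'\<bar> > 2 * E")
  case True
  have up: "\<bar>A (i + 1) - q\<bar> \<le> E \<and> \<bar>A (i + 1) - q'\<bar> > E" if "\<bar>A i - q'\<bar> > E" for i
    using R[of "i + 1"] that True by auto
  define P where "P m \<longleftrightarrow> \<bar>A (int m) - q'\<bar> > E" for m
  have "P 0 \<or> P p" unfolding P_def using far K E by (auto simp: abs_if split: if_splits)
  then have ex: "P (LEAST m. P m)" "(LEAST m. P m) \<le> p" using LeastI[of P] Least_le[of P] by fastforce+
  define m where "m = (LEAST m. P m)"
  have m: "P m" "m \<le> p" using ex by (simp_all add: m_def)
  have low: "\<bar>A (int j) - q'\<bar> \<le> E" if "j < m" for j
    using not_less_Least[of j P] that unfolding m_def P_def by auto
  have high: "\<bar>A (int (m + Suc j)) - q\<bar> \<le> E \<and> P (m + Suc j)" for j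
  proof (induction j)
    case 0
    then show ?case using up[of "int m"] m(1) by (simp add: P_def add.commute)
  next
    case (Suc j)
    then show ?case using up[of "int (m + Suc j)"] by (simp add: P_def ac_simps)
  qed
  have hi: "\<bar>A (int j) - q\<bar> \<le> E" if "j > m" for j
    using high[of "j - Suc m"] that by simp
  show ?thesis
  proof (cases "m = 0")
    case True
    then have "\<bar>A 1 - q\<bar> \<le> E" "\<bar>A (int p) - q\<bar> \<le> E" using hi[of 1] hi[of p] p by auto
    then have "\<bar>A (0 + 1) - A 0\<bar> \<ge> K - 4 * E" using far E by auto
    then show ?thesis by blast
  next
    case m0: False
    then have lo: "\<bar>A 0 - q'\<bar> \<le> E" "\<bar>A (int m - 1) - q'\<bar> \<le> E"
      using low[of 0] low[of "m - 1"] by (auto simp: of_nat_diff)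
    show ?thesis
    proof (cases "m = p")
      case True
      then have "\<bar>A ((int m - 1) + 1) - A (int m - 1)\<bar> \<ge> K - 4 * E" using lo far E by auto
      then show ?thesis by blast
    next
      case False
      then have "\<bar>A (int m + 1) - q\<bar> \<le> E" "\<bar>A (int p) - q\<bar> \<le> E"
        using hi[of "Suc m"] hi[of p] m by (auto simp: add.commute)
      then have "\<bar>A (int m + 1) - A (int m - 1)\<bar> \<ge> K - 4 * E" using lo far by auto
      then show ?thesis by blast
    qed
  qed
next
  case False
  have "2 * \<bar>A 0 - q\<bar> \<ge> K \<or> 2 * \<bar>A (int p) - q\<bar> \<ge> K" using far by (smt (verit))
  then obtain i where i: "2 * \<bar>A i - q\<bar> \<ge> K" by blast
  then have "\<bar>A i - q'\<bar> > E" "\<bar>A i - q\<bar> > E" using False K E by (smt (verit))+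
  then have "\<bar>A (i + 1) - q\<bar> \<le> E" "\<bar>A (i - 1) - q'\<bar> \<le> E" using R[of "i + 1"] R[of i] by auto
  then have "2 * \<bar>A i - A (i - 1)\<bar> \<ge> K - 8 * E \<and> 2 * \<bar>A (i + 1) - A i\<bar> \<ge> K - 8 * E"
    using i False E by (smt (verit))
  then show ?thesis by blast
qed

text \<open>Think of an interval with ends 0 and \<open>w\<close>: each position is near an end,
  \<open>v\<close> and \<open>v'\<close> at the same end, \<open>u\<close> and \<open>u'\<close> at
  different ends. So one of \<open>u\<close>, \<open>u'\<close> is opposite to both \<open>v\<close>
  and \<open>v'\<close>.\<close>

lemma four_positions:
  fixes v v' u u' w E :: int
  assumes "\<bar>v\<bar> \<le> E \<or> \<bar>w - v\<bar> \<le> E" "\<bar>v'\<bar> \<le> E \<or> \<bar>w - v'\<bar> \<le> E"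
    "\<bar>u\<bar> \<le> E \<or> \<bar>w - u\<bar> \<le> E" "\<bar>u'\<bar> \<le> E \<or> \<bar>w - u'\<bar> \<le> E"
    "\<bar>w\<bar> > 20 * E" "\<bar>u' - u\<bar> > 3 * E" "\<bar>v' - v\<bar> \<le> 3 * E" "1 \<le> E"
  shows "\<bar>u - v\<bar> > E \<and> \<bar>u - v'\<bar> > E \<or> \<bar>u' - v\<bar> > E \<and> \<bar>u' - v'\<bar> > E"
  using assms by (smt (verit))

context line_system
begin

lemma d_eq_0: "\<delta> Y x y = 0 \<Longrightarrow> d Y x z = d Y y z" "\<delta> Y x y = 0 \<Longrightarrow> d Y z x = d Y z y"
  using \<delta>_add[of Y x z y] \<delta>_add[of Y z y x] by auto

lemma at_act:
  assumes g: "g \<in> carrier G" and Y: "Y \<in> Ln" and b: "b \<in> Pt" "\<forall>Z \<in> Ln. Z \<noteq> Y \<longrightarrow> \<delta> Z b (ob Y) = 0"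
    and Z: "Z \<in> Ln" "Z \<noteq> act g Y"
  shows "\<delta> Z (pact g b) (ob (act g Y)) = 0"
proof -
  have "act (inv g) Z \<noteq> Y" using Z g by auto
  then have "\<delta> (act (inv g) Z) b (ob Y) = 0" using b Z g by simp
  then have "\<delta> Z (pact g b) (pact g (ob Y)) = 0"
    using \<delta>_act[of g "act (inv g) Z" b "ob Y"] g Y b Z by simp
  then show ?thesis
    using ob_act[of g Y Z] g Y Z \<delta>_add[of Z "pact g b" "ob (act g Y)" "pact g (ob Y)"]
      \<delta>_sym[of Z "ob (act g Y)" "pact g (ob Y)"] by simp
qed

end

context spinning
begin

lemma N_subgroup: "subgroup N G"
  by (rule rotg_subgroup) simp

lemma N_carrier [simp]: "n \<in> N \<Longrightarrow> n \<in> carrier G"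
  using rotg_closed by blast

lemma N_conj: "\<lbrakk>g \<in> carrier G; n \<in> N\<rbrakk> \<Longrightarrow> g \<otimes> n \<otimes> inv g \<in> N"
proof -
  assume g: "g \<in> carrier G" and n: "n \<in> N"
  show ?thesis using n[unfolded rotg_def]
  proof (induction rule: generate.induct)
    case one
    then show ?case using g rotg_one by simp
  next
    case (incl h)
    then obtain Y where "h = r Y" "Y \<in> Sp" by blast
    then show ?case using r_act[OF g] rotg_incl[of "act g Y" Sp] g by auto
  next
    case (inv h)
    then obtain Y where Y: "h = r Y" "Y \<in> Sp" by blast
    then have "g \<otimes> inv h \<otimes> inv g = inv (r (act g Y))"
      using r_act[OF g] g by (simp add: inv_mult_group m_assoc)
    then show ?case using rotg_inv[of Sp "r (act g Y)"] rotg_incl[of "act g Y" Sp] Y g by auto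
  next
    case (eng h1 h2)
    have c: "h1 \<in> carrier G" "h2 \<in> carrier G" using eng(1,2) N_carrier unfolding rotg_def by blast+
    have "g \<otimes> (h1 \<otimes> h2) \<otimes> inv g = (g \<otimes> h1 \<otimes> inv g) \<otimes> (g \<otimes> h2 \<otimes> inv g)"
      using c g by (simp add: m_assoc inv_solve_left)
    then show ?case using eng rotg_mult by auto
  qed
qed

lemma N_normal: "N \<lhd> G"
  using normal_inv_iff N_subgroup N_conj by blast

lemma N_pow_lmult:
  assumes "n \<in> N" "g \<in> carrier G"
  shows "\<exists>m \<in> N. (n \<otimes> g) [^] (q::nat) = m \<otimes> g [^] q"
proof (induction q)
  case 0
  then show ?case using rotg_one assms by auto
next
  case (Suc q)
  then obtain m where m: "m \<in> N" "(n \<otimes> g) [^] q = m \<otimes> g [^] q" by blast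
  let ?c = "g [^] q \<otimes> n \<otimes> inv (g [^] q)"
  have "(n \<otimes> g) [^] Suc q = m \<otimes> ?c \<otimes> g [^] Suc q"
    using m assms by (simp add: m_assoc inv_solve_left)
  moreover have "m \<otimes> ?c \<in> N" using m N_conj assms rotg_mult by auto
  ultimately show ?case by blast
qed

definition tor :: "nat \<Rightarrow> 'a \<Rightarrow> bool" where
  "tor p x \<longleftrightarrow> x \<in> carrier G \<and> x [^] p \<in> N \<and> x \<notin> N"

lemma tor_lmult: "tor p x \<Longrightarrow> n \<in> N \<Longrightarrow> tor p (n \<otimes> x)"
proof -
  assume x: "tor p x" and n: "n \<in> N"
  obtain m where "m \<in> N" "(n \<otimes> x) [^] p = m \<otimes> x [^] p" using N_pow_lmult[OF n, of x p] x by (auto simp: tor_def)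
  moreover have "n \<otimes> x \<notin> N"
  proof
    assume "n \<otimes> x \<in> N"
    then have "inv n \<otimes> (n \<otimes> x) \<in> N" using rotg_mult rotg_inv n by blast
    moreover have "inv n \<otimes> (n \<otimes> x) = x" using n x by (simp add: tor_def m_assoc[symmetric])
    ultimately show False using x by (simp add: tor_def)
  qed
  ultimately show ?thesis using x n rotg_mult by (auto simp: tor_def)
qed

lemma tor_rmult: "tor p x \<Longrightarrow> n \<in> N \<Longrightarrow> tor p (x \<otimes> n)"
proof -
  assume x: "tor p x" and n: "n \<in> N"
  have "x \<otimes> n = (x \<otimes> n \<otimes> inv x) \<otimes> x" using x n by (simp add: tor_def m_assoc)
  then show ?thesis using tor_lmult[OF x N_conj[OF _ n, of x]] x by (simp add: tor_def)
qed

lemma tor_inv: "tor p x \<Longrightarrow> tor p (inv x)"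
proof -
  assume x: "tor p x"
  then have "inv x [^] p = inv (x [^] p)" by (simp add: tor_def nat_pow_inv)
  moreover have "inv x \<notin> N" using x rotg_inv[of Sp "inv x"] by (auto simp: tor_def)
  ultimately show ?thesis using x rotg_inv[of Sp] by (simp add: tor_def)
qed

end

section \<open>Torsion modulo the spinning group\<close>

locale spinning_stab = spinning +
  assumes stab: "\<lbrakk>g \<in> carrier G; Y \<in> Sp; act g Y = Y\<rbrakk> \<Longrightarrow> \<exists>l::int. g = r Y [^] l"
    and torsion: "\<lbrakk>g \<in> carrier G; 0 < n; g [^] (n::nat) = \<one>\<rbrakk> \<Longrightarrow> g = \<one>"
begin

lemma stab_N: "\<lbrakk>g \<in> carrier G; Y \<in> Sp; act g Y = Y\<rbrakk> \<Longrightarrow> g \<in> N"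
  using stab rotg_pow[of Sp Y] by blast

lemma tor_moves: "tor p x \<Longrightarrow> Y \<in> Sp \<Longrightarrow> act x Y \<noteq> Y"
  using stab_N by (auto simp: tor_def)

context
  fixes p :: nat and W0 W1 :: 'c
  assumes p: "p > 0" and W: "W0 \<in> Sp" "W1 \<in> Sp" "W0 \<noteq> W1"
    and good: "\<And>V. V \<in> Sp \<Longrightarrow> V \<noteq> W1 \<Longrightarrow> 2 * d V (ob W0) (ob W1) \<le> k + 40 * E"
begin

text \<open>\<open>B\<close> plays the part of a geodesic from \<open>W0\<close> to
  \<open>W1\<close>, and \<open>Iv V V'\<close> of its portion between two members. An element that
  is torsion modulo \<open>N\<close> and carries one member to another will produce another such
  pair with a strictly smaller \<open>Iv\<close>.\<close>

definition "Bo = {V \<in> Sp. V \<noteq> W0 \<and> V \<noteq> W1 \<and> d V (ob W0) (ob W1) > 20 * E}"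
definition "B = insert W0 (insert W1 Bo)"
definition "Iv V V' = {U \<in> Bo - {V, V'}. d U (ob V) (ob V') > 3 * E}"

lemma B_Sp: "V \<in> B \<Longrightarrow> V \<in> Sp" and Bo_B: "V \<in> Bo \<Longrightarrow> V \<in> B"
  using W by (auto simp: B_def Bo_def)

lemma finite_Bo: "finite Bo"
  by (rule finite_subset[OF _ finS[of "ob W0" "ob W1"]]) (use E_pos W in \<open>auto simp: Bo_def\<close>)

lemma B_side:
  assumes U: "U \<in> Sp" and V: "V \<in> B" "U \<noteq> V"
  shows "d U (ob V) (ob W0) \<le> E \<or> d U (ob V) (ob W1) \<le> E"
proof (cases "V \<in> Bo")
  case True
  then have VS: "V \<in> Sp" "d V (ob W0) (ob W1) > 20 * E" by (auto simp: Bo_def)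
  have "d U (ob W0) (ob V) \<le> E \<or> d V (ob W0) (ob U) \<le> E" "d U (ob W1) (ob V) \<le> E \<or> d V (ob W1) (ob U) \<le> E"
    using cohS[of U V "ob W0"] cohS[of U V "ob W1"] U V VS W by auto
  moreover have "\<not> (d V (ob W0) (ob U) \<le> E \<and> d V (ob W1) (ob U) \<le> E)"
    using d_le''[of V "ob W0" "ob U" E "ob W1" E] VS E_pos by auto
  ultimately show ?thesis by (auto simp: d_sym[of U "ob V"])
next
  case False
  then show ?thesis using V E_pos by (auto simp: B_def)
qed

lemma B_W0: "V \<in> B \<Longrightarrow> V \<noteq> W0 \<Longrightarrow> d W0 (ob V) (ob W1) \<le> E"
proof -
  assume V: "V \<in> B" "V \<noteq> W0"
  show ?thesis
  proof (cases "V \<in> Bo")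
    case True
    then have "V \<in> Sp" "d V (ob W0) (ob W1) > 20 * E" by (auto simp: Bo_def)
    then show ?thesis using cohS[of W0 V "ob W1"] W V E_pos
      by (auto simp: d_sym[of W0 "ob V"] d_sym[of V "ob W1"])
  next
    case False
    then show ?thesis using V E_pos by (auto simp: B_def)
  qed
qed

lemma B_W1: "V \<in> B \<Longrightarrow> V \<noteq> W1 \<Longrightarrow> d W1 (ob V) (ob W0) \<le> E"
proof -
  assume V: "V \<in> B" "V \<noteq> W1"
  show ?thesis
  proof (cases "V \<in> Bo")
    case True
    then have "V \<in> Sp" "d V (ob W0) (ob W1) > 20 * E" by (auto simp: Bo_def)
    then show ?thesis using cohS[of W1 V "ob W0"] W V E_pos
      by (auto simp: d_sym[of W1 "ob V"])
  next
    case False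
    then show ?thesis using V E_pos by (auto simp: B_def)
  qed
qed

lemma B_ends:
  assumes "V \<in> B" "V' \<in> B" "U \<in> {W0, W1}" "U \<noteq> V" "U \<noteq> V'"
  shows "d U (ob V) (ob V') \<le> 2 * E"
  using assms d_le''[of U "ob V" "ob W1" E "ob V'" E] d_le''[of U "ob V" "ob W0" E "ob V'" E]
    B_W0[of V] B_W0[of V'] B_W1[of V] B_W1[of V'] by auto

lemma B_step:
  assumes V: "V \<in> B" "V' \<in> B" and U: "U \<in> Sp" "U \<noteq> V" "U \<noteq> V'" "U \<noteq> W0" "U \<noteq> W1"
  shows "d U (ob V) (ob V') \<le> d U (ob W0) (ob W1) + 2 * E"
proof -
  have "d U (ob V) (ob W0) \<le> E \<or> d U (ob V) (ob W1) \<le> E" "d U (ob V') (ob W0) \<le> E \<or> d U (ob V') (ob W1) \<le> E"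
    using B_side U V by blast+
  then show ?thesis
    using \<delta>_add[of U "ob V" "ob V'" "ob W0"] \<delta>_add[of U "ob V" "ob V'" "ob W1"]
      \<delta>_add[of U "ob V" "ob W1" "ob W0"] \<delta>_sym[of U "ob V'" "ob W0"] \<delta>_sym[of U "ob V'" "ob W1"] by arith
qed

lemma B_good:
  assumes V: "V \<in> B" "V' \<in> B" and U: "U \<in> Sp" "U \<noteq> V" "U \<noteq> V'"
  shows "2 * d U (ob V) (ob V') \<le> k + 44 * E"
proof (cases "U \<in> {W0, W1}")
  case True
  then show ?thesis using B_ends[OF V True U(2,3)] k_large E_pos by linarith
next
  case False
  then show ?thesis using B_step[OF V U] good[of U] U by auto
qed

text \<open>If some \<open>U1\<close> separated \<open>U\<close> from \<open>U'\<close> but not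
  \<open>V\<close> from \<open>V'\<close>, one of \<open>U\<close>, \<open>U'\<close> would lie
  opposite to both \<open>V\<close> and \<open>V'\<close> (\<open>four_positions\<close>); it would
  see both near \<open>U1\<close>, contrary to \<open>far\<close>. The inclusion is strict because
  \<open>U\<close> drops out.\<close>

lemma Iv_less:
  assumes V: "V \<in> B" "V' \<in> B" and U: "U \<in> Bo" "U' \<in> Bo" "U \<noteq> U'" "U \<notin> {V, V'}" "U' \<notin> {V, V'}"
    and far: "d U (ob V) (ob V') > 3 * E" "d U' (ob V) (ob V') > 3 * E"
  shows "Iv U U' \<subset> Iv V V'"
proof -
  have S: "V \<in> Sp" "V' \<in> Sp" "U \<in> Sp" "U' \<in> Sp" using V U B_Sp Bo_B by blast+
  have notV: "\<not> d Z (ob U) (ob U') > 3 * E" if Z: "Z = V \<or> Z = V'" for Z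
  proof -
    obtain Z' where Z': "{Z, Z'} = {V, V'}" using Z by blast
    have ZS: "Z \<in> Sp" "Z' \<in> Sp" "U \<noteq> Z" "U' \<noteq> Z" using Z' S U by (auto simp: doubleton_eq_iff)
    have "d Z (ob Z') (ob T) \<le> E" if T: "T = U \<or> T = U'" for T
    proof -
      have "d T (ob Z') (ob Z) > 3 * E"
        using Z' far T d_sym[of T "ob V" "ob V'"] by (auto simp: doubleton_eq_iff)
      then show ?thesis using cohS[of Z T "ob Z'"] ZS S T E_pos by auto
    qed
    then have "d Z (ob U) (ob U') \<le> 2 * E"
      using d_le[of Z "ob U" "ob Z'" E "ob U'" E] d_sym[of Z "ob U" "ob Z'"] by auto
    then show ?thesis using E_pos by auto
  qed
  have "Iv U U' \<subseteq> Iv V V'"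
  proof
    fix U1 assume "U1 \<in> Iv U U'"
    then have U1: "U1 \<in> Bo" "U1 \<noteq> U" "U1 \<noteq> U'" "d U1 (ob U) (ob U') > 3 * E" by (auto simp: Iv_def)
    have U1V: "U1 \<noteq> V" "U1 \<noteq> V'" using notV U1 by blast+
    have U1S: "U1 \<in> Sp" "d U1 (ob W0) (ob W1) > 20 * E" using U1 by (auto simp: Bo_def)
    note side = B_side[OF U1S(1)]
    have s: "d U1 (ob V) (ob W0) \<le> E \<or> d U1 (ob V) (ob W1) \<le> E" "d U1 (ob V') (ob W0) \<le> E \<or> d U1 (ob V') (ob W1) \<le> E"
      "d U1 (ob U) (ob W0) \<le> E \<or> d U1 (ob U) (ob W1) \<le> E" "d U1 (ob U') (ob W0) \<le> E \<or> d U1 (ob U') (ob W1) \<le> E"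
      using side V U1V U1 U Bo_B by blast+
    have "d U1 (ob V) (ob V') > 3 * E"
    proof (rule ccontr)
      assume near: "\<not> ?thesis"
      have "\<exists>T. (T = U \<or> T = U') \<and> d U1 (ob V) (ob T) > E \<and> d U1 (ob V') (ob T) > E"
      proof (rule ccontr)
        assume "\<not> ?thesis"
        then have n: "d U1 (ob V) (ob U) \<le> E \<or> d U1 (ob V') (ob U) \<le> E" "d U1 (ob V) (ob U') \<le> E \<or> d U1 (ob V') (ob U') \<le> E"
          by (auto simp: not_less)
        define P where "P x = \<delta> U1 (ob W0) x" for x
        have pd: "d U1 x y = \<bar>P y - P x\<bar>" for x y
          using \<delta>_add[of U1 "ob W0" y x] by (simp add: P_def)
        have "P (ob W0) = 0" by (simp add: P_def)
        then show False
          using s n near U1(4) U1S(2) E_pos four_positions[of "P (ob V)" E "P (ob W1)" "P (ob V')" "P (ob U)" "P (ob U')"]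
          unfolding pd by (simp add: abs_minus_commute not_less) (meson not_le)
      qed
      then obtain T where T: "T = U \<or> T = U'" "d U1 (ob V) (ob T) > E" "d U1 (ob V') (ob T) > E" by blast
      have TS: "T \<in> Sp" "T \<noteq> U1" using T S U1 by auto
      then have "d T (ob V) (ob U1) \<le> E" "d T (ob V') (ob U1) \<le> E"
        using cohS[of U1 T "ob V"] cohS[of U1 T "ob V'"] T U1S S by auto
      then have "d T (ob V) (ob V') \<le> 2 * E" using d_le''[of T "ob V" "ob U1" E "ob V'" E] by auto
      then show False using far T E_pos by auto
    qed
    then show "U1 \<in> Iv V V'" using U1 U1V by (auto simp: Iv_def)
  qed
  moreover have "U \<in> Iv V V'" "U \<notin> Iv U U'" using U far by (auto simp: Iv_def)
  ultimately show ?thesis by blast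
qed

text \<open>After correcting \<open>x\<close> by a rotation about \<open>V\<close>, consecutive
  points of the orbit of \<open>b\<close> under \<open>y\<close> are at most about half a turn apart
  along every line. Yet \<open>y^p\<close> is a nontrivial element of \<open>N\<close>, so some line
  sees \<open>b\<close> and \<open>y^p b\<close> almost a full turn apart. By
  \<open>two_sided_sequence\<close> two consecutive steps must share this turn, which means that a
  line \<open>U\<close> and its image under \<open>y\<close> both lie between \<open>V\<close> and
  \<open>V'\<close>.\<close>

lemma descent:
  assumes V: "V \<in> B" "V' \<in> B" "V \<noteq> V'" and x: "tor p x" "act x V = V'"
  shows "\<exists>U U' y. U \<in> B \<and> U' \<in> B \<and> U \<noteq> U' \<and> tor p y \<and> act y U = U' \<and> Iv U U' \<subset> Iv V V'"
proof -
  have S [simp]: "V \<in> Sp" "V' \<in> Sp" using V B_Sp by blast+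
  have xc [simp]: "x \<in> carrier G" using x by (simp add: tor_def)
  have xiV: "act (inv x) V \<noteq> V" using tor_moves[OF tor_inv[OF x(1)] S(1)] .
  obtain l :: int where l: "2 * d V (ob V') (pact (r V [^] l) (ob (act (inv x) V))) \<le> k"
    using rot_reduce[of V "ob (act (inv x) V)" "ob V'"] by auto
  define y where "y = x \<otimes> inv (r V [^] l)"
  have y: "tor p y" using tor_rmult[OF x(1)] rotg_inv[of Sp] rotg_pow[of Sp V l] by (simp add: y_def)
  have yc [simp]: "y \<in> carrier G" using y by (simp add: tor_def)
  have "act (inv (r V [^] l)) V = V" using act_inv[of "r V [^] l" V] act_r_pow[of V l] by simp
  then have yV: "act y V = V'" using x by (simp add: y_def act_mult)
  have yi: "inv y = r V [^] l \<otimes> inv x" by (simp add: y_def inv_mult_group)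
  have yiV: "act (inv y) V \<noteq> V" using tor_moves[OF tor_inv[OF y] S(1)] .
  have angle: "2 * d V (ob V') (ob (act (inv y) V)) \<le> k"
    using l d_ob_act'[of "r V [^] l" "act (inv x) V" V "ob V'"] yiV by (simp add: yi act_mult)
  \<comment> \<open>A point on \<open>V\<close> in the direction of \<open>V'\<close>:
    \<open>y\<close> moves it by 0 along \<open>V\<close>, and by at most half a turn along
    \<open>V'\<close> because of \<open>angle\<close>.\<close>
  obtain b where b [simp]: "b \<in> Pt" and bV: "\<delta> V (ob V') b = 0"
    and bZ: "\<forall>Z \<in> Ln. Z \<noteq> V \<longrightarrow> \<delta> Z b (ob V) = 0" using ob_at[of V "ob V'"] by auto
  have at: "\<delta> Z (pact g b) (ob (act g V)) = 0" if "g \<in> carrier G" "Z \<in> Ln" "Z \<noteq> act g V" for g Z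
    using at_act[of g V b Z] bZ that by simp
  have byd: "d Z b (pact y b) = d Z (ob V) (ob V')" if "Z \<in> Sp" "Z \<noteq> V" "Z \<noteq> V'" for Z
    using at[of y Z] bZ that d_eq_0(1)[of Z b "ob V" "pact y b"] d_eq_0(2)[of Z "pact y b" "ob V'" "ob V"] yV
    by auto
  have stepV: "\<delta> V b (pact y b) = 0"
    using at[of y V] V yV bV \<delta>_add[of V b "pact y b" "ob V'"] \<delta>_sym[of V "ob V'" b]
      \<delta>_sym[of V "ob V'" "pact y b"] by simp
  have stepV': "2 * d V (pact (inv y) b) b \<le> k"
  proof -
    have "d V (pact (inv y) b) b = d V (ob (act (inv y) V)) (ob V')"
      using at[of "inv y" V] yiV bV d_eq_0(1)[of V "pact (inv y) b" "ob (act (inv y) V)" b]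
        d_eq_0(2)[of V "ob V'" b "ob (act (inv y) V)"] by auto
    then show ?thesis using angle d_sym[of V "ob V'"] by simp
  qed
  have SB: "2 * d U b (pact y b) \<le> k + 44 * E" if U: "U \<in> Sp" for U
  proof -
    consider "U = V" | "U = V'" | "U \<noteq> V" "U \<noteq> V'" by blast
    then show ?thesis
    proof cases
      case 1
      then show ?thesis using stepV k_large E_pos by simp
    next
      case 2
      have "act (inv y) V' = V" using yV by auto
      then have "d V' b (pact y b) = d V (pact (inv y) b) b"
        using d_act[of "inv y" V' b "pact y b"] by simp
      then show ?thesis using 2 stepV' E_pos by simp
    next
      case 3
      then show ?thesis using byd[OF U] B_good[OF V(1,2) U] by simp
    qed
  qed
  define n where "n = y [^] p"
  have nN: "n \<in> N" using y by (simp add: n_def tor_def)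
  have n1: "n \<noteq> \<one>" using torsion[of y p] p y rotg_one[of Sp] unfolding n_def tor_def by auto
  obtain U0 l0 where U0: "U0 \<in> Sp" "l0 \<noteq> 0" "\<bar>\<delta> U0 b (pact n b) - l0 * k\<bar> \<le> 40 * E"
    using greendlinger[OF b nN n1] .
  have far: "d U0 b (pact n b) \<ge> k - 40 * E"
  proof -
    have "1 * k \<le> \<bar>l0\<bar> * k" using U0(2) k_large E_pos by (intro mult_right_mono) auto
    then have "\<bar>l0 * k\<bar> \<ge> k" using k_large E_pos by (simp add: abs_mult)
    then show ?thesis using U0(3) by linarith
  qed
  define a where "a i = pact (y [^] (i::int)) b" for i
  define A where "A i = \<delta> U0 b (a i)" for i
  have aP: "a i \<in> Pt" for i by (simp add: a_def)
  have a0: "a 0 = b" by (simp add: a_def)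
  have aS: "pact y (a i) = a (i + 1)" for i
    using int_pow_mult[of y 1 i] by (simp add: a_def pact_mult[symmetric] add.commute)
  have aP': "pact (inv y) (a i) = a (i - 1)" for i using aS[of "i - 1"] pact_inv[OF yc aP[of "i - 1"]] by simp
  have yU: "act y Y \<noteq> Y" "act (inv y) Y \<noteq> Y" if "Y \<in> Sp" for Y
    using tor_moves[OF y that] tor_moves[OF tor_inv[OF y] that] .
  have Rgen: "d Y (a i) (ob (act y Y)) \<le> E \<or> d Y (a (i - 1)) (ob (act (inv y) Y)) \<le> E" if Y: "Y \<in> Sp" for Y i
  proof -
    have "d Y (a i) (ob (act y Y)) \<le> E \<or> d (act y Y) (a i) (ob Y) \<le> E"
      using cohS[of Y "act y Y" "a i"] yU[OF Y] Y aP by auto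
    moreover have "d (act y Y) (a i) (ob Y) = d Y (a (i - 1)) (pact (inv y) (ob Y))"
      using d_act[of "inv y" "act y Y" "a i" "ob Y"] Y aP aP' by simp
    moreover have "\<dots> = d Y (a (i - 1)) (ob (act (inv y) Y))"
      using d_ob_act'[of "inv y" Y Y] yU[OF Y] Y by simp
    ultimately show ?thesis by simp
  qed
  have R: "\<bar>A i - \<delta> U0 b (ob (act y U0))\<bar> \<le> E \<or> \<bar>A (i - 1) - \<delta> U0 b (ob (act (inv y) U0))\<bar> \<le> E" for i
    using Rgen[OF U0(1), of i] \<delta>_add[of U0 b "ob (act y U0)" "a i"]
      \<delta>_add[of U0 b "ob (act (inv y) U0)" "a (i - 1)"] unfolding A_def by auto
  have Ap: "\<bar>A (int p) - A 0\<bar> \<ge> k - 40 * E"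
    using far by (simp add: A_def a_def n_def int_pow_int)
  define T where "T i = act (y [^] (- i)) U0" for i :: int
  have TS: "T i \<in> Sp" for i using U0 by (simp add: T_def)
  have Adiff: "A (i + 1) - A i = \<delta> (T i) b (pact y b)" for i
  proof -
    have "y [^] (- i) \<otimes> y [^] i = \<one>" using int_pow_mult[of y "- i" i] by simp
    then have 1: "pact (y [^] (- i)) (a i) = b" by (simp add: a_def pact_mult[symmetric])
    have "a (i + 1) = pact (y [^] i) (pact y b)"
      using int_pow_mult[of y i 1] by (simp add: a_def pact_mult[symmetric])
    then have 2: "pact (y [^] (- i)) (a (i + 1)) = pact y b"
      using \<open>y [^] (- i) \<otimes> y [^] i = \<one>\<close> by (simp add: pact_mult[symmetric] m_assoc[symmetric])
    have "\<delta> (T i) b (pact y b) = \<delta> U0 (a i) (a (i + 1))"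
      using \<delta>_act[of "y [^] (- i)" U0 "a i" "a (i + 1)"] U0 aP 1 2 by (simp add: T_def)
    then show ?thesis using \<delta>_add[of U0 b "a (i + 1)" "a i"] by (simp add: A_def)
  qed
  have steps: "2 * \<bar>A (i + 1) - A i\<bar> \<le> k + 44 * E" for i using SB[OF TS, of i] Adiff[of i] by simp
  \<comment> \<open>In the two-step case both steps together are at least k - 44E and each is at
    most k / 2 + 22E, so each is at least k / 2 - 66E.\<close>
  have "\<exists>i. 2 * \<bar>A i - A (i - 1)\<bar> \<ge> k - 132 * E \<and> 2 * \<bar>A (i + 1) - A i\<bar> \<ge> k - 132 * E"
  proof -
    have "k - 40 * E > 20 * E" "E \<ge> 0" using k_large E_pos by linarith+
    from two_sided_sequence[of A, OF R p Ap this] show ?thesis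
  proof (elim disjE exE)
    fix i assume "k - 40 * E - 4 * E \<le> \<bar>A (i + 1) - A i\<bar>"
    then have False using steps[of i] k_large E_pos by (smt (verit))
    then show ?thesis ..
  next
    fix i assume "k - 40 * E - 4 * E \<le> \<bar>A (i + 1) - A (i - 1)\<bar>"
    moreover have "\<bar>A (i + 1) - A (i - 1)\<bar> \<le> \<bar>A (i + 1) - A i\<bar> + \<bar>A i - A (i - 1)\<bar>" by linarith
    moreover have "2 * \<bar>A i - A (i - 1)\<bar> \<le> k + 44 * E" using steps[of "i - 1"] by simp
    ultimately have "2 * \<bar>A i - A (i - 1)\<bar> \<ge> k - 132 * E" "2 * \<bar>A (i + 1) - A i\<bar> \<ge> k - 132 * E"
      using steps[of i] by (smt (verit))+
    then show ?thesis by blast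
  next
    fix i assume "k - 40 * E - 8 * E \<le> 2 * \<bar>A i - A (i - 1)\<bar> \<and> k - 40 * E - 8 * E \<le> 2 * \<bar>A (i + 1) - A i\<bar>"
    then show ?thesis using E_pos by (intro exI[of _ i]) auto
  qed
  qed
  then obtain i where i: "2 * \<bar>A i - A (i - 1)\<bar> \<ge> k - 132 * E" "2 * \<bar>A (i + 1) - A i\<bar> \<ge> k - 132 * E" by blast
  define U where "U = T i"
  have US: "U \<in> Sp" by (simp add: U_def TS)
  have "T (i - 1) = act y U"
    using int_pow_mult[of y 1 "- i"] U0 by (simp add: T_def U_def act_mult[symmetric] add.commute)
  then have f1: "2 * d U b (pact y b) \<ge> k - 132 * E" and f2: "2 * d (act y U) b (pact y b) \<ge> k - 132 * E"
    using i Adiff[of i] Adiff[of "i - 1"] by (simp_all add: U_def)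
  have f2': "2 * d U (pact (inv y) b) b \<ge> k - 132 * E"
    using f2 d_act[of "inv y" "act y U" b "pact y b"] US by simp
  have lam: "k - 132 * E > 60 * E" using k_large E_pos by linarith
  have UV: "U \<noteq> V" using f1 stepV lam E_pos by auto
  have yUV': "act y U \<noteq> V'" using UV act_eq_iff[of y U V] yV US by auto
  have yUV: "act y U \<noteq> V" using f2 stepV lam E_pos by auto
  \<comment> \<open>Otherwise the steps from \<open>a (- 2)\<close> to \<open>a (- 1)\<close> and
    from \<open>a (- 1)\<close> to \<open>b\<close> are both long along \<open>V\<close>; but
    Behrstock's inequality for \<open>V\<close> and its image, in the form \<open>Rgen\<close>,
    makes one of them short.\<close>
  have UV': "U \<noteq> V'"
  proof
    assume "U = V'"
    have "act (inv y) V' = V" using yV by auto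
    then have g1: "2 * d V (pact (inv y) b) b \<ge> k - 132 * E"
      and g2: "2 * d V (pact (inv y) (pact (inv y) b)) (pact (inv y) b) \<ge> k - 132 * E"
      using f1 f2' d_act[of "inv y" V' b "pact y b"] d_act[of "inv y" V' "pact (inv y) b" b] \<open>U = V'\<close> by auto
    have e: "a (- 1) = pact (inv y) b" "a (- 1 - 1) = pact (inv y) (pact (inv y) b)"
      using aP'[of 0] aP'[of "- 1"] by (simp_all add: a0)
    have "d V (pact (inv y) b) (ob V') \<le> E \<or> d V (pact (inv y) (pact (inv y) b)) (ob (act (inv y) V)) \<le> E"
      using Rgen[OF S(1), of "- 1"] yV unfolding e by simp
    moreover have "d V (pact (inv y) b) (ob V') = d V (pact (inv y) b) b"
      by (rule d_eq_0(2)[OF bV])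
    moreover have "d V z (ob (act (inv y) V)) = d V z (pact (inv y) b)" for z
      using d_eq_0(2)[OF at[of "inv y" V]] yiV by simp
    ultimately show False using g1 g2 lam E_pos by auto
  qed
  have big: "d U (ob V) (ob V') > 30 * E" "d (act y U) (ob V) (ob V') > 30 * E"
    using byd[of U] byd[of "act y U"] US UV UV' yUV yUV' f1 f2 lam by auto
  have Bo: "Z \<in> Bo" if Z: "Z \<in> Sp" "Z \<noteq> V" "Z \<noteq> V'" "d Z (ob V) (ob V') > 30 * E" for Z
  proof -
    have "Z \<noteq> W0" "Z \<noteq> W1" using B_ends[OF V(1,2), of Z] Z E_pos by auto
    then show ?thesis using B_step[OF V(1,2) Z(1-3)] Z E_pos by (auto simp: Bo_def)
  qed
  have "U \<in> Bo" "act y U \<in> Bo" using Bo[of U] Bo[of "act y U"] US UV UV' yUV yUV' big by auto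
  moreover have "Iv U (act y U) \<subset> Iv V V'"
    using Iv_less[OF V(1,2) \<open>U \<in> Bo\<close> \<open>act y U \<in> Bo\<close>] yU[OF US] UV UV' yUV yUV' big E_pos by auto
  ultimately show ?thesis using Bo_B y yU[OF US] by (intro exI[of _ U] exI[of _ "act y U"] exI[of _ y]) auto
qed

lemma no_torsion_pair: "tor p x \<Longrightarrow> act x W0 \<noteq> W1"
proof
  assume x: "tor p x" "act x W0 = W1"
  have "\<not> (\<exists>x. V \<in> B \<and> V' \<in> B \<and> V \<noteq> V' \<and> tor p x \<and> act x V = V')" for V V'
  proof (induction "card (Iv V V')" arbitrary: V V' rule: less_induct)
    case less
    show ?case
    proof
      assume "\<exists>x. V \<in> B \<and> V' \<in> B \<and> V \<noteq> V' \<and> tor p x \<and> act x V = V'"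
      then obtain U U' y where U: "U \<in> B" "U' \<in> B" "U \<noteq> U'" "tor p y" "act y U = U'" "Iv U U' \<subset> Iv V V'"
        using descent by blast
      have "finite (Iv V V')" using finite_Bo by (auto simp: Iv_def)
      then have "card (Iv U U') < card (Iv V V')" using U(6) psubset_card_mono by blast
      then show False using less U by blast
    qed
  qed
  then show False using x W by (auto simp: B_def)
qed

end

text \<open>\<open>good_lift\<close> replaces \<open>g\<close> by an element of its coset that moves
  \<open>W0\<close> to a line at most about half a turn away along all other spinning lines. This
  pair starts the descent.\<close>

theorem quotient_torsion_free:
  assumes g: "g \<in> carrier G" and p: "p > 0" and gp: "g [^] (p::nat) \<in> N"
  shows "g \<in> N"
proof (rule ccontr)
  assume "g \<notin> N"
  then have t: "tor p g" using assms by (simp add: tor_def)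
  show False
  proof (cases "Sp = {}")
    case True
    then have "N = {\<one>}" by (simp add: rotg_def generate_empty)
    then show ?thesis using torsion[OF g p] gp t by (auto simp: tor_def)
  next
    case False
    then obtain W0 where W0: "W0 \<in> Sp" by blast
    obtain n where n: "n \<in> N" "\<And>U. U \<in> Sp \<Longrightarrow> 2 * d U (ob W0) (pact n (pact g (ob W0))) \<le> k + 40 * E"
      using good_lift[of "ob W0" "pact g (ob W0)"] W0 g by auto
    define x where "x = n \<otimes> g"
    have x: "tor p x" using tor_lmult[OF t n(1)] by (simp add: x_def)
    have xc: "x \<in> carrier G" using x by (simp add: tor_def)
    have "2 * d V (ob W0) (ob (act x W0)) \<le> k + 40 * E" if "V \<in> Sp" "V \<noteq> act x W0" for V
      using n(2)[OF that(1)] d_ob_act'[of x W0 V "ob W0"] that W0 xc n(1) g by (simp add: x_def pact_mult)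
    then show False
      using no_torsion_pair[OF p W0, of "act x W0" x] x xc W0 tor_moves[OF x W0] by auto
  qed
qed

end

lemma (in group) cancel_inv:
  assumes "x \<in> carrier G" "y \<in> carrier G"
  shows "inv x \<otimes> (x \<otimes> y) = y" "x \<otimes> (inv x \<otimes> y) = y"
  using assms by (simp_all add: m_assoc[symmetric])

section \<open>Good representatives, and inversion modulo the spinning group\<close>

context spinning
begin

text \<open>Powers of \<open>s\<close> hardly move \<open>z\<close>, so each \<open>s^i W\<close>
  blocks the next one from \<open>z\<close> as \<open>W\<close> blocks \<open>s W\<close>. By
  \<open>block_trans\<close> all \<open>s^(-n) W\<close> with n > 0 block \<open>W\<close> itself,
  and these are infinitely many distinct lines.\<close>

lemma block_chain:
  assumes z: "z \<in> Pt" and s: "s \<in> carrier G" and W: "W \<in> Sp"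
    and ell: "\<And>V j::int. V \<in> Sp \<Longrightarrow> d V z (pact (s [^] j) z) \<le> E"
    and ne: "act s W \<noteq> W" and far: "d W z (ob (act s W)) > 5 * E"
  shows False
proof -
  define T where "T i = act (s [^] (i::int)) W" for i
  have TS [simp]: "T i \<in> Sp" for i using s W by (simp add: T_def)
  have T0: "T 0 = W" using W by (simp add: T_def)
  have Tadd: "act (s [^] i) (T j) = T (i + j)" for i j
    using s W by (simp add: T_def act_mult[symmetric] int_pow_mult)
  have T1: "T (i + 1) = act (s [^] i) (act s W)" for i using Tadd[of i 1] s W by (simp add: T_def)
  have inv_pow: "inv (s [^] i) = s [^] (- i)" for i :: int using s by (simp add: int_pow_neg)
  have blk: "T i \<noteq> T (i + 1) \<and> d (T i) z (ob (T (i + 1))) > 4 * E" for i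
  proof -
    have 1: "T i \<noteq> T (i + 1)"
      using ne act_eq_iff[of "s [^] i" W "act s W"] s W unfolding T1 by (simp add: T_def)
    have "d (T i) z (ob (T (i + 1))) = d (T i) z (pact (s [^] i) (ob (act s W)))"
      using d_ob_act'[of "s [^] i" "act s W" "T i" z] 1 s W unfolding T1 by simp
    also have "\<dots> = d W (pact (s [^] (- i)) z) (ob (act s W))"
      using d_act[of "s [^] (- i)" "T i" z "pact (s [^] i) (ob (act s W))"] Tadd[of "- i" i] s W z
        pact_inv[of "s [^] i" "ob (act s W)"] by (simp add: T0 inv_pow)
    also have "\<dots> > 4 * E"
      using far ell[OF W, of "- i"] d_tri[of W z "ob (act s W)" "pact (s [^] (- i)) z"] by linarith
    finally show ?thesis using 1 by blast
  qed
  have claim: "T (- int (Suc n)) \<noteq> W \<and> d (T (- int (Suc n))) z (ob W) > 3 * E" for n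
  proof (induction n)
    case 0
    then show ?case using blk[of "- 1"] E_pos by (simp add: T0)
  next
    case (Suc n)
    have "T (- int (Suc (Suc n))) \<noteq> T (- int (Suc n)) \<and>
        d (T (- int (Suc (Suc n)))) z (ob (T (- int (Suc n)))) > 4 * E"
      using blk[of "- int (Suc (Suc n))"] by simp
    then show ?case
      using block_trans[of "T (- int (Suc (Suc n)))" "T (- int (Suc n))" W z E] Suc W z E_pos e_Sp by auto
  qed
  define f where "f n = T (- int (Suc n))" for n
  have "inj f"
  proof (rule linorder_injI)
    fix i j :: nat assume "i < j"
    then obtain m where m: "j = Suc (i + m)" using less_imp_Suc_add by blast
    have "act (s [^] int (Suc i)) (f i) = W" "act (s [^] int (Suc i)) (f j) = T (- int (Suc m))"
      unfolding f_def Tadd by (simp_all add: T0 m)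
    then show "f i \<noteq> f j" using claim[of m] by metis
  qed
  moreover have "finite (range f)"
  proof (rule finite_subset[OF _ finS[OF z, of "ob W"]])
    have "f n \<in> Sp \<and> d (f n) z (ob W) > E" for n
      using claim[of n] E_pos TS unfolding f_def by (intro conjI) (simp, linarith)
    then show "range f \<subseteq> {Y \<in> Sp. d Y z (ob W) > E}" by blast
  qed (use W in simp)
  ultimately show False using finite_imageD[of f UNIV] by simp
qed

text \<open>Marks the points of an \<open>N\<close>-orbit that lie on the same side of all spinning
  lines as \<open>Y\<close>, so that no rotation brings them substantially nearer. The slack is 40
  when it comes from \<open>good_lift\<close>, and 60 after a transfer to another line or to a
  nearby point.\<close>

definition good :: "int \<Rightarrow> 'l \<Rightarrow> 'p \<Rightarrow> bool" where
  "good c Y x \<longleftrightarrow> (\<forall>W \<in> Sp. 2 * d W (ob Y) x \<le> k + c * E)"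

lemma good_lift_ob:
  assumes "Y \<in> Ln" "x \<in> Pt"
  obtains n where "n \<in> N" "good 40 Y (pact n x)"
proof -
  obtain n where "n \<in> N" "\<And>U. U \<in> Sp \<Longrightarrow> 2 * d U (ob Y) (pact n x) \<le> k + 40 * E"
    using good_lift[of "ob Y" x] assms by auto
  then show ?thesis using that unfolding good_def by blast
qed

lemma good_mono: "good c Y x \<Longrightarrow> c \<le> c' \<Longrightarrow> good c' Y x"
proof -
  assume g: "good c Y x" and c: "c \<le> c'"
  have "c * E \<le> c' * E" using c E_pos by (intro mult_right_mono) auto
  then show ?thesis using g unfolding good_def by force
qed

text \<open>By Greendlinger's lemma some \<open>U\<close> sees \<open>x\<close> and
  \<open>pact n x\<close> almost a full turn apart. As each is within about half a turn of
  \<open>Y\<close>, neither is near \<open>Y\<close> on \<open>U\<close>, so \<open>Y\<close> sees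
  both near \<open>U\<close>.\<close>

lemma good_unique:
  assumes Y: "Y \<in> Ln" "Y \<notin> Sp" and x: "x \<in> Pt" and n: "n \<in> N"
    and g: "good 60 Y x" "good 60 Y (pact n x)"
  shows "d Y x (pact n x) \<le> 2 * e Y"
proof (cases "n = \<one>")
  case True
  then show ?thesis using x e_nonneg[OF Y(1)] by simp
next
  case False
  have nc: "n \<in> carrier G" using n rotg_closed by blast
  obtain U l where U: "U \<in> Sp" "l \<noteq> 0" "\<bar>\<delta> U x (pact n x) - l * k\<bar> \<le> 40 * E"
    using greendlinger[OF x n False] .
  have "1 * k \<le> \<bar>l\<bar> * k" using U(2) k_large E_pos by (intro mult_right_mono) auto
  then have "\<bar>l * k\<bar> \<ge> k" using k_large E_pos by (simp add: abs_mult)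
  then have "d U x (pact n x) \<ge> k - 40 * E" using U(3) by linarith
  moreover have "d U x (pact n x) \<le> d U (ob Y) x + d U (ob Y) (pact n x)"
    using d_le'[of U "ob Y" x "d U (ob Y) x" "pact n x" "d U (ob Y) (pact n x)"] by simp
  moreover have "2 * d U (ob Y) x \<le> k + 60 * E" "2 * d U (ob Y) (pact n x) \<le> k + 60 * E"
    using g U unfolding good_def by auto
  ultimately have "d U (ob Y) x > E" "d U (ob Y) (pact n x) > E" using k_large E_pos by linarith+
  then have "d Y x (ob U) \<le> e Y" "d Y (pact n x) (ob U) \<le> e Y"
    using coh[of Y U x] coh[of Y U "pact n x"] Y U x nc e_Sp[OF U(1)]
    by (auto simp: d_sym[of U _ "ob Y"])
  then show ?thesis using d_le''[of Y x "ob U" "e Y" "pact n x" "e Y"] by simp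
qed

text \<open>\<open>Y0\<close> sees \<open>x\<close> and \<open>Y\<close> too far apart to see both
  near the same \<open>W\<close>. So \<open>W\<close> sees \<open>x\<close> or \<open>Y\<close>
  within E of \<open>Y0\<close>, and goodness of the other one with respect to \<open>Y0\<close>
  gives the bound.\<close>

lemma good_transfer:
  assumes Y0: "Y0 \<in> Ln" "Y0 \<notin> Sp" and Y: "Y \<in> Ln" "Y \<notin> Sp" and ne: "Y0 \<noteq> Y" and x: "x \<in> Pt"
    and g: "good 40 Y0 x" "good 40 Y0 (ob Y)" and far: "d Y0 x (ob Y) > 2 * e Y0"
  shows "good 60 Y x"
  unfolding good_def
proof
  fix W assume W: "W \<in> Sp"
  have WY: "Y0 \<noteq> W" using Y0 W by auto
  have "d Y0 (ob Y) (ob W) \<le> e Y0 \<or> d W (ob Y) (ob Y0) \<le> E" "d Y0 x (ob W) \<le> e Y0 \<or> d W x (ob Y0) \<le> E"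
    using coh[of Y0 W "ob Y"] coh[of Y0 W x] Y0 Y W WY x e_Sp[OF W] by auto
  moreover have "\<not> (d Y0 (ob Y) (ob W) \<le> e Y0 \<and> d Y0 x (ob W) \<le> e Y0)"
    using d_le''[of Y0 x "ob W" "e Y0" "ob Y" "e Y0"] far by auto
  moreover have "2 * d W (ob Y0) x \<le> k + 40 * E" "2 * d W (ob Y0) (ob Y) \<le> k + 40 * E"
    using g W unfolding good_def by auto
  ultimately show "2 * d W (ob Y) x \<le> k + 60 * E"
    using d_tri[of W "ob Y" x "ob Y0"] d_sym[of W "ob Y" "ob Y0"] d_sym[of W x "ob Y0"] E_pos by linarith
qed

lemma good_near:
  assumes "good 40 Y x" "\<And>W. W \<in> Sp \<Longrightarrow> d W x y \<le> E"
  shows "good 60 Y y"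
  unfolding good_def
proof
  fix W assume W: "W \<in> Sp"
  have "2 * d W (ob Y) x \<le> k + 40 * E" "d W x y \<le> E" using assms W unfolding good_def by auto
  then show "2 * d W (ob Y) y \<le> k + 60 * E" using d_tri[of W "ob Y" y x] E_pos by linarith
qed

lemma near_not_N:
  assumes x: "x \<in> Pt" and n: "n \<in> N" and near: "\<And>W. W \<in> Sp \<Longrightarrow> d W x (pact n x) \<le> E"
  shows "n = \<one>"
proof (rule ccontr)
  assume "n \<noteq> \<one>"
  then obtain U l where U: "U \<in> Sp" "l \<noteq> 0" "\<bar>\<delta> U x (pact n x) - l * k\<bar> \<le> 40 * E"
    using greendlinger[OF x n] by blast
  have "1 * k \<le> \<bar>l\<bar> * k" using U(2) k_large E_pos by (intro mult_right_mono) auto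
  then have "\<bar>l * k\<bar> \<ge> k" using k_large E_pos by (simp add: abs_mult)
  then show False using U(3) near[OF U(1)] k_large E_pos by linarith
qed

end

context spinning_stab
begin

text \<open>Let \<open>s\<close> be the conjugate of \<open>t^m\<close> by a good representative of
  \<open>g0\<close>. If \<open>s t^n\<close> is a nontrivial element of \<open>N\<close>, some
  \<open>U\<close> sees \<open>s\<close> move \<open>o1\<close> by almost a full turn. But
  \<open>s\<close> almost fixes \<open>z\<close> along every line, and \<open>o1\<close> is about
  half a turn from \<open>z\<close> at most, so both \<open>U\<close> and its preimage under
  \<open>s\<close> separate \<open>o1\<close> from \<open>z\<close>. If they differ, this
  contradicts \<open>block_chain\<close>; if they agree, \<open>s\<close> is a rotation about
  \<open>U\<close> and does not almost fix \<open>z\<close>.\<close>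

theorem quotient_no_inversion:
  assumes o: "o1 \<in> Pt" and t: "t \<in> carrier G" and g0: "g0 \<in> carrier G"
    and ell: "\<And>V j::int. V \<in> Sp \<Longrightarrow> d V o1 (pact (t [^] j) o1) \<le> E"
    and t1: "t \<noteq> \<one>" and m: "m > 0" and N0: "g0 \<otimes> t [^] (m::nat) \<otimes> inv g0 \<otimes> t [^] (n::nat) \<in> N"
  shows "\<exists>x \<in> carrier G. x \<otimes> t [^] m \<otimes> inv x \<otimes> t [^] n = \<one>"
proof (rule ccontr)
  assume no: "\<not> ?thesis"
  obtain c where c: "c \<in> N" "\<And>U. U \<in> Sp \<Longrightarrow> 2 * d U o1 (pact c (pact g0 o1)) \<le> k + 40 * E"
    using good_lift[OF o, of "pact g0 o1"] o g0 by auto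
  define g where "g = c \<otimes> g0"
  have g: "g \<in> carrier G" using c g0 by (simp add: g_def)
  define z where "z = pact g o1"
  have z: "z \<in> Pt" and zg: "\<And>U. U \<in> Sp \<Longrightarrow> 2 * d U o1 z \<le> k + 40 * E"
    using c g o g0 by (simp_all add: z_def g_def pact_mult)
  define s where "s = g \<otimes> t [^] m \<otimes> inv g"
  have s: "s \<in> carrier G" using g t by (simp add: s_def)
  define \<nu> where "\<nu> = s \<otimes> t [^] n"
  have \<nu>N: "\<nu> \<in> N"
  proof -
    let ?u = "g0 \<otimes> t [^] m \<otimes> inv g0"
    have u: "?u \<in> carrier G" using g0 t by simp
    have "\<nu> = c \<otimes> ((?u \<otimes> inv c \<otimes> inv ?u) \<otimes> (?u \<otimes> t [^] n))"
      using c(1) g0 t by (simp add: \<nu>_def s_def g_def inv_mult_group m_assoc cancel_inv)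
    moreover have "?u \<otimes> inv c \<otimes> inv ?u \<in> N" using N_conj[OF u] rotg_inv[of Sp c] c by simp
    ultimately show ?thesis using c(1) N0 rotg_mult by simp
  qed
  have \<nu>1: "\<nu> \<noteq> \<one>" using no g by (auto simp: \<nu>_def s_def)
  have sp: "s [^] (j::nat) = g \<otimes> t [^] (m * j) \<otimes> inv g" for j
  proof (induction j)
    case (Suc j)
    have "s [^] Suc j = (g \<otimes> t [^] (m * j) \<otimes> inv g) \<otimes> s" using Suc by simp
    also have "\<dots> = g \<otimes> (t [^] (m * j) \<otimes> t [^] m) \<otimes> inv g"
      using g t by (simp add: s_def m_assoc cancel_inv)
    also have "t [^] (m * j) \<otimes> t [^] m = t [^] (m * Suc j)"
      using nat_pow_mult[OF t, of "m * j" m] by (simp add: add.commute)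
    finally show ?case .
  qed (use g in simp)
  have spi: "s [^] (j::int) = g \<otimes> t [^] (int m * j) \<otimes> inv g" for j
  proof (cases j rule: int_cases2)
    case (nonneg q)
    then show ?thesis using sp[of q] by (metis int_pow_int of_nat_mult)
  next
    case (nonpos q)
    have "s [^] j = inv (s [^] q)" using nonpos s by (simp only: int_pow_neg_int)
    also have "\<dots> = g \<otimes> inv (t [^] (m * q)) \<otimes> inv g" using sp[of q] g t by (simp add: inv_mult_group m_assoc)
    also have "inv (t [^] (m * q)) = t [^] (int m * j)"
      using nonpos t by (simp add: int_pow_neg_int[symmetric])
    finally show ?thesis .
  qed
  have ellz: "d V z (pact (s [^] j) z) \<le> E" if V: "V \<in> Sp" for V and j :: int
  proof -
    have "pact (s [^] j) z = pact g (pact (t [^] (int m * j)) o1)"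
      using g t o by (simp add: spi z_def pact_mult[symmetric] m_assoc)
    then show ?thesis
      using d_shift2[of g V o1 "pact (t [^] (int m * j)) o1"] ell[of "act (inv g) V" "int m * j"] V g t o
      by (simp add: z_def)
  qed
  obtain U l where U: "U \<in> Sp" "l \<noteq> 0" "\<bar>\<delta> U o1 (pact \<nu> o1) - l * k\<bar> \<le> 40 * E"
    using greendlinger[OF o \<nu>N \<nu>1] .
  have "1 * k \<le> \<bar>l\<bar> * k" using U(2) k_large E_pos by (intro mult_right_mono) auto
  then have "\<bar>l * k\<bar> \<ge> k" using k_large E_pos by (simp add: abs_mult)
  then have far: "d U o1 (pact \<nu> o1) \<ge> k - 40 * E" using U(3) by linarith
  define U' where "U' = act (inv s) U"
  have U': "U' \<in> Sp" "act s U' = U" using U s by (simp_all add: U'_def)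
  have "d U (pact \<nu> o1) (pact s o1) \<le> E"
  proof -
    have "pact \<nu> o1 = pact s (pact (t [^] n) o1)" using s t o by (simp add: \<nu>_def pact_mult)
    then have "d U (pact \<nu> o1) (pact s o1) = d U' (pact (t [^] n) o1) o1"
      using d_shift2[of s U "pact (t [^] n) o1" o1] U s t o by (simp add: U'_def)
    then show ?thesis using ell[OF U'(1), of "int n"] by (simp add: int_pow_int d_sym[of U' _ o1])
  qed
  then have far2: "d U o1 (pact s o1) \<ge> k - 41 * E" using far d_tri[of U o1 "pact \<nu> o1" "pact s o1"]
      d_sym[of U "pact s o1" "pact \<nu> o1"] by linarith
  have zs: "d U z (pact s z) \<le> E" using ellz[OF U(1), of 1] s by simp
  have eq': "d U (pact s z) (pact s o1) = d U' o1 z"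
    using d_shift2[of s U z o1] U s z o by (simp add: U'_def d_sym[of _ z o1])
  have "d U o1 (pact s o1) \<le> d U o1 z + d U z (pact s z) + d U (pact s z) (pact s o1)"
    using d_tri[of U o1 "pact s o1" z] d_tri[of U z "pact s o1" "pact s z"] by linarith
  then have big: "d U o1 z > 30 * E" "d U' o1 z > 30 * E"
    using far2 zs eq' zg[OF U(1)] zg[OF U'(1)] k_large E_pos by linarith+
  show False
  proof (cases "U' = U")
    case True
    then obtain i :: int where i: "s = r U [^] i" using stab[OF s U(1)] U' by auto
    show False
    proof (cases "i = 0")
      case True
      then have "g \<otimes> t [^] m \<otimes> inv g = \<one>" using i by (simp add: s_def[symmetric])
      then have "inv g \<otimes> (g \<otimes> t [^] m \<otimes> inv g) \<otimes> g = \<one>" using g by simp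
      then have "t [^] m = \<one>" using g t by (simp add: m_assoc cancel_inv)
      then show False using torsion[OF t m] t1 by simp
    next
      case False
      have "1 * k \<le> \<bar>i\<bar> * k" using False k_large E_pos by (intro mult_right_mono) auto
      then have "\<bar>i * k\<bar> \<ge> k" using k_large E_pos by (simp add: abs_mult)
      moreover have "d U z (pact s z) = \<bar>i * k\<bar>" using rot_pow[OF U(1) z, of i] i by simp
      ultimately show False using zs k_large E_pos by linarith
    qed
  next
    case False
    consider "d U' o1 (ob U) \<le> E" | "d U o1 (ob U') \<le> E" using cohS[of U U' o1] U U' False o by auto
    then show False
    proof cases
      case 1
      then have "d U' z (ob (act s U')) > 5 * E"
        using big d_le[of U' o1 "ob U" E z "d U' z (ob U)"] d_sym[of U' z "ob U"] U'(2) E_pos by auto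
      then show False using block_chain[OF z s U'(1) ellz] False U'(2) by auto
    next
      case 2
      have si: "(inv s) [^] (j::int) = s [^] (- j)" for j using s by (simp add: int_pow_inv int_pow_neg)
      have "d U z (ob (act (inv s) U)) > 5 * E"
        using 2 big d_le[of U o1 "ob U'" E z "d U z (ob U')"] d_sym[of U z "ob U'"] E_pos by (auto simp: U'_def)
      then show False
        using block_chain[OF z _ U(1), of "inv s"] ellz False s by (auto simp: si U'_def)
    qed
  qed
qed

end

section \<open>Systems of lines on cosets of cyclic subgroups\<close>

definition cyc :: "('a, 'b) monoid_scheme \<Rightarrow> 'a \<Rightarrow> 'a set" where
  "cyc G g = range (\<lambda>n::int. g [^]\<^bsub>G\<^esub> n)"

context group
begin

lemma cyc_subset: "g \<in> carrier G \<Longrightarrow> cyc G g \<subseteq> carrier G"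
  by (auto simp: cyc_def)

lemma cyc_subgroup: "g \<in> carrier G \<Longrightarrow> subgroup (cyc G g) G"
proof (rule subgroupI)
  assume g: "g \<in> carrier G"
  show "cyc G g \<subseteq> carrier G" using g by (rule cyc_subset)
  show "cyc G g \<noteq> {}" by (simp add: cyc_def)
  show "inv a \<in> cyc G g" if "a \<in> cyc G g" for a
    using that g by (auto simp: cyc_def int_pow_neg[symmetric])
  show "a \<otimes> b \<in> cyc G g" if "a \<in> cyc G g" "b \<in> cyc G g" for a b
    using that g by (auto simp: cyc_def int_pow_mult[symmetric])
qed

lemma cyc_pow [simp]: "g [^] (n::int) \<in> cyc G g"
  by (simp add: cyc_def)

definition lprod :: "'a list \<Rightarrow> 'a" where
  "lprod xs = foldr (\<otimes>) xs \<one>"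

lemma lprod_Nil [simp]: "lprod [] = \<one>" and lprod_Cons [simp]: "lprod (x # xs) = x \<otimes> lprod xs"
  by (simp_all add: lprod_def)

lemma lprod_closed [simp]: "set xs \<subseteq> carrier G \<Longrightarrow> lprod xs \<in> carrier G"
  by (induction xs) auto

lemma lprod_append: "set xs \<subseteq> carrier G \<Longrightarrow> set ys \<subseteq> carrier G \<Longrightarrow> lprod (xs @ ys) = lprod xs \<otimes> lprod ys"
  by (induction xs) (auto simp: m_assoc)

lemma generate_lprod:
  assumes "s \<in> generate G S" "S \<subseteq> carrier G"
  shows "\<exists>xs. set xs \<subseteq> S \<union> m_inv G ` S \<and> lprod xs = s"
  using assms(1)
proof induction
  case one
  then show ?case by (intro exI[of _ "[]"]) simp
next
  case (incl h)
  then show ?case using assms(2) by (intro exI[of _ "[h]"]) auto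
next
  case (inv h)
  then show ?case using assms(2) by (intro exI[of _ "[inv h]"]) auto
next
  case (eng h1 h2)
  then obtain xs ys where "set xs \<subseteq> S \<union> m_inv G ` S" "lprod xs = h1" "set ys \<subseteq> S \<union> m_inv G ` S" "lprod ys = h2"
    by blast
  moreover have "S \<union> m_inv G ` S \<subseteq> carrier G" using assms(2) by auto
  ultimately show ?case using lprod_append[of xs ys] by (intro exI[of _ "xs @ ys"]) (simp, blast?)
qed

end

section \<open>From coordinates of group elements to a line system\<close>

lemma intermediate_step:
  fixes a :: "nat \<Rightarrow> int"
  assumes "\<And>i. i < n \<Longrightarrow> \<bar>a (Suc i) - a i\<bar> \<le> c" "\<bar>a n - a 0\<bar> > 13 * c" "0 \<le> c"
  shows "\<exists>i\<le>n. \<bar>a i - a 0\<bar> > 6 * c \<and> \<bar>a n - a i\<bar> > 6 * c"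
proof -
  define i where "i = (LEAST i. \<bar>a i - a 0\<bar> > 6 * c)"
  have 1: "\<bar>a n - a 0\<bar> > 6 * c" using assms by linarith
  have i: "\<bar>a i - a 0\<bar> > 6 * c" "i \<le> n"
    unfolding i_def using LeastI[of "\<lambda>i. \<bar>a i - a 0\<bar> > 6 * c" n] Least_le[of "\<lambda>i. \<bar>a i - a 0\<bar> > 6 * c" n] 1 by auto
  then obtain j where j: "i = Suc j" using assms(3) by (cases i) auto
  have "\<not> \<bar>a j - a 0\<bar> > 6 * c" using not_less_Least[of j "\<lambda>i. \<bar>a i - a 0\<bar> > 6 * c"] j by (simp add: i_def)
  then have "\<bar>a n - a i\<bar> > 6 * c" using assms(1)[of j] assms(2) j i(2) by auto
  then show ?thesis using i by blast
qed

text \<open>Pigeonhole: of three values pairwise more than 6c apart at most one is within 3c of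
  \<open>p\<close>, and likewise for \<open>q\<close>, so two hits would have to serve three
  alternatives.\<close>

lemma near_two:
  fixes a1 b1 :: int
  assumes "\<bar>a1 - p\<bar> \<le> 3 * c \<or> \<bar>b1 - q\<bar> \<le> 3 * d" "\<bar>a2 - p\<bar> \<le> 3 * c \<or> \<bar>b2 - q\<bar> \<le> 3 * d"
    "\<bar>a3 - p\<bar> \<le> 3 * c \<or> \<bar>b3 - q\<bar> \<le> 3 * d"
    and "\<bar>a2 - a1\<bar> > 6 * c \<and> \<bar>a3 - a2\<bar> > 6 * c \<and> \<bar>a3 - a1\<bar> > 6 * c"
    "\<bar>b2 - b1\<bar> > 6 * d \<and> \<bar>b3 - b2\<bar> > 6 * d \<and> \<bar>b3 - b1\<bar> > 6 * d"
  shows False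
proof -
  have key: "\<not> (\<bar>a - p\<bar> \<le> 3 * c \<and> \<bar>b - p\<bar> \<le> 3 * c)" if "\<bar>b - a\<bar> > 6 * c" for a b p c :: int
    using that by linarith
  have "\<not> (\<bar>a1 - p\<bar> \<le> 3 * c \<and> \<bar>a2 - p\<bar> \<le> 3 * c)" "\<not> (\<bar>a2 - p\<bar> \<le> 3 * c \<and> \<bar>a3 - p\<bar> \<le> 3 * c)"
    "\<not> (\<bar>a1 - p\<bar> \<le> 3 * c \<and> \<bar>a3 - p\<bar> \<le> 3 * c)" "\<not> (\<bar>b1 - q\<bar> \<le> 3 * d \<and> \<bar>b2 - q\<bar> \<le> 3 * d)"
    "\<not> (\<bar>b2 - q\<bar> \<le> 3 * d \<and> \<bar>b3 - q\<bar> \<le> 3 * d)" "\<not> (\<bar>b1 - q\<bar> \<le> 3 * d \<and> \<bar>b3 - q\<bar> \<le> 3 * d)"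
    using assms(4,5) by (simp_all only: key not_False_eq_True)
  then show False using assms(1-3) by argo
qed

text \<open>The lines are the left cosets of the subgroups generated by the \<open>v i\<close>; \<open>f i (inv x \<otimes> s)\<close> is the coordinate of
  the projection of \<open>s\<close> to \<open>x <# cyc G (v i)\<close>. \<open>CB\<close> is Behrstock's inequality. In contrast to \<open>line_system\<close>,
  everything is expressed by coordinates of group elements, which is what HNN extensions and quotients preserve.\<close>

locale psys = group G for G (structure) +
  fixes S :: "'a set" and I :: "'i set" and v :: "'i \<Rightarrow> 'a" and m c :: "'i \<Rightarrow> int" and f :: "'i \<Rightarrow> 'a \<Rightarrow> int"
  assumes S_fin: "finite S" and S_sub: "S \<subseteq> carrier G" and S_gen: "generate G S = carrier G"
    and v_closed [simp]: "i \<in> I \<Longrightarrow> v i \<in> carrier G" and m_pos: "i \<in> I \<Longrightarrow> 0 < m i"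
    and c_nonneg: "i \<in> I \<Longrightarrow> 0 \<le> c i"
    and f_v: "\<lbrakk>i \<in> I; s \<in> carrier G\<rbrakk> \<Longrightarrow> f i (v i \<otimes> s) = f i s + m i"
    and CB: "\<lbrakk>i \<in> I; j \<in> I; x \<in> carrier G; \<not> (i = j \<and> x \<in> cyc G (v i))\<rbrakk>
      \<Longrightarrow> \<exists>p q. \<forall>s \<in> carrier G. \<bar>f i s - p\<bar> \<le> c i \<or> \<bar>f j (inv x \<otimes> s) - q\<bar> \<le> c j"
    and Fg: "s \<in> S \<Longrightarrow> finite {(i, x <# cyc G (v i)) | i x. i \<in> I \<and> x \<in> carrier G \<and>
      \<bar>f i (inv x \<otimes> s) - f i (inv x)\<bar> > c i}"
begin

lemma f_pow: 
  assumes i: "i \<in> I" and s: "s \<in> carrier G"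
  shows "f i (v i [^] (n::int) \<otimes> s) = f i s + n * m i"
proof -
  have nat: "f i (v i [^] (q::nat) \<otimes> s) = f i s + int q * m i" if "s \<in> carrier G" for q s
    using that
  proof (induction q arbitrary: s)
    case (Suc q)
    then show ?case using i Suc.IH[of "v i \<otimes> s"] by (simp add: f_v m_assoc algebra_simps)
  qed simp
  show ?thesis
  proof (cases n rule: int_cases2)
    case (nonneg q)
    then show ?thesis using nat[OF s] by (simp add: int_pow_int)
  next
    case (nonpos q)
    have "f i (v i [^] q \<otimes> (v i [^] n \<otimes> s)) = f i (v i [^] n \<otimes> s) + int q * m i" using i s by (intro nat) simp
    moreover have "v i [^] q \<otimes> (v i [^] n \<otimes> s) = s"
      using nonpos i s by (simp add: int_pow_neg_int cancel_inv)
    ultimately show ?thesis using nonpos by simp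
  qed
qed

abbreviation C where "C i \<equiv> cyc G (v i)"

definition Ln :: "('i \<times> 'a set) set" where
  "Ln = {(i, x <# C i) | i x. i \<in> I \<and> x \<in> carrier G}"

definition rp :: "'i \<times> 'a set \<Rightarrow> 'a" where
  "rp Y = (SOME x. x \<in> snd Y)"

definition act :: "'a \<Rightarrow> 'i \<times> 'a set \<Rightarrow> 'i \<times> 'a set" where
  "act g Y = (fst Y, g <# snd Y)"

lemma C_sub: "i \<in> I \<Longrightarrow> C i \<subseteq> carrier G"
  by (simp add: cyc_subset)

lemma C_subgroup: "i \<in> I \<Longrightarrow> subgroup (C i) G"
  by (simp add: cyc_subgroup)

lemma in_lcoset: "x \<in> carrier G \<Longrightarrow> i \<in> I \<Longrightarrow> y \<in> x <# C i \<longleftrightarrow> (\<exists>n::int. y = x \<otimes> v i [^] n)"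
  by (auto simp: l_coset_def cyc_def)

lemma rp_frame:
  assumes "i \<in> I" "x \<in> carrier G"
  obtains n :: int where "rp (i, x <# C i) = x \<otimes> v i [^] n"
proof -
  have "x = x \<otimes> v i [^] (0::int)" using assms by simp
  then have "x \<in> x <# C i" using in_lcoset[of x i x] assms by blast
  then have "rp (i, x <# C i) \<in> x <# C i" unfolding rp_def by (simp add: someI[of "\<lambda>y. y \<in> x <# C i" x])
  then show ?thesis using that assms in_lcoset by blast
qed

lemma lcoset_pow: 
  assumes "i \<in> I" "x \<in> carrier G" shows "(x \<otimes> v i [^] (n::int)) <# C i = x <# C i"
proof -
  have "x \<otimes> v i [^] n \<in> x <# C i" using in_lcoset[of x i] assms by blast
  then show ?thesis using l_repr_independence[OF _ assms(2) C_subgroup[OF assms(1)]] by simp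
qed

lemma lcoset_eq:
  assumes "i \<in> I" "x \<in> carrier G" "y \<in> carrier G"
  shows "x <# C i = y <# C i \<longleftrightarrow> inv x \<otimes> y \<in> C i"
proof
  assume "x <# C i = y <# C i"
  moreover have "y \<in> y <# C i" using in_lcoset[of y i y] assms by (auto intro!: exI[of _ "0::int"])
  ultimately obtain n :: int where "y = x \<otimes> v i [^] n" using in_lcoset assms by blast
  then show "inv x \<otimes> y \<in> C i" using assms by (simp add: cancel_inv)
next
  assume "inv x \<otimes> y \<in> C i"
  then obtain n :: int where "inv x \<otimes> y = v i [^] n" by (auto simp: cyc_def)
  then have "y = x \<otimes> v i [^] n" using assms cancel_inv(2)[of x y] by simp
  then show "x <# C i = y <# C i" using lcoset_pow assms by simp
qed

lemma rp_closed [simp]: "Y \<in> Ln \<Longrightarrow> rp Y \<in> carrier G"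
  and fst_Ln [simp]: "Y \<in> Ln \<Longrightarrow> fst Y \<in> I"
  and Ln_rp: "Y \<in> Ln \<Longrightarrow> (fst Y, rp Y <# C (fst Y)) = Y"
proof -
  assume "Y \<in> Ln"
  then obtain i x where Y: "Y = (i, x <# C i)" "i \<in> I" "x \<in> carrier G" by (auto simp: Ln_def)
  obtain n :: int where n: "rp Y = x \<otimes> v i [^] n" using rp_frame[OF Y(2,3)] Y(1) by metis
  then show "rp Y \<in> carrier G" "fst Y \<in> I" "(fst Y, rp Y <# C (fst Y)) = Y"
    using Y by (simp_all add: lcoset_pow)
qed

lemma Ln_I [simp]: "i \<in> I \<Longrightarrow> x \<in> carrier G \<Longrightarrow> (i, x <# C i) \<in> Ln"
  by (auto simp: Ln_def)

lemma Ln_cases: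
  assumes "Y \<in> Ln" obtains i x where "i \<in> I" "x \<in> carrier G" "Y = (i, x <# C i)"
  using assms by (auto simp: Ln_def)

lemma act_frame: "g \<in> carrier G \<Longrightarrow> i \<in> I \<Longrightarrow> x \<in> carrier G \<Longrightarrow> act g (i, x <# C i) = (i, (g \<otimes> x) <# C i)"
  by (simp add: act_def lcos_m_assoc C_sub)

lemma rp_act:
  assumes "Y \<in> Ln" "g \<in> carrier G"
  obtains n :: int where "rp (act g Y) = g \<otimes> rp Y \<otimes> v (fst Y) [^] n"
proof -
  have "act g Y = (fst Y, (g \<otimes> rp Y) <# C (fst Y))"
    using Ln_rp[OF assms(1)] act_frame[of g "fst Y" "rp Y"] assms by simp
  then show ?thesis using rp_frame[of "fst Y" "g \<otimes> rp Y"] that assms by auto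
qed

abbreviation val :: "'i \<times> 'a set \<Rightarrow> 'a \<Rightarrow> int" where
  "val Y s \<equiv> f (fst Y) (inv (rp Y) \<otimes> s)"

definition prs :: "'i \<Rightarrow> 'a \<Rightarrow> 'i \<Rightarrow> 'a \<Rightarrow> int set" where
  "prs i x j y = {p. \<exists>q. \<forall>s \<in> carrier G. \<bar>f i (inv x \<otimes> s) - p\<bar> \<le> c i \<or> \<bar>f j (inv y \<otimes> s) - q\<bar> \<le> c j}"

text \<open>\<open>CB\<close> determines projections of lines only up to a bounded error, while
  \<open>line_system\<close> asks for exact equivariance. Taking the minimum of all admissible
  values is a choice that commutes with the group (\<open>pj_frame\<close>).\<close>

definition pj :: "'i \<Rightarrow> 'a \<Rightarrow> 'i \<Rightarrow> 'a \<Rightarrow> int" where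
  "pj i x j y = Min (prs i x j y)"

lemma prs_ne:
  assumes "i \<in> I" "j \<in> I" "x \<in> carrier G" "y \<in> carrier G" "\<not> (i = j \<and> inv x \<otimes> y \<in> C i)"
  shows "prs i x j y \<noteq> {}"
proof -
  obtain p q where pq: "\<forall>s \<in> carrier G. \<bar>f i s - p\<bar> \<le> c i \<or> \<bar>f j (inv (inv x \<otimes> y) \<otimes> s) - q\<bar> \<le> c j"
    using CB[of i j "inv x \<otimes> y"] assms by auto
  have "\<bar>f i (inv x \<otimes> s) - p\<bar> \<le> c i \<or> \<bar>f j (inv y \<otimes> s) - q\<bar> \<le> c j" if s: "s \<in> carrier G" for s
  proof -
    have "inv (inv x \<otimes> y) \<otimes> (inv x \<otimes> s) = inv y \<otimes> s"
      using assms s by (simp add: inv_mult_group m_assoc cancel_inv)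
    then show ?thesis using pq[rule_format, of "inv x \<otimes> s"] assms s by simp
  qed
  then show ?thesis unfolding prs_def by blast
qed

lemma far_out:
  assumes "j \<in> I" "y \<in> carrier G"
  shows "\<exists>n::int. f j (inv y \<otimes> (y \<otimes> v j [^] n)) > B"
proof -
  have "f j (inv y \<otimes> (y \<otimes> v j [^] n)) = f j \<one> + n * m j" for n :: int
    using f_pow[of j \<one> n] assms by (simp add: cancel_inv)
  moreover have "\<bar>B - f j \<one>\<bar> \<le> \<bar>B - f j \<one>\<bar> * m j"
    using mult_left_mono[of 1 "m j" "\<bar>B - f j \<one>\<bar>"] m_pos[OF assms(1)] by simp
  ultimately have "f j (inv y \<otimes> (y \<otimes> v j [^] (\<bar>B - f j \<one>\<bar> + 1))) > B"
    using m_pos[OF assms(1)] by (simp add: algebra_simps)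
  then show ?thesis ..
qed

text \<open>At an element far out on the second line the second alternatives fail, so its coordinate
  on the first line is within \<open>c i\<close> of both \<open>p\<close> and
  \<open>p'\<close>.\<close>

lemma prs_diam:
  assumes ij: "i \<in> I" "j \<in> I" "x \<in> carrier G" "y \<in> carrier G" and p: "p \<in> prs i x j y" "p' \<in> prs i x j y"
  shows "\<bar>p - p'\<bar> \<le> 2 * c i"
proof -
  obtain q q' where q: "\<forall>s \<in> carrier G. \<bar>f i (inv x \<otimes> s) - p\<bar> \<le> c i \<or> \<bar>f j (inv y \<otimes> s) - q\<bar> \<le> c j"
    "\<forall>s \<in> carrier G. \<bar>f i (inv x \<otimes> s) - p'\<bar> \<le> c i \<or> \<bar>f j (inv y \<otimes> s) - q'\<bar> \<le> c j"
    using p by (auto simp: prs_def)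
  obtain n :: int where n: "f j (inv y \<otimes> (y \<otimes> v j [^] n)) > \<bar>q\<bar> + \<bar>q'\<bar> + c j"
    using far_out[of j y] ij by blast
  have "y \<otimes> v j [^] n \<in> carrier G" using ij by simp
  then show ?thesis using q n by fastforce
qed

lemma prs_fin:
  assumes "i \<in> I" "j \<in> I" "x \<in> carrier G" "y \<in> carrier G"
  shows "finite (prs i x j y)"
proof (cases "prs i x j y = {}")
  case False
  then obtain p where p: "p \<in> prs i x j y" by blast
  have "prs i x j y \<subseteq> {p - 2 * c i..p + 2 * c i}" using prs_diam[OF assms _ p] by fastforce
  then show ?thesis using finite_subset by blast
qed simp

lemma pj_in:
  assumes "i \<in> I" "j \<in> I" "x \<in> carrier G" "y \<in> carrier G" "\<not> (i = j \<and> inv x \<otimes> y \<in> C i)"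
  shows "pj i x j y \<in> prs i x j y"
  unfolding pj_def using assms by (intro Min_in prs_fin prs_ne) auto

text \<open>\<open>CB\<close> supplies the two projections as a pair, whereas \<open>pj\<close>
  chooses them separately; \<open>prs_diam\<close> pays for the difference, and 3c = c + 2c.\<close>

lemma coh_pt:
  assumes ij: "i \<in> I" "j \<in> I" "x \<in> carrier G" "y \<in> carrier G" and ne: "\<not> (i = j \<and> inv x \<otimes> y \<in> C i)"
    and s: "s \<in> carrier G"
  shows "\<bar>f i (inv x \<otimes> s) - pj i x j y\<bar> \<le> c i \<or> \<bar>f j (inv y \<otimes> s) - pj j y i x\<bar> \<le> 3 * c j"
proof -
  obtain q where q: "\<forall>s \<in> carrier G. \<bar>f i (inv x \<otimes> s) - pj i x j y\<bar> \<le> c i \<or> \<bar>f j (inv y \<otimes> s) - q\<bar> \<le> c j"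
    using pj_in[OF ij ne] by (auto simp: prs_def)
  then have "q \<in> prs j y i x" by (auto simp: prs_def)
  moreover have "pj j y i x \<in> prs j y i x"
  proof (rule pj_in[OF ij(2,1,4,3)])
    show "\<not> (j = i \<and> inv y \<otimes> x \<in> C j)"
      using ne lcoset_eq[of j x y] lcoset_eq[of j y x] ij by auto
  qed
  ultimately have "\<bar>q - pj j y i x\<bar> \<le> 2 * c j" using prs_diam ij by blast
  then show ?thesis using q s by force
qed

lemma prs_shift: 
  assumes "i \<in> I" "j \<in> I" "x \<in> carrier G" "y \<in> carrier G" "g \<in> carrier G"
  shows "prs i (g \<otimes> x) j (g \<otimes> y) = prs i x j y"
proof -
  have ball: "(\<forall>s \<in> carrier G. Q (inv g \<otimes> s)) = (\<forall>s \<in> carrier G. Q s)" for Q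
    using cancel_inv(1)[OF assms(5)] assms(5) by (metis inv_closed m_closed)
  have "inv (g \<otimes> x) \<otimes> s = inv x \<otimes> (inv g \<otimes> s)" "inv (g \<otimes> y) \<otimes> s = inv y \<otimes> (inv g \<otimes> s)" if "s \<in> carrier G" for s
    using that assms by (simp_all add: inv_mult_group m_assoc)
  then have "(\<forall>s \<in> carrier G. \<bar>f i (inv (g \<otimes> x) \<otimes> s) - p\<bar> \<le> c i \<or> \<bar>f j (inv (g \<otimes> y) \<otimes> s) - q\<bar> \<le> c j)
    = (\<forall>s \<in> carrier G. \<bar>f i (inv x \<otimes> s) - p\<bar> \<le> c i \<or> \<bar>f j (inv y \<otimes> s) - q\<bar> \<le> c j)" for p q
    using ball[of "\<lambda>s. \<bar>f i (inv x \<otimes> s) - p\<bar> \<le> c i \<or> \<bar>f j (inv y \<otimes> s) - q\<bar> \<le> c j"] by simp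
  then show ?thesis by (simp add: prs_def)
qed

lemma f_frame_pow:
  assumes "i \<in> I" "x \<in> carrier G" "s \<in> carrier G"
  shows "f i (inv (x \<otimes> v i [^] (n::int)) \<otimes> s) = f i (inv x \<otimes> s) - n * m i"
proof -
  have "inv (x \<otimes> v i [^] n) \<otimes> s = v i [^] (- n) \<otimes> (inv x \<otimes> s)"
    using assms by (simp add: inv_mult_group m_assoc int_pow_neg)
  then show ?thesis using f_pow[of i "inv x \<otimes> s" "- n"] assms by simp
qed

lemma prs_pow:
  assumes "i \<in> I" "j \<in> I" "x \<in> carrier G" "y \<in> carrier G"
  shows "prs i (x \<otimes> v i [^] (n::int)) j (y \<otimes> v j [^] (n'::int)) = (\<lambda>p. p - n * m i) ` prs i x j y"
proof -
  have "p - n * m i \<in> prs i (x \<otimes> v i [^] n) j (y \<otimes> v j [^] n')" if p: "p \<in> prs i x j y" for p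
  proof -
    obtain q where "\<forall>s \<in> carrier G. \<bar>f i (inv x \<otimes> s) - p\<bar> \<le> c i \<or> \<bar>f j (inv y \<otimes> s) - q\<bar> \<le> c j"
      using p[unfolded prs_def mem_Collect_eq] ..
    then have "\<forall>s \<in> carrier G. \<bar>f i (inv (x \<otimes> v i [^] n) \<otimes> s) - (p - n * m i)\<bar> \<le> c i
        \<or> \<bar>f j (inv (y \<otimes> v j [^] n') \<otimes> s) - (q - n' * m j)\<bar> \<le> c j"
      using assms by (auto simp: f_frame_pow)
    then show ?thesis unfolding prs_def by blast
  qed
  moreover have "p + n * m i \<in> prs i x j y" if p: "p \<in> prs i (x \<otimes> v i [^] n) j (y \<otimes> v j [^] n')" for p
  proof -
    obtain q where "\<forall>s \<in> carrier G. \<bar>f i (inv (x \<otimes> v i [^] n) \<otimes> s) - p\<bar> \<le> c i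
        \<or> \<bar>f j (inv (y \<otimes> v j [^] n') \<otimes> s) - q\<bar> \<le> c j"
      using p[unfolded prs_def mem_Collect_eq] ..
    then have "\<forall>s \<in> carrier G. \<bar>f i (inv x \<otimes> s) - (p + n * m i)\<bar> \<le> c i
        \<or> \<bar>f j (inv y \<otimes> s) - (q + n' * m j)\<bar> \<le> c j"
      using assms by (auto simp: f_frame_pow algebra_simps)
    then show ?thesis unfolding prs_def by blast
  qed
  ultimately show ?thesis
  proof (intro equalityI subsetI)
    fix p assume p: "p \<in> prs i (x \<otimes> v i [^] n) j (y \<otimes> v j [^] n')"
      and 2: "\<And>p. p \<in> prs i (x \<otimes> v i [^] n) j (y \<otimes> v j [^] n') \<Longrightarrow> p + n * m i \<in> prs i x j y"
    show "p \<in> (\<lambda>p. p - n * m i) ` prs i x j y"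
      by (rule image_eqI[OF _ 2[OF p]]) simp
  qed auto
qed

lemma pj_frame:
  assumes ij: "i \<in> I" "j \<in> I" "x \<in> carrier G" "y \<in> carrier G" "g \<in> carrier G"
    and ne: "\<not> (i = j \<and> inv x \<otimes> y \<in> C i)"
  shows "pj i (g \<otimes> x \<otimes> v i [^] (n::int)) j (g \<otimes> y \<otimes> v j [^] (n'::int)) = pj i x j y - n * m i"
proof -
  have "prs i (g \<otimes> x \<otimes> v i [^] n) j (g \<otimes> y \<otimes> v j [^] n') = (\<lambda>p. p - n * m i) ` prs i x j y"
    using prs_pow[of i j "g \<otimes> x" "g \<otimes> y" n n'] prs_shift[OF ij] ij by simp
  moreover have "Min ((\<lambda>p. p - n * m i) ` prs i x j y) = Min (prs i x j y) - n * m i"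
    using mono_Min_commute[of "\<lambda>p. p - n * m i" "prs i x j y"] prs_fin[OF ij(1-4)] prs_ne[OF ij(1-4) ne]
    by (simp add: mono_def)
  ultimately show ?thesis by (simp add: pj_def)
qed

abbreviation PJ :: "'i \<times> 'a set \<Rightarrow> 'i \<times> 'a set \<Rightarrow> int" where
  "PJ Y Z \<equiv> pj (fst Y) (rp Y) (fst Z) (rp Z)"

abbreviation cl :: "'i \<times> 'a set \<Rightarrow> int" where "cl Y \<equiv> c (fst Y)"

lemma Ln_neq:
  assumes "Y \<in> Ln" "Z \<in> Ln" "Y \<noteq> Z"
  shows "\<not> (fst Y = fst Z \<and> inv (rp Y) \<otimes> rp Z \<in> C (fst Y))"
  using assms lcoset_eq[of "fst Y" "rp Y" "rp Z"] Ln_rp[of Y] Ln_rp[of Z] by auto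

lemma coh_val:
  assumes "Y \<in> Ln" "Z \<in> Ln" "Y \<noteq> Z" "s \<in> carrier G"
  shows "\<bar>val Y s - PJ Y Z\<bar> \<le> 3 * cl Y \<or> \<bar>val Z s - PJ Z Y\<bar> \<le> 3 * cl Z"
  using coh_pt[OF _ _ _ _ Ln_neq[OF assms(1-3)] assms(4)] assms c_nonneg[of "fst Y"] by force

lemma far_val: "Z \<in> Ln \<Longrightarrow> \<exists>s \<in> carrier G. val Z s > B"
  using far_out[of "fst Z" "rp Z" B] by fastforce

text \<open>An element far out on \<open>Z\<close> represents the line \<open>Z\<close>: its
  coordinates on \<open>Y\<close> and on \<open>X1\<close> agree with the projections of
  \<open>Z\<close> up to 3c.\<close>

lemma coh_PJ:
  assumes Y: "Y \<in> Ln" and Z: "Z \<in> Ln" and X1: "X1 \<in> Ln" and ne: "Y \<noteq> Z" "X1 \<noteq> Z" "Y \<noteq> X1"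
  shows "\<bar>PJ Y Z - PJ Y X1\<bar> \<le> 6 * cl Y \<or> \<bar>PJ X1 Z - PJ X1 Y\<bar> \<le> 6 * cl X1"
proof -
  obtain s where s: "s \<in> carrier G" "val Z s > \<bar>PJ Z Y\<bar> + \<bar>PJ Z X1\<bar> + 3 * cl Z" using far_val[OF Z] by blast
  then have "\<bar>val Y s - PJ Y Z\<bar> \<le> 3 * cl Y" "\<bar>val X1 s - PJ X1 Z\<bar> \<le> 3 * cl X1"
    using coh_val[of Y Z s] coh_val[of X1 Z s] assms by auto
  then show ?thesis using coh_val[of Y X1 s] assms s by auto
qed

lemma val_act:
  assumes "Y \<in> Ln" "g \<in> carrier G" "s \<in> carrier G" "t \<in> carrier G"
  shows "val (act g Y) (g \<otimes> s) - val (act g Y) (g \<otimes> t) = val Y s - val Y t"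
proof -
  obtain n :: int where n: "rp (act g Y) = g \<otimes> rp Y \<otimes> v (fst Y) [^] n" using rp_act[OF assms(1,2)] .
  have "inv (g \<otimes> rp Y) \<otimes> (g \<otimes> s) = inv (rp Y) \<otimes> s" if "s \<in> carrier G" for s
    using that assms by (simp add: inv_mult_group m_assoc cancel_inv)
  then show ?thesis
    using assms n by (simp add: f_frame_pow act_def)
qed

lemma val_frame:
  assumes "i \<in> I" "x \<in> carrier G" "s \<in> carrier G" "t \<in> carrier G"
  shows "val (i, x <# C i) s - val (i, x <# C i) t = f i (inv x \<otimes> s) - f i (inv x \<otimes> t)"
  using rp_frame[OF assms(1,2)] assms by (metis (no_types, lifting) diff_diff_eq2 diff_add_cancel f_frame_pow fst_conv add_diff_eq)

lemma act_closed' [simp]: "g \<in> carrier G \<Longrightarrow> Y \<in> Ln \<Longrightarrow> act g Y \<in> Ln"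
  by (metis Ln_cases Ln_I act_frame m_closed)

lemma act_mult': "\<lbrakk>g \<in> carrier G; h \<in> carrier G; Y \<in> Ln\<rbrakk> \<Longrightarrow> act (g \<otimes> h) Y = act g (act h Y)"
  by (elim Ln_cases) (simp add: act_frame m_assoc)

lemma act_one' [simp]: "Y \<in> Ln \<Longrightarrow> act \<one> Y = Y"
  by (elim Ln_cases) (simp add: act_frame)

lemma fin_gen:
  assumes "b \<in> S \<union> m_inv G ` S" "a \<in> carrier G"
  shows "finite {Y \<in> Ln. \<bar>val Y (a \<otimes> b) - val Y a\<bar> > cl Y}"
proof -
  have 1: "finite {Y \<in> Ln. \<bar>val Y (a \<otimes> s) - val Y a\<bar> > cl Y}" if s: "s \<in> S" and a: "a \<in> carrier G" for s a
  proof -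
    have sc: "s \<in> carrier G" using s S_sub by blast
    have "{Y \<in> Ln. \<bar>val Y (a \<otimes> s) - val Y a\<bar> > cl Y} \<subseteq> act a ` {(i, x <# C i) | i x. i \<in> I \<and> x \<in> carrier G \<and>
      \<bar>f i (inv x \<otimes> s) - f i (inv x)\<bar> > c i}"
    proof
      fix Y assume "Y \<in> {Y \<in> Ln. \<bar>val Y (a \<otimes> s) - val Y a\<bar> > cl Y}"
      then have Y: "Y \<in> Ln" "\<bar>val Y (a \<otimes> s) - val Y a\<bar> > cl Y" by auto
      define Z where "Z = act (inv a) Y"
      have Z: "Z \<in> Ln" "act a Z = Y" using Y a by (simp_all add: Z_def act_mult'[symmetric])
      have "\<bar>val Z s - val Z \<one>\<bar> > cl Z"
        using val_act[of Z a s \<one>] Z Y a sc by (simp add: Z_def act_def)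
      moreover obtain i x where ix: "i \<in> I" "x \<in> carrier G" "Z = (i, x <# C i)" using Z(1) by (rule Ln_cases)
      ultimately have "\<bar>f i (inv x \<otimes> s) - f i (inv x)\<bar> > c i" using val_frame[of i x s \<one>] sc by simp
      then show "Y \<in> act a ` {(i, x <# C i) | i x. i \<in> I \<and> x \<in> carrier G \<and> \<bar>f i (inv x \<otimes> s) - f i (inv x)\<bar> > c i}"
        using ix Z(2) by blast
    qed
    then show ?thesis using finite_subset Fg[OF s] by blast
  qed
  show ?thesis
  proof (cases "b \<in> S")
    case False
    then obtain s where s: "s \<in> S" "b = inv s" using assms by auto
    have "a \<otimes> b \<otimes> s = a" "a \<otimes> b \<in> carrier G" using s assms S_sub by (auto simp: m_assoc)
    then show ?thesis using 1[OF s(1), of "a \<otimes> b"] by (simp add: abs_minus_commute)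
  qed (use 1 assms in auto)
qed

lemma three_points:
  assumes Y: "Y \<in> Ln" "Z \<in> Ln" "Y \<noteq> Z" and s: "s \<in> carrier G" "t \<in> carrier G" "u \<in> carrier G"
    and far: "\<And>X1. X1 \<in> {Y, Z} \<Longrightarrow> \<bar>val X1 t - val X1 s\<bar> > 6 * cl X1 \<and> \<bar>val X1 u - val X1 t\<bar> > 6 * cl X1 \<and>
      \<bar>val X1 u - val X1 s\<bar> > 6 * cl X1"
  shows False
  using near_two[OF coh_val[OF Y s(1)] coh_val[OF Y s(2)] coh_val[OF Y s(3)]] far[of Y] far[of Z] by blast

text \<open>\<open>Fg\<close> speaks of single generators only. Along a word for \<open>s\<close>, a
  line that sees the ends more than 13c apart either jumps at one letter, which happens for finitely
  many lines, or has a prefix more than 6c away from both ends. By \<open>three_points\<close> each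
  prefix serves at most one line in this way.\<close>

lemma fin_val:
  assumes s: "s \<in> carrier G"
  shows "finite {Y \<in> Ln. \<bar>val Y s - val Y \<one>\<bar> > 13 * cl Y}"
proof -
  have Sc: "S \<union> m_inv G ` S \<subseteq> carrier G" using S_sub by auto
  obtain xs where xs: "set xs \<subseteq> S \<union> m_inv G ` S" "lprod xs = s" using generate_lprod S_gen S_sub s by metis
  define g where "g i = lprod (take i xs)" for i
  have xc: "set xs \<subseteq> carrier G" using xs Sc by blast
  have gc [simp]: "g i \<in> carrier G" for i
    unfolding g_def using xc set_take_subset[of i xs] by (intro lprod_closed) blast
  have gS: "g (Suc i) = g i \<otimes> xs ! i" if "i < length xs" for i
  proof -
    have "set (take i xs) \<subseteq> carrier G" "xs ! i \<in> carrier G" using xc set_take_subset[of i xs] that by auto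
    then show ?thesis unfolding g_def using that by (simp add: take_Suc_conv_app_nth lprod_append)
  qed
  let ?n = "length xs"
  let ?B = "\<Union>i<?n. {Y \<in> Ln. \<bar>val Y (g (Suc i)) - val Y (g i)\<bar> > cl Y}"
  let ?M = "\<lambda>i Y. Y \<in> Ln \<and> \<bar>val Y (g i) - val Y \<one>\<bar> > 6 * cl Y \<and> \<bar>val Y s - val Y (g i)\<bar> > 6 * cl Y \<and>
     \<bar>val Y s - val Y \<one>\<bar> > 6 * cl Y"
  have B: "finite ?B" using fin_gen xs(1) gS by (intro finite_UN_I) (auto simp: subset_iff)
  have M: "finite {Y. ?M i Y}" for i
  proof (cases "{Y. ?M i Y} = {}")
    case False
    then obtain Y where Y: "?M i Y" by blast
    have "Z = Y" if "?M i Z" for Z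
    proof (rule ccontr)
      assume "Z \<noteq> Y"
      then show False using three_points[of Y Z \<one> "g i" s] Y that s gc[of i] by blast
    qed
    then have "{Y. ?M i Y} \<subseteq> {Y}" by blast
    then show ?thesis using finite_subset by blast
  next
    case True
    then show ?thesis by (metis finite.emptyI)
  qed
  have "{Y \<in> Ln. \<bar>val Y s - val Y \<one>\<bar> > 13 * cl Y} \<subseteq> ?B \<union> (\<Union>i\<le>?n. {Y. ?M i Y})"
  proof
    fix Y assume "Y \<in> {Y \<in> Ln. \<bar>val Y s - val Y \<one>\<bar> > 13 * cl Y}"
    then have Y: "Y \<in> Ln" "\<bar>val Y s - val Y \<one>\<bar> > 13 * cl Y" by auto
    have cY: "0 \<le> cl Y" using c_nonneg Y by simp
    show "Y \<in> ?B \<union> (\<Union>i\<le>?n. {Y. ?M i Y})"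
    proof (cases "Y \<in> ?B")
      case False
      have g0: "g 0 = \<one>" and gn: "g ?n = s" by (simp_all add: g_def xs(2))
      have "\<bar>val Y (g (Suc i)) - val Y (g i)\<bar> \<le> cl Y" if "i < ?n" for i
      proof (rule ccontr)
        assume "\<not> \<bar>val Y (g (Suc i)) - val Y (g i)\<bar> \<le> cl Y"
        then have "Y \<in> {Y \<in> Ln. \<bar>val Y (g (Suc i)) - val Y (g i)\<bar> > cl Y}" using Y(1) by (simp add: not_le)
        then show False using False that by blast
      qed
      then have "\<exists>i\<le>?n. \<bar>val Y (g i) - val Y (g 0)\<bar> > 6 * cl Y \<and> \<bar>val Y (g ?n) - val Y (g i)\<bar> > 6 * cl Y"
        using intermediate_step[of ?n "\<lambda>i. val Y (g i)" "cl Y"] Y(2) cY unfolding g0 gn by blast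
      then obtain i where "i \<le> ?n" "\<bar>val Y (g i) - val Y \<one>\<bar> > 6 * cl Y" "\<bar>val Y s - val Y (g i)\<bar> > 6 * cl Y"
        unfolding g0 gn by blast
      then have "?M i Y" "i \<le> ?n" using Y cY by linarith+
      then show ?thesis by blast
    qed blast
  qed
  then show ?thesis using B M finite_subset by (metis (no_types, lifting) finite_UN_I finite_Un finite_atMost)
qed

lemma fin_val2:
  assumes s: "s \<in> carrier G" and t: "t \<in> carrier G"
  shows "finite {Y \<in> Ln. \<bar>val Y s - val Y t\<bar> > 13 * cl Y}"
proof -
  have "{Y \<in> Ln. \<bar>val Y s - val Y t\<bar> > 13 * cl Y} \<subseteq> act t ` {Y \<in> Ln. \<bar>val Y (inv t \<otimes> s) - val Y \<one>\<bar> > 13 * cl Y}"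
  proof
    fix Y assume "Y \<in> {Y \<in> Ln. \<bar>val Y s - val Y t\<bar> > 13 * cl Y}"
    then have Y: "Y \<in> Ln" "\<bar>val Y s - val Y t\<bar> > 13 * cl Y" by auto
    define Z where "Z = act (inv t) Y"
    have Z: "Z \<in> Ln" "act t Z = Y" using Y t by (simp_all add: Z_def act_mult'[symmetric])
    then have "\<bar>val Z (inv t \<otimes> s) - val Z \<one>\<bar> > 13 * cl Z"
      using val_act[of Z t "inv t \<otimes> s" \<one>] Y s t by (simp add: cancel_inv) (simp add: Z_def act_def)
    then show "Y \<in> act t ` {Y \<in> Ln. \<bar>val Y (inv t \<otimes> s) - val Y \<one>\<bar> > 13 * cl Y}" using Z by blast
  qed
  then show ?thesis using finite_subset fin_val[of "inv t \<otimes> s"] s t by blast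
qed

text \<open>Of two elements far apart on \<open>Z\<close>, at least one is not near the projection
  of \<open>Y\<close> to \<open>Z\<close>; on \<open>Y\<close> it therefore lies within 3c of the
  projection of \<open>Z\<close>, and \<open>fin_val2\<close> applies to it. Hence 16 = 13 +
  3.\<close>

lemma fin_PJ:
  assumes Z: "Z \<in> Ln" and s: "s \<in> carrier G"
  shows "finite {Y \<in> Ln. Y \<noteq> Z \<and> \<bar>PJ Y Z - val Y s\<bar> > 16 * cl Y}"
proof -
  obtain t where t: "t \<in> carrier G" using s by blast
  obtain u where u: "u \<in> carrier G" "val Z u > val Z t + 6 * cl Z" using far_val[OF Z] by blast
  have "{Y \<in> Ln. Y \<noteq> Z \<and> \<bar>PJ Y Z - val Y s\<bar> > 16 * cl Y} \<subseteq>
     {Y \<in> Ln. \<bar>val Y t - val Y s\<bar> > 13 * cl Y} \<union> {Y \<in> Ln. \<bar>val Y u - val Y s\<bar> > 13 * cl Y}"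
  proof
    fix Y assume "Y \<in> {Y \<in> Ln. Y \<noteq> Z \<and> \<bar>PJ Y Z - val Y s\<bar> > 16 * cl Y}"
    then have Y: "Y \<in> Ln" "Y \<noteq> Z" "\<bar>PJ Y Z - val Y s\<bar> > 16 * cl Y" by auto
    then show "Y \<in> {Y \<in> Ln. \<bar>val Y t - val Y s\<bar> > 13 * cl Y} \<union> {Y \<in> Ln. \<bar>val Y u - val Y s\<bar> > 13 * cl Y}"
      using coh_val[of Y Z t] coh_val[of Y Z u] Z t u by auto
  qed
  then show ?thesis using finite_subset fin_val2 t u s by (metis (no_types, lifting) finite_Un)
qed

text \<open>A point of the line system is a consistent family of coordinates on all lines. Besides the group elements
  these have to include a point for each line, which no group element need represent.\<close>

definition pt :: "'a \<Rightarrow> 'i \<Rightarrow> 'a \<Rightarrow> int" where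
  "pt s = (\<lambda>i x. if x \<in> carrier G then f i (inv x \<otimes> s) else 0)"

definition pact :: "'a \<Rightarrow> ('i \<Rightarrow> 'a \<Rightarrow> int) \<Rightarrow> 'i \<Rightarrow> 'a \<Rightarrow> int" where
  "pact g \<xi> = (\<lambda>i x. if x \<in> carrier G then \<xi> i (inv g \<otimes> x) else 0)"

definition ob :: "'i \<times> 'a set \<Rightarrow> 'i \<Rightarrow> 'a \<Rightarrow> int" where
  "ob Y = (\<lambda>i x. if x \<notin> carrier G then 0 else if (i, x <# C i) = Y then f i (inv x \<otimes> rp Y) else pj i x (fst Y) (rp Y))"

abbreviation co :: "('i \<Rightarrow> 'a \<Rightarrow> int) \<Rightarrow> 'i \<times> 'a set \<Rightarrow> int" where
  "co \<xi> Y \<equiv> \<xi> (fst Y) (rp Y)"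

definition Pt :: "('i \<Rightarrow> 'a \<Rightarrow> int) set" where
  "Pt = {\<xi>. (\<forall>i x. x \<notin> carrier G \<longrightarrow> \<xi> i x = 0) \<and>
     (\<forall>i \<in> I. \<forall>x \<in> carrier G. \<forall>n::int. \<xi> i (x \<otimes> v i [^] n) = \<xi> i x - n * m i) \<and>
     (\<forall>Y \<in> Ln. \<forall>Z \<in> Ln. Y \<noteq> Z \<longrightarrow> \<bar>co \<xi> Y - PJ Y Z\<bar> \<le> 6 * cl Y \<or> \<bar>co \<xi> Z - PJ Z Y\<bar> \<le> 6 * cl Z) \<and>
     (\<exists>s \<in> carrier G. finite {Y \<in> Ln. \<bar>co \<xi> Y - val Y s\<bar> > 16 * cl Y})}"

definition \<delta> :: "'i \<times> 'a set \<Rightarrow> ('i \<Rightarrow> 'a \<Rightarrow> int) \<Rightarrow> ('i \<Rightarrow> 'a \<Rightarrow> int) \<Rightarrow> int" where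
  "\<delta> Y \<xi> \<eta> = co \<eta> Y - co \<xi> Y"

lemma co_pt [simp]: "Y \<in> Ln \<Longrightarrow> co (pt s) Y = val Y s"
  by (simp add: pt_def)

lemma pt_Pt [simp]: "s \<in> carrier G \<Longrightarrow> pt s \<in> Pt"
proof -
  assume s: "s \<in> carrier G"
  have "\<bar>co (pt s) Y - PJ Y Z\<bar> \<le> 6 * cl Y \<or> \<bar>co (pt s) Z - PJ Z Y\<bar> \<le> 6 * cl Z"
    if "Y \<in> Ln" "Z \<in> Ln" "Y \<noteq> Z" for Y Z
    using coh_val[OF that s] c_nonneg[of "fst Y"] c_nonneg[of "fst Z"] that by auto
  moreover have "{Y \<in> Ln. \<bar>co (pt s) Y - val Y s\<bar> > 16 * cl Y} = {}"
    using c_nonneg[OF fst_Ln] by (auto simp: not_less simp del: fst_Ln)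
  moreover have "pt s i (x \<otimes> v i [^] n) = pt s i x - n * m i" if "i \<in> I" "x \<in> carrier G" for i x and n :: int
    using f_frame_pow[OF that s] that by (simp add: pt_def)
  moreover have "pt s i x = 0" if "x \<notin> carrier G" for i x using that by (simp add: pt_def)
  moreover have "finite ({} :: ('i \<times> 'a set) set)" by simp
  ultimately show ?thesis unfolding Pt_def using s
    by (intro CollectI conjI ballI allI impI bexI[of _ s]) (presburger | metis)+
qed

lemma Pt_outside: "\<xi> \<in> Pt \<Longrightarrow> x \<notin> carrier G \<Longrightarrow> \<xi> i x = 0"
  and Pt_frame: "\<xi> \<in> Pt \<Longrightarrow> i \<in> I \<Longrightarrow> x \<in> carrier G \<Longrightarrow> \<xi> i (x \<otimes> v i [^] (n::int)) = \<xi> i x - n * m i"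
  and Pt_coh: "\<xi> \<in> Pt \<Longrightarrow> Y \<in> Ln \<Longrightarrow> Z \<in> Ln \<Longrightarrow> Y \<noteq> Z \<Longrightarrow>
     \<bar>co \<xi> Y - PJ Y Z\<bar> \<le> 6 * cl Y \<or> \<bar>co \<xi> Z - PJ Z Y\<bar> \<le> 6 * cl Z"
  and Pt_fin: "\<xi> \<in> Pt \<Longrightarrow> \<exists>s \<in> carrier G. finite {Y \<in> Ln. \<bar>co \<xi> Y - val Y s\<bar> > 16 * cl Y}"
  by (simp_all add: Pt_def)

lemma PtI:
  assumes "\<And>i x. x \<notin> carrier G \<Longrightarrow> \<xi> i x = 0"
    "\<And>i x n. i \<in> I \<Longrightarrow> x \<in> carrier G \<Longrightarrow> \<xi> i (x \<otimes> v i [^] (n::int)) = \<xi> i x - n * m i"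
    "\<And>Y Z. Y \<in> Ln \<Longrightarrow> Z \<in> Ln \<Longrightarrow> Y \<noteq> Z \<Longrightarrow> \<bar>co \<xi> Y - PJ Y Z\<bar> \<le> 6 * cl Y \<or> \<bar>co \<xi> Z - PJ Z Y\<bar> \<le> 6 * cl Z"
    "s \<in> carrier G" "finite {Y \<in> Ln. \<bar>co \<xi> Y - val Y s\<bar> > 16 * cl Y}"
  shows "\<xi> \<in> Pt"
  unfolding Pt_def mem_Collect_eq
  by (intro conjI allI impI ballI bexI[of _ s]) (rule assms; assumption)+

lemma co_pact:
  assumes "\<xi> \<in> Pt" "Y \<in> Ln" "g \<in> carrier G"
  obtains n :: int where "rp (act g Y) = g \<otimes> rp Y \<otimes> v (fst Y) [^] n" "co (pact g \<xi>) (act g Y) = co \<xi> Y - n * m (fst Y)"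
proof -
  obtain n :: int where n: "rp (act g Y) = g \<otimes> rp Y \<otimes> v (fst Y) [^] n" using rp_act[OF assms(2,3)] .
  have "inv g \<otimes> (g \<otimes> rp Y \<otimes> v (fst Y) [^] n) = rp Y \<otimes> v (fst Y) [^] n"
    using assms by (simp add: m_assoc cancel_inv)
  then show ?thesis using that[OF n] n assms by (simp add: pact_def act_def Pt_frame)
qed

lemma fst_act [simp]: "fst (act g Y) = fst Y"
  by (simp add: act_def)

lemma PJ_act:
  assumes "Y \<in> Ln" "Z \<in> Ln" "Y \<noteq> Z" "g \<in> carrier G" "rp (act g Y) = g \<otimes> rp Y \<otimes> v (fst Y) [^] (n::int)"
  shows "PJ (act g Y) (act g Z) = PJ Y Z - n * m (fst Y)"
proof -
  obtain n' :: int where n': "rp (act g Z) = g \<otimes> rp Z \<otimes> v (fst Z) [^] n'" using rp_act[OF assms(2,4)] .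
  show ?thesis unfolding fst_act assms(5) n'
    using pj_frame[OF _ _ _ _ assms(4) Ln_neq[OF assms(1-3)]] assms by simp
qed

lemma act_back: "g \<in> carrier G \<Longrightarrow> Y \<in> Ln \<Longrightarrow> act g (act (inv g) Y) = Y"
  by (simp add: act_mult'[symmetric])

lemma val_back:
  assumes "Y \<in> Ln" "g \<in> carrier G" "s \<in> carrier G" "rp (act g Y) = g \<otimes> rp Y \<otimes> v (fst Y) [^] (n::int)"
  shows "val (act g Y) (g \<otimes> s) = val Y s - n * m (fst Y)"
proof -
  have "inv (g \<otimes> rp Y) \<otimes> (g \<otimes> s) = inv (rp Y) \<otimes> s"
    using assms by (simp add: inv_mult_group m_assoc cancel_inv)
  then show ?thesis using assms by (simp add: f_frame_pow)
qed

lemma pact_Pt [simp]: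
  assumes g: "g \<in> carrier G" and \<xi>: "\<xi> \<in> Pt"
  shows "pact g \<xi> \<in> Pt"
proof -
  obtain s where s: "s \<in> carrier G" "finite {Y \<in> Ln. \<bar>co \<xi> Y - val Y s\<bar> > 16 * cl Y}" using Pt_fin[OF \<xi>] by blast
  show ?thesis
  proof (rule PtI[of _ "g \<otimes> s"])
    show "pact g \<xi> i (x \<otimes> v i [^] n) = pact g \<xi> i x - n * m i" if "i \<in> I" "x \<in> carrier G" for i x and n :: int
      using Pt_frame[OF \<xi> that(1), of "inv g \<otimes> x" n] that g by (simp add: pact_def m_assoc)
    show "\<bar>co (pact g \<xi>) Y - PJ Y Z\<bar> \<le> 6 * cl Y \<or> \<bar>co (pact g \<xi>) Z - PJ Z Y\<bar> \<le> 6 * cl Z"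
      if YZ: "Y \<in> Ln" "Z \<in> Ln" "Y \<noteq> Z" for Y Z
    proof -
      define Y' Z' where "Y' = act (inv g) Y" and "Z' = act (inv g) Z"
      have Y': "Y' \<in> Ln" "Z' \<in> Ln" "Y = act g Y'" "Z = act g Z'" using YZ g by (simp_all add: Y'_def Z'_def act_back)
      then have ne: "Y' \<noteq> Z'" using YZ by auto
      obtain n :: int where n: "rp (act g Y') = g \<otimes> rp Y' \<otimes> v (fst Y') [^] n"
        "co (pact g \<xi>) (act g Y') = co \<xi> Y' - n * m (fst Y')" using co_pact[OF \<xi> Y'(1) g] .
      obtain n' :: int where n': "rp (act g Z') = g \<otimes> rp Z' \<otimes> v (fst Z') [^] n'"
        "co (pact g \<xi>) (act g Z') = co \<xi> Z' - n' * m (fst Z')" using co_pact[OF \<xi> Y'(2) g] .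
      show ?thesis
        using Pt_coh[OF \<xi> Y'(1,2) ne] PJ_act[OF Y'(1,2) ne g n(1)] PJ_act[OF Y'(2,1) ne[symmetric] g n'(1)] n(2) n'(2)
        unfolding Y'(3,4) by simp
    qed
    have "{Y \<in> Ln. \<bar>co (pact g \<xi>) Y - val Y (g \<otimes> s)\<bar> > 16 * cl Y} \<subseteq> act g ` {Y \<in> Ln. \<bar>co \<xi> Y - val Y s\<bar> > 16 * cl Y}"
    proof
      fix Y assume "Y \<in> {Y \<in> Ln. \<bar>co (pact g \<xi>) Y - val Y (g \<otimes> s)\<bar> > 16 * cl Y}"
      then have Y: "Y \<in> Ln" "\<bar>co (pact g \<xi>) Y - val Y (g \<otimes> s)\<bar> > 16 * cl Y" by auto
      define Y' where "Y' = act (inv g) Y"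
      have Y': "Y' \<in> Ln" "Y = act g Y'" using Y g by (simp_all add: Y'_def act_back)
      obtain n :: int where n: "rp (act g Y') = g \<otimes> rp Y' \<otimes> v (fst Y') [^] n"
        "co (pact g \<xi>) (act g Y') = co \<xi> Y' - n * m (fst Y')" using co_pact[OF \<xi> Y'(1) g] .
      have "\<bar>co \<xi> Y' - val Y' s\<bar> > 16 * cl Y'"
        using Y(2) n(2) val_back[OF Y'(1) g s(1) n(1)] unfolding Y'(2) by simp
      then show "Y \<in> act g ` {Y \<in> Ln. \<bar>co \<xi> Y - val Y s\<bar> > 16 * cl Y}" using Y' by blast
    qed
    then show "finite {Y \<in> Ln. \<bar>co (pact g \<xi>) Y - val Y (g \<otimes> s)\<bar> > 16 * cl Y}" using s(2) finite_surj by blast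
  qed (use g s in \<open>simp_all add: pact_def\<close>)
qed

lemma co_ob: "Y \<in> Ln \<Longrightarrow> Z \<in> Ln \<Longrightarrow> Y \<noteq> Z \<Longrightarrow> co (ob Z) Y = PJ Y Z"
  using Ln_rp[of Y] by (simp add: ob_def)

lemma ob_frame:
  assumes "Z \<in> Ln" "i \<in> I" "x \<in> carrier G"
  shows "ob Z i (x \<otimes> v i [^] (n::int)) = ob Z i x - n * m i"
proof (cases "(i, x <# C i) = Z")
  case True
  then show ?thesis using assms by (simp add: ob_def lcoset_pow f_frame_pow)
next
  case False
  have "\<not> (i = fst Z \<and> inv x \<otimes> rp Z \<in> C i)"
    using False assms Ln_rp[of Z] lcoset_eq[of i x "rp Z"] by auto
  then show ?thesis using pj_frame[of i "fst Z" x "rp Z" \<one> n 0] False assms by (simp add: ob_def lcoset_pow)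
qed

text \<open>The point on \<open>Z\<close> whose position along \<open>Z\<close> is that of \<xi>,
  and which all other lines see like \<open>Z\<close>. It witnesses \<open>ob_at\<close>.\<close>

lemma ob_upd_Pt:
  assumes "Z \<in> Ln" "\<xi> \<in> Pt"
  shows "(\<lambda>i x. if x \<in> carrier G \<and> (i, x <# C i) = Z then \<xi> i x else ob Z i x) \<in> Pt" (is "?\<eta> \<in> Pt")
proof -
  have Y: "co ?\<eta> Y = (if Y = Z then co \<xi> Z else PJ Y Z)" if "Y \<in> Ln" for Y
    using that assms co_ob[of Y Z] Ln_rp[of Y] by simp
  obtain s :: 'a where s: "s \<in> carrier G" by blast
  show ?thesis
  proof (rule PtI[OF _ _ _ s])
    show "?\<eta> i x = 0" if "x \<notin> carrier G" for i x using that by (simp add: ob_def)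
    show "?\<eta> i (x \<otimes> v i [^] n) = ?\<eta> i x - n * m i" if "i \<in> I" "x \<in> carrier G" for i x and n :: int
      using that Pt_frame[OF assms(2)] ob_frame[OF assms(1)] by (simp add: lcoset_pow)
    show "\<bar>co ?\<eta> Y - PJ Y Y'\<bar> \<le> 6 * cl Y \<or> \<bar>co ?\<eta> Y' - PJ Y' Y\<bar> \<le> 6 * cl Y'"
      if YY: "Y \<in> Ln" "Y' \<in> Ln" "Y \<noteq> Y'" for Y Y'
    proof (cases "Z \<in> {Y, Y'}")
      case True
      then show ?thesis using YY c_nonneg[of "fst Y"] c_nonneg[of "fst Y'"] unfolding Y[OF YY(1)] Y[OF YY(2)] by auto
    next
      case False
      then show ?thesis using coh_PJ[of Y Z Y'] YY assms unfolding Y[OF YY(1)] Y[OF YY(2)] by auto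
    qed
    have "{Y \<in> Ln. \<bar>co ?\<eta> Y - val Y s\<bar> > 16 * cl Y} \<subseteq> insert Z {Y \<in> Ln. Y \<noteq> Z \<and> \<bar>PJ Y Z - val Y s\<bar> > 16 * cl Y}"
      using Y by (intro subsetI) (force simp: Y)
    then show "finite {Y \<in> Ln. \<bar>co ?\<eta> Y - val Y s\<bar> > 16 * cl Y}"
      using fin_PJ[OF assms(1) s] finite_subset by (metis (no_types, lifting) finite_insert)
  qed
qed

lemma ob_Pt' [simp]:
  assumes Z: "Z \<in> Ln" shows "ob Z \<in> Pt"
proof -
  have 1: "pt (rp Z) \<in> Pt" using Z by simp
  have 2: "(\<lambda>i x. if x \<in> carrier G \<and> (i, x <# C i) = Z then pt (rp Z) i x else ob Z i x) = ob Z"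
    by (intro ext) (auto simp: ob_def pt_def)
  show ?thesis using ob_upd_Pt[OF Z 1] unfolding 2 .
qed

text \<open>45 = 16 + 16 + 13: outside finite sets each of two points agrees with a group element up
  to 16c (\<open>Pt_fin\<close>), and these two elements agree with each other up to 13c
  (\<open>fin_val2\<close>).\<close>

sublocale lsys: line_system G Ln act Pt pact \<delta> ob "\<lambda>Y. 45 * cl Y"
proof
  show "pact \<one> \<xi> = \<xi>" if "\<xi> \<in> Pt" for \<xi>
    using Pt_outside[OF that] by (intro ext) (simp add: pact_def)
  show "pact (g \<otimes> h) \<xi> = pact g (pact h \<xi>)" if "g \<in> carrier G" "h \<in> carrier G" for g h \<xi>
    using that by (intro ext) (simp add: pact_def inv_mult_group m_assoc)
  show "\<delta> (act g Y) (pact g \<xi>) (pact g \<eta>) = \<delta> Y \<xi> \<eta>"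
    if gY: "g \<in> carrier G" "Y \<in> Ln" "\<xi> \<in> Pt" "\<eta> \<in> Pt" for g Y \<xi> \<eta>
  proof -
    obtain n :: int where n: "rp (act g Y) = g \<otimes> rp Y \<otimes> v (fst Y) [^] n" using rp_act[OF gY(2,1)] .
    have "inv g \<otimes> (g \<otimes> rp Y \<otimes> v (fst Y) [^] n) = rp Y \<otimes> v (fst Y) [^] n"
      using that by (simp add: m_assoc cancel_inv)
    then show ?thesis using n that by (simp add: \<delta>_def pact_def Pt_frame)
  qed
  show "\<delta> Z (ob (act g Y)) (pact g (ob Y)) = 0"
    if YZ: "g \<in> carrier G" "Y \<in> Ln" "Z \<in> Ln" "Z \<noteq> act g Y" for g Y Z
  proof -
    define Z' where "Z' = act (inv g) Z"
    have Z': "Z' \<in> Ln" "Z = act g Z'" using YZ by (simp_all add: Z'_def act_back)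
    then have ne: "Z' \<noteq> Y" using YZ by auto
    obtain n :: int where n: "rp (act g Z') = g \<otimes> rp Z' \<otimes> v (fst Z') [^] n"
      "co (pact g (ob Y)) (act g Z') = co (ob Y) Z' - n * m (fst Z')" using co_pact[OF ob_Pt'[OF YZ(2)] Z'(1) YZ(1)] .
    show ?thesis using n PJ_act[OF Z'(1) YZ(2) ne YZ(1) n(1)] co_ob[OF Z'(1) YZ(2) ne] co_ob[of Z "act g Y"] YZ
      unfolding Z'(2) by (simp add: \<delta>_def)
  qed
  show "\<exists>b \<in> Pt. \<delta> Y \<xi> b = 0 \<and> (\<forall>Z \<in> Ln. Z \<noteq> Y \<longrightarrow> \<delta> Z b (ob Y) = 0)" if "Y \<in> Ln" "\<xi> \<in> Pt" for Y \<xi>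
  proof (intro bexI[OF _ ob_upd_Pt[OF that]] conjI ballI impI)
    show "\<delta> Y \<xi> (\<lambda>i x. if x \<in> carrier G \<and> (i, x <# C i) = Y then \<xi> i x else ob Y i x) = 0"
      using Ln_rp[OF that(1)] that by (simp add: \<delta>_def)
    fix Z assume "Z \<in> Ln" "Z \<noteq> Y"
    then show "\<delta> Z (\<lambda>i x. if x \<in> carrier G \<and> (i, x <# C i) = Y then \<xi> i x else ob Y i x) (ob Y) = 0"
      using Ln_rp[of Z] by (simp add: \<delta>_def)
  qed
  show "\<bar>\<delta> Y \<xi> (ob Z)\<bar> \<le> 45 * cl Y \<or> \<bar>\<delta> Z \<xi> (ob Y)\<bar> \<le> 45 * cl Z"
    if "Y \<in> Ln" "Z \<in> Ln" "Y \<noteq> Z" "\<xi> \<in> Pt" for Y Z \<xi>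
    using Pt_coh[OF that(4,1,2,3)] co_ob[OF that(1-3)] co_ob[OF that(2,1) that(3)[symmetric]]
      c_nonneg[of "fst Y"] c_nonneg[of "fst Z"] that by (auto simp: \<delta>_def)
  show "finite {Y \<in> Ln. \<bar>\<delta> Y \<xi> \<eta>\<bar> > 45 * cl Y}" if \<xi>: "\<xi> \<in> Pt" "\<eta> \<in> Pt" for \<xi> \<eta>
  proof -
    obtain s where s: "s \<in> carrier G" "finite {Y \<in> Ln. \<bar>co \<xi> Y - val Y s\<bar> > 16 * cl Y}" using Pt_fin[OF \<xi>(1)] by blast
    obtain t where t: "t \<in> carrier G" "finite {Y \<in> Ln. \<bar>co \<eta> Y - val Y t\<bar> > 16 * cl Y}" using Pt_fin[OF \<xi>(2)] by blast
    have "{Y \<in> Ln. \<bar>\<delta> Y \<xi> \<eta>\<bar> > 45 * cl Y} \<subseteq> {Y \<in> Ln. \<bar>co \<xi> Y - val Y s\<bar> > 16 * cl Y} \<union>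
      {Y \<in> Ln. \<bar>co \<eta> Y - val Y t\<bar> > 16 * cl Y} \<union> {Y \<in> Ln. \<bar>val Y s - val Y t\<bar> > 13 * cl Y}"
      by (intro subsetI) (auto simp: \<delta>_def)
    then show ?thesis using s t fin_val2[OF s(1) t(1)] finite_subset by (metis (no_types, lifting) finite_Un)
  qed
qed (simp_all add: act_mult' \<delta>_def c_nonneg)

end

section \<open>Axes of chains of lines\<close>

context line_system
begin

text \<open>A quasi-geodesic made of lines: it turns by at least \<open>K\<close> at every pivot,
  and an edge between consecutive pivots is at most \<open>D\<close> long as seen by any third line.
  Such a chain is going to be a line of a new system.\<close>

definition chain :: "int \<Rightarrow> int \<Rightarrow> (int \<Rightarrow> 'l) \<Rightarrow> bool" where
  "chain K D P \<longleftrightarrow> (\<forall>i. P i \<in> Ln \<and> P i \<noteq> P (i + 1) \<and> d (P i) (ob (P (i - 1))) (ob (P (i + 1))) \<ge> K \<and>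
     (\<forall>Z \<in> Ln. Z \<noteq> P i \<longrightarrow> Z \<noteq> P (i + 1) \<longrightarrow> d Z (ob (P i)) (ob (P (i + 1))) \<le> D))"

definition right :: "(int \<Rightarrow> 'l) \<Rightarrow> int \<Rightarrow> 'p \<Rightarrow> int \<Rightarrow> bool" where
  "right P E x i \<longleftrightarrow> d (P i) x (ob (P (i - 1))) > E"

text \<open>The coordinate along the chain is the index of the last pivot passed. It is well defined
  because \<open>right\<close> holds exactly up to some index (\<open>rt_iff\<close>).\<close>

definition pos :: "(int \<Rightarrow> 'l) \<Rightarrow> int \<Rightarrow> 'p \<Rightarrow> int" where
  "pos P E x = (THE i. right P E x i \<and> \<not> right P E x (i + 1))"

text \<open>Replaces equality of lines: two chains without three common consecutive pivots, in
  either direction, have bounded projections to each other (\<open>ps_window\<close>).\<close>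

definition share :: "(int \<Rightarrow> 'l) \<Rightarrow> (int \<Rightarrow> 'l) \<Rightarrow> bool" where
  "share P Q \<longleftrightarrow> (\<exists>a b. P a = Q b \<and> P (a + 1) = Q (b + 1) \<and> P (a + 2) = Q (b + 2) \<or>
     P a = Q b \<and> P (a + 1) = Q (b - 1) \<and> P (a + 2) = Q (b - 2))"

lemma chain_reverse: "chain K D P \<Longrightarrow> chain K D (\<lambda>i. P (- i))"
  unfolding chain_def
proof (intro allI conjI ballI impI)
  fix i assume a: "\<forall>i. P i \<in> Ln \<and> P i \<noteq> P (i + 1) \<and> K \<le> d (P i) (ob (P (i - 1))) (ob (P (i + 1))) \<and>
    (\<forall>Z \<in> Ln. Z \<noteq> P i \<longrightarrow> Z \<noteq> P (i + 1) \<longrightarrow> d Z (ob (P i)) (ob (P (i + 1))) \<le> D)"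
  show "P (- i) \<in> Ln" using a by blast
  have "P (- i - 1) \<noteq> P (- i)" using conjunct1[OF conjunct2[OF a[rule_format, of "- i - 1"]]] by simp
  then show "P (- i) \<noteq> P (- (i + 1))" by (simp add: eq_commute[of "P (- i)"])
  have "- (i - 1) = - i + 1" "- (i + 1) = - i - 1" by simp_all
  then show "K \<le> d (P (- i)) (ob (P (- (i - 1)))) (ob (P (- (i + 1))))"
    using a[rule_format, of "- i"] d_sym[of "P (- i)" "ob (P (- i - 1))" "ob (P (- i + 1))"] by simp
  fix Z assume "Z \<in> Ln" "Z \<noteq> P (- i)" "Z \<noteq> P (- (i + 1))"
  then show "d Z (ob (P (- i))) (ob (P (- (i + 1)))) \<le> D"
    using a[rule_format, of "- i - 1"] by (simp add: d_sym[of Z "ob (P (- i))"])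
qed

lemma chain_act: 
  assumes "chain K D P" "g \<in> carrier G" shows "chain K D (\<lambda>i. act g (P i))"
  unfolding chain_def
proof (intro allI conjI ballI impI)
  fix i
  have P: "P i \<in> Ln" "P (i - 1) \<in> Ln" "P (i + 1) \<in> Ln" "P i \<noteq> P (i + 1)" "P (i - 1) \<noteq> P i"
    "K \<le> d (P i) (ob (P (i - 1))) (ob (P (i + 1)))"
    "\<And>Z. Z \<in> Ln \<Longrightarrow> Z \<noteq> P i \<Longrightarrow> Z \<noteq> P (i + 1) \<Longrightarrow> d Z (ob (P i)) (ob (P (i + 1))) \<le> D"
    using assms(1) unfolding chain_def by (auto dest: spec[of _ "i - 1"])
  have sh: "d Z (ob (act g A)) (ob (act g B)) = d (act (inv g) Z) (ob A) (ob B)"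
    if "Z \<in> Ln" "A \<in> Ln" "B \<in> Ln" "Z \<noteq> act g A" "Z \<noteq> act g B" for Z A B
    using that assms d_ob_act[of g A Z "ob (act g B)"] d_ob_act'[of g B Z "pact g (ob A)"]
      d_shift2[of g Z "ob A" "ob B"] by auto
  show "act g (P i) \<in> Ln" "act g (P i) \<noteq> act g (P (i + 1))" using P assms(2) act_eq_iff by auto
  show "K \<le> d (act g (P i)) (ob (act g (P (i - 1)))) (ob (act g (P (i + 1))))"
    using P assms(2) act_eq_iff sh[of "act g (P i)" "P (i - 1)" "P (i + 1)"] by simp
  fix Z assume Z: "Z \<in> Ln" "Z \<noteq> act g (P i)" "Z \<noteq> act g (P (i + 1))"
  then have "act (inv g) Z \<noteq> P i" "act (inv g) Z \<noteq> P (i + 1)"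
    using assms(2) act_inv'[of g Z] by metis+
  then show "d Z (ob (act g (P i))) (ob (act g (P (i + 1)))) \<le> D"
    using sh[of Z "P i" "P (i + 1)"] P(1,3) Z P(7)[of "act (inv g) Z"] assms(2) by simp
qed

lemma right_act:
  assumes "\<And>i. P i \<in> Ln" "\<And>i. P i \<noteq> P (i + 1)" "g \<in> carrier G" "x \<in> Pt"
  shows "right (\<lambda>i. act g (P i)) E (pact g x) i = right P E x i"
proof -
  have "act g (P (i - 1)) \<noteq> act g (P i)" using act_eq_iff assms(1,3) assms(2)[of "i - 1"] by simp
  then show ?thesis using d_ob_act'[of g "P (i - 1)" "act g (P i)" "pact g x"] d_act[of g "P i" x "ob (P (i - 1))"] assms
    by (simp add: right_def)
qed

lemma pos_act:
  assumes "\<And>i. P i \<in> Ln" "\<And>i. P i \<noteq> P (i + 1)" "g \<in> carrier G" "x \<in> Pt"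
  shows "pos (\<lambda>i. act g (P i)) E (pact g x) = pos P E x"
  unfolding pos_def using right_act[where P = P and E = E, OF assms] by simp

end

locale uniform_lines = line_system G Ln act Pt pact \<delta> ob e
  for G (structure) and Ln :: "'l set" and act :: "'a \<Rightarrow> 'l \<Rightarrow> 'l"
    and Pt :: "'p set" and pact and \<delta> and ob and e +
  fixes E K D :: int
  assumes e_E: "Y \<in> Ln \<Longrightarrow> e Y = E" and E_ge: "1 \<le> E" and D_ge: "E \<le> D" and K_ge: "K \<ge> 20 * D"
begin

abbreviation "chn \<equiv> chain K D"
abbreviation "rt P \<equiv> right P E"
abbreviation "ps P \<equiv> pos P E"

lemma cohE: "\<lbrakk>Y \<in> Ln; Z \<in> Ln; Y \<noteq> Z; x \<in> Pt\<rbrakk> \<Longrightarrow> d Y x (ob Z) \<le> E \<or> d Z x (ob Y) \<le> E"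
  using coh[of Y Z x] by (simp add: e_E)

context
  fixes P assumes P: "chn P"
begin

lemma chn_Ln [simp]: "P i \<in> Ln"
  and chn_ne: "P i \<noteq> P (i + 1)"
  and chn_ne': "P (i - 1) \<noteq> P i"
  and chn_K: "d (P i) (ob (P (i - 1))) (ob (P (i + 1))) \<ge> K"
  and chn_D: "Z \<in> Ln \<Longrightarrow> Z \<noteq> P i \<Longrightarrow> Z \<noteq> P (i + 1) \<Longrightarrow> d Z (ob (P i)) (ob (P (i + 1))) \<le> D"
proof -
  note * = P[unfolded chain_def, rule_format, of i]
  show "P i \<in> Ln" "P i \<noteq> P (i + 1)" "d (P i) (ob (P (i - 1))) (ob (P (i + 1))) \<ge> K" using * by auto
  show "Z \<in> Ln \<Longrightarrow> Z \<noteq> P i \<Longrightarrow> Z \<noteq> P (i + 1) \<Longrightarrow> d Z (ob (P i)) (ob (P (i + 1))) \<le> D" using * by blast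
  show "P (i - 1) \<noteq> P i" using P[unfolded chain_def, rule_format, of "i - 1"] by simp
qed

lemma chn_far:
  assumes "d (P i) x (ob (P (i - 1))) \<le> E"
  shows "d (P i) x (ob (P (i + 1))) \<ge> K - E"
  using assms chn_K[of i] d_tri[of "P i" "ob (P (i - 1))" "ob (P (i + 1))" x]
    d_sym[of "P i" x "ob (P (i - 1))"] by linarith

lemma chn_far':
  assumes "d (P i) x (ob (P (i + 1))) \<le> E"
  shows "d (P i) x (ob (P (i - 1))) \<ge> K - E"
  using assms chn_K[of i] d_tri[of "P i" "ob (P (i - 1))" "ob (P (i + 1))" x]
    d_sym[of "P i" x "ob (P (i - 1))"] by linarith

text \<open>From local to global: if \<open>P (i + 1)\<close> sees a later pivot near
  \<open>P (i + 2)\<close>, it sees it far from \<open>P i\<close>, and Behrstock's inequality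
  passes the statement on to \<open>P i\<close>.\<close>

lemma chn_forward: "P i \<noteq> P (i + int (Suc n)) \<and> d (P i) (ob (P (i + int (Suc n)))) (ob (P (i + 1))) \<le> E"
proof (induction n arbitrary: i)
  case 0
  then show ?case using chn_ne[of i] E_ge by simp
next
  case (Suc n)
  let ?j = "i + int (Suc (Suc n))"
  have j: "i + 1 + int (Suc n) = ?j" by simp
  have "P (i + 1) \<noteq> P ?j" "d (P (i + 1)) (ob (P ?j)) (ob (P (i + 2))) \<le> E"
    using Suc.IH[of "i + 1"] unfolding j by (simp_all add: add.assoc)
  then have "d (P (i + 1)) (ob (P ?j)) (ob (P i)) \<ge> K - E"
    using chn_far'[of "i + 1" "ob (P ?j)"] by (simp add: add.assoc)
  then have far: "d (P (i + 1)) (ob (P ?j)) (ob (P i)) > E" using K_ge D_ge E_ge by linarith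
  then have "P i \<noteq> P ?j" using E_ge by auto
  moreover have "d (P i) (ob (P ?j)) (ob (P (i + 1))) \<le> E"
    using cohE[of "P i" "P (i + 1)" "ob (P ?j)"] chn_ne[of i] far by auto
  ultimately show ?case by blast
qed

lemma rt_pred: "x \<in> Pt \<Longrightarrow> rt P x i \<Longrightarrow> d (P (i - 1)) x (ob (P i)) \<le> E"
  using cohE[of "P i" "P (i - 1)" x] chn_ne'[of i] by (auto simp: right_def)

lemma rt_down: "x \<in> Pt \<Longrightarrow> rt P x i \<Longrightarrow> rt P x (i - 1)"
  using rt_pred[of x i] chn_far'[of "i - 1" x] K_ge D_ge E_ge by (simp add: right_def)

lemma rt_down_le: "x \<in> Pt \<Longrightarrow> rt P x i \<Longrightarrow> j \<le> i \<Longrightarrow> rt P x j"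
proof -
  assume x: "x \<in> Pt" "rt P x i"
  have "rt P x (i - int n)" for n
  proof (induction n)
    case (Suc n)
    then show ?case using rt_down[OF x(1), of "i - int n"] by (simp add: algebra_simps)
  qed (use x in simp)
  from this[of "nat (i - j)"] show "j \<le> i \<Longrightarrow> rt P x j" by simp
qed

end

lemma chn_lt: "chn P \<Longrightarrow> i < j \<Longrightarrow> P i \<noteq> P j \<and> d (P i) (ob (P j)) (ob (P (i + 1))) \<le> E"
proof -
  assume "chn P" "i < j"
  moreover have "i + int (Suc (nat (j - i - 1))) = j" using \<open>i < j\<close> by simp
  ultimately show ?thesis using chn_forward[of P i "nat (j - i - 1)"] by metis
qed

lemma chn_gt: "chn P \<Longrightarrow> j < i \<Longrightarrow> P i \<noteq> P j \<and> d (P i) (ob (P j)) (ob (P (i - 1))) \<le> E"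
  using chn_lt[OF chain_reverse, of P "- i" "- j"] by simp

lemma chn_inj: "chn P \<Longrightarrow> P i = P j \<longleftrightarrow> i = j"
  using chn_lt[of P i j] chn_lt[of P j i] by (metis linorder_neqE)

lemma chn_infinite: "chn P \<Longrightarrow> infinite (P ` {a..})" "chn P \<Longrightarrow> infinite (P ` {..a})"
  using finite_imageD[of P] chn_inj[of P] infinite_Ici[of a] infinite_Iic[of a] by (auto simp: inj_on_def)

context
  fixes P assumes P: "chn P"
begin

lemma fin_far: "x \<in> Pt \<Longrightarrow> y \<in> Pt \<Longrightarrow> finite {Y \<in> Ln. d Y x y > E}"
  by (rule finite_subset[OF _ fin[of x y]]) (auto simp: e_E)

lemma rt_ex: assumes x: "x \<in> Pt" shows "\<exists>i. rt P x i"
proof (rule ccontr)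
  assume "\<not> ?thesis"
  then have n: "d (P i) x (ob (P (i - 1))) \<le> E" for i by (auto simp: right_def not_less)
  have "P ` {..- 1} \<subseteq> {Y \<in> Ln. d Y x (ob (P 0)) > E}"
  proof (intro image_subsetI CollectI conjI)
    fix i :: int assume "i \<in> {..- 1}"
    then have "d (P i) (ob (P 0)) (ob (P (i + 1))) \<le> E" using chn_lt[OF P, of i 0] by simp
    then show "d (P i) x (ob (P 0)) > E"
      using chn_far[OF P n[of i]] d_tri[of "P i" x "ob (P (i + 1))" "ob (P 0)"] K_ge D_ge E_ge by linarith
  qed (use P in simp)
  then show False using fin_far[of x "ob (P 0)"] x chn_infinite(2)[OF P] finite_subset P by (metis chn_Ln ob_Pt)
qed

lemma rt_nex: assumes x: "x \<in> Pt" shows "\<exists>i. \<not> rt P x i"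
proof (rule ccontr)
  assume "\<not> ?thesis"
  then have n: "d (P i) x (ob (P (i + 1))) \<le> E" for i
    using rt_pred[OF P x, of "i + 1"] by simp
  have "P ` {1..} \<subseteq> {Y \<in> Ln. d Y x (ob (P 0)) > E}"
  proof (intro image_subsetI CollectI conjI)
    fix i :: int assume "i \<in> {1..}"
    then have "d (P i) (ob (P 0)) (ob (P (i - 1))) \<le> E" using chn_gt[OF P, of 0 i] by simp
    then show "d (P i) x (ob (P 0)) > E"
      using chn_far'[OF P n[of i]] d_tri[of "P i" x "ob (P (i - 1))" "ob (P 0)"] K_ge D_ge E_ge by linarith
  qed (use P in simp)
  then show False using fin_far[of x "ob (P 0)"] x chn_infinite(1)[OF P] finite_subset P by (metis chn_Ln ob_Pt)
qed

lemma ps_ex: assumes x: "x \<in> Pt" shows "\<exists>i. rt P x i \<and> \<not> rt P x (i + 1)"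
proof -
  obtain a b where ab: "rt P x a" "\<not> rt P x b" using rt_ex[OF x] rt_nex[OF x] by blast
  then have lt: "a < b" using rt_down_le[OF P x] by (meson not_le)
  define n where "n = (LEAST n. \<not> rt P x (a + int n))"
  have "\<not> rt P x (a + int (nat (b - a)))" using ab lt by simp
  then have n: "\<not> rt P x (a + int n)" unfolding n_def by (rule LeastI)
  then obtain m where m: "n = Suc m" using ab by (cases n) auto
  have "rt P x (a + int m)" using not_less_Least[of m "\<lambda>n. \<not> rt P x (a + int n)"] m by (simp add: n_def)
  then show ?thesis using n m by (intro exI[of _ "a + int m"]) (simp add: algebra_simps)
qed

lemma rt_iff: assumes x: "x \<in> Pt" shows "rt P x i \<longleftrightarrow> i \<le> ps P x"
proof -
  obtain i0 where i0: "rt P x i0" "\<not> rt P x (i0 + 1)" using ps_ex[OF x] by blast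
  have iff: "rt P x i \<longleftrightarrow> i \<le> i0" for i using i0 rt_down_le[OF P x] by (metis not_le zless_imp_add1_zle)
  have "ps P x = i0" unfolding pos_def iff by (rule the_equality) auto
  then show ?thesis using iff by simp
qed

lemma ps_left: "x \<in> Pt \<Longrightarrow> i < ps P x \<Longrightarrow> d (P i) x (ob (P (i + 1))) \<le> E"
  using rt_pred[OF P, of x "i + 1"] rt_iff[of x "i + 1"] by simp

lemma ps_right: "x \<in> Pt \<Longrightarrow> ps P x < i \<Longrightarrow> d (P i) x (ob (P (i - 1))) \<le> E"
  using rt_iff[of x i] by (simp add: right_def)

lemma ps_ob: "ps P (ob (P j)) \<in> {j - 1, j}"
proof -
  have "rt P (ob (P j)) (j - 1)"
    using chn_lt[OF P, of "j - 1" j] chn_far'[OF P, of "j - 1" "ob (P j)"] K_ge D_ge E_ge by (simp add: right_def)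
  moreover have "\<not> rt P (ob (P j)) (j + 1)" using chn_gt[OF P, of j "j + 1"] by (simp add: right_def)
  ultimately show ?thesis using rt_iff[of "ob (P j)"] P by auto
qed

lemma ps_between:
  assumes x: "x \<in> Pt" "y \<in> Pt" and i: "ps P x < i" "i < ps P y"
  shows "d (P i) x y \<ge> K - 2 * E"
  using ps_right[OF x(1) i(1)] ps_left[OF x(2) i(2)] chn_K[OF P, of i]
    d_tri[of "P i" "ob (P (i - 1))" "ob (P (i + 1))" x] d_tri[of "P i" x "ob (P (i + 1))" y]
    d_sym[of "P i" x "ob (P (i - 1))"] by linarith

lemma ps_lipschitz:
  assumes x: "x \<in> Pt" "y \<in> Pt" and near: "\<And>Y. Y \<in> Ln \<Longrightarrow> 3 * d Y x y \<le> K"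
  shows "\<bar>ps P x - ps P y\<bar> \<le> 1"
proof (rule ccontr)
  assume "\<not> ?thesis"
  then consider "ps P x < ps P x + 1 \<and> ps P x + 1 < ps P y" | "ps P y < ps P y + 1 \<and> ps P y + 1 < ps P x" by linarith
  then show False
    using ps_between[OF x, of "ps P x + 1"] ps_between[OF x(2,1), of "ps P y + 1"] near[of "P (ps P x + 1)"]
      near[of "P (ps P y + 1)"] K_ge D_ge E_ge chn_Ln[OF P] d_sym[of "P (ps P y + 1)" x y] by (smt (verit))
qed

text \<open>A pivot strictly between the positions of \<open>x\<close> and \<open>Z\<close> sees the
  two almost \<open>K\<close> apart, so \<open>Z\<close> sees \<open>x\<close> within E of that
  pivot; one more edge, of length at most \<open>D\<close> on \<open>Z\<close>, leads to the pivot
  in the statement.\<close>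

lemma ps_line:
  assumes x: "x \<in> Pt" and Z: "Z \<in> Ln" "\<And>i. Z \<noteq> P i"
  shows "\<bar>ps P x - ps P (ob Z)\<bar> \<le> 1 \<or> d Z x (ob (P (ps P (ob Z)))) \<le> D + E"
proof -
  define p where "p = ps P (ob Z)"
  have step: "d Z x (ob (P i)) \<le> E" if "ps P x < i \<and> i < p \<or> p < i \<and> i < ps P x" for i
  proof -
    have "d (P i) x (ob Z) \<ge> K - 2 * E"
      using that ps_between[OF x, of "ob Z" i] ps_between[of "ob Z" x i] x Z d_sym[of "P i" x] by (auto simp: p_def)
    then show ?thesis using cohE[of "P i" Z x] Z x P K_ge D_ge E_ge by fastforce
  qed
  consider "\<bar>ps P x - p\<bar> \<le> 1" | "ps P x < p - 1" | "p + 1 < ps P x" by linarith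
  then show ?thesis
  proof cases
    case 2
    have "d Z x (ob (P (p - 1))) \<le> E" using 2 by (intro step) simp
    moreover have "d Z (ob (P (p - 1))) (ob (P p)) \<le> D" using chn_D[OF P Z(1), of "p - 1"] Z(2) by simp
    ultimately show ?thesis using d_le[of Z x "ob (P (p - 1))" E "ob (P p)" D] by (simp add: p_def add.commute)
  next
    case 3
    have "d Z x (ob (P (p + 1))) \<le> E" using 3 by (intro step) simp
    moreover have "d Z (ob (P p)) (ob (P (p + 1))) \<le> D" using chn_D[OF P Z(1), of p] Z(2) by simp
    ultimately show ?thesis using d_le''[of Z x "ob (P (p + 1))" E "ob (P p)" D] by (simp add: p_def add.commute)
  qed (simp add: p_def)
qed

lemma ps_shift:
  assumes "x \<in> Pt"
  shows "ps (\<lambda>i. P (i + k)) x = ps P x - k"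
proof -
  have "right (\<lambda>i. P (i + k)) E x i = right P E x (i + k)" for i by (simp add: right_def algebra_simps)
  then have "right (\<lambda>i. P (i + k)) E x i \<longleftrightarrow> i \<le> ps P x - k" for i using rt_iff[OF assms] by auto
  then show ?thesis unfolding pos_def[of "\<lambda>i. P (i + k)"] by (intro the_equality) auto
qed

end

text \<open>A longer window contains three consecutive pivots of \<open>P\<close>, each of which
  sees two lines of \<open>Q\<close> almost \<open>K\<close> apart. Such a pivot belongs to
  \<open>Q\<close>, because a line outside \<open>Q\<close> sees all of \<open>Q\<close> within 4D.
  Two consecutive ones are neighbours in \<open>Q\<close> too, as otherwise a line of
  \<open>Q\<close> between them would see an edge of \<open>P\<close> longer than
  \<open>D\<close>.\<close>

lemma ps_window:
  assumes P: "chn P" and Q: "chn Q" and ns: "\<not> share P Q"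
  shows "ps P (ob (Q n)) - ps P (ob (Q m)) \<le> 3"
proof (rule ccontr)
  assume "\<not> ?thesis"
  then have big: "ps P (ob (Q n)) \<ge> ps P (ob (Q m)) + 4" by simp
  define a where "a = ps P (ob (Q m)) + 1"
  have on: "\<exists>j. P i = Q j" if i: "i \<in> {a, a + 1, a + 2}" for i
  proof (rule ccontr)
    assume no: "\<not> ?thesis"
    let ?Z = "P i" let ?p = "ps Q (ob ?Z)"
    have near: "d ?Z (ob (Q l)) (ob (Q ?p)) \<le> 2 * D" for l
    proof -
      have st: "d ?Z (ob (Q j)) (ob (Q (j + 1))) \<le> D" for j using chn_D[OF Q, of ?Z j] no P by auto
      consider "\<bar>ps Q (ob (Q l)) - ?p\<bar> \<le> 1" | "d ?Z (ob (Q l)) (ob (Q ?p)) \<le> D + E"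
        using ps_line[OF Q, of "ob (Q l)" ?Z] no P Q by auto
      then show ?thesis
      proof cases
        case 1
        moreover have "ps Q (ob (Q l)) = l - 1 \<or> ps Q (ob (Q l)) = l" using ps_ob[OF Q, of l] by simp
        ultimately consider "l = ?p - 1" | "l = ?p" | "l = ?p + 1" | "l = ?p + 1 + 1" by linarith
        then show ?thesis
        proof cases
          case 1
          then show ?thesis using st[of "?p - 1"] D_ge E_ge by simp
        next
          case 2
          then show ?thesis using D_ge E_ge by simp
        next
          case 3
          then show ?thesis using st[of ?p] d_sym[of ?Z "ob (Q (?p + 1))" "ob (Q ?p)"] D_ge E_ge by simp
        next
          case 4
          then show ?thesis
            using d_le[OF st[of ?p] st[of "?p + 1"]] d_sym[of ?Z "ob (Q ?p)" "ob (Q (?p + 1 + 1))"] by simp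
        qed
      qed (use D_ge in simp)
    qed
    have "d ?Z (ob (Q m)) (ob (Q n)) \<ge> K - 2 * E"
      using ps_between[OF P, of "ob (Q m)" "ob (Q n)" i] i big Q by (auto simp: a_def)
    then show False using d_le''[OF near[of m] near[of n]] K_ge D_ge E_ge by linarith
  qed
  have adj: "\<bar>j - j'\<bar> = 1" if "P i = Q j" "P (i + 1) = Q j'" for i j j'
  proof (rule ccontr)
    assume "\<bar>j - j'\<bar> \<noteq> 1"
    moreover have "j \<noteq> j'" using that chn_ne[OF P, of i] by auto
    ultimately have "j < j + 1 \<and> j + 1 < j' \<or> j' < j' + 1 \<and> j' + 1 < j" by linarith
    then obtain l where l: "j < l \<and> l < j' \<or> j' < l \<and> l < j"
      by blast
    have far: "d (Q l) (ob (Q a)) (ob (Q b)) \<ge> K - 2 * E" if "a < l" "l < b" for a b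
      using chn_gt[OF Q that(1)] chn_lt[OF Q that(2)] chn_K[OF Q, of l]
        d_tri[of "Q l" "ob (Q (l - 1))" "ob (Q (l + 1))" "ob (Q a)"] d_tri[of "Q l" "ob (Q a)" "ob (Q (l + 1))" "ob (Q b)"]
        d_sym[of "Q l" "ob (Q a)" "ob (Q (l - 1))"] by linarith
    have lower: "d (Q l) (ob (P i)) (ob (P (i + 1))) \<ge> K - 2 * E"
      using l that(1,2)
    proof (elim disjE conjE)
      assume "j < l" "l < j'" then show ?thesis using far[of j j'] unfolding that by simp
    next
      assume "j' < l" "l < j" then show ?thesis using far[of j' j] d_sym[of "Q l" "ob (Q j)"] unfolding that by simp
    qed
    have "Q l \<noteq> P i" "Q l \<noteq> P (i + 1)" unfolding that chn_inj[OF Q] using l by linarith+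
    then have "d (Q l) (ob (P i)) (ob (P (i + 1))) \<le> D" by (intro chn_D[OF P chn_Ln[OF Q]])
    then have "K - 2 * E \<le> D" using lower by (rule order_trans[rotated])
    then show False using K_ge D_ge E_ge by linarith
  qed
  obtain j0 where "P a = Q j0" using on[of a] by auto
  moreover obtain j1 where "P (a + 1) = Q j1" using on[of "a + 1"] by auto
  moreover obtain j2 where "P (a + 2) = Q j2" using on[of "a + 2"] by auto
  ultimately have j: "P a = Q j0" "P (a + 1) = Q j1" "P (a + 2) = Q j2" by simp_all
  have "\<bar>j0 - j1\<bar> = 1" "\<bar>j1 - j2\<bar> = 1" using adj[of a j0 j1] adj[of "a + 1" j1 j2] j by (simp_all add: add.assoc)
  moreover have "j0 \<noteq> j2" using j chn_inj[OF P, of a "a + 2"] by auto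
  ultimately consider "j1 = j0 + 1" "j2 = j0 + 2" | "j1 = j0 - 1" "j2 = j0 - 2" by linarith
  then show False using ns j unfolding share_def by cases blast+
qed

lemma share_sym: "share P Q \<Longrightarrow> share Q P"
  unfolding share_def
proof (elim exE disjE)
  fix a b assume "P a = Q b \<and> P (a + 1) = Q (b - 1) \<and> P (a + 2) = Q (b - 2)"
  then show "\<exists>a b. Q a = P b \<and> Q (a + 1) = P (b + 1) \<and> Q (a + 2) = P (b + 2) \<or>
     Q a = P b \<and> Q (a + 1) = P (b - 1) \<and> Q (a + 2) = P (b - 2)"
    by (rule_tac exI[of _ "b - 2"], rule_tac exI[of _ "a + 2"], rule_tac disjI2) (simp add: add.commute)
qed metis

text \<open>6 is the window of 3 plus room for two adjacent pivots. If both alternatives fail, two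
  adjacent pivots of each chain separate \<open>x\<close> from every line of the other chain;
  choosing distinct ones contradicts Behrstock's inequality for that pair of lines.\<close>

lemma ps_two_chains:
  assumes P: "chn P" and Q: "chn Q" and ns: "\<not> share P Q" and x: "x \<in> Pt"
  shows "\<bar>ps P x - ps P (ob (Q 0))\<bar> \<le> 6 \<or> \<bar>ps Q x - ps Q (ob (P 0))\<bar> \<le> 6"
proof (rule ccontr)
  assume far: "\<not> ?thesis"
  have wP: "\<bar>ps P (ob (Q n)) - ps P (ob (Q 0))\<bar> \<le> 3" for n
    using ps_window[OF assms(1-3), of n 0] ps_window[OF assms(1-3), of 0 n] by linarith
  have ns': "\<not> share Q P" using ns share_sym by blast
  have wQ: "\<bar>ps Q (ob (P n)) - ps Q (ob (P 0))\<bar> \<le> 3" for n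
    using ps_window[OF Q P ns', of n 0] ps_window[OF Q P ns', of 0 n] by linarith
  have cut: "\<exists>i. \<forall>i'\<in>{i, i + 1}. \<forall>n. d (A i') x (ob (B n)) > E"
    if A: "chn A" and B: "chn B" and w: "\<And>n. \<bar>ps A (ob (B n)) - ps A (ob (B 0))\<bar> \<le> 3"
      and fr: "\<bar>ps A x - ps A (ob (B 0))\<bar> > 6" for A B
  proof -
    define i where "i = (if ps A x > ps A (ob (B 0)) then ps A x - 2 else ps A x + 1)"
    have "d (A i') x (ob (B n)) > E" if "i' \<in> {i, i + 1}" for i' n
    proof -
      have "ps A x < i' \<and> i' < ps A (ob (B n)) \<or> ps A (ob (B n)) < i' \<and> i' < ps A x"
        using that w[of n] fr unfolding i_def by (auto split: if_splits)
      then have "d (A i') x (ob (B n)) \<ge> K - 2 * E"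
        using ps_between[OF A x, of "ob (B n)" i'] ps_between[OF A, of "ob (B n)" x i'] x B d_sym[of "A i'" x] by auto
      then show ?thesis using K_ge D_ge E_ge by linarith
    qed
    then show ?thesis by blast
  qed
  obtain i where i: "\<forall>i'\<in>{i, i + 1}. \<forall>n. d (P i') x (ob (Q n)) > E" using cut[OF P Q wP] far by auto
  obtain j where j: "\<forall>j'\<in>{j, j + 1}. \<forall>n. d (Q j') x (ob (P n)) > E" using cut[OF Q P wQ] far by auto
  obtain i' where i': "i' \<in> {i, i + 1}" "P i' \<noteq> Q j" using chn_ne[OF P, of i] by (metis insertI1 insertI2)
  then show False using cohE[of "P i'" "Q j" x] i j x P Q by (metis chn_Ln insertI1 not_le)
qed

end

section \<open>Orbits of single elements, and new axes\<close>

context line_system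
begin

lemma d_ob_ob_act:
  assumes "g \<in> carrier G" "Z \<in> Ln" "A \<in> Ln" "B \<in> Ln" "Z \<noteq> act g A" "Z \<noteq> act g B"
  shows "d Z (ob (act g A)) (ob (act g B)) = d (act (inv g) Z) (ob A) (ob B)"
  using assms d_ob_act[of g A Z "ob (act g B)"] d_ob_act'[of g B Z "pact g (ob A)"]
    d_shift2[of g Z "ob A" "ob B"] by auto

lemma rotation_pow:
  assumes "g \<in> carrier G" "Y \<in> Ln" "act g Y = Y" "\<And>x. x \<in> Pt \<Longrightarrow> \<delta> Y x (pact g x) = a" "x \<in> Pt"
  shows "\<delta> Y x (pact (g [^] (n::nat)) x) = int n * a"
proof (induction n)
  case (Suc n)
  have "pact (g [^] Suc n) x = pact g (pact (g [^] n) x)"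
    using assms nat_pow_Suc2[of g n] by (simp add: pact_mult del: nat_pow_Suc)
  then have "\<delta> Y (pact g x) (pact (g [^] Suc n) x) = \<delta> Y x (pact (g [^] n) x)"
    using \<delta>_act[of g Y x "pact (g [^] n) x"] assms by simp
  then show ?case using \<delta>_add[of Y x "pact (g [^] Suc n) x" "pact g x"] assms Suc by (simp add: algebra_simps)
qed (use assms in simp)

text \<open>A high power of \<open>g\<close> moves \<open>x\<close> far along both lines, beyond the
  projection of the other line, which Behrstock's inequality forbids.\<close>

lemma two_rotations:
  assumes g: "g \<in> carrier G" and x: "x \<in> Pt"
    and Y: "Y \<in> Ln" "act g Y = Y" "\<And>x. x \<in> Pt \<Longrightarrow> \<delta> Y x (pact g x) = a" "a \<noteq> 0"
    and Z: "Z \<in> Ln" "act g Z = Z" "\<And>x. x \<in> Pt \<Longrightarrow> \<delta> Z x (pact g x) = b" "b \<noteq> 0"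
  shows "Y = Z"
proof (rule ccontr)
  assume ne: "Y \<noteq> Z"
  define n where "n = nat (e Y + e Z + d Y x (ob Z) + d Z x (ob Y) + 1)"
  have n: "int n > e Y + d Y x (ob Z)" "int n > e Z + d Z x (ob Y)"
    using e_nonneg[OF Y(1)] e_nonneg[OF Z(1)] by (simp_all add: n_def)
  have far: "\<bar>int n * c\<bar> \<ge> int n" if "c \<noteq> 0" for c
    using mult_left_mono[of 1 "\<bar>c\<bar>" "int n"] that by (simp add: abs_mult)
  have "d Y x (pact (g [^] n) x) \<ge> int n" "d Z x (pact (g [^] n) x) \<ge> int n"
    using rotation_pow[OF g Y(1-3) x, of n] rotation_pow[OF g Z(1-3) x, of n] far[OF Y(4)] far[OF Z(4)] by simp_all
  then have "\<not> d Y (pact (g [^] n) x) (ob Z) \<le> e Y" "\<not> d Z (pact (g [^] n) x) (ob Y) \<le> e Z"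
    using n d_tri[of Y x "pact (g [^] n) x" "ob Z"] d_sym[of Y "ob Z" "pact (g [^] n) x"]
      d_tri[of Z x "pact (g [^] n) x" "ob Y"] d_sym[of Z "ob Y" "pact (g [^] n) x"] by linarith+
  then show False using coh[OF Y(1) Z(1) ne, of "pact (g [^] n) x"] g x by simp
qed

lemma d_bounded:
  assumes "x \<in> Pt" "y \<in> Pt" "\<And>Y. Y \<in> Ln \<Longrightarrow> e Y \<le> E"
  shows "\<exists>B. \<forall>Y \<in> Ln. d Y x y \<le> B"
proof -
  define F where "F = {Y \<in> Ln. d Y x y > e Y}"
  have F: "finite F" unfolding F_def using assms by (intro fin)
  have "d Y x y \<le> \<bar>E\<bar> + (\<Sum>Y\<in>F. d Y x y)" if "Y \<in> Ln" for Y
  proof (cases "Y \<in> F")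
    case True
    then have "d Y x y \<le> (\<Sum>Y\<in>F. d Y x y)" using F by (intro member_le_sum) auto
    then show ?thesis by simp
  next
    case False
    have "0 \<le> (\<Sum>Y\<in>F. d Y x y)" by (intro sum_nonneg) simp
    moreover have "d Y x y \<le> e Y" using False that by (simp add: F_def)
    ultimately show ?thesis using assms(3)[OF that] by linarith
  qed
  then show ?thesis by blast
qed

text \<open>The first step is bounded by \<open>B\<close> along all lines, hence so is every step.
  By \<open>two_sided_sequence\<close> a large total displacement along a line that \<open>u\<close>
  moves would need one or two consecutive steps beyond that bound; \<open>K\<close> is chosen
  accordingly. Negative powers reduce to positive ones on a translated line.\<close>

lemma bounded_orbit:
  assumes u: "u \<in> carrier G" and x: "x \<in> Pt" and E: "\<And>Y. Y \<in> Ln \<Longrightarrow> e Y \<le> E" "0 \<le> E"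
  shows "\<exists>B. \<forall>Y \<in> Ln. act u Y \<noteq> Y \<longrightarrow> (\<forall>l::int. d Y x (pact (u [^] l) x) \<le> B)"
proof -
  obtain B where B: "\<And>Y. Y \<in> Ln \<Longrightarrow> d Y x (pact u x) \<le> B" using d_bounded[of x "pact u x" E] u x E(1) by auto
  define K where "K = 2 * \<bar>B\<bar> + 30 * E + 20"
  have nat: "d Y x (pact (u [^] int p) x) \<le> K" if Y: "Y \<in> Ln" "act u Y \<noteq> Y" for Y p
  proof (rule ccontr)
    assume no: "\<not> ?thesis"
    then have p0: "p > 0" using x E by (cases p) (auto simp: K_def)
    define A where "A i = \<delta> Y x (pact (u [^] (i::int)) x)" for i
    define q q' where "q = \<delta> Y x (ob (act u Y))" and "q' = \<delta> Y x (ob (act (inv u) Y))"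
    have ne': "act (inv u) Y \<noteq> Y" using Y u by (metis act_inv')
    have inv_pow: "inv (u [^] i) = u [^] (- i)" for i :: int using u by (simp add: int_pow_neg)
    have step: "\<bar>A (i + 1) - A i\<bar> \<le> B" for i
    proof -
      have "A (i + 1) - A i = \<delta> Y (pact (u [^] i) x) (pact (u [^] (i + 1)) x)"
        using \<delta>_add[of Y x "pact (u [^] (i + 1)) x" "pact (u [^] i) x"] by (simp add: A_def)
      moreover have "pact (u [^] (i + 1)) x = pact (u [^] i) (pact u x)"
        using u x by (simp add: pact_mult[symmetric] int_pow_mult)
      ultimately show ?thesis using d_shift2[of "u [^] i" Y x "pact u x"] B[of "act (inv (u [^] i)) Y"] u x Y by simp
    qed
    have R: "\<bar>A i - q\<bar> \<le> E \<or> \<bar>A (i - 1) - q'\<bar> \<le> E" for i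
    proof -
      let ?y = "pact (u [^] i) x"
      have y: "?y \<in> Pt" "pact (inv u) ?y = pact (u [^] (i - 1)) x"
        using u x int_pow_mult[of u "-1" i] by (simp_all add: pact_mult[symmetric] int_pow_neg)
      have "d Y ?y (ob (act u Y)) \<le> E \<or> d (act u Y) ?y (ob Y) \<le> E"
        using coh[of Y "act u Y" ?y] Y u y E(1)[of Y] by fastforce
      moreover have "d (act u Y) ?y (ob Y) = d Y (pact (inv u) ?y) (pact (inv u) (ob Y))"
        using d_shift2[of "inv u" Y "?y" "ob Y"] Y u y by simp
      moreover have "\<dots> = d Y (pact (u [^] (i - 1)) x) (ob (act (inv u) Y))"
        unfolding y(2) using d_ob_act'[of "inv u" Y Y] Y u ne' by simp
      ultimately have "d Y ?y (ob (act u Y)) \<le> E \<or> d Y (pact (u [^] (i - 1)) x) (ob (act (inv u) Y)) \<le> E" by simp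
      moreover have "\<bar>A i - q\<bar> = d Y ?y (ob (act u Y))"
        using \<delta>_add[of Y x "ob (act u Y)" ?y] by (simp add: A_def q_def)
      moreover have "\<bar>A (i - 1) - q'\<bar> = d Y (pact (u [^] (i - 1)) x) (ob (act (inv u) Y))"
        using \<delta>_add[of Y x "ob (act (inv u) Y)" "pact (u [^] (i - 1)) x"] by (simp add: A_def q'_def)
      ultimately show ?thesis by simp
    qed
    have A0: "A 0 = 0" using x by (simp add: A_def)
    have big: "\<bar>A (int p) - A 0\<bar> \<ge> K" "K > 20 * E" using no E A0 by (auto simp: A_def K_def)
    have step2: "\<bar>A (i + 1) - A (i - 1)\<bar> \<le> 2 * B" for i using step[of i] step[of "i - 1"] by simp
    show False
      using two_sided_sequence[of A q E q' p K, OF R p0 big E(2)] step step2 E(2) unfolding K_def by (smt (verit))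
  qed
  have "d Y x (pact (u [^] l) x) \<le> K" if Y: "Y \<in> Ln" "act u Y \<noteq> Y" for Y and l :: int
  proof (cases l rule: int_cases2)
    case (nonneg p)
    then show ?thesis using nat[OF Y] by simp
  next
    case (nonpos p)
    define Z where "Z = act (u [^] int p) Y"
    have "Z \<in> Ln" "act u Z \<noteq> Z"
    proof -
      show "Z \<in> Ln" using Y u by (simp add: Z_def)
      have "act u Z = act (u [^] int p) (act u Y)"
        using u Y int_pow_mult[of u 1 "int p"] int_pow_mult[of u "int p" 1] by (simp add: Z_def act_mult[symmetric] add.commute)
      then show "act u Z \<noteq> Z" using Y u act_eq_iff unfolding Z_def by simp
    qed
    moreover have "d Y x (pact (u [^] l) x) = d Z (pact (u [^] int p) x) x"
      using d_act[of "u [^] int p" Y x "pact (u [^] l) x"] nonpos u x Y int_pow_mult[of u "int p" l, symmetric]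
      by (simp add: Z_def pact_mult[symmetric])
    ultimately show ?thesis using nat[of Z p] d_sym[of Z x] by simp
  qed
  then show ?thesis by blast
qed

end

context psys
begin

lemma stab_rotation:
  assumes g: "g \<in> carrier G" and Y: "Y \<in> Ln" "act g Y = Y"
  shows "\<exists>n::int. g = rp Y \<otimes> v (fst Y) [^] n \<otimes> inv (rp Y) \<and> (\<forall>\<xi> \<in> Pt. \<delta> Y \<xi> (pact g \<xi>) = n * m (fst Y))"
proof -
  have i: "fst Y \<in> I" "rp Y \<in> carrier G" using Y by simp_all
  have "(fst Y, (g \<otimes> rp Y) <# C (fst Y)) = (fst Y, rp Y <# C (fst Y))"
    using act_frame[OF g i] Y(2) Ln_rp[OF Y(1)] by simp
  then have "inv (rp Y) \<otimes> (g \<otimes> rp Y) \<in> C (fst Y)" using lcoset_eq[of "fst Y" "rp Y" "g \<otimes> rp Y"] i g by simp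
  then obtain n :: int where n: "inv (rp Y) \<otimes> (g \<otimes> rp Y) = v (fst Y) [^] n" by (auto simp: cyc_def)
  have gn: "g = rp Y \<otimes> v (fst Y) [^] n \<otimes> inv (rp Y)"
    using i g by (simp add: n[symmetric] m_assoc cancel_inv)
  have "\<delta> Y \<xi> (pact g \<xi>) = n * m (fst Y)" if "\<xi> \<in> Pt" for \<xi>
  proof -
    have "inv g \<otimes> rp Y = rp Y \<otimes> v (fst Y) [^] (- n)"
      using i by (simp add: gn inv_mult_group m_assoc int_pow_neg cancel_inv)
    then show ?thesis using Pt_frame[OF that i, of "- n"] i by (simp add: \<delta>_def pact_def)
  qed
  then show ?thesis using gn by blast
qed

lemma stab_two:
  assumes g: "g \<in> carrier G" and Y: "Y \<in> Ln" "act g Y = Y" and Z: "Z \<in> Ln" "act g Z = Z" and ne: "Y \<noteq> Z"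
  shows "g = \<one>"
proof (rule ccontr)
  assume g1: "g \<noteq> \<one>"
  obtain n :: int where n: "g = rp Y \<otimes> v (fst Y) [^] n \<otimes> inv (rp Y)" "\<And>\<xi>. \<xi> \<in> Pt \<Longrightarrow> \<delta> Y \<xi> (pact g \<xi>) = n * m (fst Y)"
    using stab_rotation[OF g Y] by metis
  obtain n' :: int where n': "g = rp Z \<otimes> v (fst Z) [^] n' \<otimes> inv (rp Z)" "\<And>\<xi>. \<xi> \<in> Pt \<Longrightarrow> \<delta> Z \<xi> (pact g \<xi>) = n' * m (fst Z)"
    using stab_rotation[OF g Z] by metis
  have "n \<noteq> 0" "n' \<noteq> 0" using n(1) n'(1) g1 Y Z by auto
  then have "n * m (fst Y) \<noteq> 0" "n' * m (fst Z) \<noteq> 0" using m_pos[of "fst Y"] m_pos[of "fst Z"] Y Z by auto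
  then show False using lsys.two_rotations[OF g pt_Pt[OF one_closed] Y n(2) _ Z n'(2)] ne by blast
qed

lemma pact_pt: "g \<in> carrier G \<Longrightarrow> s \<in> carrier G \<Longrightarrow> pact g (pt s) = pt (g \<otimes> s)"
  by (intro ext) (simp add: pact_def pt_def inv_mult_group m_assoc)

lemma \<delta>_pt: 
  assumes "i \<in> I" "x \<in> carrier G" "s \<in> carrier G" "t \<in> carrier G"
  shows "\<delta> (i, x <# C i) (pt s) (pt t) = f i (inv x \<otimes> t) - f i (inv x \<otimes> s)"
  using val_frame[OF assms(1,2,4,3)] unfolding \<delta>_def co_pt[OF Ln_I[OF assms(1,2)]] .

lemma near_shift:
  assumes "x \<in> carrier G" "s \<in> carrier G" "t \<in> carrier G" "\<And>Y. Y \<in> Ln \<Longrightarrow> 3 * \<bar>\<delta> Y (pt s) (pt t)\<bar> \<le> K" "Y \<in> Ln"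
  shows "3 * \<bar>\<delta> Y (pt (x \<otimes> s)) (pt (x \<otimes> t))\<bar> \<le> K"
  using lsys.d_shift2[of x Y "pt s" "pt t"] assms(4)[of "act (inv x) Y"] assms by (simp add: pact_pt)

text \<open>Adds the chains \<open>P a\<close> as lines and keeps the classes \<open>B\<close> that
  do not occur among their pivots. The error 6 comes from \<open>ps_two_chains\<close>, and
  \<open>D + E\<close> from \<open>ps_line\<close>. By \<open>near\<close> a generator changes the
  coordinate along an axis by at most 1, so that the axes contribute nothing to
  \<open>Fg\<close>.\<close>

theorem axis_psys:
  assumes E: "\<And>i. i \<in> I \<Longrightarrow> 45 * c i = E" "1 \<le> E" "E \<le> D" "20 * D \<le> K"
    and AB: "A \<inter> B = {}" "B \<subseteq> I"
    and P: "\<And>a. a \<in> A \<Longrightarrow> lsys.chain K D (P a)"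
    and rr: "\<And>a. a \<in> A \<Longrightarrow> rr a \<in> carrier G" "\<And>a. a \<in> A \<Longrightarrow> 0 < kk a"
      "\<And>a i. a \<in> A \<Longrightarrow> P a (i + kk a) = act (rr a) (P a i)"
    and ns: "\<And>a b x. \<lbrakk>a \<in> A; b \<in> A; x \<in> carrier G; \<not> (a = b \<and> x \<in> cyc G (rr a))\<rbrakk>
      \<Longrightarrow> \<not> lsys.share (P a) (\<lambda>i. act x (P b i))"
    and BP: "\<And>Y a i. \<lbrakk>Y \<in> Ln; fst Y \<in> B; a \<in> A\<rbrakk> \<Longrightarrow> Y \<noteq> P a i"
    and near: "\<And>s Y. \<lbrakk>s \<in> S; Y \<in> Ln\<rbrakk> \<Longrightarrow> 3 * \<bar>\<delta> Y (pt \<one>) (pt s)\<bar> \<le> K"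
  shows "psys G S (A \<union> B) (\<lambda>i. if i \<in> A then rr i else v i) (\<lambda>i. if i \<in> A then kk i else m i)
     (\<lambda>i. if i \<in> A then 6 else D + E) (\<lambda>i s. if i \<in> A then lsys.pos (P i) E (pt s) else f i s)" (is ?psys)
    and "\<And>a s t. \<lbrakk>a \<in> A; s \<in> carrier G; t \<in> carrier G; \<And>Y. Y \<in> Ln \<Longrightarrow> 3 * \<bar>\<delta> Y (pt s) (pt t)\<bar> \<le> K\<rbrakk>
      \<Longrightarrow> \<bar>lsys.pos (P a) E (pt s) - lsys.pos (P a) E (pt t)\<bar> \<le> 1"
proof -
  interpret uniform_lines G Ln act Pt pact \<delta> ob "\<lambda>Y. 45 * cl Y" E K D
    by unfold_locales (use E in auto)
  show lip: "\<bar>ps (P a) (pt s) - ps (P a) (pt t)\<bar> \<le> 1"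
    if "a \<in> A" "s \<in> carrier G" "t \<in> carrier G" "\<And>Y. Y \<in> Ln \<Longrightarrow> 3 * \<bar>\<delta> Y (pt s) (pt t)\<bar> \<le> K" for a s t
    using ps_lipschitz[OF P[OF that(1)], of "pt s" "pt t"] that by simp
  let ?v = "\<lambda>i. if i \<in> A then rr i else v i" and ?m = "\<lambda>i. if i \<in> A then kk i else m i"
    and ?c = "\<lambda>i. if i \<in> A then 6 else D + E" and ?f = "\<lambda>i s. if i \<in> A then ps (P i) (pt s) else f i s"
  have tr: "ps (P a) (pt (inv x \<otimes> s)) = ps (\<lambda>i. act x (P a i)) (pt s)" if "a \<in> A" "x \<in> carrier G" "s \<in> carrier G" for a x s
    using lsys.pos_act[of "P a" x "pt (inv x \<otimes> s)" E] chn_Ln[OF P] chn_ne[OF P] that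
    by (simp add: pact_pt cancel_inv)
  have AA: "\<exists>p q. \<forall>s \<in> carrier G. \<bar>?f i s - p\<bar> \<le> ?c i \<or> \<bar>?f j (inv x \<otimes> s) - q\<bar> \<le> ?c j"
    if i: "i \<in> A" "j \<in> A" and x: "x \<in> carrier G" "\<not> (i = j \<and> x \<in> cyc G (?v i))" for i j x
  proof -
    have Q: "chn (\<lambda>l. act x (P j l))" using lsys.chain_act[OF P[OF i(2)] x(1)] .
    have "\<not> lsys.share (P i) (\<lambda>l. act x (P j l))" using ns[OF i x(1)] x i by simp
    note two = ps_two_chains[OF P[OF i(1)] Q this]
    have "\<forall>s \<in> carrier G. \<bar>?f i s - ps (P i) (ob (act x (P j 0)))\<bar> \<le> ?c i \<or>
        \<bar>?f j (inv x \<otimes> s) - ps (\<lambda>l. act x (P j l)) (ob (P i 0))\<bar> \<le> ?c j"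
    proof
      fix s assume s: "s \<in> carrier G"
      show "\<bar>?f i s - ps (P i) (ob (act x (P j 0)))\<bar> \<le> ?c i \<or>
        \<bar>?f j (inv x \<otimes> s) - ps (\<lambda>l. act x (P j l)) (ob (P i 0))\<bar> \<le> ?c j"
        using two[of "pt s"] tr[OF i(2) x(1) s] i s by simp
    qed
    then show ?thesis by blast
  qed
  have AB': "\<exists>p q. \<forall>s \<in> carrier G. \<bar>?f i s - p\<bar> \<le> ?c i \<or> \<bar>?f j (inv x \<otimes> s) - q\<bar> \<le> ?c j"
    if i: "i \<in> A" "j \<in> B" and x: "x \<in> carrier G" for i j x
  proof -
    define Z where "Z = (j, x <# C j)"
    have j: "j \<in> I" "j \<notin> A" using i AB by auto
    have Z: "Z \<in> Ln" "fst Z \<in> B" using j x i by (simp_all add: Z_def)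
    define p where "p = ps (P i) (ob Z)"
    define q where "q = \<delta> Z (pt \<one>) (ob (P i p)) + f j (inv x)"
    have "\<bar>ps (P i) (pt s) - p\<bar> \<le> 6 \<or> \<bar>f j (inv x \<otimes> s) - q\<bar> \<le> D + E" if s: "s \<in> carrier G" for s
    proof -
      have "\<bar>ps (P i) (pt s) - p\<bar> \<le> 1 \<or> \<bar>\<delta> Z (pt s) (ob (P i p))\<bar> \<le> D + E"
        unfolding p_def using Z BP[OF Z i(1)] s by (intro ps_line[OF P[OF i(1)]]) auto
      moreover have "\<delta> Z (pt s) (ob (P i p)) = q - f j (inv x \<otimes> s)"
        using lsys.\<delta>_add[of Z "pt \<one>" "ob (P i p)" "pt s"] \<delta>_pt[of j x \<one> s] j x s by (simp add: q_def Z_def)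
      ultimately show ?thesis by (auto simp: abs_minus_commute)
    qed
    then show ?thesis using i j by (intro exI[of _ p] exI[of _ q]) simp
  qed
  have sym: "\<exists>p q. \<forall>s \<in> carrier G. \<bar>F s - p\<bar> \<le> a \<or> \<bar>H (inv x \<otimes> s) - q\<bar> \<le> b"
    if x: "x \<in> carrier G" and 1: "\<exists>p q. \<forall>s \<in> carrier G. \<bar>H s - p\<bar> \<le> b \<or> \<bar>F (x \<otimes> s) - q\<bar> \<le> a" for F H a b x
  proof -
    obtain p q where pq: "\<And>s. s \<in> carrier G \<Longrightarrow> \<bar>H s - p\<bar> \<le> b \<or> \<bar>F (x \<otimes> s) - q\<bar> \<le> a" using 1 by blast
    have "\<bar>F s - q\<bar> \<le> a \<or> \<bar>H (inv x \<otimes> s) - p\<bar> \<le> b" if "s \<in> carrier G" for s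
      using pq[of "inv x \<otimes> s"] that x by (auto simp: cancel_inv)
    then show ?thesis by blast
  qed
  have cD: "c i \<le> D + E" if "i \<in> I" for i using E(1)[OF that] E by linarith
  show ?psys
  proof
    show "finite S" "S \<subseteq> carrier G" "generate G S = carrier G" by (rule S_fin S_sub S_gen)+
    show "?v i \<in> carrier G" "0 < ?m i" if "i \<in> A \<union> B" for i using that rr AB m_pos by auto
    show "0 \<le> ?c i" if "i \<in> A \<union> B" for i using E by simp
    show "?f i (?v i \<otimes> s) = ?f i s + ?m i" if i: "i \<in> A \<union> B" and s: "s \<in> carrier G" for i s
    proof (cases "i \<in> A")
      case True
      have "ps (\<lambda>l. act (rr i) (P i l)) (pact (rr i) (pt s)) = ps (P i) (pt s)"
        using lsys.pos_act[of "P i" "rr i" "pt s" E] chn_Ln[OF P] chn_ne[OF P] True rr s by simp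
      moreover have "(\<lambda>l. act (rr i) (P i l)) = (\<lambda>l. P i (l + kk i))" using rr(3)[OF True] by simp
      moreover have "ps (\<lambda>l. P i (l + kk i)) (pt (rr i \<otimes> s)) = ps (P i) (pt (rr i \<otimes> s)) - kk i"
        using ps_shift[OF P[OF True]] rr(1)[OF True] s by simp
      ultimately show ?thesis using True rr(1)[OF True] s by (simp add: pact_pt)
    next
      case False
      then show ?thesis using i s AB f_v by auto
    qed
    show "\<exists>p q. \<forall>s \<in> carrier G. \<bar>?f i s - p\<bar> \<le> ?c i \<or> \<bar>?f j (inv x \<otimes> s) - q\<bar> \<le> ?c j"
      if i: "i \<in> A \<union> B" "j \<in> A \<union> B" and x: "x \<in> carrier G" "\<not> (i = j \<and> x \<in> cyc G (?v i))" for i j x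
    proof -
      consider "i \<in> A" "j \<in> A" | "i \<in> A" "j \<in> B" | "i \<in> B" "j \<in> A" | "i \<in> B" "j \<in> B" using i by blast
      then show ?thesis
      proof cases
        case 1
        then show ?thesis using AA[of i j x] x by blast
      next
        case 2
        then show ?thesis using AB'[of i j x] x by blast
      next
        case 3
        have "\<exists>p q. \<forall>s \<in> carrier G. \<bar>?f j s - p\<bar> \<le> ?c j \<or> \<bar>?f i (x \<otimes> s) - q\<bar> \<le> ?c i"
          using AB'[OF 3(2,1) inv_closed[OF x(1)]] unfolding inv_inv[OF x(1)] .
        then show ?thesis using sym[of x "?f j" "?c j" "?f i" "?c i"] x(1) by blast
      next
        case 4
        then have *: "i \<in> I" "j \<in> I" "i \<notin> A" "j \<notin> A" using AB by auto
        then have "\<not> (i = j \<and> x \<in> C i)" using x(2) by simp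
        from CB[OF *(1,2) x(1) this] obtain p q where
          "\<forall>s \<in> carrier G. \<bar>f i s - p\<bar> \<le> c i \<or> \<bar>f j (inv x \<otimes> s) - q\<bar> \<le> c j" by blast
        then have "\<forall>s \<in> carrier G. \<bar>?f i s - p\<bar> \<le> ?c i \<or> \<bar>?f j (inv x \<otimes> s) - q\<bar> \<le> ?c j"
          using * cD[of i] cD[of j] by force
        then show ?thesis by blast
      qed
    qed
    show "finite {(i, x <# cyc G (?v i)) | i x. i \<in> A \<union> B \<and> x \<in> carrier G \<and> \<bar>?f i (inv x \<otimes> s) - ?f i (inv x)\<bar> > ?c i}"
      if s: "s \<in> S" for s
    proof (rule finite_subset[OF _ Fg[OF s]], clarify)
      fix i x assume i: "i \<in> A \<union> B" and x: "x \<in> carrier G" and far: "\<bar>?f i (inv x \<otimes> s) - ?f i (inv x)\<bar> > ?c i"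
      have sc: "s \<in> carrier G" using s S_sub by blast
      have nA: "i \<notin> A"
      proof
        assume iA: "i \<in> A"
        have "3 * \<bar>\<delta> Y (pt (inv x \<otimes> \<one>)) (pt (inv x \<otimes> s))\<bar> \<le> K" if "Y \<in> Ln" for Y
          using near_shift[of "inv x" \<one> s K Y] near[OF s] that x sc by simp
        then have "\<bar>ps (P i) (pt (inv x \<otimes> \<one>)) - ps (P i) (pt (inv x \<otimes> s))\<bar> \<le> 1" using lip[OF iA] x sc by simp
        then show False using far iA x by simp
      qed
      then have iI: "i \<in> I" using i AB by auto
      then show "\<exists>i' x'. (i, x <# cyc G (?v i)) = (i', x' <# C i') \<and> i' \<in> I \<and> x' \<in> carrier G \<and>
          c i' < \<bar>f i' (inv x' \<otimes> s) - f i' (inv x')\<bar>"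
        using nA far x cD[OF iI] by (intro exI[of _ i] exI[of _ x]) auto
    qed
  qed
qed

definition base :: "'i \<Rightarrow> 'i \<times> 'a set" where
  "base i = (i, \<one> <# C i)"

text \<open>For large \<open>M\<close> the element \<open>R M\<close> has an axis that zigzags along the lines \<open>piv M i\<close>; \<open>pre j\<close> and \<open>nxt j\<close> are the
  neighbours of the pivot \<open>base (\<kappa> j)\<close>, up to the choice of the exponent \<open>M\<close>.\<close>

definition zig :: "(nat \<Rightarrow> 'i) \<Rightarrow> nat \<Rightarrow> nat \<Rightarrow> 'a" where
  "zig \<kappa> M j = lprod (map (\<lambda>i. v (\<kappa> i) [^] M) [0..<j])"

lemma base_Ln [simp]: "i \<in> I \<Longrightarrow> base i \<in> Ln" and fst_base [simp]: "fst (base i) = i"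
  by (simp_all add: base_def)

lemma act_v_base: "i \<in> I \<Longrightarrow> act (v i [^] (n::nat)) (base i) = base i"
  using lcoset_pow[of i \<one> "int n", unfolded int_pow_int] by (simp add: base_def act_frame)

lemma base_rotation:
  assumes "i \<in> I" "\<xi> \<in> Pt" shows "\<delta> (base i) \<xi> (pact (v i [^] (n::nat)) \<xi>) = int n * m i"
proof -
  obtain a :: int where a: "rp (base i) = \<one> \<otimes> v i [^] a" unfolding base_def using rp_frame[of i \<one>] assms by blast
  have "inv (v i [^] n) \<otimes> v i [^] a = v i [^] a \<otimes> v i [^] (- int n)"
    using assms by (simp add: int_pow_mult[symmetric] int_pow_int[symmetric] int_pow_neg[symmetric] del: int_pow_int)
  then show ?thesis using Pt_frame[OF assms(2,1), of "v i [^] a" "- int n"] a assms by (simp add: \<delta>_def pact_def)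
qed

context
  fixes \<kappa> :: "nat \<Rightarrow> 'i" and k :: nat and z :: 'a
  assumes k: "k > 0" and \<kappa>: "\<And>j. \<kappa> j \<in> I" and z: "z \<in> carrier G"
begin

abbreviation "V M \<equiv> zig \<kappa> M"

definition R :: "nat \<Rightarrow> 'a" where "R M = V M k \<otimes> inv z"

definition pre :: "nat \<Rightarrow> 'i \<times> 'a set" where
  "pre j = (if j = 0 then act z (base (\<kappa> (k - 1))) else base (\<kappa> (j - 1)))"

definition nxt :: "nat \<Rightarrow> 'i \<times> 'a set" where
  "nxt j = (if Suc j = k then act (inv z) (base (\<kappa> 0)) else base (\<kappa> (Suc j)))"

definition piv :: "nat \<Rightarrow> int \<Rightarrow> 'i \<times> 'a set" where
  "piv M i = act (R M [^] (i div int k) \<otimes> V M (nat (i mod int k))) (base (\<kappa> (nat (i mod int k))))"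

lemma V_closed [simp]: "V M j \<in> carrier G"
  using \<kappa> by (auto simp: zig_def intro!: lprod_closed)

lemma R_closed [simp]: "R M \<in> carrier G"
  using z by (simp add: R_def)

lemma V_0 [simp]: "V M 0 = \<one>" by (simp add: zig_def)

lemma V_Suc: "V M (Suc j) = V M j \<otimes> v (\<kappa> j) [^] M"
  unfolding zig_def using \<kappa> by (simp add: lprod_append image_subset_iff)

lemma piv_eq: "j < k \<Longrightarrow> piv M (int k * q + int j) = act (R M [^] q \<otimes> V M j) (base (\<kappa> j))"
  by (simp add: piv_def)

lemma piv_shift: "piv M (i + int k) = act (R M) (piv M i)"
proof -
  have "(i + int k) div int k = i div int k + 1" "(i + int k) mod int k = i mod int k" using k by simp_all
  then have "piv M (i + int k) = act (R M \<otimes> (R M [^] (i div int k) \<otimes> V M (nat (i mod int k)))) (base (\<kappa> (nat (i mod int k))))"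
    unfolding piv_def using int_pow_mult[of "R M" 1 "i div int k"] by (simp add: m_assoc add.commute)
  then show ?thesis by (simp add: piv_def act_mult' \<kappa>)
qed

lemma fst_piv [simp]: "fst (piv M i) = \<kappa> (nat (i mod int k))"
  by (simp add: piv_def)

lemma pre_Ln [simp]: "pre j \<in> Ln" and nxt_Ln [simp]: "nxt j \<in> Ln" and piv_Ln [simp]: "piv M i \<in> Ln"
  using z \<kappa> by (simp_all add: pre_def nxt_def piv_def)

text \<open>Every turn is a translate of one of \<open>k\<close> models. A power of
  \<open>v (\<kappa> j)\<close> fixes \<open>base (\<kappa> j)\<close>, so the exponent
  \<open>M\<close> only rotates the outgoing neighbour about the pivot.\<close>

lemma piv_turn:
  "\<exists>g j. g \<in> carrier G \<and> j < k \<and> piv M i = act g (base (\<kappa> j)) \<and> piv M (i - 1) = act g (pre j) \<and>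
     piv M (i + 1) = act g (act (v (\<kappa> j) [^] M) (nxt j))"
proof -
  define q j where "q = i div int k" and "j = nat (i mod int k)"
  have j: "j < k" and i: "i = int k * q + int j" using k by (simp_all add: q_def j_def nat_less_iff)
  let ?g = "R M [^] q \<otimes> V M j"
  have g: "?g \<in> carrier G" by simp
  have 1: "piv M i = act ?g (base (\<kappa> j))" unfolding i by (rule piv_eq[OF j])
  have 2: "piv M (i - 1) = act ?g (pre j)"
  proof (cases j)
    case 0
    have "i - 1 = int k * (q - 1) + int (k - 1)" using k i 0 by (simp add: algebra_simps of_nat_diff)
    then have p: "piv M (i - 1) = act (R M [^] (q - 1) \<otimes> V M (k - 1)) (base (\<kappa> (k - 1)))"
      using piv_eq[of "k - 1" M "q - 1"] k by (simp only: diff_less zero_less_one)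
    have "R M [^] q \<otimes> z = R M [^] (q - 1) \<otimes> (R M \<otimes> z)"
      using int_pow_mult[of "R M" "q - 1" 1] z by (simp add: m_assoc[symmetric])
    also have "R M \<otimes> z = V M (k - 1) \<otimes> v (\<kappa> (k - 1)) [^] M"
      using V_Suc[of M "k - 1"] k z \<kappa> by (simp add: R_def m_assoc)
    finally have "act (R M [^] q \<otimes> z) (base (\<kappa> (k - 1))) =
       act (R M [^] (q - 1) \<otimes> V M (k - 1)) (act (v (\<kappa> (k - 1)) [^] M) (base (\<kappa> (k - 1))))"
      using \<kappa> by (simp add: act_mult'[symmetric] m_assoc)
    then show ?thesis using p z \<kappa> 0 by (simp add: act_v_base pre_def act_mult'[symmetric])
  next
    case (Suc j')
    have "i - 1 = int k * q + int j'" using i Suc by simp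
    then have "piv M (i - 1) = act (R M [^] q \<otimes> V M j') (base (\<kappa> j'))" using piv_eq j Suc by simp
    also have "\<dots> = act (R M [^] q \<otimes> V M j') (act (v (\<kappa> j') [^] M) (base (\<kappa> j')))" using \<kappa> by (simp add: act_v_base)
    also have "\<dots> = act ?g (pre j)" using Suc \<kappa> by (simp add: V_Suc pre_def act_mult'[symmetric] m_assoc)
    finally show ?thesis .
  qed
  have 3: "piv M (i + 1) = act ?g (act (v (\<kappa> j) [^] M) (nxt j))"
  proof (cases "Suc j = k")
    case True
    have "i + 1 = int k * (q + 1) + int 0" using i True by (simp add: algebra_simps)
    then have "piv M (i + 1) = act (R M [^] (q + 1) \<otimes> V M 0) (base (\<kappa> 0))" using piv_eq k by metis
    moreover have "R M [^] (q + 1) = R M [^] q \<otimes> R M" using int_pow_mult[of "R M" q 1] by simp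
    then have "R M [^] (q + 1) = R M [^] q \<otimes> (V M (Suc j) \<otimes> inv z)"
      unfolding True by (simp only: R_def[of M, symmetric])
    ultimately show ?thesis using True V_Suc[of M j] z \<kappa> by (simp add: nxt_def act_mult'[symmetric] m_assoc)
  next
    case False
    then have j': "Suc j < k" using j by simp
    have "i + 1 = int k * q + int (Suc j)" using i by simp
    then have "piv M (i + 1) = act (R M [^] q \<otimes> V M (Suc j)) (base (\<kappa> (Suc j)))" using piv_eq[OF j'] by metis
    then show ?thesis using False \<kappa> by (simp add: V_Suc nxt_def act_mult'[symmetric] m_assoc)
  qed
  show ?thesis using 1 2 3 g j by blast
qed

lemma piv_chain_at:
  assumes ne: "\<And>j. j < k \<Longrightarrow> pre j \<noteq> base (\<kappa> j) \<and> nxt j \<noteq> base (\<kappa> j)"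
    and D: "\<And>j Y. j < k \<Longrightarrow> Y \<in> Ln \<Longrightarrow> lsys.d Y (ob (base (\<kappa> j))) (ob (nxt j)) \<le> D"
    and M: "\<And>j. j < k \<Longrightarrow> int M \<ge> K + lsys.d (base (\<kappa> j)) (ob (pre j)) (ob (nxt j))"
  shows "lsys.chain K D (piv M)"
  unfolding lsys.chain_def
proof
  fix i
  obtain g j where g: "g \<in> carrier G" "j < k" "piv M i = act g (base (\<kappa> j))" "piv M (i - 1) = act g (pre j)"
    "piv M (i + 1) = act g (act (v (\<kappa> j) [^] M) (nxt j))" using piv_turn by blast
  let ?l = "base (\<kappa> j)" and ?w = "v (\<kappa> j) [^] M"
  have w: "?w \<in> carrier G" "act ?w ?l = ?l" using \<kappa> by (simp_all add: act_v_base)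
  have wn: "act ?w (nxt j) \<noteq> ?l" using lsys.act_eq_iff[of ?w "nxt j" ?l] w ne[OF g(2)] \<kappa> by auto
  have "lsys.d (piv M i) (ob (piv M (i - 1))) (ob (piv M (i + 1))) = lsys.d ?l (ob (pre j)) (ob (act ?w (nxt j)))"
    unfolding g(3-5) using lsys.d_ob_ob_act[of g "act g ?l" "pre j" "act ?w (nxt j)"] g(1) w wn[symmetric]
      ne[OF g(2), THEN conjunct1, symmetric] \<kappa> by (simp add: lsys.act_eq_iff)
  also have "\<dots> = lsys.d ?l (ob (pre j)) (pact ?w (ob (nxt j)))"
    using lsys.d_ob_act'[of ?w "nxt j" ?l] w wn \<kappa> by simp
  also have "\<dots> \<ge> int M * m (\<kappa> j) - lsys.d ?l (ob (pre j)) (ob (nxt j))"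
    using lsys.\<delta>_add[of ?l "ob (pre j)" "pact ?w (ob (nxt j))" "ob (nxt j)"] base_rotation[of "\<kappa> j" "ob (nxt j)" M] \<kappa>
    by simp
  moreover have "int M * m (\<kappa> j) \<ge> int M" using mult_left_mono[of 1 "m (\<kappa> j)" "int M"] m_pos[OF \<kappa>, of j] by simp
  ultimately have A: "K \<le> lsys.d (piv M i) (ob (piv M (i - 1))) (ob (piv M (i + 1)))" using M[OF g(2)] by linarith
  have B: "lsys.d Z (ob (piv M i)) (ob (piv M (i + 1))) \<le> D" if Z: "Z \<in> Ln" "Z \<noteq> piv M i" "Z \<noteq> piv M (i + 1)" for Z
  proof -
    have gw: "piv M i = act (g \<otimes> ?w) ?l" "piv M (i + 1) = act (g \<otimes> ?w) (nxt j)"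
      unfolding g(3,5) using g(1) w \<kappa> by (simp_all add: act_mult')
    then show ?thesis using lsys.d_ob_ob_act[of "g \<otimes> ?w" Z ?l "nxt j"] Z g(1) w D[OF g(2), of "act (inv (g \<otimes> ?w)) Z"] \<kappa>
      by simp
  qed
  have "piv M i \<noteq> piv M (i + 1)" unfolding g(3,5) using lsys.act_eq_iff g(1) w wn[symmetric] \<kappa> by simp
  then show "piv M i \<in> Ln \<and> piv M i \<noteq> piv M (i + 1) \<and> K \<le> lsys.d (piv M i) (ob (piv M (i - 1))) (ob (piv M (i + 1))) \<and>
     (\<forall>Z \<in> Ln. Z \<noteq> piv M i \<longrightarrow> Z \<noteq> piv M (i + 1) \<longrightarrow> lsys.d Z (ob (piv M i)) (ob (piv M (i + 1))) \<le> D)"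
    using A B by simp
qed

text \<open>The order of the quantifiers is the point. Every edge is a translate of one of finitely
  many that do not involve \<open>M\<close>, so \<open>D\<close> is fixed before \<open>K\<close>;
  the turn at a pivot grows with \<open>M\<close>. Thus \<open>K\<close> can be made large compared
  with \<open>D\<close>.\<close>

theorem piv_chain:
  assumes ne: "\<And>j. j < k \<Longrightarrow> pre j \<noteq> base (\<kappa> j) \<and> nxt j \<noteq> base (\<kappa> j)"
    and E: "\<And>i. i \<in> I \<Longrightarrow> 45 * c i \<le> E"
  shows "\<exists>D \<ge> E. \<forall>K. \<exists>M0. \<forall>M \<ge> M0. lsys.chain K D (piv M)"
proof -
  have "\<exists>B. \<forall>Y \<in> Ln. lsys.d Y (ob (base (\<kappa> j))) (ob (nxt j)) \<le> B" for j
    using lsys.d_bounded[of "ob (base (\<kappa> j))" "ob (nxt j)" E] E \<kappa> by simp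
  then obtain B where B: "\<And>j Y. Y \<in> Ln \<Longrightarrow> lsys.d Y (ob (base (\<kappa> j))) (ob (nxt j)) \<le> B j" by metis
  define D where "D = \<bar>E\<bar> + (\<Sum>j<k. \<bar>B j\<bar>)"
  have D0: "0 \<le> (\<Sum>j<k. \<bar>B j\<bar>)" by (intro sum_nonneg) simp
  have D: "lsys.d Y (ob (base (\<kappa> j))) (ob (nxt j)) \<le> D" if "j < k" "Y \<in> Ln" for j Y
  proof -
    have "\<bar>B j\<bar> \<le> (\<Sum>j<k. \<bar>B j\<bar>)" using that by (intro member_le_sum) auto
    then show ?thesis using B[OF that(2), of j] unfolding D_def by linarith
  qed
  define \<Theta> where "\<Theta> = (\<Sum>j<k. lsys.d (base (\<kappa> j)) (ob (pre j)) (ob (nxt j)))"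
  have \<Theta>: "lsys.d (base (\<kappa> j)) (ob (pre j)) (ob (nxt j)) \<le> \<Theta>" if "j < k" for j
    unfolding \<Theta>_def using that by (intro member_le_sum[of j "{..<k}" "\<lambda>j. lsys.d (base (\<kappa> j)) (ob (pre j)) (ob (nxt j))"]) auto
  have "\<forall>M \<ge> nat (K + \<Theta>). lsys.chain K D (piv M)" for K
  proof (intro allI impI piv_chain_at ne D)
    fix M j assume M: "nat (K + \<Theta>) \<le> M" and j: "j < k"
    show "K + lsys.d (base (\<kappa> j)) (ob (pre j)) (ob (nxt j)) \<le> int M" using M \<Theta>[OF j] by linarith
  qed
  moreover have "E \<le> D" using D0 unfolding D_def by linarith
  ultimately show ?thesis by blast
qed

end

end

section \<open>Uniform bounds, and axes adapted to a relator\<close>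

context psys
begin

lemma psys_reindex:
  assumes \<sigma>: "inj_on \<sigma> I'" "\<sigma> ` I' \<subseteq> I" and c': "\<And>i. i \<in> I' \<Longrightarrow> c (\<sigma> i) \<le> c' i"
  shows "psys G S I' (\<lambda>i. v (\<sigma> i)) (\<lambda>i. m (\<sigma> i)) c' (\<lambda>i. f (\<sigma> i))"
proof
  show "finite S" "S \<subseteq> carrier G" "generate G S = carrier G" by (rule S_fin S_sub S_gen)+
  have I: "\<sigma> i \<in> I" if "i \<in> I'" for i using that \<sigma> by blast
  show "v (\<sigma> i) \<in> carrier G" "0 < m (\<sigma> i)" if "i \<in> I'" for i using I[OF that] m_pos by simp_all
  show "0 \<le> c' i" if "i \<in> I'" for i using I[OF that] c_nonneg c'[OF that] by force
  show "f (\<sigma> i) (v (\<sigma> i) \<otimes> s) = f (\<sigma> i) s + m (\<sigma> i)" if "i \<in> I'" "s \<in> carrier G" for i s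
    using I that f_v by simp
  show "\<exists>p q. \<forall>s \<in> carrier G. \<bar>f (\<sigma> i) s - p\<bar> \<le> c' i \<or> \<bar>f (\<sigma> j) (inv x \<otimes> s) - q\<bar> \<le> c' j"
    if "i \<in> I'" "j \<in> I'" "x \<in> carrier G" "\<not> (i = j \<and> x \<in> C (\<sigma> i))" for i j x
  proof -
    have "\<not> (\<sigma> i = \<sigma> j \<and> x \<in> C (\<sigma> i))" using that \<sigma>(1) by (auto dest: inj_onD)
    from CB[OF I[OF that(1)] I[OF that(2)] that(3) this] obtain p q where
      "\<forall>s \<in> carrier G. \<bar>f (\<sigma> i) s - p\<bar> \<le> c (\<sigma> i) \<or> \<bar>f (\<sigma> j) (inv x \<otimes> s) - q\<bar> \<le> c (\<sigma> j)" by blast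
    then have "\<forall>s \<in> carrier G. \<bar>f (\<sigma> i) s - p\<bar> \<le> c' i \<or> \<bar>f (\<sigma> j) (inv x \<otimes> s) - q\<bar> \<le> c' j"
      using c'[OF that(1)] c'[OF that(2)] by force
    then show ?thesis by blast
  qed
  show "finite {(i, x <# C (\<sigma> i)) | i x. i \<in> I' \<and> x \<in> carrier G \<and> \<bar>f (\<sigma> i) (inv x \<otimes> s) - f (\<sigma> i) (inv x)\<bar> > c' i}"
    (is "finite ?F") if s: "s \<in> S" for s
  proof (rule finite_imageD)
    have "map_prod \<sigma> id ` ?F \<subseteq> {(i, x <# C i) | i x. i \<in> I \<and> x \<in> carrier G \<and> \<bar>f i (inv x \<otimes> s) - f i (inv x)\<bar> > c i}"
    proof (clarsimp simp: map_prod_def)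
      fix i x assume "i \<in> I'" "x \<in> carrier G" "c' i < \<bar>f (\<sigma> i) (inv x \<otimes> s) - f (\<sigma> i) (inv x)\<bar>"
      then show "\<exists>x'. x <# C (\<sigma> i) = x' <# C (\<sigma> i) \<and> \<sigma> i \<in> I \<and> x' \<in> carrier G \<and>
          c (\<sigma> i) < \<bar>f (\<sigma> i) (inv x' \<otimes> s) - f (\<sigma> i) (inv x')\<bar>"
        using I c'[of i] by (intro exI[of _ x]) auto
    qed
    then show "finite (map_prod \<sigma> id ` ?F)" using Fg[OF s] finite_subset by blast
    show "inj_on (map_prod \<sigma> id) ?F" using \<sigma>(1) by (auto intro!: inj_onI dest: inj_onD)
  qed
qed

lemma bounded_pt:
  assumes "\<And>i g l. i \<in> I \<Longrightarrow> g \<in> carrier G \<Longrightarrow> \<bar>f i (g \<otimes> u [^] (l::int)) - f i g\<bar> \<le> B" "u \<in> carrier G" "Y \<in> Ln"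
  shows "\<bar>\<delta> Y (pt \<one>) (pt (u [^] (l::int)))\<bar> \<le> B"
proof -
  obtain i x where "i \<in> I" "x \<in> carrier G" "Y = (i, x <# C i)" using assms(3) by (rule Ln_cases)
  then show ?thesis using \<delta>_pt[of i x \<one> "u [^] l"] assms(1)[of i "inv x" l] assms(2) by simp
qed

lemma stab_base:
  assumes "i \<in> I" "g \<in> carrier G" "h \<in> carrier G"
  shows "act g (base i) = act h (base i) \<longleftrightarrow> inv g \<otimes> h \<in> C i"
  using assms lcoset_eq[of i g h] by (simp add: base_def act_frame)

end

locale psysN = psys G S I v m c f
  for G (structure) and S and I :: "nat set" and v m c f
begin

text \<open>A nontrivial \<open>u\<close> stabilises at most one line (\<open>stab_two\<close>).
  Beyond the class of that line \<open>bounded_orbit\<close> applies everywhere.\<close>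

lemma orbit_bounded:
  assumes E: "\<And>i. i \<in> I \<Longrightarrow> c i \<le> E" and u: "u \<in> carrier G" "u \<noteq> \<one>"
  shows "\<exists>n0 B. \<forall>i \<in> I. n0 \<le> i \<longrightarrow> (\<forall>g \<in> carrier G. \<forall>l::int. \<bar>f i (g \<otimes> u [^] l) - f i g\<bar> \<le> B)"
proof -
  have "45 * c (fst Y) \<le> 45 * \<bar>E\<bar>" if "Y \<in> Ln" for Y using E[OF fst_Ln[OF that]] by simp
  from lsys.bounded_orbit[OF u(1) pt_Pt[OF one_closed] this] obtain B where
    B: "\<And>Y l. Y \<in> Ln \<Longrightarrow> act u Y \<noteq> Y \<Longrightarrow> \<bar>\<delta> Y (pt \<one>) (pact (u [^] (l::int)) (pt \<one>))\<bar> \<le> B"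
    by auto
  have "\<exists>n0. \<forall>Y \<in> Ln. n0 \<le> fst Y \<longrightarrow> act u Y \<noteq> Y"
  proof (cases "\<exists>Y \<in> Ln. act u Y = Y")
    case True
    then obtain Y where Y: "Y \<in> Ln" "act u Y = Y" by blast
    have "act u Z \<noteq> Z" if "Z \<in> Ln" "Suc (fst Y) \<le> fst Z" for Z
      using stab_two[OF u(1) Y that(1)] u(2) that(2) by (metis Suc_n_not_le_n)
    then show ?thesis by blast
  qed blast
  then obtain n0 where n0: "\<And>Y. Y \<in> Ln \<Longrightarrow> n0 \<le> fst Y \<Longrightarrow> act u Y \<noteq> Y" by blast
  have "\<bar>f i (g \<otimes> u [^] l) - f i g\<bar> \<le> B" if "i \<in> I" "n0 \<le> i" "g \<in> carrier G" for i g and l :: int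
    using B[of "(i, inv g <# C i)" l] n0[of "(i, inv g <# C i)"] \<delta>_pt[of i "inv g" \<one> "u [^] l"] that u
    by (simp add: pact_pt)
  then show ?thesis by blast
qed

lemma gen_bounded:
  assumes E: "\<And>i. i \<in> I \<Longrightarrow> c i \<le> E"
  shows "\<exists>B. \<forall>s \<in> S. \<forall>Y \<in> Ln. \<bar>\<delta> Y (pt \<one>) (pt s)\<bar> \<le> B"
proof -
  have "\<exists>B. \<forall>Y \<in> Ln. \<bar>\<delta> Y (pt \<one>) (pt s)\<bar> \<le> B" if "s \<in> S" for s
    using lsys.d_bounded[of "pt \<one>" "pt s" "45 * E"] that S_sub E by auto
  then obtain B where B: "\<And>s Y. s \<in> S \<Longrightarrow> Y \<in> Ln \<Longrightarrow> \<bar>\<delta> Y (pt \<one>) (pt s)\<bar> \<le> B s" by metis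
  have "\<bar>\<delta> Y (pt \<one>) (pt s)\<bar> \<le> (\<Sum>s\<in>S. \<bar>B s\<bar>)" if "s \<in> S" "Y \<in> Ln" for s Y
    using B[OF that] member_le_sum[of s S "\<lambda>s. \<bar>B s\<bar>"] that S_fin by auto
  then show ?thesis by blast
qed

end

context psys
begin

lemma piv_shift_mult:
  assumes "k > 0" "\<And>j. \<kappa> j \<in> I" "z \<in> carrier G"
  shows "piv \<kappa> k z M (i + int k * l) = act (R \<kappa> k z M [^] l) (piv \<kappa> k z M i)"
proof -
  note [simp] = R_closed[OF assms] V_closed[OF assms]
  have "(i + int k * l) div int k = i div int k + l" "(i + int k * l) mod int k = i mod int k" using assms(1) by simp_all
  then have "piv \<kappa> k z M (i + int k * l) = act (R \<kappa> k z M [^] l \<otimes> (R \<kappa> k z M [^] (i div int k) \<otimes>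
      zig \<kappa> M (nat (i mod int k)))) (base (\<kappa> (nat (i mod int k))))"
    unfolding piv_def[OF assms] by (simp add: m_assoc[symmetric] int_pow_mult[symmetric] add.commute)
  then show ?thesis by (simp add: piv_def[OF assms] act_mult' assms)
qed

lemma zig_generate:
  assumes "\<And>j. \<kappa> j \<in> I" shows "zig \<kappa> M k \<in> generate G (v ` range \<kappa>)"
proof (induction k)
  case 0
  then show ?case by (simp add: zig_def generate.one)
next
  case (Suc k)
  have "v (\<kappa> k) [^] n \<in> generate G (v ` range \<kappa>)" for n :: nat
  proof (induction n)
    case (Suc n)
    have "v (\<kappa> k) \<in> generate G (v ` range \<kappa>)" by (rule generate.incl) blast
    from generate.eng[OF Suc this] show ?case by simp
  qed (simp add: generate.one)
  moreover have "zig \<kappa> M (Suc k) = zig \<kappa> M k \<otimes> v (\<kappa> k) [^] M"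
    unfolding zig_def using assms by (simp add: lprod_append image_subset_iff)
  ultimately show ?case using Suc by (auto intro: generate.eng)
qed

end

context psysN
begin

text \<open>The pivots run cyclically through the classes 0, ..., k - 1, so the class of a pivot
  shows its position modulo \<open>k\<close>. A translate that shares pivots in the same order comes
  from a power of \<open>R\<close>, and opposite order would force \<open>k\<close> to divide 2. As
  \<open>M\<close> is chosen last, \<open>D\<close> does not depend on \<open>B\<close>.\<close>

theorem fill_axis:
  assumes I: "I = UNIV" and c: "\<And>i. c i = c0" "1 \<le> c0" and k: "3 \<le> k" and z: "z \<in> carrier G"
  shows "\<exists>D \<ge> 0. \<forall>B. \<exists>V fW. V \<in> generate G (range v) \<and>
     psys G S ({0} \<union> {k..}) (\<lambda>i. if i \<in> {0} then V \<otimes> inv z else v i) (\<lambda>i. if i \<in> {0} then int k else m i)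
       (\<lambda>i. if i \<in> {0} then 6 else D) (\<lambda>i s. if i \<in> {0} then fW s else f i s) \<and>
     (\<forall>s \<in> carrier G. \<forall>t \<in> carrier G. (\<forall>Y \<in> Ln. \<bar>\<delta> Y (pt s) (pt t)\<bar> \<le> B) \<longrightarrow> \<bar>fW s - fW t\<bar> \<le> 1)"
proof -
  have kk: "k > 0" "\<And>j. id j \<in> I" using k I by auto
  note prm = kk z
  let ?P = "piv id k z" and ?R = "R id k z" and ?E = "45 * c0"
  note [simp] = R_closed[OF prm] V_closed[OF prm] piv_Ln[OF prm]
  have ne: "pre id k z j \<noteq> base (id j) \<and> nxt id k z j \<noteq> base (id j)" if "j < k" for j
  proof -
    have "fst (pre id k z j) \<noteq> j" "fst (nxt id k z j) \<noteq> j"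
      using k that by (auto simp: pre_def[OF prm] nxt_def[OF prm])
    then show ?thesis by auto
  qed
  obtain D where D: "?E \<le> D" "\<And>K. \<exists>M0. \<forall>M \<ge> M0. lsys.chain K D (?P M)"
    using piv_chain[OF prm ne, of ?E] c by auto
  obtain BS where BS: "\<And>s Y. s \<in> S \<Longrightarrow> Y \<in> Ln \<Longrightarrow> \<bar>\<delta> Y (pt \<one>) (pt s)\<bar> \<le> BS" using gen_bounded[of c0] c by (metis order_refl)
  have main: "\<exists>V fW. V \<in> generate G (range v) \<and>
     psys G S ({0} \<union> {k..}) (\<lambda>i. if i \<in> {0} then V \<otimes> inv z else v i) (\<lambda>i. if i \<in> {0} then int k else m i)
       (\<lambda>i. if i \<in> {0} then 6 else D + ?E) (\<lambda>i s. if i \<in> {0} then fW s else f i s) \<and>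
     (\<forall>s \<in> carrier G. \<forall>t \<in> carrier G. (\<forall>Y \<in> Ln. \<bar>\<delta> Y (pt s) (pt t)\<bar> \<le> B) \<longrightarrow> \<bar>fW s - fW t\<bar> \<le> 1)" for B
  proof -
    define K where "K = 20 * D + 3 * \<bar>B\<bar> + 3 * \<bar>BS\<bar>"
    obtain M where M: "lsys.chain K D (?P M)" using D(2)[of K] by blast
    have noshare: "x \<in> cyc G (?R M)" if x: "x \<in> carrier G" and sh: "lsys.share (?P M) (\<lambda>i. act x (?P M i))" for x
    proof -
      have cl: "a mod int k = b mod int k" if "?P M a = act x (?P M b)" for a b
      proof -
        have "fst (?P M a) = fst (act x (?P M b))" using that by simp
        then have "nat (a mod int k) = nat (b mod int k)" by (simp add: fst_piv[OF prm])
        then show ?thesis using kk(1) by (simp add: eq_nat_nat_iff)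
      qed
      obtain a b where ab: "?P M a = act x (?P M b) \<and> ?P M (a + 1) = act x (?P M (b + 1)) \<or>
          ?P M a = act x (?P M b) \<and> ?P M (a + 1) = act x (?P M (b - 1))"
        using sh unfolding lsys.share_def by blast
      then show ?thesis
      proof (elim disjE conjE)
        assume eq: "?P M a = act x (?P M b)" "?P M (a + 1) = act x (?P M (b + 1))"
        obtain l where l: "a = b + int k * l" using cl[OF eq(1)] by (metis mod_eq_dvd_iff dvd_def diff_eq_eq add.commute)
        have sh: "?P M (i + int k * l) = act (?R M [^] l) (?P M i)" for i by (rule piv_shift_mult[OF prm])
        let ?g = "inv (?R M [^] l) \<otimes> x"
        have "act x (?P M b) = act (?R M [^] l) (?P M b)" "act x (?P M (b + 1)) = act (?R M [^] l) (?P M (b + 1))"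
          using eq sh[of b] sh[of "b + 1"] l by (simp_all add: algebra_simps)
        then have fx: "act ?g (?P M b) = ?P M b" "act ?g (?P M (b + 1)) = ?P M (b + 1)"
          using x by (simp_all add: act_mult')
        have "?P M b \<noteq> ?P M (b + 1)" using M unfolding lsys.chain_def by blast
        then have "?g = \<one>" using stab_two[OF _ _ fx(1) _ fx(2)] x by simp
        then have "x = ?R M [^] l" using x by (simp add: inv_solve_left' flip: inv_inv)
        then show ?thesis by simp
      next
        assume eq: "?P M a = act x (?P M b)" "?P M (a + 1) = act x (?P M (b - 1))"
        have "int k dvd a - b" "int k dvd (a + 1) - (b - 1)"
          using cl[OF eq(1)] cl[OF eq(2)] mod_eq_dvd_iff by blast+
        then have "int k dvd ((a + 1) - (b - 1)) - (a - b)" using dvd_diff by blast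
        then have "int k dvd 2" by simp
        then have "int k \<le> 2" by (rule zdvd_imp_le) simp
        then show ?thesis using k by simp
      qed
    qed
    have E1: "1 \<le> ?E" "?E \<le> D" "20 * D \<le> K" "0 \<le> D" using c D by (auto simp: K_def)
    have near: "3 * \<bar>\<delta> Y (pt \<one>) (pt s)\<bar> \<le> K" if "s \<in> S" "Y \<in> Ln" for s Y
      using BS[OF that] E1 unfolding K_def by linarith
    have BP: "Y \<noteq> ?P M i" if "fst Y \<in> {k..}" for Y i
    proof -
      have "nat (i mod int k) < k" using kk(1) by (simp add: nat_less_iff)
      then show ?thesis using that by (auto simp: fst_piv[OF prm])
    qed
    have sh1: "?P M (i + int k) = act (?R M) (?P M i)" for i by (rule piv_shift[OF prm])
    note ax = axis_psys[of ?E D K "{0}" "{k..}" "\<lambda>_. ?P M" "\<lambda>_. ?R M" "\<lambda>_. int k"]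
    have 1: "psys G S ({0} \<union> {k..}) (\<lambda>i. if i \<in> {0} then ?R M else v i) (\<lambda>i. if i \<in> {0} then int k else m i)
       (\<lambda>i. if i \<in> {0} then 6 else D + ?E) (\<lambda>i s. if i \<in> {0} then lsys.pos (?P M) ?E (pt s) else f i s)"
      by (rule ax(1)) (use c E1 k I M noshare near BP kk sh1 in auto)
    have 2: "\<bar>lsys.pos (?P M) ?E (pt s) - lsys.pos (?P M) ?E (pt t)\<bar> \<le> 1"
      if st: "s \<in> carrier G" "t \<in> carrier G" "\<forall>Y \<in> Ln. \<bar>\<delta> Y (pt s) (pt t)\<bar> \<le> B" for s t
    proof -
      have near': "3 * \<bar>\<delta> Y (pt s) (pt t)\<bar> \<le> K" if "Y \<in> Ln" for Y using st(3) that E1 unfolding K_def by force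
      show ?thesis
      proof (rule ax(2)[of 0 s t])
        show "3 * \<bar>\<delta> Y (pt s) (pt t)\<bar> \<le> K" if "Y \<in> Ln" for Y by (rule near'[OF that])
      qed (use c E1 k I M noshare near BP kk sh1 st(1,2) in auto)
    qed
    have "zig id M k \<in> generate G (range v)" using zig_generate[of id M k] kk(2) by simp
    then show ?thesis
      by (intro exI[of _ "zig id M k"] exI[of _ "\<lambda>s. lsys.pos (?P M) ?E (pt s)"] conjI 1[unfolded R_def[OF prm]] ballI impI 2)
        (assumption | erule bspec)+
  qed
  have "0 \<le> D + ?E" using c D by simp
  then show ?thesis using main by blast
qed

text \<open>Here one class of lines has to produce infinitely many. All pivots have the same class,
  so opposite order is excluded by \<open>rev\<close> instead. Different exponents of
  \<open>v 0\<close> give axes that are not translates of each other.\<close>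

theorem initial_axis:
  assumes I: "I = {0}" and t: "t \<in> carrier G" and c: "1 \<le> c 0"
    and ne: "t \<notin> C 0" and rev: "\<And>p::int. t \<otimes> v 0 [^] p \<otimes> t \<notin> C 0"
  shows "\<exists>M0 f'. psys G S (UNIV :: nat set) (\<lambda>j. v 0 [^] (M0 + j) \<otimes> t) (\<lambda>_. 1) (\<lambda>_. 6) f'"
proof -
  have I0 [simp]: "0 \<in> I" using I by simp
  let ?\<kappa> = "\<lambda>_::nat. 0::nat" and ?y = "v 0" and ?l = "base 0"
  have prm: "(1::nat) > 0" "\<And>j. ?\<kappa> j \<in> I" "inv t \<in> carrier G" using t by auto
  let ?P = "piv ?\<kappa> 1 (inv t)" and ?R = "R ?\<kappa> 1 (inv t)" and ?E = "45 * c 0"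
  note [simp] = R_closed[OF prm, unfolded One_nat_def] R_closed[OF prm] piv_Ln[OF prm]
  have y: "?y \<in> carrier G" "?l \<in> Ln" by simp_all
  have Req: "?R M = ?y [^] M \<otimes> t" for M
    unfolding R_def[OF prm] using y t by (simp add: zig_def)
  note Req' = Req[unfolded One_nat_def]
  have tl: "act t ?l \<noteq> ?l" "act (inv t) ?l \<noteq> ?l"
  proof -
    show "act t ?l \<noteq> ?l"
    proof
      assume "act t ?l = ?l"
      then have "inv t \<in> C 0" using stab_base[of 0 t \<one>] t y by simp
      then show False using ne subgroup.m_inv_closed[OF C_subgroup[of 0]] t by fastforce
    qed
    show "act (inv t) ?l \<noteq> ?l" using stab_base[of 0 "inv t" \<one>] t y ne by simp
  qed
  have "pre ?\<kappa> 1 (inv t) j \<noteq> base (?\<kappa> j) \<and> nxt ?\<kappa> 1 (inv t) j \<noteq> base (?\<kappa> j)" if "j < 1" for j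
    unfolding pre_def[OF prm] nxt_def[OF prm] using that tl t by simp
  then obtain D where D: "?E \<le> D" "\<And>K. \<exists>M0. \<forall>M \<ge> M0. lsys.chain K D (?P M)"
    using piv_chain[OF prm, of ?E] I by (metis order_refl singletonD)
  obtain BS where BS: "\<And>s Y. s \<in> S \<Longrightarrow> Y \<in> Ln \<Longrightarrow> \<bar>\<delta> Y (pt \<one>) (pt s)\<bar> \<le> BS" using gen_bounded[of "c 0"] I by (metis order_refl singletonD)
  define K where "K = 20 * D + 3 * \<bar>BS\<bar>"
  obtain M0 where M0: "\<And>M. M \<ge> M0 \<Longrightarrow> lsys.chain K D (?P M)" using D(2)[of K] by blast
  have P: "?P M i = act (?R M [^] i) ?l" for M i
    unfolding piv_def[OF prm] using V_0[OF prm] by simp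
  have yl: "act (?y [^] (p::int)) ?l = ?l" for p using stab_base[of 0 "?y [^] p" \<one>] y by (simp add: int_pow_neg[symmetric])
  have yt: "?y [^] (p::int) = \<one> \<Longrightarrow> p = 0" for p using f_pow[of 0 \<one> p] m_pos[of 0] by simp
  have noshare: "M = M' \<and> x \<in> cyc G (?R M)"
    if x: "x \<in> carrier G" and sh: "lsys.share (?P M) (\<lambda>i. act x (?P M' i))" for x M M'
  proof -
    have Rl: "act (?R M [^] (1::int)) ?l = act (?y [^] int M) (act t ?l)" for M
      using y t by (simp add: Req' act_mult' int_pow_int)
    have Rn: "act (?R M [^] (-1::int)) ?l = act (inv t) ?l" for M
    proof -
      have "?R M [^] (-1::int) = inv t \<otimes> ?y [^] (- int M)"
        using y t by (simp add: Req' int_pow_neg inv_mult_group int_pow_int)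
      then show ?thesis using y t yl[of "- int M"] by (simp add: act_mult')
    qed
    have cut: "?R M [^] (a + 1 + i) = ?R M [^] (a + 1) \<otimes> ?R M [^] i" for M and a i :: int by (simp add: int_pow_mult)
    define sg :: "int \<Rightarrow> bool \<Rightarrow> int" where "sg i b = (if b then i else - i)" for i b
    obtain a b dir where sh': "\<And>i. i \<in> {0, 1, 2} \<Longrightarrow> ?P M (a + i) = act x (?P M' (b + sg i dir))"
    proof -
      obtain a b where "(?P M a = act x (?P M' b) \<and> ?P M (a + 1) = act x (?P M' (b + 1)) \<and> ?P M (a + 2) = act x (?P M' (b + 2)) \<or>
         ?P M a = act x (?P M' b) \<and> ?P M (a + 1) = act x (?P M' (b - 1)) \<and> ?P M (a + 2) = act x (?P M' (b - 2)))"
        using sh unfolding lsys.share_def by blast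
      then show ?thesis
      proof (elim disjE conjE)
        assume "?P M a = act x (?P M' b)" "?P M (a + 1) = act x (?P M' (b + 1))" "?P M (a + 2) = act x (?P M' (b + 2))"
        then show ?thesis by (intro that[of a b True]) (auto simp: sg_def)
      next
        assume "?P M a = act x (?P M' b)" "?P M (a + 1) = act x (?P M' (b - 1))" "?P M (a + 2) = act x (?P M' (b - 2))"
        then show ?thesis by (intro that[of a b False]) (auto simp: sg_def)
      qed
    qed
    define c1 where "c1 = b + sg 1 dir"
    define h where "h = inv (?R M [^] (a + 1)) \<otimes> x \<otimes> ?R M' [^] c1"
    have h: "h \<in> carrier G" using x by (simp add: h_def)
    have hP: "act h (act (?R M' [^] (sg i dir)) ?l) = act (?R M [^] i) ?l" if "i \<in> {-1, 0, 1}" for i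
    proof -
      have c1i: "c1 + sg i dir = b + sg (1 + i) dir" by (simp add: c1_def sg_def)
      have "act h (act (?R M' [^] (sg i dir)) ?l) = act (inv (?R M [^] (a + 1))) (act x (act (?R M' [^] (c1 + sg i dir)) ?l))"
        using x y by (simp add: h_def act_mult' int_pow_mult)
      also have "act x (act (?R M' [^] (c1 + sg i dir)) ?l) = ?P M (a + (1 + i))"
        using sh'[of "1 + i"] that unfolding c1i P by auto
      also have "\<dots> = act (?R M [^] (a + 1)) (act (?R M [^] i) ?l)"
        unfolding P using cut[of M a i] y by (simp add: add.assoc act_mult')
      finally show ?thesis using y by (simp add: act_mult'[symmetric] cancel_inv)
    qed
    have hl: "act h ?l = ?l" using hP[of 0] y by (cases dir) (simp_all add: sg_def)
    show ?thesis
    proof (cases dir)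
      \<comment> \<open>Same direction: \<open>h\<close> fixes two adjacent pivots and is therefore
        trivial, and the third pivot compares the exponents \<open>M\<close> and
        \<open>M'\<close>.\<close>
      case True
      have "act h (act (inv t) ?l) = act (inv t) ?l" using hP[of "-1"] True Rn by (simp add: sg_def)
      then have h1: "h = \<one>" using stab_two[OF h y(2) hl, of "act (inv t) ?l"] tl t y by simp
      then have "act (?y [^] int M') (act t ?l) = act (?y [^] int M) (act t ?l)"
        using hP[of 1] True Rl y t by (simp add: sg_def)
      then have "act (?y [^] (- int M)) (act (?y [^] int M') (act t ?l)) = act t ?l"
        using y t by (simp add: act_mult'[symmetric] int_pow_neg cancel_inv)
      then have "act (?y [^] (int M' - int M)) (act t ?l) = act t ?l"
        using y t int_pow_mult[of ?y "- int M" "int M'"] by (simp add: act_mult'[symmetric] m_assoc)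
      then have "?y [^] (int M' - int M) = \<one>"
        using stab_two[OF _ y(2) yl, of "int M' - int M" "act t ?l"] tl t y by simp
      then have MM: "M = M'" using yt by fastforce
      have "x = ?R M [^] (a + 1) \<otimes> h \<otimes> inv (?R M' [^] c1)" using x by (simp add: h_def m_assoc cancel_inv)
      then have "x = ?R M [^] (a + 1 - c1)" using h1 MM by (simp add: int_pow_mult int_pow_neg diff_conv_add_uminus del: add_uminus_conv_diff)
      then show ?thesis using MM by simp
    next
      \<comment> \<open>Opposite direction: \<open>h\<close> fixes the middle pivot and exchanges
        the directions of its neighbours, which is what \<open>rev\<close> rules out.\<close>
      case False
      have "h \<in> C 0" 
        using stab_base[of 0 \<one> h] hl h y by simp
      then obtain p :: int where p: "h = ?y [^] p" by (auto simp: cyc_def)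
      have "act h (act (?y [^] int M') (act t ?l)) = act (inv t) ?l"
        using hP[of "-1"] False Rl Rn by (simp add: sg_def)
      then have "act (?y [^] (p + int M') \<otimes> t) ?l = act (inv t) ?l"
        using p y t by (simp add: act_mult' int_pow_mult)
      then have "inv (inv t) \<otimes> (?y [^] (p + int M') \<otimes> t) \<in> C 0" using stab_base[of 0 "inv t" "?y [^] (p + int M') \<otimes> t"] t y by simp
      then show ?thesis using rev[of "p + int M'"] t y by (simp add: m_assoc)
    qed
  qed
  have E1: "1 \<le> ?E" "?E \<le> D" "20 * D \<le> K" using c D by (auto simp: K_def)
  have near: "3 * \<bar>\<delta> Y (pt \<one>) (pt s)\<bar> \<le> K" if "s \<in> S" "Y \<in> Ln" for s Y
    using BS[OF that] E1 c unfolding K_def by linarith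
  have "psys G S (UNIV \<union> {}) (\<lambda>i. if i \<in> UNIV then ?R (M0 + i) else v i) (\<lambda>i. if i \<in> UNIV then 1 else m i)
     (\<lambda>i. if i \<in> UNIV then 6 else D + ?E) (\<lambda>i s. if i \<in> UNIV then lsys.pos (?P (M0 + i)) ?E (pt s) else f i s)"
  proof (rule axis_psys(1)[of ?E D K UNIV "{}" "\<lambda>a. ?P (M0 + a)" "\<lambda>a. ?R (M0 + a)" "\<lambda>_. 1"])
    show "\<not> lsys.share (?P (M0 + a)) (\<lambda>i. act x (?P (M0 + b) i))"
      if "x \<in> carrier G" "\<not> (a = b \<and> x \<in> cyc G (?R (M0 + a)))" for a b x
      using noshare[OF that(1), of "M0 + a" "M0 + b"] that(2) by auto
    show "?P (M0 + a) (i + 1) = act (?R (M0 + a)) (?P (M0 + a) i)" for a i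
      using piv_shift[OF prm, of "M0 + a" i] by simp
  qed (use I E1 M0 near in auto)
  then show ?thesis unfolding Req by auto
qed

end

section \<open>Quotients by spinning families\<close>

lemma (in group) conj_hom: "g \<in> carrier G \<Longrightarrow> (\<lambda>x. g \<otimes> x \<otimes> inv g) \<in> hom G G"
  by (rule homI) (simp_all add: m_assoc cancel_inv)

lemma (in group) conj_int_pow:
  "g \<in> carrier G \<Longrightarrow> x \<in> carrier G \<Longrightarrow> (g \<otimes> x \<otimes> inv g) [^] (n::int) = g \<otimes> x [^] n \<otimes> inv g"
  using hom_int_pow[OF conj_hom _ is_group is_group, of g x n] by simp

context psys
begin

definition rot :: "'i \<times> 'a set \<Rightarrow> 'a" where
  "rot Y = rp Y \<otimes> v (fst Y) \<otimes> inv (rp Y)"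

lemma rot_closed [simp]: "Y \<in> Ln \<Longrightarrow> rot Y \<in> carrier G"
  by (simp add: rot_def)

lemma rot_pow: "Y \<in> Ln \<Longrightarrow> rot Y [^] (n::int) = rp Y \<otimes> v (fst Y) [^] n \<otimes> inv (rp Y)"
  by (simp add: rot_def conj_int_pow)

end

text \<open>By \<open>near\<close> the spinning lines hardly notice a generator, so that a good
  representative stays good when it is multiplied by one; \<open>fq_Fg\<close> depends on
  this.\<close>

locale psys_spin = psys G S I v m c f
  for G (structure) and S and I :: "'i set" and v m c f +
  fixes w :: 'i
  assumes w: "w \<in> I" and cw: "1 \<le> c w" and mw: "200 * (45 * c w) \<le> m w"
    and tf: "\<lbrakk>g \<in> carrier G; 0 < n; g [^] (n::nat) = \<one>\<rbrakk> \<Longrightarrow> g = \<one>"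
    and near: "\<lbrakk>s \<in> S; g \<in> carrier G\<rbrakk> \<Longrightarrow> \<bar>f w (g \<otimes> s) - f w g\<bar> \<le> 45 * c w"
begin

definition Sp where "Sp = {Y \<in> Ln. fst Y = w}"

sublocale sp: spinning_stab G Ln act Pt pact \<delta> ob "\<lambda>Y. 45 * cl Y" Sp rot "m w" "45 * c w"
proof
  show "rot (act g Y) = g \<otimes> rot Y \<otimes> inv g" if g: "g \<in> carrier G" and "Y \<in> Sp" for g Y
  proof -
    have Y: "Y \<in> Ln" using that by (simp add: Sp_def)
    obtain n :: int where n: "rp (act g Y) = g \<otimes> rp Y \<otimes> v (fst Y) [^] n" using rp_act[OF Y g] .
    have "v (fst Y) [^] n \<otimes> v (fst Y) = v (fst Y) \<otimes> v (fst Y) [^] n"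
      using Y int_pow_mult[of "v (fst Y)" n 1] int_pow_mult[of "v (fst Y)" 1 n] by (simp add: add.commute)
    then have "v (fst Y) [^] n \<otimes> v (fst Y) \<otimes> inv (v (fst Y) [^] n) = v (fst Y)" using Y by (simp add: m_assoc)
    then have vv: "v (fst Y) [^] n \<otimes> (v (fst Y) \<otimes> (inv (v (fst Y) [^] n) \<otimes> b)) = v (fst Y) \<otimes> b" if "b \<in> carrier G" for b
      using Y that by (simp add: m_assoc[symmetric])
    show ?thesis using Y g n vv by (simp add: rot_def inv_mult_group m_assoc)
  qed
  have rx: "inv (rot Y) \<otimes> rp Y = rp Y \<otimes> v w [^] (- 1 :: int)" if "Y \<in> Sp" for Y
    using that w by (auto simp: Sp_def rot_def inv_mult_group m_assoc int_pow_neg cancel_inv)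
  show "\<delta> Y x (pact (rot Y) x) = m w" if "Y \<in> Sp" "x \<in> Pt" for Y x
    using Pt_frame[OF that(2) w, of "rp Y" "- 1"] that rx[OF that(1)] by (simp add: \<delta>_def pact_def Sp_def)
  show "act (rot Y) Y = Y" if "Y \<in> Sp" for Y
  proof -
    have Y: "Y \<in> Ln" "fst Y = w" using that by (auto simp: Sp_def)
    have "rot Y \<otimes> rp Y = rp Y \<otimes> v w" using Y w by (simp add: rot_def m_assoc)
    then have "inv (rot Y \<otimes> rp Y) \<otimes> rp Y = v w [^] (- 1 :: int)"
      using Y w by (simp add: inv_mult_group m_assoc int_pow_neg)
    then have "inv (rot Y \<otimes> rp Y) \<otimes> rp Y \<in> C w" by (simp only: cyc_pow)
    then show ?thesis
      using act_frame[of "rot Y" w "rp Y"] lcoset_eq[of w "rot Y \<otimes> rp Y" "rp Y"] Ln_rp[OF Y(1)] Y w by simp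
  qed
  show "\<exists>l::int. g = rot Y [^] l" if "g \<in> carrier G" "Y \<in> Sp" "act g Y = Y" for g Y
  proof -
    have Y: "Y \<in> Ln" using that by (simp add: Sp_def)
    show ?thesis using stab_rotation[OF that(1) Y that(3)] rot_pow[OF Y] by metis
  qed
  show "Sp \<subseteq> Ln" by (auto simp: Sp_def)
  show "act g Y \<in> Sp" if "g \<in> carrier G" "Y \<in> Sp" for g Y using that by (simp add: Sp_def)
  show "rot Y \<in> carrier G" "45 * cl Y = 45 * c w" if "Y \<in> Sp" for Y using that by (simp_all add: Sp_def)
  show "1 \<le> 45 * c w" "200 * (45 * c w) \<le> m w" using cw mw by simp_all
  show "g = \<one>" if "g \<in> carrier G" "0 < n" "g [^] (n::nat) = \<one>" for g n using tf that by blast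
qed

declare sp.Sp_Ln [simp del]

abbreviation "N \<equiv> sp.N"

lemma N_act_pt: "n \<in> N \<Longrightarrow> s \<in> carrier G \<Longrightarrow> pact n (pt s) = pt (n \<otimes> s)"
  by (simp add: pact_pt)

lemma Sp_\<delta>:
  assumes "Y \<in> Sp" "s \<in> carrier G"
  shows "\<delta> Y (pt \<one>) (pt s) = f w (inv (rp Y) \<otimes> s) - f w (inv (rp Y))" "rp Y \<in> carrier G"
  using assms by (auto simp: \<delta>_def pt_def Sp_def)

lemma v_in_N: "v w \<in> N"
proof -
  have Y: "base w \<in> Sp" using w by (simp add: Sp_def)
  then have "rot (base w) \<in> N" unfolding sp.rotg_def by (intro generate.incl) blast
  then have "inv (rp (base w)) \<otimes> rot (base w) \<otimes> inv (inv (rp (base w))) \<in> N"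
    using sp.N_conj[of "inv (rp (base w))"] Y by (simp add: Sp_def)
  then show ?thesis using Y w by (simp add: rot_def Sp_def m_assoc cancel_inv)
qed

lemma near_gen: "s \<in> S \<Longrightarrow> g \<in> carrier G \<Longrightarrow> W \<in> Sp \<Longrightarrow> \<bar>\<delta> W (pt g) (pt (g \<otimes> s))\<bar> \<le> 45 * c w"
proof -
  assume s: "s \<in> S" "g \<in> carrier G" "W \<in> Sp"
  then have W: "W \<in> Ln" "fst W = w" "s \<in> carrier G" using S_sub by (auto simp: Sp_def)
  have "\<delta> W (pt g) (pt (g \<otimes> s)) = f w (inv (rp W) \<otimes> g \<otimes> s) - f w (inv (rp W) \<otimes> g)"
    using W s by (simp add: \<delta>_def pt_def m_assoc)
  then show ?thesis using near[OF s(1), of "inv (rp W) \<otimes> g"] W s by simp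
qed

lemma good_act:
  assumes "g \<in> carrier G" "Y \<in> Ln" "Y \<notin> Sp" "x \<in> Pt" "sp.good a Y x"
  shows "sp.good a (act g Y) (pact g x)"
  unfolding sp.good_def
proof
  fix W assume W: "W \<in> Sp"
  have "act (inv g) W \<in> Sp" using W assms(1) by simp
  moreover have "act g Y \<noteq> W" using W assms by (auto simp: Sp_def)
  then have "lsys.d W (ob (act g Y)) (pact g x) = lsys.d (act (inv g) W) (ob Y) x"
    using lsys.d_ob_act[of g Y W "pact g x"] lsys.d_shift2[of g W "ob Y" x] assms W by (simp add: Sp_def)
  ultimately show "2 * lsys.d W (ob (act g Y)) (pact g x) \<le> m w + a * (45 * c w)"
    using assms(5) unfolding sp.good_def by simp
qed

lemma good_act_base:
  assumes "i \<in> I" "i \<noteq> w" "g \<in> carrier G" "s \<in> carrier G"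
  shows "sp.good a (act g (base i)) (pt s) \<longleftrightarrow> sp.good a (base i) (pt (inv g \<otimes> s))"
proof -
  have "base i \<in> Ln" "base i \<notin> Sp" "act g (base i) \<notin> Sp" using assms by (auto simp: Sp_def)
  then show ?thesis
    using good_act[of g "base i" "pt (inv g \<otimes> s)" a] good_act[of "inv g" "act g (base i)" "pt s" a] assms
    by (auto simp: pact_pt cancel_inv)
qed

end

locale psys_quot = psys_spin G S I v m c f w + h: group_hom G H h
  for G (structure) and S and I :: "'i set" and v m c f w and H (structure) and h +
  assumes surj: "h ` carrier G = carrier H" and ker: "g \<in> carrier G \<Longrightarrow> h g = \<one>\<^bsub>H\<^esub> \<longleftrightarrow> g \<in> N"
begin

lemma h_eq:
  assumes "s \<in> carrier G" "t \<in> carrier G" "h s = h t"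
  obtains n where "n \<in> N" "t = n \<otimes> s"
proof -
  have "h (t \<otimes> inv s) = \<one>\<^bsub>H\<^esub>" using assms by simp
  then have "t \<otimes> inv s \<in> N" using ker[of "t \<otimes> inv s"] assms by simp
  then show ?thesis using that[of "t \<otimes> inv s"] assms by (simp add: m_assoc)
qed

lemma h_surj:
  assumes "A \<in> carrier H" obtains s where "s \<in> carrier G" "h s = A"
  using assms surj[symmetric] by auto

lemma h_N: "n \<in> N \<Longrightarrow> h n = \<one>\<^bsub>H\<^esub>"
  using ker by simp

text \<open>Any two good lifts agree up to a bounded error; the minimum is a choice that commutes with the action.\<close>

definition lifts :: "'i \<Rightarrow> 'c \<Rightarrow> int set" where
  "lifts i A = {f i s | s. s \<in> carrier G \<and> h s = A \<and> sp.good 40 (base i) (pt s)}"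

definition fq :: "'i \<Rightarrow> 'c \<Rightarrow> int" where "fq i A = Min (lifts i A)"

lemma lifts_close:
  assumes i: "i \<in> I" "i \<noteq> w" and s: "s \<in> carrier G" "t \<in> carrier G" "h s = h t"
    and g: "sp.good 60 (base i) (pt s)" "sp.good 60 (base i) (pt t)"
  shows "\<bar>f i s - f i t\<bar> \<le> 90 * c i"
proof -
  obtain n where n: "n \<in> N" "t = n \<otimes> s" using h_eq[OF s] .
  have "\<bar>\<delta> (base i) (pt s) (pact n (pt s))\<bar> \<le> 2 * (45 * cl (base i))"
    using sp.good_unique[of "base i" "pt s" n] n g i s by (simp add: N_act_pt Sp_def)
  then show ?thesis using \<delta>_pt[of i \<one> s t] n s i by (simp add: N_act_pt base_def[symmetric])
qed

lemma lift_ex: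
  assumes i: "i \<in> I" "i \<noteq> w" and A: "A \<in> carrier H"
  obtains s where "s \<in> carrier G" "h s = A" "sp.good 40 (base i) (pt s)"
proof -
  obtain s0 where s0: "s0 \<in> carrier G" "h s0 = A" using h_surj[OF A] .
  obtain n where "n \<in> N" "sp.good 40 (base i) (pact n (pt s0))"
    using sp.good_lift_ob[of "base i" "pt s0"] i s0 by auto
  then show ?thesis using that[of "n \<otimes> s0"] s0 A by (simp add: N_act_pt h_N)
qed

lemma lifts_fin:
  assumes i: "i \<in> I" "i \<noteq> w" and A: "A \<in> carrier H"
  shows "finite (lifts i A)" "lifts i A \<noteq> {}"
proof -
  obtain s where s: "s \<in> carrier G" "h s = A" "sp.good 40 (base i) (pt s)" using lift_ex[OF i A] .
  then show "lifts i A \<noteq> {}" by (auto simp: lifts_def)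
  have "lifts i A \<subseteq> {f i s - 90 * c i..f i s + 90 * c i}"
  proof
    fix p assume "p \<in> lifts i A"
    then obtain t where t: "p = f i t" "t \<in> carrier G" "h t = A" "sp.good 40 (base i) (pt t)" by (auto simp: lifts_def)
    have "\<bar>f i s - f i t\<bar> \<le> 90 * c i" using lifts_close[OF i s(1) t(2)] s t sp.good_mono by simp
    then show "p \<in> {f i s - 90 * c i..f i s + 90 * c i}" using t(1) by auto
  qed
  then show "finite (lifts i A)" using finite_subset by blast
qed

lemma fq_close:
  assumes i: "i \<in> I" "i \<noteq> w" and s: "s \<in> carrier G" and g: "sp.good 60 (base i) (pt s)"
  shows "\<bar>fq i (h s) - f i s\<bar> \<le> 90 * c i"
proof -
  have "fq i (h s) \<in> lifts i (h s)" unfolding fq_def using lifts_fin[OF i] s by (intro Min_in) auto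
  then obtain t where t: "fq i (h s) = f i t" "t \<in> carrier G" "h t = h s" "sp.good 40 (base i) (pt t)" by (auto simp: lifts_def)
  then show ?thesis using lifts_close[OF i t(2) s t(3)] sp.good_mono g by simp
qed

lemma fq_v:
  assumes i: "i \<in> I" "i \<noteq> w" and A: "A \<in> carrier H"
  shows "fq i (h (v i) \<otimes>\<^bsub>H\<^esub> A) = fq i A + m i"
proof -
  have fix_base: "act (v i) (base i) = base i" "act (inv (v i)) (base i) = base i"
    using stab_base[of i "v i" \<one>] stab_base[of i "inv (v i)" \<one>] i subgroup.m_inv_closed[OF C_subgroup[of i], of "v i"]
      cyc_pow[of "v i" 1] by simp_all
  have gv: "sp.good 40 (base i) (pt (v i \<otimes> s)) \<longleftrightarrow> sp.good 40 (base i) (pt s)" if "s \<in> carrier G" for s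
    using good_act_base[of i "v i" "v i \<otimes> s" 40] fix_base i that by (simp add: cancel_inv)
  have "lifts i (h (v i) \<otimes>\<^bsub>H\<^esub> A) = (\<lambda>p. p + m i) ` lifts i A"
  proof (intro equalityI subsetI)
    fix p assume "p \<in> lifts i (h (v i) \<otimes>\<^bsub>H\<^esub> A)"
    then obtain s where s: "p = f i s" "s \<in> carrier G" "h s = h (v i) \<otimes>\<^bsub>H\<^esub> A" "sp.good 40 (base i) (pt s)"
      by (auto simp: lifts_def)
    let ?t = "inv (v i) \<otimes> s"
    have "?t \<in> carrier G" "h ?t = A" "sp.good 40 (base i) (pt ?t)" "p = f i ?t + m i"
      using s i A gv[of ?t] f_v[of i ?t] h.H.cancel_inv(1)[of "h (v i)" A] by (simp_all add: cancel_inv)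
    then show "p \<in> (\<lambda>p. p + m i) ` lifts i A" by (auto simp: lifts_def)
  next
    fix p assume "p \<in> (\<lambda>p. p + m i) ` lifts i A"
    then obtain s where s: "p = f i s + m i" "s \<in> carrier G" "h s = A" "sp.good 40 (base i) (pt s)"
      by (auto simp: lifts_def)
    then show "p \<in> lifts i (h (v i) \<otimes>\<^bsub>H\<^esub> A)" unfolding lifts_def mem_Collect_eq
      by (intro exI[of _ "v i \<otimes> s"]) (use i gv f_v in simp)
  qed
  moreover have "Min ((\<lambda>p. p + m i) ` lifts i A) = Min (lifts i A) + m i"
    using mono_Min_commute[of "\<lambda>p. p + m i" "lifts i A"] lifts_fin[OF i A] by (simp add: mono_def)
  ultimately show ?thesis by (simp add: fq_def)
qed

text \<open>The lift \<open>x'\<close> of \<open>A\<close> puts its line \<open>?Y\<close> in good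
  position relative to \<open>base i\<close>. Let \<open>s\<close> be a lift of \<open>B\<close>
  that is good for \<open>base i\<close>. Either \<open>s\<close> projects to \<open>base i\<close>
  near \<open>?Y\<close>, or \<open>good_transfer\<close> makes it good for \<open>?Y\<close> too,
  where Behrstock's inequality in \<open>G\<close> bounds its distance from \<open>base i\<close>.
  Replacing \<open>f\<close> by \<open>fq\<close> costs 90c.\<close>

lemma fq_CB:
  assumes i: "i \<in> I" "i \<noteq> w" "j \<in> I" "j \<noteq> w" and A: "A \<in> carrier H" and ne: "\<not> (i = j \<and> A \<in> cyc H (h (v i)))"
  shows "\<exists>p q. \<forall>B \<in> carrier H. \<bar>fq i B - p\<bar> \<le> 225 * c i \<or> \<bar>fq j (inv\<^bsub>H\<^esub> A \<otimes>\<^bsub>H\<^esub> B) - q\<bar> \<le> 225 * c j"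
proof -
  obtain x where x: "x \<in> carrier G" "h x = A" using h_surj[OF A] .
  let ?Z = "base i"
  have Y0: "?Z \<in> Ln" "?Z \<notin> Sp" using i by (simp_all add: Sp_def)
  obtain n where n: "n \<in> N" "sp.good 40 ?Z (pact n (ob (act x (base j))))"
    using sp.good_lift_ob[OF Y0(1), of "ob (act x (base j))"] i x by auto
  define x' where "x' = n \<otimes> x"
  have x': "x' \<in> carrier G" "h x' = A" using n x A by (simp_all add: x'_def h_N)
  let ?Y = "act x' (base j)"
  have Y: "?Y \<in> Ln" "?Y \<notin> Sp" using i x' by (simp_all add: Sp_def)
  have gY: "sp.good 40 ?Z (ob ?Y)"
    unfolding sp.good_def
  proof
    fix W assume W: "W \<in> Sp"
    have "W \<noteq> act n (act x (base j))" using W i by (auto simp: Sp_def)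
    then have eq: "lsys.d W (ob ?Z) (ob ?Y) = lsys.d W (ob ?Z) (pact n (ob (act x (base j))))"
      using lsys.d_ob_act'[of n "act x (base j)" W "ob ?Z"] W n x i by (simp add: x'_def act_mult' Sp_def)
    show "2 * lsys.d W (ob ?Z) (ob ?Y) \<le> m w + 40 * (45 * c w)" 
      using bspec[OF n(2)[unfolded sp.good_def] W] unfolding eq .
  qed
  have YY: "?Z \<noteq> ?Y"
  proof
    assume eq: "?Z = ?Y"
    then have ij: "i = j" by (metis fst_act fst_base)
    then have "x' \<in> C i" using eq stab_base[of i \<one> x'] i x' Y0 by simp
    then have "A \<in> cyc H (h (v i))" using x' i by (auto simp: cyc_def h.hom_int_pow)
    then show False using ne ij by blast
  qed
  define p q where "p = f i \<one> + \<delta> ?Z (pt \<one>) (ob ?Y)" and "q = f j (inv x') + \<delta> ?Y (pt \<one>) (ob ?Z)"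
  have "\<bar>fq i B - p\<bar> \<le> 225 * c i \<or> \<bar>fq j (inv\<^bsub>H\<^esub> A \<otimes>\<^bsub>H\<^esub> B) - q\<bar> \<le> 225 * c j" if B: "B \<in> carrier H" for B
  proof -
    obtain s where s: "s \<in> carrier G" "h s = B" "sp.good 40 ?Z (pt s)" using lift_ex[OF i(1,2) B] .
    have fi: "\<bar>fq i B - f i s\<bar> \<le> 90 * c i" using fq_close[OF i(1,2) s(1)] s sp.good_mono by simp
    have di: "\<delta> ?Z (pt s) (ob ?Y) = p - f i s"
      using lsys.\<delta>_add[of ?Z "pt \<one>" "ob ?Y" "pt s"] \<delta>_pt[of i \<one> \<one> s] s i by (simp add: p_def base_def)
    have dj: "\<delta> ?Y (pt s) (ob ?Z) = q - f j (inv x' \<otimes> s)"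
      using lsys.\<delta>_add[of ?Y "pt \<one>" "ob ?Z" "pt s"] \<delta>_pt[of j x' \<one> s] s i x' by (simp add: q_def base_def act_frame)
    show ?thesis
    proof (cases "\<bar>\<delta> ?Z (pt s) (ob ?Y)\<bar> \<le> 2 * (45 * c i)")
      case True
      then show ?thesis using fi di c_nonneg[OF i(1)] by linarith
    next
      case False
      then have "sp.good 60 ?Y (pt s)" using sp.good_transfer[OF Y0 Y YY pt_Pt[OF s(1)] s(3) gY] by simp
      then have "sp.good 60 (base j) (pt (inv x' \<otimes> s))" using good_act_base[OF i(3,4) x'(1) s(1)] by simp
      then have "\<bar>fq j (h (inv x' \<otimes> s)) - f j (inv x' \<otimes> s)\<bar> \<le> 90 * c j" using fq_close[OF i(3,4), of "inv x' \<otimes> s"] x' s by simp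
      then have fj: "\<bar>fq j (inv\<^bsub>H\<^esub> A \<otimes>\<^bsub>H\<^esub> B) - f j (inv x' \<otimes> s)\<bar> \<le> 90 * c j" using x' s by simp
      have "\<bar>\<delta> ?Y (pt s) (ob ?Z)\<bar> \<le> 45 * c j"
        using lsys.coh[OF Y0(1) Y(1) YY pt_Pt[OF s(1)]] False c_nonneg[OF i(1)] by simp
      then show ?thesis using fj dj c_nonneg[OF i(3)] by linarith
    qed
  qed
  then show ?thesis by blast
qed

text \<open>A good lift \<open>a\<close> remains good after multiplication by the generator, so a
  jump of \<open>fq\<close> comes from a jump of \<open>f\<close> at \<open>a\<close>. Passing from
  \<open>fq\<close> to \<open>f\<close> costs 90c at each end, which 225c absorbs. Finitely many
  cosets upstairs then account for all cosets downstairs.\<close>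

lemma fq_Fg:
  assumes s: "s \<in> S" and J: "J \<subseteq> I - {w}"
  shows "finite {(i, A <#\<^bsub>H\<^esub> cyc H (h (v i))) | i A. i \<in> J \<and> A \<in> carrier H \<and>
      \<bar>fq i (inv\<^bsub>H\<^esub> A \<otimes>\<^bsub>H\<^esub> h s) - fq i (inv\<^bsub>H\<^esub> A)\<bar> > 225 * c i}" (is "finite ?F")
proof -
  let ?B = "{(i, x <# C i) | i x. i \<in> I \<and> x \<in> carrier G \<and> \<bar>f i (inv x \<otimes> s) - f i (inv x)\<bar> > c i}"
  have sc: "s \<in> carrier G" using s S_sub by blast
  have "?F \<subseteq> (\<lambda>(i, B). (i, h ` B)) ` ?B"
  proof
    fix Z assume "Z \<in> ?F"
    then obtain i A where Z: "Z = (i, A <#\<^bsub>H\<^esub> cyc H (h (v i)))" "i \<in> J" "A \<in> carrier H"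
      "\<bar>fq i (inv\<^bsub>H\<^esub> A \<otimes>\<^bsub>H\<^esub> h s) - fq i (inv\<^bsub>H\<^esub> A)\<bar> > 225 * c i" by blast
    have i: "i \<in> I" "i \<noteq> w" using Z J by auto
    obtain a where a: "a \<in> carrier G" "h a = inv\<^bsub>H\<^esub> A" "sp.good 40 (base i) (pt a)"
      using lift_ex[OF i, of "inv\<^bsub>H\<^esub> A"] Z(3) by auto
    have "sp.good 60 (base i) (pt (a \<otimes> s))"
      by (rule sp.good_near[OF a(3)]) (use near_gen[OF s a(1)] in simp)
    then have 1: "\<bar>fq i (h (a \<otimes> s)) - f i (a \<otimes> s)\<bar> \<le> 90 * c i" using fq_close[OF i, of "a \<otimes> s"] a sc by simp
    have 2: "\<bar>fq i (h a) - f i a\<bar> \<le> 90 * c i" using fq_close[OF i a(1)] a sp.good_mono by simp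
    have "\<bar>f i (a \<otimes> s) - f i a\<bar> > c i"
      using 1 2 Z(4) a sc c_nonneg[OF i(1)] by simp
    then have B: "(i, inv a <# C i) \<in> ?B" using i a by (intro CollectI exI[of _ i] exI[of _ "inv a"]) simp
    have hB: "h ` (inv a <# C i) = A <#\<^bsub>H\<^esub> cyc H (h (v i))"
    proof -
      have "h (inv a \<otimes> v i [^] n) = A \<otimes>\<^bsub>H\<^esub> h (v i) [^]\<^bsub>H\<^esub> n" for n :: int
        using a i Z(3) by (simp add: h.hom_int_pow)
      then show ?thesis by (auto simp: l_coset_def cyc_def image_iff)
    qed
    have "Z = (\<lambda>(i, B). (i, h ` B)) (i, inv a <# C i)" using Z(1) hB by simp
    then show "Z \<in> (\<lambda>(i, B). (i, h ` B)) ` ?B" using B by (rule image_eqI)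
  qed
  then show ?thesis using Fg[OF s] finite_subset by blast
qed

theorem quotient_psys:
  assumes J: "J \<subseteq> I - {w}"
  shows "psys H (h ` S) J (\<lambda>i. h (v i)) m (\<lambda>i. 225 * c i) fq"
proof
  have Ji: "i \<in> I" "i \<noteq> w" if "i \<in> J" for i using that J by auto
  show "finite (h ` S)" "h ` S \<subseteq> carrier H" using S_fin S_sub by auto
  show "generate H (h ` S) = carrier H" using h.generate_img[OF S_sub] S_gen surj by simp
  show "\<exists>p q. \<forall>s \<in> carrier H. \<bar>fq i s - p\<bar> \<le> 225 * c i \<or> \<bar>fq j (inv\<^bsub>H\<^esub> x \<otimes>\<^bsub>H\<^esub> s) - q\<bar> \<le> 225 * c j"
    if "i \<in> J" "j \<in> J" "x \<in> carrier H" "\<not> (i = j \<and> x \<in> cyc H (h (v i)))" for i j x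
    using fq_CB[OF Ji[OF that(1)] Ji[OF that(2)] that(3,4)] .
  show "finite {(i, x <#\<^bsub>H\<^esub> cyc H (h (v i))) | i x. i \<in> J \<and> x \<in> carrier H \<and>
      225 * c i < \<bar>fq i (inv\<^bsub>H\<^esub> x \<otimes>\<^bsub>H\<^esub> s) - fq i (inv\<^bsub>H\<^esub> x)\<bar>}" if s: "s \<in> h ` S" for s
    using s fq_Fg[OF _ J] by blast
qed (use J fq_v m_pos c_nonneg in auto)

end

text \<open>This is condition (I). The exponent \<open>n = 0\<close> is allowed, so that infinite
  order of \<open>t\<close> is included.\<close>

definition no_inversion :: "('a, 'b) monoid_scheme \<Rightarrow> 'a \<Rightarrow> bool" where
  "no_inversion G t \<longleftrightarrow> (\<forall>x \<in> carrier G. \<forall>(m::nat) (n::nat). 0 < m \<longrightarrow>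
     x \<otimes>\<^bsub>G\<^esub> t [^]\<^bsub>G\<^esub> m \<otimes>\<^bsub>G\<^esub> inv\<^bsub>G\<^esub> x \<otimes>\<^bsub>G\<^esub> t [^]\<^bsub>G\<^esub> n \<noteq> \<one>\<^bsub>G\<^esub>)"

lemma (in group) no_inversion_ne: "no_inversion G t \<Longrightarrow> t \<noteq> \<one>"
  unfolding no_inversion_def by (auto dest!: bspec[OF _ one_closed] spec[of _ "1::nat"])

definition sys :: "('a, 'b) monoid_scheme \<Rightarrow> 'a set \<Rightarrow> (nat \<Rightarrow> 'a) \<Rightarrow> bool" where
  "sys G S v \<longleftrightarrow> (\<exists>m c f. 1 \<le> c \<and> psys G S (UNIV :: nat set) v m (\<lambda>_. c) f)"

text \<open>The classes stabilised by \<open>t\<close> or \<open>a\<close> are dropped beforehand.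
  On the rest the powers of \<open>t\<close>, the element \<open>a\<close> and the generators have
  bounded displacement, so that multiplication by them changes the coordinate along the new axis by
  at most 1. This is the smallness that \<open>quotient_no_inversion\<close>,
  \<open>near_not_N\<close> and \<open>near\<close> ask for.\<close>

theorem (in group) fill:
  assumes sys: "sys G S v" and tf: "torsion_free G" and z: "z \<in> carrier G" and t: "t \<in> carrier G"
    and ni: "no_inversion G t" and a: "a \<in> carrier G" "a \<noteq> \<one>"
  obtains N n0 where "N \<lhd> G" "sys (G Mod N) ((#>) N ` S) (\<lambda>i. N #> v (i + n0))"
    "torsion_free (G Mod N)" "no_inversion (G Mod N) (N #> t)" "a \<notin> N"
    "\<exists>V \<in> generate G (range v). V \<otimes> inv z \<in> N"
proof -
  obtain m c f where c: "1 \<le> c" and P: "psys G S (UNIV :: nat set) v m (\<lambda>_. c) f" using sys unfolding sys_def by blast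
  interpret P: psysN G S UNIV v m "\<lambda>_. c" f using P by (simp add: psysN_def)
  have t1: "t \<noteq> \<one>" using no_inversion_ne[OF ni] .
  obtain nt Bt where Bt: "\<And>i g l. nt \<le> i \<Longrightarrow> g \<in> carrier G \<Longrightarrow> \<bar>f i (g \<otimes> t [^] (l::int)) - f i g\<bar> \<le> Bt"
    using P.orbit_bounded[of c t] t t1 by (metis UNIV_I order_refl)
  obtain na Ba where Ba: "\<And>i g l. na \<le> i \<Longrightarrow> g \<in> carrier G \<Longrightarrow> \<bar>f i (g \<otimes> a [^] (l::int)) - f i g\<bar> \<le> Ba"
    using P.orbit_bounded[of c a] a by (metis UNIV_I order_refl)
  define \<sigma> where "\<sigma> i = i + max nt na" for i :: nat
  have "psys G S UNIV (\<lambda>i. v (\<sigma> i)) (\<lambda>i. m (\<sigma> i)) (\<lambda>_. c) (\<lambda>i. f (\<sigma> i))"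
    by (rule P.psys_reindex) (auto simp: \<sigma>_def inj_on_def)
  then interpret P1: psysN G S UNIV "\<lambda>i. v (\<sigma> i)" "\<lambda>i. m (\<sigma> i)" "\<lambda>_. c" "\<lambda>i. f (\<sigma> i)"
    by (simp add: psysN_def)
  \<comment> \<open>\<open>200 * (45 * 6)\<close>: the axis has error constant 6, and \<open>k\<close> is its translation length.\<close>
  define k :: nat where "k = 54000"
  obtain BS where BS: "\<And>s Y. s \<in> S \<Longrightarrow> Y \<in> P1.Ln \<Longrightarrow> \<bar>P1.\<delta> Y (P1.pt \<one>) (P1.pt s)\<bar> \<le> BS"
    using P1.gen_bounded[of c] by (metis order_refl)
  define B where "B = \<bar>Bt\<bar> + \<bar>Ba\<bar> + \<bar>BS\<bar>"
  have B: "BS \<le> B" "Bt \<le> B" "Ba \<le> B" by (simp_all add: B_def)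
  obtain D V fW where D: "0 \<le> D" and V: "V \<in> generate G (range (\<lambda>i. v (\<sigma> i)))"
    and Q: "psys G S ({0} \<union> {k..}) (\<lambda>i. if i \<in> {0} then V \<otimes> inv z else v (\<sigma> i))
       (\<lambda>i. if i \<in> {0} then int k else m (\<sigma> i)) (\<lambda>i. if i \<in> {0} then 6 else D)
       (\<lambda>i s. if i \<in> {0} then fW s else f (\<sigma> i) s)" (is "psys G S ?I ?v ?m ?c ?f")
    and fW: "\<And>s u. s \<in> carrier G \<Longrightarrow> u \<in> carrier G \<Longrightarrow>
       (\<And>Y. Y \<in> P1.Ln \<Longrightarrow> \<bar>P1.\<delta> Y (P1.pt s) (P1.pt u)\<bar> \<le> B) \<Longrightarrow> \<bar>fW s - fW u\<bar> \<le> 1"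
  proof -
    have "(3::nat) \<le> k" by (simp add: k_def)
    from P1.fill_axis[OF HOL.refl HOL.refl c this z] obtain D where "0 \<le> D" and
      ex: "\<exists>V fW. V \<in> generate G (range (\<lambda>i. v (\<sigma> i))) \<and> psys G S ?I (\<lambda>i. if i \<in> {0} then V \<otimes> inv z else v (\<sigma> i)) ?m
       (\<lambda>i. if i \<in> {0} then 6 else D) (\<lambda>i s. if i \<in> {0} then fW s else f (\<sigma> i) s) \<and>
       (\<forall>s \<in> carrier G. \<forall>u \<in> carrier G. (\<forall>Y \<in> P1.Ln. \<bar>P1.\<delta> Y (P1.pt s) (P1.pt u)\<bar> \<le> B) \<longrightarrow> \<bar>fW s - fW u\<bar> \<le> 1)"
      by blast
    from this(2) show ?thesis
    proof (elim exE conjE)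
      fix V fW
      assume 1: "V \<in> generate G (range (\<lambda>i. v (\<sigma> i)))"
        and 2: "psys G S ?I (\<lambda>i. if i \<in> {0} then V \<otimes> inv z else v (\<sigma> i)) ?m
          (\<lambda>i. if i \<in> {0} then 6 else D) (\<lambda>i s. if i \<in> {0} then fW s else f (\<sigma> i) s)"
        and 3: "\<forall>s \<in> carrier G. \<forall>u \<in> carrier G. (\<forall>Y \<in> P1.Ln. \<bar>P1.\<delta> Y (P1.pt s) (P1.pt u)\<bar> \<le> B) \<longrightarrow> \<bar>fW s - fW u\<bar> \<le> 1"
      show ?thesis by (rule that[OF \<open>0 \<le> D\<close> 1 2]) (rule 3[rule_format], assumption+)
    qed
  qed
  have small: "\<bar>fW (g \<otimes> u) - fW g\<bar> \<le> 1"
    if u: "u \<in> carrier G" "g \<in> carrier G" "\<And>Y. Y \<in> P1.Ln \<Longrightarrow> \<bar>P1.\<delta> Y (P1.pt \<one>) (P1.pt u)\<bar> \<le> B" for u g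
  proof -
    have "3 * \<bar>P1.\<delta> Y (P1.pt (g \<otimes> \<one>)) (P1.pt (g \<otimes> u))\<bar> \<le> 3 * B" if "Y \<in> P1.Ln" for Y
      by (rule P1.near_shift) (use u that in auto)
    then show ?thesis using fW[of g "g \<otimes> u"] u by (simp add: abs_minus_commute)
  qed
  have small_t: "\<bar>fW (g \<otimes> t [^] (l::int)) - fW g\<bar> \<le> 1" if "g \<in> carrier G" for g l
    using that t B by (intro small order_trans[OF P1.bounded_pt[of t Bt]] Bt) (auto simp: \<sigma>_def)
  have small_a: "\<bar>fW (g \<otimes> a) - fW g\<bar> \<le> 1" if "g \<in> carrier G" for g
  proof -
    have "\<bar>P1.\<delta> Y (P1.pt \<one>) (P1.pt (a [^] (1::int)))\<bar> \<le> B" if "Y \<in> P1.Ln" for Y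
      using that a B by (intro order_trans[OF P1.bounded_pt[of a Ba]] Ba) (auto simp: \<sigma>_def)
    then show ?thesis using that a by (intro small) simp_all
  qed
  have small_S: "\<bar>fW (g \<otimes> s) - fW g\<bar> \<le> 1" if "g \<in> carrier G" "s \<in> S" for g s
    using P1.S_sub by (intro small that order_trans[OF BS[OF that(2)] B(1)]) (use that in auto)
  define II vv mm cc ff where "II = ?I" and "vv = ?v" and "mm = ?m" and "cc = ?c" and "ff = ?f"
  have II: "0 \<in> II" "{k..} \<subseteq> II - {0}" by (auto simp: II_def k_def)
  have vv: "vv 0 = V \<otimes> inv z" "vv (i + k) = v (i + (k + max nt na))" for i
    by (simp_all add: vv_def k_def \<sigma>_def add.assoc)
  have mc: "mm 0 = int k" "cc 0 = 6" "cc (i + k) = D" "ff 0 = fW" for i by (simp_all add: mm_def cc_def ff_def k_def)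
  have Q': "psys G S II vv mm cc ff" unfolding II_def vv_def mm_def cc_def ff_def by (rule Q)
  interpret Q: psys G S II vv mm cc ff by (rule Q')
  interpret Q: psys_spin G S II vv mm cc ff 0
  proof
    show "g = \<one>" if "g \<in> carrier G" "0 < n" "g [^] (n::nat) = \<one>" for g n
      using tf that unfolding torsion_free_def by blast
    show "\<bar>ff 0 (g \<otimes> s) - ff 0 g\<bar> \<le> 45 * cc 0" if "s \<in> S" "g \<in> carrier G" for s g
      using small_S[OF that(2,1)] by (simp add: mc)
  qed (simp_all add: mc II k_def)
  have W: "\<bar>Q.\<delta> Y (Q.pt \<one>) (Q.pt s)\<bar> = \<bar>fW (inv (Q.rp Y) \<otimes> s) - fW (inv (Q.rp Y))\<bar>" "Q.rp Y \<in> carrier G"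
    if "Y \<in> Q.Sp" "s \<in> carrier G" for Y s
    using Q.Sp_\<delta>[OF that] by (simp_all add: mc)
  let ?N = "Q.N"
  interpret N: normal ?N G by (rule Q.sp.N_normal)
  have hom: "(#>) ?N \<in> hom G (G Mod ?N)" by (rule N.r_coset_hom_Mod)
  interpret h: group_hom G "G Mod ?N" "(#>) ?N"
    using hom N.factorgroup_is_group is_group by (simp add: group_hom_def group_hom_axioms_def)
  have surj: "(#>) ?N ` carrier G = carrier (G Mod ?N)" by (auto simp: FactGroup_def RCOSETS_def)
  have ker: "?N #> g = \<one>\<^bsub>G Mod ?N\<^esub> \<longleftrightarrow> g \<in> ?N" if "g \<in> carrier G" for g
    using coset_join1[OF _ that N.subgroup_axioms] coset_join2[OF that N.subgroup_axioms] by auto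
  interpret Qq: psys_quot G S II vv mm cc ff 0 "G Mod ?N" "(#>) ?N"
    by unfold_locales (use surj ker in auto)
  have quot: "psys (G Mod ?N) ((#>) ?N ` S) {k..} (\<lambda>i. ?N #> vv i) mm (\<lambda>i. 225 * cc i) Qq.fq"
    by (rule Qq.quotient_psys[OF II(2)])
  interpret R: psys "G Mod ?N" "(#>) ?N ` S" "{k..}" "\<lambda>i. ?N #> vv i" mm "\<lambda>i. 225 * cc i" Qq.fq by (rule quot)
  have "psys (G Mod ?N) ((#>) ?N ` S) UNIV (\<lambda>i. ?N #> vv (i + k)) (\<lambda>i. mm (i + k)) (\<lambda>_. 225 * D + 1) (\<lambda>i. Qq.fq (i + k))"
    by (rule R.psys_reindex) (auto simp: inj_on_def mc)
  then have 1: "sys (G Mod ?N) ((#>) ?N ` S) (\<lambda>i. ?N #> v (i + (k + max nt na)))"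
    unfolding sys_def vv using D by (intro exI[of _ "\<lambda>i. mm (i + k)"] exI[of _ "225 * D + 1"] exI[of _ "\<lambda>i. Qq.fq (i + k)"]) simp
  have 2: "torsion_free (G Mod ?N)"
    unfolding torsion_free_def
  proof (intro ballI allI impI)
    fix x n assume x: "x \<in> carrier (G Mod ?N)" "0 < (n::nat)" "x [^]\<^bsub>G Mod ?N\<^esub> n = \<one>\<^bsub>G Mod ?N\<^esub>"
    obtain g where g: "g \<in> carrier G" "x = ?N #> g" using Qq.h_surj[OF x(1)] by metis
    have "?N #> (g [^] n) = \<one>\<^bsub>G Mod ?N\<^esub>" using x(3) h.hom_nat_pow[OF g(1), of n] unfolding g(2) by simp
    then have "g [^] n \<in> ?N" using ker g by simp
    then show "x = \<one>\<^bsub>G Mod ?N\<^esub>" using Q.sp.quotient_torsion_free[OF g(1) x(2)] ker[OF g(1)] g(2) by simp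
  qed
  have 3: "no_inversion (G Mod ?N) (?N #> t)"
    unfolding no_inversion_def
  proof (intro ballI allI impI notI)
    fix x and p n :: nat
    assume x: "x \<in> carrier (G Mod ?N)" "0 < p" and eq: "x \<otimes>\<^bsub>G Mod ?N\<^esub> (?N #> t) [^]\<^bsub>G Mod ?N\<^esub> p \<otimes>\<^bsub>G Mod ?N\<^esub>
       inv\<^bsub>G Mod ?N\<^esub> x \<otimes>\<^bsub>G Mod ?N\<^esub> (?N #> t) [^]\<^bsub>G Mod ?N\<^esub> n = \<one>\<^bsub>G Mod ?N\<^esub>"
    obtain g where g: "g \<in> carrier G" "x = ?N #> g" using Qq.h_surj[OF x(1)] by metis
    have cl: "g \<otimes> t [^] p \<otimes> inv g \<otimes> t [^] n \<in> carrier G" using g t by simp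
    have q1: "?N #> (g \<otimes> t [^] p \<otimes> inv g \<otimes> t [^] n) = \<one>\<^bsub>G Mod ?N\<^esub>"
      using eq g t h.hom_nat_pow[OF t] by (simp only: h.hom_mult h.hom_inv nat_pow_closed m_closed inv_closed)
    have N: "g \<otimes> t [^] p \<otimes> inv g \<otimes> t [^] n \<in> ?N" by (rule iffD1[OF ker[OF cl] q1])
    have "\<exists>x \<in> carrier G. x \<otimes> t [^] p \<otimes> inv x \<otimes> t [^] n = \<one>"
    proof (rule Q.sp.quotient_no_inversion[OF Q.pt_Pt[OF one_closed] t g(1) _ t1 x(2) N])
      fix Y and j :: int assume "Y \<in> Q.Sp"
      then show "\<bar>Q.\<delta> Y (Q.pt \<one>) (Q.pact (t [^] j) (Q.pt \<one>))\<bar> \<le> 45 * cc 0"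
        using W[of Y "t [^] j"] small_t[of "inv (Q.rp Y)" j] t by (simp add: Q.pact_pt mc)
    qed
    then show False using ni x(2) unfolding no_inversion_def by blast
  qed
  have 4: "a \<notin> ?N"
  proof
    assume aN: "a \<in> ?N"
    have "a = \<one>"
    proof (rule Q.sp.near_not_N[OF Q.pt_Pt[OF one_closed] aN])
      fix Y assume "Y \<in> Q.Sp"
      then show "\<bar>Q.\<delta> Y (Q.pt \<one>) (Q.pact a (Q.pt \<one>))\<bar> \<le> 45 * cc 0"
        using W[of Y a] small_a[of "inv (Q.rp Y)"] a by (simp add: Q.pact_pt mc)
    qed
    then show False using a by simp
  qed
  have "V \<otimes> inv z \<in> ?N" using Q.v_in_N by (simp add: vv)
  moreover have "V \<in> generate G (range v)" using V mono_generate[of "range (\<lambda>i. v (\<sigma> i))" "range v"] by blast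
  ultimately have 5: "\<exists>V \<in> generate G (range v). V \<otimes> inv z \<in> ?N" by blast
  show thesis by (rule that[OF N.normal_axioms 1 2 3 4 5])
qed

section \<open>HNN extensions with cyclic associated subgroups\<close>

locale hnn_base = group G for G (structure) +
  fixes u h :: 'a
  assumes u [simp]: "u \<in> carrier G" and h [simp]: "h \<in> carrier G"
    and iso: "u [^] (n::int) = \<one> \<longleftrightarrow> h [^] n = \<one>"
begin

definition cu :: "bool \<Rightarrow> 'a" where "cu b = (if b then u else h)"

abbreviation A :: "bool \<Rightarrow> 'a set" where "A b \<equiv> cyc G (cu b)"

lemma cu_closed [simp]: "cu b \<in> carrier G"
  by (simp add: cu_def)

lemma A_subgroup: "subgroup (A b) G"
  by (rule cyc_subgroup) simp

lemma A_closed [simp]: "a \<in> A b \<Longrightarrow> a \<in> carrier G"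
  using cyc_subset[of "cu b"] by auto

lemma A_one [simp]: "\<one> \<in> A b"
  using cyc_pow[of "cu b" 0] by simp

lemma A_mult: "a \<in> A b \<Longrightarrow> a' \<in> A b \<Longrightarrow> a \<otimes> a' \<in> A b"
  by (rule subgroup.m_closed[OF A_subgroup])

lemma A_inv: "a \<in> A b \<Longrightarrow> inv a \<in> A b"
  by (rule subgroup.m_inv_closed[OF A_subgroup])

lemma A_cancel: "a \<in> A b \<Longrightarrow> g \<in> carrier G \<Longrightarrow> a \<otimes> g \<in> A b \<longleftrightarrow> g \<in> A b"
  using A_mult[of "inv a" b "a \<otimes> g"] A_mult[of a b g] A_inv[of a b] by (auto simp: cancel_inv)

lemma A_cancel': "a \<in> A b \<Longrightarrow> g \<in> carrier G \<Longrightarrow> g \<otimes> a \<in> A b \<longleftrightarrow> g \<in> A b"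
  using A_mult[of "g \<otimes> a" b "inv a"] A_mult[of g b a] A_inv[of a b] by (auto simp: m_assoc)

lemma iso_pow: "cu b [^] (n::int) = cu b [^] (n'::int) \<Longrightarrow> cu (\<not> b) [^] n = cu (\<not> b) [^] n'"
proof -
  have 1: "x [^] n = x [^] n' \<longleftrightarrow> x [^] (n - n') = \<one>" if "x \<in> carrier G" for x and n n' :: int
    using that by (metis int_pow_diff inv_closed inv_equality int_pow_closed inv_inv r_inv)
  have "cu b [^] (n - n') = \<one> \<longleftrightarrow> cu (\<not> b) [^] (n - n') = \<one>" using iso by (simp add: cu_def)
  then show "cu b [^] n = cu b [^] n' \<Longrightarrow> cu (\<not> b) [^] n = cu (\<not> b) [^] n'" using 1[of "cu b" n n'] 1[of "cu (\<not> b)" n n'] by simp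
qed

text \<open>The choice depends only on the coset, since the predicate does
  (\<open>rep_mult\<close>). The trivial coset is represented by 1, so that a cancelling pair of
  stable letters can be read off the word.\<close>

definition rep :: "bool \<Rightarrow> 'a \<Rightarrow> 'a" where
  "rep b g = (if g \<in> A b then \<one> else (SOME x. \<exists>a \<in> A b. x = a \<otimes> g))"

lemma rep_ex: assumes g: "g \<in> carrier G" shows "\<exists>n::int. g = cu b [^] n \<otimes> rep b g"
proof (cases "g \<in> A b")
  case True
  then show ?thesis by (auto simp: rep_def cyc_def)
next
  case False
  have "\<exists>a \<in> A b. rep b g = a \<otimes> g"
    unfolding rep_def using False g by (simp, intro someI_ex[of "\<lambda>x. \<exists>a \<in> A b. x = a \<otimes> g"]) (auto intro: A_one)
  then obtain n :: int where "rep b g = cu b [^] n \<otimes> g" by (auto simp: cyc_def)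
  then have "g = cu b [^] (- n) \<otimes> rep b g" using g by (simp add: int_pow_neg cancel_inv)
  then show ?thesis by blast
qed

text \<open>The exponent is not unique when \<open>cu b\<close> has finite order; by
  \<open>iso_pow\<close> the corresponding power of the other generator does not depend on it. This
  case occurs: the first HNN extension has trivial associated subgroups.\<close>

definition cf :: "bool \<Rightarrow> 'a \<Rightarrow> int" where
  "cf b g = (SOME n. g = cu b [^] n \<otimes> rep b g)"

lemma cf: "g \<in> carrier G \<Longrightarrow> g = cu b [^] cf b g \<otimes> rep b g"
  unfolding cf_def using someI_ex[OF rep_ex[of g b]] by simp

lemma rep_closed [simp]: assumes g: "g \<in> carrier G" shows "rep b g \<in> carrier G"
proof (cases "g \<in> A b")
  case False
  have "\<exists>a \<in> A b. rep b g = a \<otimes> g"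
    unfolding rep_def using False g by (simp, intro someI_ex[of "\<lambda>x. \<exists>a \<in> A b. x = a \<otimes> g"]) (auto intro: A_one)
  then show ?thesis using g by auto
qed (simp add: rep_def)

lemma rep_mult: assumes a: "a \<in> A b" and g: "g \<in> carrier G" shows "rep b (a \<otimes> g) = rep b g"
proof -
  have "(\<exists>a' \<in> A b. x = a' \<otimes> (a \<otimes> g)) \<longleftrightarrow> (\<exists>a' \<in> A b. x = a' \<otimes> g)" for x
  proof
    assume "\<exists>a' \<in> A b. x = a' \<otimes> (a \<otimes> g)"
    then obtain a' where "a' \<in> A b" "x = a' \<otimes> (a \<otimes> g)" by blast
    then show "\<exists>a' \<in> A b. x = a' \<otimes> g" using a g by (intro bexI[of _ "a' \<otimes> a"]) (simp_all add: m_assoc A_mult)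
  next
    assume "\<exists>a' \<in> A b. x = a' \<otimes> g"
    then obtain a' where "a' \<in> A b" "x = a' \<otimes> g" by blast
    then show "\<exists>a' \<in> A b. x = a' \<otimes> (a \<otimes> g)" using a g
      by (intro bexI[of _ "a' \<otimes> inv a"]) (simp_all add: m_assoc A_mult A_inv cancel_inv)
  qed
  then show ?thesis using A_cancel[OF a g] by (simp add: rep_def)
qed

lemma rep_rep [simp]: assumes g: "g \<in> carrier G" shows "rep b (rep b g) = rep b g"
proof -
  have "rep b g = rep b (cu b [^] cf b g \<otimes> rep b g)" using cf[OF g, of b] by simp
  then show ?thesis using rep_mult[of "cu b [^] cf b g" b "rep b g"] g by simp
qed

lemma rep_one: "g \<in> carrier G \<Longrightarrow> rep b g = \<one> \<longleftrightarrow> g \<in> A b"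
  using cf[of g b] by (auto simp: rep_def) (metis cyc_pow cu_closed int_pow_closed r_one)

lemma cf_unique: 
  assumes "g = cu b [^] (n::int) \<otimes> r" "r \<in> carrier G" "rep b r = r"
  shows "rep b g = r" "cu (\<not> b) [^] cf b g = cu (\<not> b) [^] n"
proof -
  show r: "rep b g = r" using assms rep_mult[of "cu b [^] n" b r] by simp
  have "cu b [^] cf b g \<otimes> r = cu b [^] n \<otimes> r" using cf[of g b] assms r by simp
  then have "cu b [^] cf b g = cu b [^] n" using assms by simp
  then show "cu (\<not> b) [^] cf b g = cu (\<not> b) [^] n" by (rule iso_pow)
qed

text \<open>A pair \<open>(g, [(b\<^sub>1, r\<^sub>1), \<dots>])\<close> stands for \<open>g z\<^bsup>b\<^sub>1\<^esup> r\<^sub>1 \<dots>\<close>, where \<open>True\<close> is the exponent 1 and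
  \<open>False\<close> the exponent -1 of the stable letter \<open>z\<close>, which satisfies \<open>z u = h z\<close>.\<close>

fun wf :: "(bool \<times> 'a) list \<Rightarrow> bool" where
  "wf [] \<longleftrightarrow> True"
| "wf ((b, r) # l) \<longleftrightarrow> r \<in> carrier G \<and> rep b r = r \<and> \<not> (r = \<one> \<and> l \<noteq> [] \<and> fst (hd l) = (\<not> b)) \<and> wf l"

definition gact :: "'a \<Rightarrow> 'a \<times> (bool \<times> 'a) list \<Rightarrow> 'a \<times> (bool \<times> 'a) list" where
  "gact g y = (g \<otimes> fst y, snd y)"

definition zact :: "bool \<Rightarrow> 'a \<times> (bool \<times> 'a) list \<Rightarrow> 'a \<times> (bool \<times> 'a) list" where
  "zact b y = (if fst y \<in> A b \<and> snd y \<noteq> [] \<and> fst (hd (snd y)) = (\<not> b)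
     then (cu (\<not> b) [^] cf b (fst y) \<otimes> snd (hd (snd y)), tl (snd y))
     else (cu (\<not> b) [^] cf b (fst y), (b, rep b (fst y)) # snd y))"

definition lact :: "(bool \<times> 'a) list \<Rightarrow> 'a \<times> (bool \<times> 'a) list \<Rightarrow> 'a \<times> (bool \<times> 'a) list" where
  "lact l y = foldr (\<lambda>(b, r) y. zact b (gact r y)) l y"

definition HC where "HC = {(g, l). g \<in> carrier G \<and> wf l}"

text \<open>Van der Waerden's trick: the product lets the letters of the left factor act one by one
  on normal forms, so associativity needs no analysis of how three words cancel.\<close>

definition hnn :: "('a \<times> (bool \<times> 'a) list) monoid" where
  "hnn = \<lparr>carrier = HC, monoid.mult = \<lambda>x y. gact (fst x) (lact (snd x) y), monoid.one = (\<one>, [])\<rparr>"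

lemma lact_Nil [simp]: "lact [] y = y" and lact_Cons [simp]: "lact ((b, r) # l) y = zact b (gact r (lact l y))"
  and lact_append: "lact (l @ l') y = lact l (lact l' y)"
  by (simp_all add: lact_def)

lemma wf_tl: "wf l \<Longrightarrow> wf (tl l)" by (cases l) auto

lemma wf_hd: "wf l \<Longrightarrow> l \<noteq> [] \<Longrightarrow> snd (hd l) \<in> carrier G"
  by (cases l) auto

lemma HC_iff: "y \<in> HC \<longleftrightarrow> fst y \<in> carrier G \<and> wf (snd y)"
  by (cases y) (simp add: HC_def)

lemma gact_HC [simp]: "g \<in> carrier G \<Longrightarrow> y \<in> HC \<Longrightarrow> gact g y \<in> HC"
  by (simp add: HC_iff gact_def)

lemma zact_HC [simp]: assumes "y \<in> HC" shows "zact b y \<in> HC"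
proof (cases "fst y \<in> A b \<and> snd y \<noteq> [] \<and> fst (hd (snd y)) = (\<not> b)")
  case True
  then show ?thesis using assms by (simp add: zact_def HC_iff wf_tl wf_hd)
next
  case False
  then show ?thesis using assms rep_one[of "fst y" b] by (auto simp: zact_def HC_iff)
qed

lemma lact_HC [simp]: "wf l \<Longrightarrow> y \<in> HC \<Longrightarrow> lact l y \<in> HC"
  by (induction l) auto

lemma gact_gact: "\<lbrakk>g \<in> carrier G; g' \<in> carrier G; y \<in> HC\<rbrakk> \<Longrightarrow> gact g (gact g' y) = gact (g \<otimes> g') y"
  by (simp add: gact_def m_assoc HC_iff)

lemma gact_one [simp]: "y \<in> HC \<Longrightarrow> gact \<one> y = y"
  by (simp add: gact_def HC_iff)

lemma zact_zact: assumes y: "y \<in> HC" shows "zact b (zact (\<not> b) y) = y"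
proof -
  obtain g l where gl: "y = (g, l)" "g \<in> carrier G" "wf l" using y by (cases y) (auto simp: HC_iff)
  show ?thesis
  proof (cases "g \<in> A (\<not> b) \<and> l \<noteq> [] \<and> fst (hd l) = b")
    case True
    then obtain r l' where l: "l = (b, r) # l'" by (cases l) auto
    have r: "r \<in> carrier G" "rep b r = r" "\<not> (r = \<one> \<and> l' \<noteq> [] \<and> fst (hd l') = (\<not> b))" using gl l by auto
    let ?n = "cf (\<not> b) g"
    have g: "g = cu (\<not> b) [^] ?n" using cf[OF gl(2), of "\<not> b"] rep_one[OF gl(2), of "\<not> b"] True by simp
    have 1: "zact (\<not> b) y = (cu b [^] ?n \<otimes> r, l')" using True by (simp add: zact_def gl l)
    note uq = cf_unique[OF HOL.refl r(1,2), of ?n]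
    have "cu b [^] ?n \<otimes> r \<in> A b \<longleftrightarrow> r = \<one>"
      using A_cancel[of "cu b [^] ?n" b r] rep_one[of r b] r by simp
    then have "zact b (cu b [^] ?n \<otimes> r, l') = (cu (\<not> b) [^] ?n, (b, r) # l')"
      using r(3) uq by (auto simp: zact_def)
    then show ?thesis using 1 g gl l by simp
  next
    case False
    let ?n = "cf (\<not> b) g"
    have 1: "zact (\<not> b) y = (cu b [^] ?n, (\<not> b, rep (\<not> b) g) # l)" using False by (auto simp: zact_def gl)
    have rb: "rep b \<one> = \<one>" using rep_one[of \<one> b] by simp
    have "cu (\<not> b) [^] cf b (cu b [^] ?n) = cu (\<not> b) [^] ?n"
      by (rule cf_unique(2)[of _ b ?n \<one>]) (simp_all add: rb)
    then show ?thesis using 1 cf[OF gl(2), of "\<not> b"] gl by (simp add: zact_def)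
  qed
qed

lemma zact_cu:
  assumes y: "y \<in> HC" shows "zact b (gact (cu b [^] (n::int)) y) = gact (cu (\<not> b) [^] n) (zact b y)"
proof -
  have g: "fst y \<in> carrier G" using y by (simp add: HC_iff)
  have "cu b [^] n \<otimes> fst y = cu b [^] (n + cf b (fst y)) \<otimes> rep b (fst y)"
    using cf[OF g, of b] g by (simp add: int_pow_mult m_assoc)
  then have "rep b (cu b [^] n \<otimes> fst y) = rep b (fst y)"
    "cu (\<not> b) [^] cf b (cu b [^] n \<otimes> fst y) = cu (\<not> b) [^] n \<otimes> cu (\<not> b) [^] cf b (fst y)"
    using cf_unique[of "cu b [^] n \<otimes> fst y" b "n + cf b (fst y)" "rep b (fst y)"] g by (simp_all add: int_pow_mult)
  moreover have "cu b [^] n \<otimes> fst y \<in> A b \<longleftrightarrow> fst y \<in> A b" using A_cancel[of "cu b [^] n" b] g by simp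
  ultimately show ?thesis using y wf_hd[of "snd y"] by (auto simp: zact_def gact_def m_assoc HC_iff)
qed

definition mul where "mul x y = gact (fst x) (lact (snd x) y)"

lemma mul_gact: "\<lbrakk>g \<in> carrier G; x \<in> HC; y \<in> HC\<rbrakk> \<Longrightarrow> mul (gact g x) y = gact g (mul x y)"
  unfolding mul_def gact_def by (simp add: HC_iff m_assoc) (metis HC_iff lact_HC m_assoc)

text \<open>With \<open>mul_gact\<close> this gives associativity, as left action by a letter
  commutes with right multiplication. The defining relations enter as the operator identities
  \<open>zact_zact\<close> and \<open>zact_cu\<close>.\<close>

lemma mul_zact: assumes x: "x \<in> HC" and y: "y \<in> HC" shows "mul (zact b x) y = zact b (mul x y)"
proof -
  obtain g l where gl: "x = (g, l)" "g \<in> carrier G" "wf l" using x by (cases x) (auto simp: HC_iff)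
  let ?n = "cf b g"
  show ?thesis
  proof (cases "g \<in> A b \<and> l \<noteq> [] \<and> fst (hd l) = (\<not> b)")
    case True
    then obtain r l' where l: "l = (\<not> b, r) # l'" by (cases l) auto
    have r: "r \<in> carrier G" "wf l'" using gl l by auto
    have g: "g = cu b [^] ?n" using cf[OF gl(2), of b] rep_one[OF gl(2), of b] True by simp
    have Y: "gact r (lact l' y) \<in> HC" using r y by simp
    have "mul (zact b x) y = gact (cu (\<not> b) [^] ?n \<otimes> r) (lact l' y)" using True by (simp add: zact_def gl l mul_def)
    also have "\<dots> = gact (cu (\<not> b) [^] ?n) (zact b (zact (\<not> b) (gact r (lact l' y))))"
      using r y zact_zact[OF Y, of b] by (simp add: gact_gact)
    also have "\<dots> = zact b (gact (cu b [^] ?n) (zact (\<not> b) (gact r (lact l' y))))"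
      using Y by (simp add: zact_cu)
    also have "\<dots> = zact b (mul x y)" using g by (simp add: mul_def gl l)
    finally show ?thesis .
  next
    case False
    have Y: "gact (rep b g) (lact l y) \<in> HC" using gl y by simp
    have "mul (zact b x) y = gact (cu (\<not> b) [^] ?n) (zact b (gact (rep b g) (lact l y)))"
      using False by (auto simp: zact_def gl mul_def)
    also have "\<dots> = zact b (gact (cu b [^] ?n) (gact (rep b g) (lact l y)))" using Y by (simp add: zact_cu)
    also have "\<dots> = zact b (mul x y)" using cf[OF gl(2), of b] gl y by (simp add: gact_gact mul_def)
    finally show ?thesis .
  qed
qed

lemma mul_HC [simp]: "x \<in> HC \<Longrightarrow> y \<in> HC \<Longrightarrow> mul x y \<in> HC"
  by (simp add: mul_def HC_iff[of x])

lemma mul_lact: "\<lbrakk>wf l; x \<in> HC; y \<in> HC\<rbrakk> \<Longrightarrow> mul (lact l x) y = lact l (mul x y)"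
proof (induction l)
  case (Cons p l)
  obtain b r where "p = (b, r)" by fastforce
  then show ?case using Cons by (simp add: mul_zact mul_gact)
qed simp

lemma mul_assoc: "\<lbrakk>x \<in> HC; y \<in> HC; w \<in> HC\<rbrakk> \<Longrightarrow> mul (mul x y) w = mul x (mul y w)"
  unfolding mul_def[of x] by (simp add: mul_gact mul_lact HC_iff[of x])

lemma lact_one: "wf l \<Longrightarrow> lact l (\<one>, []) = (\<one>, l)"
proof (induction l)
  case (Cons p l)
  obtain b r where p: "p = (b, r)" by fastforce
  have r: "r \<in> carrier G" "rep b r = r" "\<not> (r = \<one> \<and> l \<noteq> [] \<and> fst (hd l) = (\<not> b))" using Cons p by auto
  have "cu (\<not> b) [^] cf b r = cu (\<not> b) [^] (0::int)" by (rule cf_unique(2)[of r b 0 r]) (use r in simp_all)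
  moreover have "r \<in> A b \<longleftrightarrow> r = \<one>" using rep_one[of r b] r by simp
  ultimately show ?case using Cons p r by (auto simp: gact_def zact_def)
qed simp

lemma mul_one: "x \<in> HC \<Longrightarrow> mul x (\<one>, []) = x"
  by (simp add: mul_def HC_iff lact_one gact_def)

lemma mul_inv_ex: "x \<in> HC \<Longrightarrow> \<exists>y \<in> HC. mul y x = (\<one>, [])"
proof (induction "length (snd x)" arbitrary: x)
  case 0
  then show ?case by (intro bexI[of _ "(inv (fst x), [])"]) (auto simp: mul_def gact_def HC_iff)
next
  case (Suc n)
  obtain g b r l where x: "x = (g, (b, r) # l)" using Suc(2) by (cases x; cases "snd x") auto
  have w: "g \<in> carrier G" "wf ((b, r) # l)" "(r, l) \<in> HC" "(\<one>, []) \<in> HC" using Suc(3) by (auto simp: x HC_iff)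
  obtain y where y: "y \<in> HC" "mul y (r, l) = (\<one>, [])" using Suc(1)[of "(r, l)"] Suc(2) w x by auto
  define y' where "y' = mul y (zact (\<not> b) (gact (inv g) (\<one>, [])))"
  have xz: "x = gact g (zact b (r, l))"
    using lact_one[OF w(2)] lact_one[of l] w by (simp add: x gact_def)
  have "mul y' x = mul y (zact (\<not> b) (gact (inv g) (mul (\<one>, []) x)))"
    using y w Suc(3) by (simp add: y'_def mul_assoc mul_zact mul_gact)
  also have "mul (\<one>, []) x = x" using Suc(3) by (simp add: mul_def)
  also have "gact (inv g) x = zact b (r, l)" using w by (simp add: xz gact_gact)
  also have "zact (\<not> b) (zact b (r, l)) = (r, l)" using zact_zact[OF w(3), of "\<not> b"] by simp
  finally have "mul y' x = (\<one>, [])" using y by simp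
  moreover have "y' \<in> HC" using y w by (simp add: y'_def)
  ultimately show ?case by blast
qed

lemma hnn_simps [simp]: "carrier hnn = HC" "monoid.mult hnn = mul" "monoid.one hnn = (\<one>, [])"
  by (simp_all add: hnn_def mul_def[abs_def])

lemma one_HC [simp]: "(\<one>, []) \<in> HC"
  by (simp add: HC_iff)

lemma hnn_group: "group hnn"
proof (rule groupI)
  show "\<one>\<^bsub>hnn\<^esub> \<otimes>\<^bsub>hnn\<^esub> x = x" if "x \<in> carrier hnn" for x using that by (simp add: mul_def)
qed (use mul_assoc mul_inv_ex in auto)

definition emb :: "'a \<Rightarrow> 'a \<times> (bool \<times> 'a) list" where "emb g = (g, [])"

definition zz :: "bool \<Rightarrow> 'a \<times> (bool \<times> 'a) list" where "zz b = (\<one>, [(b, \<one>)])"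

lemma rep_one_one [simp]: "rep b \<one> = \<one>"
  by (simp add: rep_def)

lemma emb_HC [simp]: "g \<in> carrier G \<Longrightarrow> emb g \<in> HC" and zz_HC [simp]: "zz b \<in> HC"
  by (simp_all add: emb_def zz_def HC_iff)

lemma mul_emb: "mul (emb g) y = gact g y"
  by (simp add: mul_def emb_def)

lemma mul_zz: assumes "y \<in> HC" shows "mul (zz b) y = zact b y"
proof -
  have "zz b = zact b (\<one>, [])" using lact_one[of "[(b, \<one>)]"] by (simp add: zz_def gact_def)
  then show ?thesis using mul_zact[of "(\<one>, [])" y b] assms by (simp add: mul_def)
qed

sublocale H: group hnn by (rule hnn_group)

lemma emb_hom: "emb \<in> hom G hnn"
  by (rule homI) (simp_all add: mul_emb gact_def, simp add: emb_def)

sublocale emb: group_hom G hnn emb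
  by unfold_locales (rule emb_hom)

declare emb.hom_inv [simp del] emb.hom_mult [simp del]

lemma emb_inj: "emb g = emb g' \<longleftrightarrow> g = g'"
  by (simp add: emb_def)

lemma inv_emb [simp]: "g \<in> carrier G \<Longrightarrow> inv\<^bsub>hnn\<^esub> (emb g) = emb (inv g)"
  using emb.hom_inv by simp

lemma inv_zz: "inv\<^bsub>hnn\<^esub> (zz b) = zz (\<not> b)"
proof (rule H.inv_equality)
  have "zz b = zact b (\<one>, [])" using mul_zz[of "(\<one>, [])" b] mul_one[OF zz_HC] by simp
  then show "zz (\<not> b) \<otimes>\<^bsub>hnn\<^esub> zz b = \<one>\<^bsub>hnn\<^esub>"
    using mul_zz[OF zz_HC, of "\<not> b" b] zact_zact[of "(\<one>, [])" "\<not> b"] by simp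
qed simp_all

lemma zz_conj: "mul (mul (zz b) (emb (cu b [^] (n::int)))) (zz (\<not> b)) = emb (cu (\<not> b) [^] n)"
proof -
  have z1: "zact (\<not> b) (\<one>, []) = zz (\<not> b)" using mul_zz[of "(\<one>, [])" "\<not> b"] mul_one[OF zz_HC] by simp
  have "mul (mul (zz b) (emb (cu b [^] n))) (zz (\<not> b)) = zact b (gact (cu b [^] n) (zz (\<not> b)))"
    using mul_zz[of "mul (emb (cu b [^] n)) (zz (\<not> b))" b] by (simp add: mul_assoc mul_emb)
  also have "\<dots> = gact (cu (\<not> b) [^] n) (zact b (zact (\<not> b) (\<one>, [])))" by (simp add: zact_cu z1)
  also have "\<dots> = emb (cu (\<not> b) [^] n)" by (simp add: zact_zact, simp add: gact_def emb_def)
  finally show ?thesis .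
qed

lemma HC_generate:
  assumes S: "S \<subseteq> carrier G" "generate G S = carrier G"
  shows "generate hnn (insert (zz True) (emb ` S)) = HC"
proof
  let ?S = "insert (zz True) (emb ` S)"
  have SH: "?S \<subseteq> carrier hnn" using S by auto
  show "generate hnn ?S \<subseteq> HC" using H.generate_incl[OF SH] by simp
  have "emb ` carrier G \<subseteq> generate hnn ?S"
    using emb.generate_img[OF S(1)] S(2) H.mono_generate[of "emb ` S" ?S] by auto
  then have g: "emb g \<in> generate hnn ?S" if "g \<in> carrier G" for g using that by blast
  have zT: "zz True \<in> generate hnn ?S" by (rule generate.incl) simp
  have z: "zz b \<in> generate hnn ?S" for b
    using zT H.generate_m_inv_closed[OF SH zT] inv_zz[of True] by (cases b) simp_all
  have "(\<one>, l) \<in> generate hnn ?S" if "wf l" for l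
    using that
  proof (induction l)
    case Nil
    then show ?case using generate.one[of hnn ?S] by simp
  next
    case (Cons p l)
    obtain b r where p: "p = (b, r)" by fastforce
    have w: "r \<in> carrier G" "wf l" "wf ((b, r) # l)" using Cons p by auto
    have HCl: "(\<one>, l) \<in> HC" using w by (simp add: HC_iff)
    have "(\<one>, p # l) = mul (zz b) (mul (emb r) (\<one>, l))"
      using lact_one[OF w(3)] lact_one[OF w(2)] w HCl by (simp add: mul_zz mul_emb p)
    then show ?case using generate.eng[OF z generate.eng[OF g[OF w(1)] Cons.IH[OF w(2)]], of b] by simp
  qed
  then have "mul (emb g) (\<one>, l) \<in> generate hnn ?S" if "g \<in> carrier G" "wf l" for g l
    using generate.eng[OF g[OF that(1)]] that(2) by simp
  then show "HC \<subseteq> generate hnn ?S" by (auto simp: HC_def mul_emb gact_def)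
qed

end

section \<open>Lines, torsion and conjugacy in HNN extensions\<close>

text \<open>Closed under conjugation and insensitive to positive powers and roots
  (\<open>pos_conj_pow\<close>); under (I) it contains no element together with its inverse
  (\<open>pos_conj_inv\<close>). This makes it the right invariant set for
  \<open>conj_reduce\<close>.\<close>

definition pos_conj :: "('a, 'b) monoid_scheme \<Rightarrow> 'a \<Rightarrow> 'a set" where
  "pos_conj G t = {x \<in> carrier G. \<exists>g \<in> carrier G. \<exists>(m::nat) (n::nat). 0 < m \<and> 0 < n \<and>
     g \<otimes>\<^bsub>G\<^esub> x [^]\<^bsub>G\<^esub> m \<otimes>\<^bsub>G\<^esub> inv\<^bsub>G\<^esub> g = t [^]\<^bsub>G\<^esub> n}"

context hnn_base
begin

definition sg :: "'a \<times> (bool \<times> 'a) list \<Rightarrow> bool" where "sg x = fst (hd (snd x))"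

text \<open>\<open>edge x y\<close>: in the Bass-Serre tree, the geodesics from the base vertex to its images under \<open>x\<close> and \<open>y\<close>
  start with the same edge.\<close>

definition edge where
  "edge x y \<longleftrightarrow> snd x \<noteq> [] \<and> snd y \<noteq> [] \<and> sg x = sg y \<and> inv (fst x) \<otimes> fst y \<in> A (\<not> sg x)"

lemma fst_HC [simp]: "x \<in> HC \<Longrightarrow> fst x \<in> carrier G"
  by (simp add: HC_iff)

lemma edge_sym: assumes "x \<in> HC" "y \<in> HC" "edge x y" shows "edge y x"
proof -
  have e: "sg y = sg x" "snd x \<noteq> []" "snd y \<noteq> []" "inv (fst x) \<otimes> fst y \<in> A (\<not> sg x)" using assms by (auto simp: edge_def)
  then show ?thesis using A_inv[OF e(4)] assms(1,2) by (simp add: edge_def inv_mult_group)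
qed

lemma edge_trans: assumes "x \<in> HC" "y \<in> HC" "w \<in> HC" "edge x y" "edge y w" shows "edge x w"
proof -
  have e: "sg y = sg x" "sg w = sg x" "snd x \<noteq> []" "snd w \<noteq> []" "inv (fst x) \<otimes> fst y \<in> A (\<not> sg x)"
    "inv (fst y) \<otimes> fst w \<in> A (\<not> sg x)" using assms by (auto simp: edge_def)
  then show ?thesis using A_mult[OF e(5,6)] assms(1-3) by (simp add: edge_def m_assoc cancel_inv)
qed

lemma wf_last: "wf (l @ [(b, r)]) \<Longrightarrow> r \<in> carrier G \<and> rep b r = r \<and> wf l"
proof (induction l)
  case (Cons p l)
  obtain b1 r1 where p: "p = (b1, r1)" by fastforce
  have w: "r1 \<in> carrier G" "rep b1 r1 = r1" "\<not> (r1 = \<one> \<and> fst (hd (l @ [(b, r)])) = (\<not> b1))" "wf (l @ [(b, r)])"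
    using Cons(2) p by simp_all
  then show ?case using Cons.IH[OF w(4)] p by (cases l) simp_all
qed simp

text \<open>Cancellation against \<open>w\<close> can only begin at the last stable letter. If it
  does not begin there, a later one would need two inverse stable letters of the reduced word to
  meet with \<open>r1 = \<one>\<close> between them, which \<open>wf\<close> excludes.\<close>

lemma first_edge:
  assumes "wf (l @ [(b, r)])" "w \<in> HC" "\<not> (snd w \<noteq> [] \<and> sg w = (\<not> b) \<and> r \<otimes> fst w \<in> A b)"
  defines "y \<equiv> lact (l @ [(b, r)]) w"
  shows "snd y \<noteq> [] \<and> sg y = fst (hd (l @ [(b, r)])) \<and> fst y \<in> A (\<not> sg y)"
  using assms(1) unfolding y_def
proof (induction l)
  case Nil
  then show ?case using assms(2,3) by (auto simp: zact_def gact_def sg_def)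
next
  case (Cons p l)
  obtain b1 r1 where p: "p = (b1, r1)" by fastforce
  let ?l = "l @ [(b, r)]" and ?y = "lact (l @ [(b, r)]) w"
  have w: "r1 \<in> carrier G" "rep b1 r1 = r1" "\<not> (r1 = \<one> \<and> fst (hd ?l) = (\<not> b1))" "wf ?l" using Cons p by auto
  have IH: "snd ?y \<noteq> []" "sg ?y = fst (hd ?l)" "fst ?y \<in> A (\<not> sg ?y)" using Cons.IH[OF w(4)] by auto
  have "\<not> (r1 \<otimes> fst ?y \<in> A b1 \<and> sg ?y = (\<not> b1))"
  proof
    assume *: "r1 \<otimes> fst ?y \<in> A b1 \<and> sg ?y = (\<not> b1)"
    then have "r1 \<in> A b1" using IH(3) A_cancel'[of "fst ?y" b1 r1] w(1) by simp
    then have "r1 = \<one>" using w rep_one[of r1 b1] by simp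
    then show False using w(3) * IH(2) by simp
  qed
  then have "zact b1 (gact r1 ?y) = (cu (\<not> b1) [^] cf b1 (r1 \<otimes> fst ?y), (b1, rep b1 (r1 \<otimes> fst ?y)) # snd ?y)"
    by (auto simp: zact_def gact_def sg_def)
  then show ?case by (simp add: p sg_def)
qed

lemma mul_edge:
  assumes "x \<in> HC" "w \<in> HC" "snd x = l @ [(b, r)]" "\<not> (snd w \<noteq> [] \<and> sg w = (\<not> b) \<and> r \<otimes> fst w \<in> A b)"
  shows "edge x (mul x w)"
proof -
  have "wf (l @ [(b, r)])" using assms by (metis HC_iff)
  note fe = first_edge[OF this assms(2,4)]
  have "lact (snd x) w \<in> HC" using assms by (simp add: HC_iff[of x])
  then have "inv (fst x) \<otimes> (fst x \<otimes> fst (lact (snd x) w)) = fst (lact (snd x) w)" using assms by (simp add: cancel_inv)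
  then show ?thesis using fe assms(3) by (auto simp: edge_def mul_def gact_def sg_def)
qed

lemma mul_cancel:
  assumes "x \<in> HC" "w \<in> HC" "snd x = l @ [(b, r)]" "\<not> edge x (mul x w)"
  shows "snd w \<noteq> []" "sg w = (\<not> b)" "r \<otimes> fst w \<in> A b"
  using mul_edge[OF assms(1-3)] assms(4) by blast+

abbreviation iv where "iv x \<equiv> inv\<^bsub>hnn\<^esub> x"

lemma iv_HC [simp]: "x \<in> HC \<Longrightarrow> iv x \<in> HC"
  using H.inv_closed by simp

lemma iv_mul [simp]: "x \<in> HC \<Longrightarrow> mul (iv x) x = (\<one>, [])" "x \<in> HC \<Longrightarrow> mul x (iv x) = (\<one>, [])"
  "x \<in> HC \<Longrightarrow> iv (iv x) = x"
  using H.l_inv H.r_inv H.inv_inv by simp_all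

lemma iv_cancel [simp]: "x \<in> HC \<Longrightarrow> y \<in> HC \<Longrightarrow> mul x (mul (iv x) y) = y" "x \<in> HC \<Longrightarrow> y \<in> HC \<Longrightarrow> mul (iv x) (mul x y) = y"
  using H.cancel_inv by simp_all

lemma emb_iff: "x \<in> HC \<Longrightarrow> snd x = [] \<longleftrightarrow> (\<exists>g \<in> carrier G. x = emb g)"
  by (cases x) (auto simp: emb_def HC_iff)

lemma iv_Nil: "x \<in> HC \<Longrightarrow> snd (iv x) = [] \<longleftrightarrow> snd x = []"
proof -
  have "snd (iv x) = []" if "x \<in> HC" "snd x = []" for x
    using that emb_iff[of x] inv_emb by (auto simp: emb_def)
  then show "x \<in> HC \<Longrightarrow> snd (iv x) = [] \<longleftrightarrow> snd x = []" by (metis iv_HC iv_mul(3))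
qed

lemma snoc_ex: "l \<noteq> [] \<Longrightarrow> \<exists>l' b r. l = l' @ [(b, r)]"
  by (metis append_butlast_last_id surj_pair)

text \<open>If the path for \<open>iv x\<close> loses its first edge when \<open>s\<close> is
  appended, then it cancels completely, and the last edge cancelled is the one with which both
  \<open>x\<close> and \<open>s\<close> begin.\<close>

lemma junction:
  assumes x: "x \<in> HC" "snd x \<noteq> []" and s: "s \<in> HC"
  shows "edge x s \<or> edge (iv x) (mul (iv x) s)"
proof (rule ccontr)
  assume no: "\<not> ?thesis"
  obtain l b r where l: "snd (iv x) = l @ [(b, r)]" using snoc_ex iv_Nil[OF x(1)] x(2) by blast
  have r: "r \<in> carrier G" using l wf_last[of l b r] x iv_HC[OF x(1)] by (metis HC_iff)
  have 1: "snd s \<noteq> []" "sg s = (\<not> b)" "r \<otimes> fst s \<in> A b"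
    using mul_cancel[OF iv_HC[OF x(1)] s l] no by blast+
  have "\<not> edge (iv x) (mul (iv x) x)" using x by (simp add: edge_def)
  then have 2: "sg x = (\<not> b)" "r \<otimes> fst x \<in> A b" using mul_cancel[OF iv_HC[OF x(1)] x(1) l] by blast+
  have "inv (r \<otimes> fst x) \<otimes> (r \<otimes> fst s) \<in> A b" using A_mult[OF A_inv[OF 2(2)] 1(3)] .
  then have "inv (fst x) \<otimes> fst s \<in> A b" using r x s by (simp add: inv_mult_group m_assoc cancel_inv)
  then show False using no 1 2 x by (simp add: edge_def)
qed

lemma edge_fst: "x \<in> HC \<Longrightarrow> y \<in> HC \<Longrightarrow> edge x y \<Longrightarrow> \<exists>a \<in> A (\<not> sg x). fst y = fst x \<otimes> a"
  by (intro bexI[of _ "inv (fst x) \<otimes> fst y"]) (auto simp: edge_def cancel_inv)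

lemma edge_emb: "x \<in> HC \<Longrightarrow> snd x \<noteq> [] \<Longrightarrow> g \<in> carrier G \<Longrightarrow> edge x (mul x (emb g))"
  using snoc_ex[of "snd x"] mul_edge[of x "emb g"] by (auto simp: emb_def HC_iff)

lemma lact_snoc: "lact (l @ [(b, r)]) w = lact l (zact b (gact r w))"
  by (simp add: lact_append)

lemma fst_mul_zz:
  assumes x: "x \<in> HC" shows "\<exists>b'. \<exists>a \<in> A b'. fst (mul x (zz b)) = fst x \<otimes> a"
proof (cases "snd x = []")
  case True
  then have "fst (mul x (zz b)) = fst x \<otimes> \<one>" by (simp add: mul_def zz_def gact_def)
  then show ?thesis using A_one by blast
next
  case False
  show ?thesis
  proof (cases "edge x (mul x (zz b))")
    case True
    then show ?thesis using edge_fst[OF x _ True] x by auto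
  next
    case ne: False
    obtain l b' r where l: "snd x = l @ [(b', r)]" using snoc_ex False by blast
    have w: "r \<in> carrier G" "rep b' r = r" "wf l" using l wf_last[of l b' r] x by (simp_all add: HC_iff)
    have "b' = (\<not> b)" "r \<in> A b'" using mul_cancel[OF x zz_HC l ne] w by (simp_all add: sg_def zz_def)
    then have b: "b' = (\<not> b)" "r = \<one>" using rep_one[of r b'] w by simp_all
    have zb: "zact b (\<one>, []) = zz b" using mul_zz[of "(\<one>, [])" b] mul_one[OF zz_HC] by simp
    have "mul x (zz b) = gact (fst x) (lact l (zact (\<not> b) (zz b)))" using l b by (simp add: mul_def lact_snoc)
    also have "zact (\<not> b) (zz b) = (\<one>, [])" using zact_zact[of "(\<one>, [])" "\<not> b"] by (simp add: zb)
    finally have "fst (mul x (zz b)) = fst x \<otimes> \<one>" using w by (simp add: lact_one gact_def)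
    then show ?thesis using A_one by blast
  qed
qed

text \<open>The coordinate of \<open>x\<close> is read off its first component, that is, off the
  edge by which the path to \<open>x\<close> leaves the base vertex. That edge determines the
  component up to right multiplication by an associated subgroup, hence the coordinate up to
  \<open>B\<close>. For lines at different vertices \<open>junction\<close> is Behrstock's
  inequality.\<close>

theorem psys_hnn:
  assumes P: "psys G S I v m c f" and B: "0 \<le> B"
    and bd: "\<And>i g a b. \<lbrakk>i \<in> I; g \<in> carrier G; a \<in> A b\<rbrakk> \<Longrightarrow> \<bar>f i (g \<otimes> a) - f i g\<bar> \<le> B"
  shows "psys hnn (insert (zz True) (emb ` S)) I (\<lambda>i. emb (v i)) m (\<lambda>i. c i + B) (\<lambda>i x. f i (fst x))"
proof -
  interpret P: psys G S I v m c f by (rule P)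
  have eb: "\<bar>f i (fst y) - f i (fst x)\<bar> \<le> c i + B" if xy: "edge x y" "x \<in> HC" "y \<in> HC" "i \<in> I" for x y i
  proof -
    obtain a where "a \<in> A (\<not> sg x)" "fst y = fst x \<otimes> a" using edge_fst[OF xy(2,3,1)] by blast
    then show ?thesis using bd[OF xy(4) fst_HC[OF xy(2)]] P.c_nonneg[OF xy(4)] by (metis add_increasing)
  qed
  have zb: "\<bar>f i (fst (mul x (zz b))) - f i (fst x)\<bar> \<le> c i + B" if xi: "x \<in> HC" "i \<in> I" for x i b
  proof -
    obtain b' a where "a \<in> A b'" "fst (mul x (zz b)) = fst x \<otimes> a" using fst_mul_zz[OF xi(1), of b] by blast
    then show ?thesis using bd[OF xi(2) fst_HC[OF xi(1)]] P.c_nonneg[OF xi(2)] by (metis add_increasing)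
  qed
  have coset: "emb ` (g <# cyc G (v i)) = emb g <#\<^bsub>hnn\<^esub> cyc hnn (emb (v i))" if "g \<in> carrier G" "i \<in> I" for g i
  proof -
    have "emb (g \<otimes> v i [^] n) = emb g \<otimes>\<^bsub>hnn\<^esub> emb (v i) [^]\<^bsub>hnn\<^esub> n" for n :: int
      using that emb.hom_int_pow[of "v i" n] emb.hom_mult by simp
    then show ?thesis by (auto simp: l_coset_def cyc_def image_iff)
  qed
  show ?thesis
  proof
    show "finite (insert (zz True) (emb ` S))" using P.S_fin by simp
    show "insert (zz True) (emb ` S) \<subseteq> carrier hnn" using P.S_sub by auto
    show "generate hnn (insert (zz True) (emb ` S)) = carrier hnn" using HC_generate[OF P.S_sub P.S_gen] by simp
    show "emb (v i) \<in> carrier hnn" "0 < m i" "0 \<le> c i + B" if "i \<in> I" for i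
      using that P.m_pos P.c_nonneg[of i] B by simp_all
    show "f i (fst (emb (v i) \<otimes>\<^bsub>hnn\<^esub> s)) = f i (fst s) + m i" if "i \<in> I" "s \<in> carrier hnn" for i s
      using that P.f_v by (simp add: mul_emb gact_def)
    show "\<exists>p q. \<forall>s \<in> carrier hnn. \<bar>f i (fst s) - p\<bar> \<le> c i + B \<or> \<bar>f j (fst (iv x \<otimes>\<^bsub>hnn\<^esub> s)) - q\<bar> \<le> c j + B"
      if ij: "i \<in> I" "j \<in> I" and x: "x \<in> carrier hnn" "\<not> (i = j \<and> x \<in> cyc hnn (emb (v i)))" for i j x
    proof (cases "snd x = []")
      case True
      then obtain g where g: "g \<in> carrier G" "x = emb g" using emb_iff[of x] x by auto
      have "\<not> (i = j \<and> g \<in> cyc G (v i))"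
        using x(2) g ij emb.hom_int_pow[of "v i"] by (auto simp: cyc_def)
      from P.CB[OF ij g(1) this] obtain p q where
        pq: "\<forall>s \<in> carrier G. \<bar>f i s - p\<bar> \<le> c i \<or> \<bar>f j (inv g \<otimes> s) - q\<bar> \<le> c j" by blast
      have "\<forall>s \<in> carrier hnn. \<bar>f i (fst s) - p\<bar> \<le> c i + B \<or> \<bar>f j (fst (iv x \<otimes>\<^bsub>hnn\<^esub> s)) - q\<bar> \<le> c j + B"
      proof
        fix s assume "s \<in> carrier hnn"
        then have "\<bar>f i (fst s) - p\<bar> \<le> c i \<or> \<bar>f j (inv g \<otimes> fst s) - q\<bar> \<le> c j" using pq by simp
        then show "\<bar>f i (fst s) - p\<bar> \<le> c i + B \<or> \<bar>f j (fst (iv x \<otimes>\<^bsub>hnn\<^esub> s)) - q\<bar> \<le> c j + B"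
          using g B by (auto simp: mul_emb gact_def)
      qed
      then show ?thesis by blast
    next
      case False
      have "\<forall>s \<in> carrier hnn. \<bar>f i (fst s) - f i (fst x)\<bar> \<le> c i + B \<or>
          \<bar>f j (fst (iv x \<otimes>\<^bsub>hnn\<^esub> s)) - f j (fst (iv x))\<bar> \<le> c j + B"
      proof
        fix s assume "s \<in> carrier hnn"
        then have sH: "s \<in> HC" and xH: "x \<in> HC" using x by simp_all
        show "\<bar>f i (fst s) - f i (fst x)\<bar> \<le> c i + B \<or> \<bar>f j (fst (iv x \<otimes>\<^bsub>hnn\<^esub> s)) - f j (fst (iv x))\<bar> \<le> c j + B"
          using junction[OF xH False sH] eb[OF _ xH sH ij(1)] eb[OF _ iv_HC[OF xH] _ ij(2), of "mul (iv x) s"] xH sH by auto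
      qed
      then show ?thesis by blast
    qed
    show "finite {(i, x <#\<^bsub>hnn\<^esub> cyc hnn (emb (v i))) | i x. i \<in> I \<and> x \<in> carrier hnn \<and>
        c i + B < \<bar>f i (fst (iv x \<otimes>\<^bsub>hnn\<^esub> s)) - f i (fst (iv x))\<bar>}" (is "finite ?F")
      if s: "s \<in> insert (zz True) (emb ` S)" for s
    proof (cases "s = zz True")
      case True
      have F0: "?F = {}" using zb iv_HC unfolding True by (auto simp: not_less[symmetric])
      show ?thesis unfolding F0 by simp
    next
      case False
      then obtain s0 where s0: "s0 \<in> S" "s = emb s0" using s by blast
      then have s0c: "s0 \<in> carrier G" using P.S_sub by blast
      let ?G = "{(i, g <# cyc G (v i)) | i g. i \<in> I \<and> g \<in> carrier G \<and> \<bar>f i (inv g \<otimes> s0) - f i (inv g)\<bar> > c i}"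
      have "?F \<subseteq> map_prod id ((`) emb) ` ?G"
      proof
        fix Z assume "Z \<in> ?F"
        then obtain i x where Z: "Z = (i, x <#\<^bsub>hnn\<^esub> cyc hnn (emb (v i)))" "i \<in> I" "x \<in> HC"
          "c i + B < \<bar>f i (fst (mul (iv x) (emb s0))) - f i (fst (iv x))\<bar>" using s0 by auto
        have "snd (iv x) = []"
          using edge_emb[OF iv_HC[OF Z(3)] _ s0c] eb[of "iv x" "mul (iv x) (emb s0)" i] Z s0c by fastforce
        then obtain g where g: "g \<in> carrier G" "x = emb g" using emb_iff[of x] iv_Nil Z(3) by auto
        have "fst (mul (iv x) (emb s0)) = inv g \<otimes> s0" "fst (iv x) = inv g"
          using g s0c by (simp_all add: mul_emb gact_def) (simp_all add: emb_def)
        then have Gin: "(i, g <# cyc G (v i)) \<in> ?G" using Z(2,4) g(1) B by auto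
        have Zeq: "Z = map_prod id ((`) emb) (i, g <# cyc G (v i))" using Z(1,2) g coset by simp
        show "Z \<in> map_prod id ((`) emb) ` ?G" using Gin unfolding Zeq by (rule imageI)
      qed
      then show ?thesis using P.Fg[OF s0(1)] finite_surj by blast
    qed
  qed
qed

lemma split_last: 
  assumes "x \<in> HC" "snd x = l @ [(b, r)]"
  shows "x = mul (fst x, l) (mul (zz b) (emb r))" "(fst x, l) \<in> HC" "r \<in> carrier G"
proof -
  have w: "wf l" "r \<in> carrier G" using assms wf_last[of l b r] by (simp_all add: HC_iff)
  then show "(fst x, l) \<in> HC" "r \<in> carrier G" using assms by (simp_all add: HC_iff)
  have "x = mul x (\<one>, [])" using mul_one assms by simp
  also have "\<dots> = gact (fst x) (lact l (zact b (emb r)))" using assms w by (simp add: mul_def lact_snoc gact_def emb_def)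
  finally show "x = mul (fst x, l) (mul (zz b) (emb r))" using w by (simp add: mul_zz) (simp add: mul_def)
qed

text \<open>Conjugation by \<open>s\<close> is carried out from the innermost letter. As the result
  lies in \<open>G\<close>, the last stable letter must cancel, so it conjugates a power of
  \<open>u\<close> to the same power of \<open>h\<close> or conversely. By \<open>uh\<close> the
  element stays in \<open>T\<close>, and \<open>s\<close> becomes shorter.\<close>

theorem conj_reduce:
  assumes T: "T \<subseteq> carrier G" "\<And>g x. g \<in> carrier G \<Longrightarrow> x \<in> T \<Longrightarrow> g \<otimes> x \<otimes> inv g \<in> T"
    and uh: "\<And>n::int. u [^] n \<in> T \<longleftrightarrow> h [^] n \<in> T"
    and s: "s \<in> HC" and x: "x \<in> T" and y: "y \<in> carrier G" and eq: "mul (mul s (emb x)) (iv s) = emb y"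
  shows "y \<in> T"
  using s x eq
proof (induction "length (snd s)" arbitrary: s x rule: less_induct)
  case less
  have xc: "x \<in> carrier G" using less.prems T by blast
  show ?case
  proof (cases "snd s = []")
    case True
    then obtain g where g: "g \<in> carrier G" "s = emb g" using emb_iff less.prems by blast
    have "emb (g \<otimes> x \<otimes> inv g) = emb y" using less.prems(3) g xc emb.hom_mult by simp
    then show ?thesis using T(2)[OF g(1) less.prems(2)] by (simp add: emb_inj)
  next
    case False
    then obtain l b r where l: "snd s = l @ [(b, r)]" using snoc_ex by blast
    note sp = split_last[OF less.prems(1) l]
    let ?w = "mul (emb x) (iv s)"
    have w: "?w \<in> HC" "mul s ?w = emb y" using less.prems xc by (simp_all add: mul_assoc)
    have "\<not> edge s (mul s ?w)" "\<not> edge s (mul s (iv s))" using w(2) less.prems by (simp_all add: edge_def emb_def)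
    then have 1: "r \<otimes> fst ?w \<in> A b" "r \<otimes> fst (iv s) \<in> A b"
      using mul_cancel(3)[OF less.prems(1) w(1) l] mul_cancel(3)[OF less.prems(1) iv_HC[OF less.prems(1)] l] by blast+
    have "(r \<otimes> fst ?w) \<otimes> inv (r \<otimes> fst (iv s)) \<in> A b" using 1 by (rule_tac A_mult[OF _ A_inv])
    moreover have "(r \<otimes> fst ?w) \<otimes> inv (r \<otimes> fst (iv s)) = r \<otimes> x \<otimes> inv r"
      using sp(3) xc less.prems by (simp add: mul_emb gact_def inv_mult_group m_assoc cancel_inv)
    ultimately obtain n :: int where n: "r \<otimes> x \<otimes> inv r = cu b [^] n" by (auto simp: cyc_def)
    have "cu b [^] n \<in> T" using T(2)[OF sp(3) less.prems(2)] n by simp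
    then have x1: "cu (\<not> b) [^] n \<in> T" using uh by (cases b) (simp_all add: cu_def)
    let ?s1 = "(fst s, l)"
    have "mul (mul s (emb x)) (iv s) = mul (mul ?s1 (mul (mul (zz b) (mul (mul (emb r) (emb x)) (iv (emb r)))) (iv (zz b)))) (iv ?s1)"
    proof -
      define s1 where "s1 = ?s1"
      have sp': "s = mul s1 (mul (zz b) (emb r))" "s1 \<in> HC" "r \<in> carrier G" using sp by (simp_all add: s1_def)
      have "iv s = mul (iv (mul (zz b) (emb r))) (iv s1)" using sp' H.inv_mult_group[of s1 "mul (zz b) (emb r)"] by simp
      also have "iv (mul (zz b) (emb r)) = mul (iv (emb r)) (iv (zz b))" using H.inv_mult_group[of "zz b" "emb r"] sp' by simp
      finally have 1: "iv s = mul (mul (iv (emb r)) (iv (zz b))) (iv s1)" .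
      have 2: "mul s (emb x) = mul s1 (mul (zz b) (mul (emb r) (emb x)))"
        by (subst sp'(1)) (use sp' xc in \<open>simp add: mul_assoc\<close>)
      show ?thesis unfolding 1 2 s1_def[symmetric] using sp'(2,3) xc by (simp add: mul_assoc del: inv_emb)
    qed
    also have "mul (mul (emb r) (emb x)) (iv (emb r)) = emb (cu b [^] n)"
      using n[symmetric] sp xc emb.hom_mult by simp
    also have "mul (mul (zz b) (emb (cu b [^] n))) (iv (zz b)) = emb (cu (\<not> b) [^] n)"
      using zz_conj by (simp add: inv_zz)
    finally have "mul (mul ?s1 (emb (cu (\<not> b) [^] n))) (iv ?s1) = emb y" using less.prems(3) by simp
    then show ?thesis using less.hyps[of ?s1 "cu (\<not> b) [^] n"] sp(2) x1 l by simp
  qed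
qed

theorem hnn_no_inversion:
  assumes ni: "no_inversion G t" and t: "t \<in> carrier G"
    and uh: "\<And>n::int. u [^] n \<in> pos_conj G t \<longleftrightarrow> h [^] n \<in> pos_conj G t"
  shows "no_inversion hnn (emb t)"
  unfolding no_inversion_def
proof (intro ballI allI impI notI)
  fix s and m n :: nat
  assume s: "s \<in> carrier hnn" and m: "0 < m"
    and eq: "s \<otimes>\<^bsub>hnn\<^esub> emb t [^]\<^bsub>hnn\<^esub> m \<otimes>\<^bsub>hnn\<^esub> iv s \<otimes>\<^bsub>hnn\<^esub> emb t [^]\<^bsub>hnn\<^esub> n = \<one>\<^bsub>hnn\<^esub>"
  have p: "emb t [^]\<^bsub>hnn\<^esub> q = emb (t [^] q)" for q :: nat using emb.hom_nat_pow[OF t, of q] by simp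
  have "mul (mul s (emb (t [^] m))) (iv s) = iv (emb (t [^] n))"
    using eq s t unfolding p by (intro H.inv_equality[symmetric]) simp_all
  then have eq': "mul (mul s (emb (t [^] m))) (iv s) = emb (inv (t [^] n))" using t by simp
  have "inv (t [^] n) \<in> pos_conj G t"
  proof (rule conj_reduce[OF _ _ uh _ _ _ eq'])
    show "pos_conj G t \<subseteq> carrier G" by (auto simp: pos_conj_def)
    show "g \<otimes> x \<otimes> inv g \<in> pos_conj G t" if g: "g \<in> carrier G" and x: "x \<in> pos_conj G t" for g x
    proof -
      obtain k a b where k: "x \<in> carrier G" "k \<in> carrier G" "0 < a" "0 < b" "k \<otimes> x [^] (a::nat) \<otimes> inv k = t [^] (b::nat)"
        using x unfolding pos_conj_def by blast
      have "(g \<otimes> x \<otimes> inv g) [^] a = g \<otimes> x [^] a \<otimes> inv g" using conj_int_pow[OF g k(1), of "int a"] by (simp add: int_pow_int)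
      then have "(k \<otimes> inv g) \<otimes> (g \<otimes> x \<otimes> inv g) [^] a \<otimes> inv (k \<otimes> inv g) = t [^] b"
        using k g by (simp add: inv_mult_group m_assoc cancel_inv)
      moreover have "k \<otimes> inv g \<in> carrier G" using k g by simp
      ultimately show ?thesis using k g unfolding pos_conj_def by (intro CollectI conjI) (simp, blast)
    qed
    show "t [^] m \<in> pos_conj G t" unfolding pos_conj_def using t m
      by (intro CollectI conjI bexI[of _ \<one>] exI[of _ 1] exI[of _ m]) simp_all
  qed (use s t in simp_all)
  then obtain g a b where g: "g \<in> carrier G" "0 < a" "0 < b" "g \<otimes> inv (t [^] n) [^] (a::nat) \<otimes> inv g = t [^] (b::nat)"
    unfolding pos_conj_def by blast
  have "inv (t [^] n) [^] a = inv (t [^] (n * a))" using t by (simp add: nat_pow_pow nat_pow_inv)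
  then have "inv g \<otimes> t [^] b \<otimes> inv (inv g) \<otimes> t [^] (n * a) = \<one>"
    using g(1) t g(4)[symmetric] by (simp add: m_assoc cancel_inv)
  then show False using ni g(1,3) unfolding no_inversion_def by (metis inv_closed)
qed

lemma length_lact: "length (snd (lact l y)) \<le> length l + length (snd y)"
proof (induction l)
  case (Cons p l)
  obtain b r where p: "p = (b, r)" by fastforce
  have "length (snd (zact b w)) \<le> Suc (length (snd w))" for w by (auto simp: zact_def)
  from this[of "gact r (lact l y)"] show ?case using Cons by (simp add: p gact_def)
qed simp

text \<open>If \<open>x\<close> and its inverse begin with different edges, nothing cancels in the
  powers of \<open>x\<close>, so they all begin like \<open>x\<close> and none is trivial. If they
  begin with the same edge, conjugation by \<open>p\<close>, the first segment of \<open>x\<close>,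
  makes \<open>x\<close> shorter.\<close>

theorem hnn_torsion_free:
  assumes tf: "torsion_free G"
  shows "torsion_free hnn"
  unfolding torsion_free_def
proof (intro ballI allI impI)
  fix x and n :: nat
  assume "x \<in> carrier hnn" "0 < n" "x [^]\<^bsub>hnn\<^esub> n = \<one>\<^bsub>hnn\<^esub>"
  then show "x = \<one>\<^bsub>hnn\<^esub>"
  proof (induction "length (snd x)" arbitrary: x rule: less_induct)
    case less
    then have x: "x \<in> HC" by simp
    show ?case
    proof (cases "snd x = []")
      case True
      then obtain g where g: "g \<in> carrier G" "x = emb g" using emb_iff x by blast
      have "emb (g [^] n) = emb \<one>" using less.prems(3) g emb.hom_nat_pow[OF g(1), of n] by (simp add: emb_def)
      then have "g = \<one>" using tf g less.prems(2) unfolding torsion_free_def emb_inj by blast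
      then show ?thesis using g by (simp add: emb_def)
    next
      case ne: False
      obtain l b r where l: "snd x = l @ [(b, r)]" using snoc_ex ne by blast
      show ?thesis
      proof (cases "edge (iv x) x")
        case True
        obtain e q l' where hd: "snd x = (e, q) # l'" using ne by (cases "snd x") auto
        let ?g = "fst x"
        define p where "p = mul (emb (fst x)) (zz e)"
        have q: "(q, l') \<in> HC" "q \<in> carrier G" using x hd by (simp_all add: HC_iff)
        have g: "?g \<in> carrier G" and pH: "p \<in> HC" using x by (simp_all add: p_def)
        have "lact (snd x) (\<one>, []) = zact e (q, l')" 
          using q lact_one[of l'] by (simp add: hd gact_def HC_iff)
        then have xp: "x = mul p (q, l')"
          using mul_one[OF x] q g by (simp add: mul_def[of x] mul_gact mul_emb mul_zz p_def)
        have "\<not> edge x (mul x (iv x))" using x by (simp add: edge_def)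
        then have 1: "sg (iv x) = (\<not> b)" "r \<otimes> fst (iv x) \<in> A b" using mul_cancel[OF x iv_HC[OF x] l] by blast+
        have "sg (iv x) = sg x" "inv (fst (iv x)) \<otimes> ?g \<in> A (\<not> sg (iv x))" using True unfolding edge_def by blast+
        then have e: "e = (\<not> b)" "inv (fst (iv x)) \<otimes> ?g \<in> A b" unfolding 1(1) using hd by (auto simp: sg_def)
        have "(r \<otimes> fst (iv x)) \<otimes> (inv (fst (iv x)) \<otimes> ?g) \<in> A b" using 1(2) e(2) by (rule A_mult)
        moreover have rc: "r \<in> carrier G" using split_last[OF x l] by simp
        ultimately have "r \<otimes> ?g \<in> A b" using x g by (simp add: m_assoc cancel_inv)
        then obtain n' :: int where n': "r \<otimes> ?g = cu b [^] n'" by (auto simp: cyc_def)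
        have "l' \<noteq> []" using l hd e by auto
        then obtain l'' where l'': "l' = l'' @ [(b, r)]" using l hd by (cases l) auto
        have sp: "(q, l') = mul (q, l'') (mul (zz b) (emb r))" "(q, l'') \<in> HC"
          using split_last(1,2)[OF q(1), of l'' b r, unfolded fst_conv snd_conv, OF l''] .
        have "mul (q, l') p = mul (q, l'') (mul (mul (zz b) (mul (emb r) (emb ?g))) (zz e))"
          using sp rc g by (simp add: mul_assoc p_def)
        also have "mul (emb r) (emb ?g) = emb (cu b [^] n')" using n'[symmetric] emb.hom_mult[OF rc g] by simp
        also have "mul (mul (zz b) (emb (cu b [^] n'))) (zz e) = emb (cu (\<not> b) [^] n')" using zz_conj e by simp
        finally have y: "mul (q, l') p = mul (q, l'') (emb (cu (\<not> b) [^] n'))" .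
        let ?y = "mul (mul (iv p) x) p"
        have yeq: "?y = mul (q, l') p" using xp q pH by simp
        have "length (snd ?y) \<le> length l''" unfolding yeq y using length_lact[of l''] by (simp add: mul_def gact_def emb_def) (metis add.right_neutral list.size(3) snd_conv)
        then have len: "length (snd ?y) < length (snd x)" by (simp add: hd l'')
        have "?y [^]\<^bsub>hnn\<^esub> n = mul (mul (iv p) (x [^]\<^bsub>hnn\<^esub> n)) p"
          using H.conj_int_pow[of "iv p" x "int n"] x pH by (simp add: int_pow_int)
        then have "?y [^]\<^bsub>hnn\<^esub> n = \<one>\<^bsub>hnn\<^esub>" using less.prems pH mul_one[of "iv p"] by simp
        then have "?y = \<one>\<^bsub>hnn\<^esub>" using less.hyps[OF len] x pH less.prems(2) by simp
        then have "mul (iv p) x = iv p" using H.inv_equality[of "mul (iv p) x" p] x pH by simp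
        then have "mul p (mul (iv p) x) = (\<one>, [])" using pH by simp
        then show ?thesis using x pH by simp
      next
        case False
        have "edge x (x [^]\<^bsub>hnn\<^esub> Suc k)" for k
        proof (induction k)
          case 0
          have "inv (fst x) \<otimes> fst x \<in> A (\<not> sg x)" using x by simp
          then show ?case using ne x mul_def[of "(\<one>, [])" x] by (simp add: edge_def)
        next
          case (Suc k)
          have pw: "x [^]\<^bsub>hnn\<^esub> Suc k \<in> HC" using x H.nat_pow_closed[of x "Suc k"] by simp
          have "\<not> edge (iv x) (x [^]\<^bsub>hnn\<^esub> Suc k)"
            using False Suc edge_trans[OF iv_HC[OF x] pw x] edge_sym[OF x pw] by blast
          then have "edge x (mul x (x [^]\<^bsub>hnn\<^esub> Suc k))"
            using junction[of "iv x" "x [^]\<^bsub>hnn\<^esub> Suc k"] x pw ne iv_Nil[OF x] by simp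
          then show ?case using H.nat_pow_Suc2[of x "Suc k"] x by simp
        qed
        moreover obtain k where "n = Suc k" using less.prems(2) by (cases n) auto
        ultimately have "edge x (\<one>\<^bsub>hnn\<^esub>)" using less.prems(3) by metis
        then show ?thesis by (simp add: edge_def)
      qed
    qed
  qed
qed

definition es :: "'a \<times> (bool \<times> 'a) list \<Rightarrow> int" where
  "es x = (\<Sum>p\<leftarrow>snd x. if fst p then 1 else - 1)"

lemma es_zact: "es (zact b y) = es y + (if b then 1 else - 1)"
proof (cases "snd y")
  case (Cons p l)
  then show ?thesis by (cases b; cases "fst p") (simp_all add: es_def zact_def)
qed (simp add: es_def zact_def)

lemma es_mul: "es (mul x y) = es x + es y"
proof -
  have "es (gact g y) = es y" for g y by (simp add: es_def gact_def)
  moreover have "es (lact l y) = (\<Sum>p\<leftarrow>l. if fst p then 1 else - 1) + es y" for l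
    by (induction l) (auto simp: es_zact calculation)
  ultimately show ?thesis by (simp add: mul_def es_def[of x])
qed

text \<open>The exponent sum of the stable letter is additive, and it equals m + n > 0 on the
  product in question.\<close>

lemma zz_no_inversion: "no_inversion hnn (zz True)"
  unfolding no_inversion_def
proof (intro ballI allI impI notI)
  fix x and m n :: nat
  assume x: "x \<in> carrier hnn" "0 < m" and eq: "x \<otimes>\<^bsub>hnn\<^esub> zz True [^]\<^bsub>hnn\<^esub> m \<otimes>\<^bsub>hnn\<^esub> iv x \<otimes>\<^bsub>hnn\<^esub> zz True [^]\<^bsub>hnn\<^esub> n = \<one>\<^bsub>hnn\<^esub>"
  have one: "es (\<one>, []) = 0" by (simp add: es_def)
  have pw: "es (zz True [^]\<^bsub>hnn\<^esub> q) = int q" for q :: nat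
    by (induction q) (simp_all add: es_mul one, simp add: es_def zz_def)
  have "es (iv x) = - es x" using es_mul[of x "iv x"] x one by simp
  then have "es (x \<otimes>\<^bsub>hnn\<^esub> zz True [^]\<^bsub>hnn\<^esub> m \<otimes>\<^bsub>hnn\<^esub> iv x \<otimes>\<^bsub>hnn\<^esub> zz True [^]\<^bsub>hnn\<^esub> n) = int m + int n"
    by (simp add: es_mul pw)
  then show False using eq one x(2) by simp
qed

end

section \<open>Making two elements conjugate\<close>

context group
begin

lemma tf_int_pow: "torsion_free G \<Longrightarrow> x \<in> carrier G \<Longrightarrow> x \<noteq> \<one> \<Longrightarrow> x [^] (n::int) = \<one> \<longleftrightarrow> n = 0"
proof -
  assume tf: "torsion_free G" and x: "x \<in> carrier G" "x \<noteq> \<one>"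
  have nat: "x [^] (q::nat) = \<one> \<longleftrightarrow> q = 0" for q using tf x unfolding torsion_free_def by (cases "q = 0") auto
  show ?thesis
  proof (cases n rule: int_cases2)
    case (nonneg q)
    then show ?thesis using nat[of q] by (simp add: int_pow_int)
  next
    case (nonpos q)
    then show ?thesis using nat[of q] x by (simp add: int_pow_neg_int)
  qed
qed

lemma conj_nat_pow: "g \<in> carrier G \<Longrightarrow> x \<in> carrier G \<Longrightarrow> (g \<otimes> x \<otimes> inv g) [^] (n::nat) = g \<otimes> x [^] n \<otimes> inv g"
  using conj_int_pow[of g x "int n"] by (simp add: int_pow_int)

lemma pos_conjI: "\<lbrakk>x \<in> carrier G; g \<in> carrier G; 0 < m; 0 < n; g \<otimes> x [^] (m::nat) \<otimes> inv g = t [^] (n::nat)\<rbrakk> \<Longrightarrow> x \<in> pos_conj G t"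
  unfolding pos_conj_def by blast

lemma pos_conj_conj: 
  assumes "g \<in> carrier G" "x \<in> pos_conj G t" shows "g \<otimes> x \<otimes> inv g \<in> pos_conj G t"
proof -
  obtain k a b where k: "x \<in> carrier G" "k \<in> carrier G" "0 < a" "0 < b" "k \<otimes> x [^] (a::nat) \<otimes> inv k = t [^] (b::nat)"
    using assms unfolding pos_conj_def by blast
  then have "(k \<otimes> inv g) \<otimes> (g \<otimes> x \<otimes> inv g) [^] a \<otimes> inv (k \<otimes> inv g) = t [^] b"
    unfolding conj_nat_pow[OF assms(1) k(1)] using assms(1) k by (simp add: inv_mult_group m_assoc cancel_inv)
  then show ?thesis using k assms by (intro pos_conjI[of _ "k \<otimes> inv g" a b]) simp_all
qed

lemma pos_conj_self: "t \<in> carrier G \<Longrightarrow> t \<in> pos_conj G t"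
  by (rule pos_conjI[of _ \<one> 1 1]) simp_all

lemma pos_conj_pow:
  assumes t: "t \<in> carrier G" and x: "x \<in> carrier G" and n: "0 < (n::nat)"
  shows "x [^] n \<in> pos_conj G t \<longleftrightarrow> x \<in> pos_conj G t"
proof
  assume "x [^] n \<in> pos_conj G t"
  then obtain g a b where "g \<in> carrier G" "0 < a" "0 < b" "g \<otimes> (x [^] n) [^] (a::nat) \<otimes> inv g = t [^] (b::nat)"
    unfolding pos_conj_def by blast
  then show "x \<in> pos_conj G t" using x n by (intro pos_conjI[of x g "n * a" b]) (simp_all add: nat_pow_pow)
next
  assume "x \<in> pos_conj G t"
  then obtain g a b where g: "g \<in> carrier G" "0 < a" "0 < b" "g \<otimes> x [^] (a::nat) \<otimes> inv g = t [^] (b::nat)"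
    unfolding pos_conj_def by blast
  then have "g \<otimes> (x [^] n) [^] a \<otimes> inv g = t [^] (b * n)"
    using x t conj_nat_pow[of g "x [^] a" n] by (simp add: nat_pow_pow mult.commute)
  then show "x [^] n \<in> pos_conj G t" using x n g by (intro pos_conjI[of _ g a "b * n"]) simp_all
qed

lemma pos_conj_inv:
  assumes ni: "no_inversion G t" and t: "t \<in> carrier G" and x: "x \<in> pos_conj G t"
  shows "inv x \<notin> pos_conj G t"
proof
  assume "inv x \<in> pos_conj G t"
  then obtain g' a' b' where g': "g' \<in> carrier G" "0 < a'" "0 < b'" "g' \<otimes> inv x [^] (a'::nat) \<otimes> inv g' = t [^] (b'::nat)"
    unfolding pos_conj_def by blast
  obtain g a b where g: "x \<in> carrier G" "g \<in> carrier G" "0 < a" "0 < b" "g \<otimes> x [^] (a::nat) \<otimes> inv g = t [^] (b::nat)"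
    using x unfolding pos_conj_def by blast
  have 1: "g \<otimes> x [^] (a * a') \<otimes> inv g = t [^] (b * a')"
    using g t conj_nat_pow[of g "x [^] a" a'] by (simp add: nat_pow_pow)
  have 2: "g' \<otimes> inv (x [^] (a * a')) \<otimes> inv g' = t [^] (b' * a)"
    using g g' t conj_nat_pow[of g' "inv x [^] a'" a] by (simp add: nat_pow_pow nat_pow_inv mult.commute)
  define xp where "xp = x [^] (a * a')"
  have xp: "xp \<in> carrier G" using g by (simp add: xp_def)
  have "(g \<otimes> inv g') \<otimes> t [^] (b' * a) \<otimes> inv (g \<otimes> inv g') \<otimes> t [^] (b * a') = \<one>"
    unfolding 1[symmetric] 2[symmetric] xp_def[symmetric]
    using g g' xp by (simp add: inv_mult_group m_assoc cancel_inv)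
  moreover have "g \<otimes> inv g' \<in> carrier G" "0 < b' * a" using g g' by simp_all
  ultimately show False using ni unfolding no_inversion_def by blast
qed

lemma pos_conj_int_pow:
  assumes ni: "no_inversion G t" and t: "t \<in> carrier G" and x: "x \<in> carrier G"
  shows "x [^] (n::int) \<in> pos_conj G t \<longleftrightarrow> (n > 0 \<and> x \<in> pos_conj G t \<or> n < 0 \<and> inv x \<in> pos_conj G t)"
proof -
  have one: "\<one> \<notin> pos_conj G t" using pos_conj_inv[OF ni t, of \<one>] by auto
  show ?thesis
  proof (cases n rule: int_cases3)
    case zero
    then show ?thesis using one by simp
  next
    case (pos q)
    then show ?thesis using pos_conj_pow[OF t x, of q] by (simp add: int_pow_int)
  next
    case (neg q)
    have "x [^] n = inv x [^] q" using neg x by (simp add: int_pow_neg_int nat_pow_inv)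
    then show ?thesis using pos_conj_pow[OF t inv_closed[OF x], of q] neg by simp
  qed
qed

end

lemma sysI: "psys G S UNIV v m (\<lambda>_. c) f \<Longrightarrow> 1 \<le> c \<Longrightarrow> sys G S v"
  unfolding sys_def by blast

lemma (in hnn_base) sys_hnn:
  assumes sys: "sys G S v" and ne: "u \<noteq> \<one>" "h \<noteq> \<one>"
  obtains n0 where "sys hnn (insert (zz True) (emb ` S)) (\<lambda>i. emb (v (i + n0)))"
proof -
  obtain m c f where c: "1 \<le> c" and P: "psys G S (UNIV :: nat set) v m (\<lambda>_. c) f" using sys unfolding sys_def by blast
  interpret P: psysN G S UNIV v m "\<lambda>_. c" f using P by (simp add: psysN_def)
  obtain n1 B1 where B1: "\<And>i g l. n1 \<le> i \<Longrightarrow> g \<in> carrier G \<Longrightarrow> \<bar>f i (g \<otimes> u [^] (l::int)) - f i g\<bar> \<le> B1"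
    using P.orbit_bounded[of c u] ne by (metis UNIV_I order_refl u)
  obtain n2 B2 where B2: "\<And>i g l. n2 \<le> i \<Longrightarrow> g \<in> carrier G \<Longrightarrow> \<bar>f i (g \<otimes> h [^] (l::int)) - f i g\<bar> \<le> B2"
    using P.orbit_bounded[of c h] ne by (metis UNIV_I order_refl h)
  define n0 where "n0 = max n1 n2"
  have "psys G S UNIV (\<lambda>i. v (i + n0)) (\<lambda>i. m (i + n0)) (\<lambda>_. c) (\<lambda>i. f (i + n0))"
    by (rule P.psys_reindex) (auto simp: inj_on_def)
  then have "psys hnn (insert (zz True) (emb ` S)) UNIV (\<lambda>i. emb (v (i + n0))) (\<lambda>i. m (i + n0)) (\<lambda>i. c + (\<bar>B1\<bar> + \<bar>B2\<bar>)) (\<lambda>i x. f (i + n0) (fst x))"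
  proof (rule psys_hnn)
    show "\<bar>f (i + n0) (g \<otimes> a) - f (i + n0) g\<bar> \<le> \<bar>B1\<bar> + \<bar>B2\<bar>" if ga: "g \<in> carrier G" "a \<in> A b" for i g a b
    proof -
      obtain l :: int where "a = cu b [^] l" using ga(2) by (auto simp: cyc_def)
      moreover have "n1 \<le> i + n0" "n2 \<le> i + n0" by (simp_all add: n0_def)
      ultimately show ?thesis using B1[of "i + n0" g l] B2[of "i + n0" g l] ga(1) by (cases b) (auto simp: cu_def)
    qed
  qed simp
  then show ?thesis by (rule that[OF sysI]) (use c in simp)
qed

lemma (in group_hom) hom_no_inversion_conv:
  assumes surj: "h ` carrier G = carrier H" and t: "t \<in> carrier G"
  shows "no_inversion H (h t) \<longleftrightarrow> (\<forall>x \<in> carrier G. \<forall>(m::nat) (n::nat). 0 < m \<longrightarrow>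
    h (x \<otimes> t [^] m \<otimes> inv x \<otimes> t [^] n) \<noteq> \<one>\<^bsub>H\<^esub>)"
proof -
  have "h (x \<otimes> t [^] m \<otimes> inv x \<otimes> t [^] n) = h x \<otimes>\<^bsub>H\<^esub> h t [^]\<^bsub>H\<^esub> m \<otimes>\<^bsub>H\<^esub> inv\<^bsub>H\<^esub> h x \<otimes>\<^bsub>H\<^esub> h t [^]\<^bsub>H\<^esub> n"
    if "x \<in> carrier G" for x and m n :: nat using that t by (simp add: hom_nat_pow)
  then show ?thesis unfolding no_inversion_def surj[symmetric] by auto
qed

lemma (in group_hom) hom_torsion_free_conv:
  assumes surj: "h ` carrier G = carrier H"
  shows "torsion_free H \<longleftrightarrow> (\<forall>x \<in> carrier G. \<forall>n::nat. 0 < n \<longrightarrow> h (x [^] n) = \<one>\<^bsub>H\<^esub> \<longrightarrow> h x = \<one>\<^bsub>H\<^esub>)"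
  unfolding torsion_free_def surj[symmetric] by (auto simp: hom_nat_pow)

lemma (in normal) Mod_hom: "group_hom G (G Mod H) ((#>) H)"
  using r_coset_hom_Mod factorgroup_is_group is_group by (simp add: group_hom_def group_hom_axioms_def)

lemma Mod_surj: "(#>\<^bsub>G\<^esub>) N ` carrier G = carrier (G Mod N)"
  by (auto simp: FactGroup_def RCOSETS_def)

lemma (in normal) Mod_one: "g \<in> carrier G \<Longrightarrow> H #> g = \<one>\<^bsub>G Mod H\<^esub> \<longleftrightarrow> g \<in> H"
  using coset_join1[OF _ _ subgroup_axioms] coset_join2[OF _ subgroup_axioms] by auto

context group
begin

text \<open>The result is again a quotient of \<open>G\<close>: \<open>fill\<close> identifies the
  stable letter with a product of elements \<open>v i\<close>, which come from \<open>G\<close>. The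
  relation that defines the HNN extension then becomes conjugacy by the image of an element of
  \<open>G\<close>.\<close>

lemma resolve_pair:
  fixes S :: "'a set"
  assumes sys: "sys G S v" and tf: "torsion_free G" and ni: "no_inversion G t"
    and t: "t \<in> carrier G" and a: "a \<in> carrier G" "a \<noteq> \<one>"
    and u: "u \<in> carrier G" "u \<noteq> \<one>" and h: "h \<in> carrier G" "h \<noteq> \<one>"
    and uh: "\<And>n::int. u [^] n \<in> pos_conj G t \<longleftrightarrow> h [^] n \<in> pos_conj G t"
  obtains K :: "('a \<times> (bool \<times> 'a) list) set monoid" and \<psi> S' v' where
    "group_hom G K \<psi>" "\<psi> ` carrier G = carrier K" "sys K S' v'" "torsion_free K" "no_inversion K (\<psi> t)" "\<psi> a \<noteq> \<one>\<^bsub>K\<^esub>"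
    "\<exists>g \<in> carrier G. \<psi> (g \<otimes> u \<otimes> inv g) = \<psi> h"
proof -
  interpret L: hnn_base G u h
    by unfold_locales (use u h tf_int_pow[OF tf u] tf_int_pow[OF tf h] in auto)
  obtain n0 where sysL: "sys L.hnn (insert (L.zz True) (L.emb ` S)) (\<lambda>i. L.emb (v (i + n0)))"
    using L.sys_hnn[OF sys u(2) h(2)] .
  have vc: "v i \<in> carrier G" for i
    using sys unfolding sys_def by (metis psys.v_closed UNIV_I)
  have z: "L.zz True \<in> carrier L.hnn" and tL: "L.emb t \<in> carrier L.hnn" and aL: "L.emb a \<in> carrier L.hnn" "L.emb a \<noteq> \<one>\<^bsub>L.hnn\<^esub>"
    using t a L.zz_HC by (simp_all only: L.hnn_simps L.emb_HC) (simp add: L.emb_def)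
  have ni': "no_inversion L.hnn (L.emb t)" by (rule L.hnn_no_inversion[OF ni t uh])
  obtain N n1 where N: "N \<lhd> L.hnn"
    and sysK: "sys (L.hnn Mod N) ((#>\<^bsub>L.hnn\<^esub>) N ` insert (L.zz True) (L.emb ` S)) (\<lambda>i. N #>\<^bsub>L.hnn\<^esub> L.emb (v (i + n1 + n0)))"
    and tfK: "torsion_free (L.hnn Mod N)" and niK: "no_inversion (L.hnn Mod N) (N #>\<^bsub>L.hnn\<^esub> L.emb t)" and aN: "L.emb a \<notin> N"
    and V: "\<exists>V \<in> generate L.hnn (range (\<lambda>i. L.emb (v (i + n0)))). V \<otimes>\<^bsub>L.hnn\<^esub> inv\<^bsub>L.hnn\<^esub> L.zz True \<in> N"
    using L.H.fill[OF sysL L.hnn_torsion_free[OF tf] z tL ni' aL] .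
  interpret N: normal N L.hnn by (rule N)
  let ?K = "L.hnn Mod N" and ?q = "(#>\<^bsub>L.hnn\<^esub>) N"
  interpret q: group_hom L.hnn ?K ?q by (rule N.Mod_hom)
  define \<psi> where "\<psi> g = ?q (L.emb g)" for g
  interpret psi: group_hom G ?K \<psi>
  proof unfold_locales
    have "\<psi> = ?q \<circ> L.emb" by (auto simp: \<psi>_def)
    then show "\<psi> \<in> hom G ?K" using Group.hom_compose[OF L.emb_hom q.homh] by simp
  qed
  have "generate L.hnn (range (\<lambda>i. L.emb (v (i + n0)))) \<subseteq> L.emb ` carrier G"
  proof (rule L.H.generate_subgroup_incl)
    show "subgroup (L.emb ` carrier G) L.hnn" by (rule L.emb.img_is_subgroup)
  qed (use vc in auto)
  then obtain w where w: "w \<in> carrier G" "L.emb w \<otimes>\<^bsub>L.hnn\<^esub> inv\<^bsub>L.hnn\<^esub> L.zz True \<in> N" using V by blast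
  have qz: "?q (L.zz True) = \<psi> w"
  proof -
    have ew: "L.emb w \<in> carrier L.hnn" using w by simp
    have "?q (L.emb w) \<otimes>\<^bsub>?K\<^esub> inv\<^bsub>?K\<^esub> ?q (L.zz True) = \<one>\<^bsub>?K\<^esub>"
      using N.Mod_one[of "L.emb w \<otimes>\<^bsub>L.hnn\<^esub> inv\<^bsub>L.hnn\<^esub> L.zz True"] w ew z q.hom_mult[OF ew L.H.inv_closed[OF z]] q.hom_inv[OF z]
      by (metis L.H.inv_closed L.H.m_closed)
    then have "?q (L.emb w) = ?q (L.zz True)"
      by (metis q.H.inv_equality q.H.inv_inv q.H.inv_closed q.hom_closed ew z)
    then show ?thesis by (simp only: \<psi>_def)
  qed
  have gc: "generate G (carrier G) = carrier G"
    using generate_incl[of "carrier G"] by (auto intro: generate.incl)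
  have surj: "\<psi> ` carrier G = carrier ?K"
  proof
    show "\<psi> ` carrier G \<subseteq> carrier ?K" using psi.hom_closed by blast
    have "carrier ?K = ?q ` generate L.hnn (insert (L.zz True) (L.emb ` carrier G))"
      using L.HC_generate[OF order_refl gc] Mod_surj[of L.hnn N] by simp
    also have "\<dots> = generate ?K (?q ` insert (L.zz True) (L.emb ` carrier G))"
      using z by (intro q.generate_img[symmetric]) auto
    also have "\<dots> \<subseteq> \<psi> ` carrier G"
    proof (rule q.H.generate_subgroup_incl[OF _ psi.img_is_subgroup])
      show "?q ` insert (L.zz True) (L.emb ` carrier G) \<subseteq> \<psi> ` carrier G" using qz w by (auto simp: \<psi>_def)
    qed
    finally show "carrier ?K \<subseteq> \<psi> ` carrier G" .
  qed
  have conj: "\<psi> (w \<otimes> u \<otimes> inv w) = \<psi> h"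
  proof -
    have "\<psi> (w \<otimes> u \<otimes> inv w) = ?q (L.zz True) \<otimes>\<^bsub>?K\<^esub> ?q (L.emb u) \<otimes>\<^bsub>?K\<^esub> inv\<^bsub>?K\<^esub> ?q (L.zz True)"
      using w u psi.hom_mult psi.hom_inv unfolding qz by (simp add: \<psi>_def[of u])
    also have "\<dots> = ?q (L.zz True \<otimes>\<^bsub>L.hnn\<^esub> L.emb u \<otimes>\<^bsub>L.hnn\<^esub> inv\<^bsub>L.hnn\<^esub> L.zz True)"
      using z u q.hom_mult q.hom_inv by simp
    also have "L.zz True \<otimes>\<^bsub>L.hnn\<^esub> L.emb u \<otimes>\<^bsub>L.hnn\<^esub> inv\<^bsub>L.hnn\<^esub> L.zz True = L.emb h"
      using L.zz_conj[of True 1] u h by (simp add: L.inv_zz L.cu_def)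
    finally show ?thesis by (simp only: \<psi>_def)
  qed
  have "\<psi> a \<noteq> \<one>\<^bsub>?K\<^esub>" using aN N.Mod_one[OF aL(1)] by (simp add: \<psi>_def)
  then show ?thesis using that[OF psi.group_hom_axioms surj sysK tfK] niK conj w by (metis \<psi>_def)
qed

theorem resolve:
  fixes S :: "'a set"
  assumes sys: "sys G S v" and tf: "torsion_free G" and ni: "no_inversion G t"
    and t: "t \<in> carrier G" and a: "a \<in> carrier G" "a \<noteq> \<one>" and ta: "t \<otimes> a \<otimes> inv t = inv a"
    and u: "u \<in> carrier G" "u \<noteq> \<one>"
  obtains K :: "('a \<times> (bool \<times> 'a) list) set monoid" and \<psi> S' v' where
    "group_hom G K \<psi>" "\<psi> ` carrier G = carrier K" "sys K S' v'" "torsion_free K" "no_inversion K (\<psi> t)" "\<psi> a \<noteq> \<one>\<^bsub>K\<^esub>"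
    "\<exists>g \<in> carrier G. \<exists>c \<in> {a, t, inv t}. \<psi> (g \<otimes> u \<otimes> inv g) = \<psi> c"
proof -
  let ?T = "pos_conj G t"
  note pw = pos_conj_int_pow[OF ni t]
  have tT: "t \<in> ?T" "inv t \<notin> ?T" using pos_conj_self[OF t] pos_conj_inv[OF ni t] by auto
  have t1: "t \<noteq> \<one>" using no_inversion_ne[OF ni] .
  consider "u \<in> ?T" | "inv u \<in> ?T" | "u \<notin> ?T" "inv u \<notin> ?T" by blast
  then show thesis
  proof cases
    case 1
    have "u [^] n \<in> ?T \<longleftrightarrow> t [^] n \<in> ?T" for n :: int
      using pw[OF u(1)] pw[OF t] 1 tT pos_conj_inv[OF ni t 1] by simp
    from resolve_pair[OF sys tf ni t a u t t1 this] show thesis using that by (metis insertCI)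
  next
    \<comment> \<open>\<open>inv u\<close> is made conjugate to \<open>t\<close>, and the equation
      is inverted.\<close>
    case 2
    have "inv u [^] n \<in> ?T \<longleftrightarrow> t [^] n \<in> ?T" for n :: int
      using pw[OF inv_closed[OF u(1)]] pw[OF t] 2 tT pos_conj_inv[OF ni t 2] u by simp
    moreover have iu: "inv u \<in> carrier G" "inv u \<noteq> \<one>" using u by auto
    ultimately obtain K :: "('a \<times> (bool \<times> 'a) list) set monoid" and \<psi> S' v' where
      K: "group_hom G K \<psi>" "\<psi> ` carrier G = carrier K" "sys K S' v'" "torsion_free K" "no_inversion K (\<psi> t)" "\<psi> a \<noteq> \<one>\<^bsub>K\<^esub>"
      and g: "\<exists>g \<in> carrier G. \<psi> (g \<otimes> inv u \<otimes> inv g) = \<psi> t"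
      using resolve_pair[OF sys tf ni t a iu t t1] by metis
    interpret K: group_hom G K \<psi> by (rule K(1))
    obtain g where g: "g \<in> carrier G" "\<psi> (g \<otimes> inv u \<otimes> inv g) = \<psi> t" using g by blast
    have "g \<otimes> u \<otimes> inv g = inv (g \<otimes> inv u \<otimes> inv g)" using g u by (simp add: inv_mult_group m_assoc)
    then have "\<psi> (g \<otimes> u \<otimes> inv g) = \<psi> (inv t)" using g u t by (metis K.hom_inv m_closed inv_closed)
    then show thesis using that[OF K] g by blast
  next
    case 3
    \<comment> \<open>\<open>t\<close> conjugates \<open>a\<close> to its inverse, so
      \<open>?T\<close> would contain both, which (I) forbids.\<close>
    have aT: "a \<notin> ?T"
      using pos_conj_conj[OF t, of a t] pos_conj_inv[OF ni t, of a] ta by auto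
    have "inv a \<notin> ?T"
    proof
      assume "inv a \<in> ?T"
      then have "t \<otimes> inv a \<otimes> inv t \<in> ?T" by (rule pos_conj_conj[OF t])
      moreover have "t \<otimes> inv a \<otimes> inv t = inv (t \<otimes> a \<otimes> inv t)" using t a by (simp add: inv_mult_group m_assoc)
      ultimately show False using aT ta a by simp
    qed
    then have "u [^] n \<in> ?T \<longleftrightarrow> a [^] n \<in> ?T" for n :: int
      using pw[OF u(1)] pw[OF a(1)] 3 aT by simp
    from resolve_pair[OF sys tf ni t a u a this] show thesis using that by (metis insertCI)
  qed
qed

end

lemma sys_iso:
  assumes G: "group G" and H: "group H" and \<theta>: "\<theta> \<in> iso G H" and sys: "sys G S v"
  shows "sys H (\<theta> ` S) (\<lambda>i. \<theta> (v i))"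
proof -
  interpret G: group G by (rule G)
  interpret H: group H by (rule H)
  interpret th: group_hom G H \<theta> using \<theta> by unfold_locales (simp add: iso_def)
  obtain m c f where c: "1 \<le> c" and P: "psys G S (UNIV :: nat set) v m (\<lambda>_. c) f" using sys unfolding sys_def by blast
  interpret P: psys G S UNIV v m "\<lambda>_. c" f by (rule P)
  have bij: "inj_on \<theta> (carrier G)" "\<theta> ` carrier G = carrier H" using \<theta> by (auto simp: iso_def bij_betw_def)
  define \<kappa> where "\<kappa> = inv_into (carrier G) \<theta>"
  have \<kappa>: "\<kappa> (\<theta> x) = x" if "x \<in> carrier G" for x using that bij by (simp add: \<kappa>_def)
  have ex: "\<exists>x \<in> carrier G. y = \<theta> x" if "y \<in> carrier H" for y using that bij(2) by auto
  have "psys H (\<theta> ` S) UNIV (\<lambda>i. \<theta> (v i)) m (\<lambda>_. c) (\<lambda>i y. f i (\<kappa> y))"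
  proof
    show "finite (\<theta> ` S)" "\<theta> ` S \<subseteq> carrier H" using P.S_fin P.S_sub by auto
    show "generate H (\<theta> ` S) = carrier H" using th.generate_img[OF P.S_sub] P.S_gen bij by simp
    show "f i (\<kappa> (\<theta> (v i) \<otimes>\<^bsub>H\<^esub> s)) = f i (\<kappa> s) + m i" if sH: "s \<in> carrier H" for i s
    proof -
      obtain x where x: "x \<in> carrier G" "s = \<theta> x" using ex[OF sH] by blast
      then show ?thesis using \<kappa>[of "v i \<otimes>\<^bsub>G\<^esub> x"] \<kappa>[of x] P.f_v by simp
    qed
    show "\<exists>p q. \<forall>s \<in> carrier H. \<bar>f i (\<kappa> s) - p\<bar> \<le> c \<or> \<bar>f j (\<kappa> (inv\<^bsub>H\<^esub> y \<otimes>\<^bsub>H\<^esub> s)) - q\<bar> \<le> c"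
      if y: "y \<in> carrier H" "\<not> (i = j \<and> y \<in> cyc H (\<theta> (v i)))" for i j y
    proof -
      obtain x where x: "x \<in> carrier G" "y = \<theta> x" using ex[OF y(1)] by blast
      have "\<not> (i = j \<and> x \<in> cyc G (v i))" using y(2) x by (auto simp: cyc_def th.hom_int_pow)
      from P.CB[OF _ _ x(1) this] obtain p q where
        pq: "\<forall>s \<in> carrier G. \<bar>f i s - p\<bar> \<le> c \<or> \<bar>f j (inv\<^bsub>G\<^esub> x \<otimes>\<^bsub>G\<^esub> s) - q\<bar> \<le> c" by blast
      have "\<bar>f i (\<kappa> s) - p\<bar> \<le> c \<or> \<bar>f j (\<kappa> (inv\<^bsub>H\<^esub> y \<otimes>\<^bsub>H\<^esub> s)) - q\<bar> \<le> c" if s: "s \<in> carrier H" for s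
      proof -
        obtain g where g: "g \<in> carrier G" "s = \<theta> g" using ex[OF s] by blast
        then show ?thesis using pq x \<kappa>[of g] \<kappa>[of "inv\<^bsub>G\<^esub> x \<otimes>\<^bsub>G\<^esub> g"] by simp
      qed
      then show ?thesis by blast
    qed
    show "finite {(i, y <#\<^bsub>H\<^esub> cyc H (\<theta> (v i))) | i y. i \<in> UNIV \<and> y \<in> carrier H \<and>
        c < \<bar>f i (\<kappa> (inv\<^bsub>H\<^esub> y \<otimes>\<^bsub>H\<^esub> s)) - f i (\<kappa> (inv\<^bsub>H\<^esub> y))\<bar>}" (is "finite ?F") if s: "s \<in> \<theta> ` S" for s
    proof -
      obtain s0 where s0: "s0 \<in> S" "s = \<theta> s0" using s by blast
      have s0c: "s0 \<in> carrier G" using s0 P.S_sub by blast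
      let ?G = "{(i, x <#\<^bsub>G\<^esub> cyc G (v i)) | i x. i \<in> UNIV \<and> x \<in> carrier G \<and>
          c < \<bar>f i (inv\<^bsub>G\<^esub> x \<otimes>\<^bsub>G\<^esub> s0) - f i (inv\<^bsub>G\<^esub> x)\<bar>}"
      have "?F \<subseteq> map_prod id ((`) \<theta>) ` ?G"
      proof
        fix Z assume "Z \<in> ?F"
        then obtain i y where Z: "Z = (i, y <#\<^bsub>H\<^esub> cyc H (\<theta> (v i)))" "y \<in> carrier H"
          "c < \<bar>f i (\<kappa> (inv\<^bsub>H\<^esub> y \<otimes>\<^bsub>H\<^esub> s)) - f i (\<kappa> (inv\<^bsub>H\<^esub> y))\<bar>" by blast
        obtain x where x: "x \<in> carrier G" "y = \<theta> x" using ex[OF Z(2)] by blast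
        have "\<kappa> (inv\<^bsub>H\<^esub> y \<otimes>\<^bsub>H\<^esub> s) = inv\<^bsub>G\<^esub> x \<otimes>\<^bsub>G\<^esub> s0" "\<kappa> (inv\<^bsub>H\<^esub> y) = inv\<^bsub>G\<^esub> x"
          using \<kappa>[of "inv\<^bsub>G\<^esub> x \<otimes>\<^bsub>G\<^esub> s0"] \<kappa>[of "inv\<^bsub>G\<^esub> x"] x s0 s0c by simp_all
        then have Gin: "(i, x <#\<^bsub>G\<^esub> cyc G (v i)) \<in> ?G" using Z(3) x(1) by auto
        have "\<theta> (x \<otimes>\<^bsub>G\<^esub> v i [^]\<^bsub>G\<^esub> n) = y \<otimes>\<^bsub>H\<^esub> \<theta> (v i) [^]\<^bsub>H\<^esub> n" for n :: int
          using x by (simp add: th.hom_int_pow)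
        then have "\<theta> ` (x <#\<^bsub>G\<^esub> cyc G (v i)) = y <#\<^bsub>H\<^esub> cyc H (\<theta> (v i))"
          by (auto simp: l_coset_def cyc_def image_iff)
        then have Zeq: "Z = map_prod id ((`) \<theta>) (i, x <#\<^bsub>G\<^esub> cyc G (v i))" using Z(1) by simp
        show "Z \<in> map_prod id ((`) \<theta>) ` ?G" using Gin unfolding Zeq by (rule imageI)
      qed
      then show ?thesis using P.Fg[OF s0(1)] finite_surj by blast
    qed
  qed (use P.m_pos c in auto)
  then show ?thesis using c by (rule sysI)
qed

section \<open>The limit group\<close>

context group
begin

text \<open>Every application of \<open>resolve\<close> yields a group of a new type. Recording only
  its kernel in the fixed group \<open>G\<close> keeps the type constant, so that the whole sequence
  can be obtained by dependent choice. The last three conditions are those of the quotient, pulled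
  back to \<open>G\<close>.\<close>

definition ok :: "'a \<Rightarrow> 'a \<Rightarrow> 'a set \<Rightarrow> bool" where
  "ok a t M \<longleftrightarrow> M \<lhd> G \<and> (\<exists>S v. sys (G Mod M) S v) \<and>
     (\<forall>g \<in> carrier G. \<forall>n::nat. 0 < n \<longrightarrow> g [^] n \<in> M \<longrightarrow> g \<in> M) \<and>
     (\<forall>x \<in> carrier G. \<forall>(m::nat) (n::nat). 0 < m \<longrightarrow> x \<otimes> t [^] m \<otimes> inv x \<otimes> t [^] n \<notin> M) \<and> a \<notin> M"

lemma okD:
  assumes "ok a t M"
  shows "M \<lhd> G" "\<exists>S v. sys (G Mod M) S v" "\<And>g n. g \<in> carrier G \<Longrightarrow> 0 < (n::nat) \<Longrightarrow> g [^] n \<in> M \<Longrightarrow> g \<in> M"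
    "\<And>x m n. x \<in> carrier G \<Longrightarrow> 0 < (m::nat) \<Longrightarrow> x \<otimes> t [^] m \<otimes> inv x \<otimes> t [^] (n::nat) \<notin> M" "a \<notin> M"
proof -
  note 1 = assms[unfolded ok_def, THEN conjunct2]
  note 2 = 1[THEN conjunct2]
  note 3 = 2[THEN conjunct2]
  show "M \<lhd> G" using assms[unfolded ok_def] by (rule conjunct1)
  show "\<exists>S v. sys (G Mod M) S v" using 1 by (rule conjunct1)
  show "g \<in> M" if "g \<in> carrier G" "0 < (n::nat)" "g [^] n \<in> M" for g n
    using 2[THEN conjunct1, rule_format, OF that] .
  show "x \<otimes> t [^] m \<otimes> inv x \<otimes> t [^] n \<notin> M" if "x \<in> carrier G" "0 < m" for x and m n :: nat
    using 3[THEN conjunct1, rule_format, OF that] .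
  show "a \<notin> M" using 3 by (rule conjunct2)
qed

lemma ok_kernel:
  assumes \<phi>: "group_hom G K \<phi>" "\<phi> ` carrier G = carrier K" and K: "sys K S v" "torsion_free K" "no_inversion K (\<phi> t)"
    and a: "a \<in> carrier G" "\<phi> a \<noteq> \<one>\<^bsub>K\<^esub>" and t: "t \<in> carrier G"
  shows "ok a t (kernel G K \<phi>)"
proof -
  interpret p: group_hom G K \<phi> by (rule \<phi>(1))
  let ?M = "kernel G K \<phi>"
  have M: "?M \<lhd> G" by (rule p.normal_kernel)
  have "(\<lambda>A. the_elem (\<phi> ` A)) \<in> iso (G Mod ?M) K" by (rule p.FactGroup_iso_set[OF \<phi>(2)])
  then have "inv_into (carrier (G Mod ?M)) (\<lambda>A. the_elem (\<phi> ` A)) \<in> iso K (G Mod ?M)"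
    using group.iso_set_sym normal.factorgroup_is_group[OF M] by blast
  from sys_iso[OF p.H.is_group normal.factorgroup_is_group[OF M] this K(1)]
  have "\<exists>S v. sys (G Mod ?M) S v" by blast
  moreover have "x \<in> ?M \<longleftrightarrow> \<phi> x = \<one>\<^bsub>K\<^esub>" if "x \<in> carrier G" for x using that by (simp add: kernel_def)
  ultimately show ?thesis
    using M a t K(2,3) p.hom_torsion_free_conv[OF \<phi>(2)] p.hom_no_inversion_conv[OF \<phi>(2) t] unfolding ok_def by simp
qed

lemma ok_step:
  assumes M: "ok a t M" and a: "a \<in> carrier G" and t: "t \<in> carrier G" and ta: "t \<otimes> a \<otimes> inv t = inv a" and u: "u \<in> carrier G"
  shows "\<exists>M'. ok a t M' \<and> M \<subseteq> M' \<and>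
    (u \<in> M' \<or> (\<exists>g \<in> carrier G. \<exists>c \<in> {a, t, inv t}. g \<otimes> u \<otimes> inv g \<otimes> inv c \<in> M'))"
proof (cases "u \<in> M")
  case True
  then show ?thesis using M by blast
next
  case False
  interpret M: normal M G by (rule okD(1)[OF M])
  let ?G = "G Mod M" and ?q = "(#>) M"
  interpret q: group_hom G ?G ?q by (rule M.Mod_hom)
  note one = M.Mod_one
  have surj: "?q ` carrier G = carrier ?G" by (rule Mod_surj)
  obtain S v where sys: "sys ?G S v" using okD(2)[OF M] by blast
  note okM = okD(3-5)[OF M]
  have tf: "torsion_free ?G"
    unfolding q.hom_torsion_free_conv[OF surj]
  proof (intro ballI allI impI)
    fix g and n :: nat
    assume g: "g \<in> carrier G" "0 < n" "?q (g [^] n) = \<one>\<^bsub>?G\<^esub>"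
    then have "g [^] n \<in> M" using one[OF nat_pow_closed[OF g(1), of n]] by (rule_tac iffD1)
    then show "?q g = \<one>\<^bsub>?G\<^esub>" unfolding one[OF g(1)] by (rule okM(1)[OF g(1,2)])
  qed
  have ni: "no_inversion ?G (?q t)"
    unfolding q.hom_no_inversion_conv[OF surj t]
  proof (intro ballI allI impI notI)
    fix x and m n :: nat
    assume x: "x \<in> carrier G" "0 < m" and eq: "?q (x \<otimes> t [^] m \<otimes> inv x \<otimes> t [^] n) = \<one>\<^bsub>?G\<^esub>"
    have "x \<otimes> t [^] m \<otimes> inv x \<otimes> t [^] n \<in> M" by (rule iffD1[OF one eq]) (use x t in simp)
    then show False using okM(2)[OF x] by blast
  qed
  have qa: "?q a \<noteq> \<one>\<^bsub>?G\<^esub>" "?q u \<noteq> \<one>\<^bsub>?G\<^esub>" unfolding one[OF a] one[OF u] by (fact okM(3), fact False)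
  have qc: "?q x \<in> carrier ?G" if "x \<in> carrier G" for x using q.hom_closed that by blast
  have qta: "?q t \<otimes>\<^bsub>?G\<^esub> ?q a \<otimes>\<^bsub>?G\<^esub> inv\<^bsub>?G\<^esub> ?q t = inv\<^bsub>?G\<^esub> ?q a"
    using ta t a q.hom_mult q.hom_inv by (metis inv_closed m_closed)
  obtain K :: "('a set \<times> (bool \<times> 'a set) list) set monoid" and \<psi> S' v' where
    K: "group_hom ?G K \<psi>" "\<psi> ` carrier ?G = carrier K" "sys K S' v'" "torsion_free K" "no_inversion K (\<psi> (?q t))" "\<psi> (?q a) \<noteq> \<one>\<^bsub>K\<^esub>"
    and c: "\<exists>g \<in> carrier ?G. \<exists>c \<in> {?q a, ?q t, inv\<^bsub>?G\<^esub> ?q t}. \<psi> (g \<otimes>\<^bsub>?G\<^esub> ?q u \<otimes>\<^bsub>?G\<^esub> inv\<^bsub>?G\<^esub> g) = \<psi> c"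
    using q.H.resolve[OF sys tf ni qc[OF t] qc[OF a] qa(1) qta qc[OF u] qa(2)] .
  interpret psi: group_hom ?G K \<psi> by (rule K(1))
  define \<phi> where "\<phi> x = \<psi> (?q x)" for x
  have \<phi>: "group_hom G K \<phi>"
  proof unfold_locales
    have "\<phi> = \<psi> \<circ> ?q" by (auto simp: \<phi>_def)
    then show "\<phi> \<in> hom G K" using Group.hom_compose[OF q.homh psi.homh] by simp
  qed
  interpret \<phi>: group_hom G K \<phi> by (rule \<phi>)
  have surj\<phi>: "\<phi> ` carrier G = carrier K" using K(2) surj by (simp add: \<phi>_def image_image[symmetric])
  have "ok a t (kernel G K \<phi>)" by (rule ok_kernel[OF \<phi> surj\<phi> K(3,4)]) (use K(5,6) a t in \<open>simp_all add: \<phi>_def\<close>)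
  moreover have "M \<subseteq> kernel G K \<phi>"
  proof
    fix x assume x: "x \<in> M"
    then have "x \<in> carrier G" by (rule M.mem_carrier)
    moreover have "?q x = \<one>\<^bsub>?G\<^esub>" using one x calculation by blast
    ultimately show "x \<in> kernel G K \<phi>" using psi.hom_one by (simp only: kernel_def mem_Collect_eq \<phi>_def)
  qed
  moreover have "\<exists>g \<in> carrier G. \<exists>c \<in> {a, t, inv t}. g \<otimes> u \<otimes> inv g \<otimes> inv c \<in> kernel G K \<phi>"
  proof -
    obtain A C where A: "A \<in> carrier ?G" "C \<in> {?q a, ?q t, inv\<^bsub>?G\<^esub> ?q t}" "\<psi> (A \<otimes>\<^bsub>?G\<^esub> ?q u \<otimes>\<^bsub>?G\<^esub> inv\<^bsub>?G\<^esub> A) = \<psi> C"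
      using c by blast
    obtain g where g: "g \<in> carrier G" "A = ?q g" using A(1) surj by blast
    obtain c where c: "c \<in> {a, t, inv t}" "C = ?q c" using A(2) q.hom_inv[OF t] by blast
    have cc: "c \<in> carrier G" using c a t by auto
    have "\<phi> (g \<otimes> u \<otimes> inv g) = \<psi> (A \<otimes>\<^bsub>?G\<^esub> ?q u \<otimes>\<^bsub>?G\<^esub> inv\<^bsub>?G\<^esub> A)"
      unfolding \<phi>_def g(2) using g(1) u q.hom_mult q.hom_inv by (metis inv_closed m_closed)
    then have "\<phi> (g \<otimes> u \<otimes> inv g) = \<phi> c" unfolding A(3) c(2) \<phi>_def .
    then have "\<phi> (g \<otimes> u \<otimes> inv g \<otimes> inv c) = \<one>\<^bsub>K\<^esub>" using g(1) u cc by (metis \<phi>.hom_closed \<phi>.hom_inv \<phi>.hom_mult psi.H.r_inv inv_closed m_closed)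
    then show ?thesis using g(1) u cc c(1) by (intro bexI[of _ g] bexI[of _ c]) (simp_all add: kernel_def)
  qed
  ultimately show ?thesis by blast
qed

end

text \<open>Freedom from torsion, (I) and \<open>a \<notin> M\<close> pass to the union of an
  increasing sequence, since a violation would occur at a finite stage; \<open>sys\<close> need not,
  and is not claimed. One pass through an enumeration suffices, because a resolved element stays
  resolved in all later quotients.\<close>

lemma (in group) ok_limit:
  assumes countable: "countable (carrier G)" and M0: "ok a t M0"
    and a: "a \<in> carrier G" and t: "t \<in> carrier G" and ta: "t \<otimes> a \<otimes> inv t = inv a"
  obtains M where "M \<lhd> G" "M0 \<subseteq> M" "\<And>g n. g \<in> carrier G \<Longrightarrow> 0 < (n::nat) \<Longrightarrow> g [^] n \<in> M \<Longrightarrow> g \<in> M"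
    "\<And>x m n. x \<in> carrier G \<Longrightarrow> 0 < (m::nat) \<Longrightarrow> x \<otimes> t [^] m \<otimes> inv x \<otimes> t [^] (n::nat) \<notin> M" "a \<notin> M"
    "\<And>u. u \<in> carrier G \<Longrightarrow> u \<in> M \<or> (\<exists>g \<in> carrier G. \<exists>c \<in> {a, t, inv t}. g \<otimes> u \<otimes> inv g \<otimes> inv c \<in> M)"
proof -
  define en where "en = from_nat_into (carrier G)"
  have en: "en i \<in> carrier G" for i unfolding en_def by (rule from_nat_into) (use one_closed in blast)
  have "\<exists>F. \<forall>i. (ok a t (F i) \<and> M0 \<subseteq> F i) \<and> (F i \<subseteq> F (Suc i) \<and>
    (en i \<in> F (Suc i) \<or> (\<exists>g \<in> carrier G. \<exists>c \<in> {a, t, inv t}. g \<otimes> en i \<otimes> inv g \<otimes> inv c \<in> F (Suc i))))"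
  proof (rule dependent_nat_choice)
    show "\<exists>x. ok a t x \<and> M0 \<subseteq> x" using M0 by blast
    show "\<exists>y. (ok a t y \<and> M0 \<subseteq> y) \<and> x \<subseteq> y \<and>
        (en i \<in> y \<or> (\<exists>g \<in> carrier G. \<exists>c \<in> {a, t, inv t}. g \<otimes> en i \<otimes> inv g \<otimes> inv c \<in> y))" if "ok a t x \<and> M0 \<subseteq> x" for x i
      using ok_step[of a t x "en i"] that a t ta en by blast
  qed
  then obtain F where F: "\<And>i. ok a t (F i)" "\<And>i. M0 \<subseteq> F i" "\<And>i. F i \<subseteq> F (Suc i)"
    "\<And>i. en i \<in> F (Suc i) \<or> (\<exists>g \<in> carrier G. \<exists>c \<in> {a, t, inv t}. g \<otimes> en i \<otimes> inv g \<otimes> inv c \<in> F (Suc i))" by metis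
  have N: "F i \<lhd> G" for i by (rule okD(1)[OF F(1)])
  have Nconj: "x \<in> carrier G \<Longrightarrow> y \<in> F i \<Longrightarrow> x \<otimes> y \<otimes> inv x \<in> F i" for x y i
    using N[of i] unfolding normal_inv_iff by blast
  have mono: "F i \<subseteq> F j" if "i \<le> j" for i j using lift_Suc_mono_le[of F] F(3) that by blast
  let ?M = "\<Union>i. F i"
  have "subgroup ?M G"
  proof (rule subgroupI)
    show "?M \<subseteq> carrier G" using subgroup.subset[OF normal_imp_subgroup[OF N]] by auto
    show "?M \<noteq> {}" using subgroup.one_closed[OF normal_imp_subgroup[OF N]] by auto
    show "inv x \<in> ?M" if "x \<in> ?M" for x using that subgroup.m_inv_closed[OF normal_imp_subgroup[OF N]] by auto
    show "x \<otimes> y \<in> ?M" if xy: "x \<in> ?M" "y \<in> ?M" for x y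
    proof -
      obtain i j where "x \<in> F i" "y \<in> F j" using xy by blast
      then have "x \<in> F (max i j)" "y \<in> F (max i j)" using mono[of i "max i j"] mono[of j "max i j"] by auto
      then have "x \<otimes> y \<in> F (max i j)" by (rule subgroup.m_closed[OF normal_imp_subgroup[OF N]])
      then show ?thesis by blast
    qed
  qed
  then have "?M \<lhd> G" unfolding normal_inv_iff using Nconj by auto
  moreover have "M0 \<subseteq> ?M" using F(2) by blast
  moreover have "g \<in> ?M" if g: "g \<in> carrier G" "0 < (n::nat)" "g [^] n \<in> ?M" for g n
  proof -
    obtain i where "g [^] n \<in> F i" using g(3) by auto
    then show ?thesis using okD(3)[OF F(1) g(1,2)] by auto
  qed
  moreover have "x \<otimes> t [^] m \<otimes> inv x \<otimes> t [^] n \<notin> ?M" if "x \<in> carrier G" "0 < m" for x and m n :: nat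
    using okD(4)[OF F(1) that] by auto
  moreover have "a \<notin> ?M" using okD(5)[OF F(1)] by auto
  moreover have "u \<in> ?M \<or> (\<exists>g \<in> carrier G. \<exists>c \<in> {a, t, inv t}. g \<otimes> u \<otimes> inv g \<otimes> inv c \<in> ?M)" if u: "u \<in> carrier G" for u
  proof -
    obtain i where "u = en i" using from_nat_into_surj[OF countable u] by (auto simp: en_def)
    then show ?thesis using F(4)[of i] by blast
  qed
  ultimately show thesis by (rule that)
qed

section \<open>Assembling the group \<open>Q\<close>\<close>

lemma (in group) nat_model:
  assumes "countable (carrier G)"
  obtains Q :: "nat monoid" and \<theta> where "group Q" "\<theta> \<in> iso G Q"
proof -
  define e where "e = to_nat_on (carrier G)"
  have inj: "inj_on e (carrier G)" unfolding e_def by (rule inj_on_to_nat_on[OF assms])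
  let ?d = "inv_into (carrier G) e"
  define Q where "Q = \<lparr>carrier = e ` carrier G, monoid.mult = \<lambda>x y. e (?d x \<otimes> ?d y), monoid.one = e \<one>\<rparr>"
  have "e \<in> iso G Q" using inj by (auto simp: Q_def iso_def hom_def bij_betw_def)
  moreover from iso_imp_img_group[OF this] have "group Q" by (simp add: Q_def)
  ultimately show ?thesis using that by blast
qed

lemma (in group) conj_inv_sym:
  assumes "t \<in> carrier G" "a \<in> carrier G" "t \<otimes> a \<otimes> inv t = inv a"
  shows "inv t \<otimes> a \<otimes> inv (inv t) = inv a"
proof -
  have "inv (t \<otimes> a \<otimes> inv t) = a" using assms by simp
  then have "t \<otimes> inv a \<otimes> inv t = a" using assms(1,2) by (simp add: inv_mult_group m_assoc)
  moreover have "inv t \<otimes> (t \<otimes> inv a \<otimes> inv t) \<otimes> inv (inv t) = inv a" using assms(1,2) by (simp add: m_assoc cancel_inv)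
  ultimately show ?thesis by simp
qed

text \<open>Every element of the Klein bottle group has the form a^m t^n, by pushing
  \<open>t\<close> to the right (\<open>nf\<close>). So a homomorphism is injective as soon as no
  nontrivial product of this form is killed.\<close>

lemma (in group) klein_embedding:
  assumes A: "A \<in> carrier G" and T: "T \<in> carrier G" and rel: "T \<otimes> A \<otimes> inv T = inv A"
    and indep: "\<And>(m::int) (n::int). A [^] m \<otimes> T [^] n = \<one> \<Longrightarrow> m = 0 \<and> n = 0"
  obtains \<phi> where "\<phi> \<in> mon klein_group G" "\<phi> klein_t = T" "\<phi> (inv\<^bsub>klein_group\<^esub> klein_t) = inv T"
proof -
  define f where "f x = (case x of Gen_a \<Rightarrow> A | Gen_t \<Rightarrow> T)" for x
  have f: "f x \<in> carrier G" for x using A T by (cases x) (simp_all add: f_def)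
  have "eval_word G f u = eval_word G f v" if "(u, v) \<in> klein_relations" for u v
    using that rel A T by (auto simp: klein_relations_def eval_word_Cons[OF is_group f] eval_word_Nil[OF is_group f]) (simp_all add: f_def m_assoc)
  from presented_group_universal[OF is_group f this] obtain \<theta> where
    \<theta>: "\<theta> \<in> hom klein_group G" "\<And>w. \<theta> (word_elem klein_relations w) = eval_word G f w"
    unfolding klein_group_def by blast
  interpret K: group klein_group unfolding klein_group_def by (rule group_presented_group)
  interpret th: group_hom klein_group G \<theta> by unfold_locales (rule \<theta>(1))
  let ?w = "word_elem klein_relations"
  let ?a = "?w [(Gen_a, True)]" and ?t = "?w [(Gen_t, True)]"
  have wc: "?w w \<in> carrier klein_group" for w by (simp add: klein_group_def carrier_presented_group)
  have wm: "?w u \<otimes>\<^bsub>klein_group\<^esub> ?w v = ?w (u @ v)" for u v by (simp add: klein_group_def)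
  have \<theta>a: "\<theta> ?a = A" "\<theta> ?t = T"
    using A T f[of Gen_a] f[of Gen_t] by (simp_all add: \<theta>(2) eval_word_Cons[OF is_group f] eval_word_Nil[OF is_group f]) (simp_all add: f_def)
  have w0: "?w [] = \<one>\<^bsub>klein_group\<^esub>"
    using K.l_cancel_one'[OF wc wc, of "[]" "[]"] wm[of "[]" "[]"] by simp
  have winv: "?w [(x, False)] = inv\<^bsub>klein_group\<^esub> ?w [(x, True)]" for x
  proof (rule K.inv_equality[symmetric])
    have "free_equiv [(x, False), (x, True)] []" using free_equiv.cancel[of "[]" x False "[]"] by simp
    then have "free_class [(x, False), (x, True)] = free_class []" by (simp add: free_class_eq_iff)
    then show "?w [(x, False)] \<otimes>\<^bsub>klein_group\<^esub> ?w [(x, True)] = \<one>\<^bsub>klein_group\<^esub>"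
      unfolding wm w0[symmetric] by (simp add: word_elem_def)
  qed (rule wc)+
  have relK: "?t \<otimes>\<^bsub>klein_group\<^esub> ?a \<otimes>\<^bsub>klein_group\<^esub> inv\<^bsub>klein_group\<^esub> ?t = inv\<^bsub>klein_group\<^esub> ?a"
    unfolding winv[symmetric] wm using word_elem_relation[of _ _ klein_relations] by (simp add: klein_relations_def)
  note relKi = K.conj_inv_sym[OF wc wc relK]
  have nf: "\<exists>(m::int) (n::int). ?w w = ?a [^]\<^bsub>klein_group\<^esub> m \<otimes>\<^bsub>klein_group\<^esub> ?t [^]\<^bsub>klein_group\<^esub> n" for w
  proof (induction w)
    case Nil
    have "?w [] = ?a [^]\<^bsub>klein_group\<^esub> (0::int) \<otimes>\<^bsub>klein_group\<^esub> ?t [^]\<^bsub>klein_group\<^esub> (0::int)" using w0 by simp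
    then show ?case by blast
  next
    case (Cons l w)
    obtain x b where l: "l = (x, b)" by fastforce
    obtain m n :: int where mn: "?w w = ?a [^]\<^bsub>klein_group\<^esub> m \<otimes>\<^bsub>klein_group\<^esub> ?t [^]\<^bsub>klein_group\<^esub> n" using Cons by blast
    define s :: int where "s = (if b then 1 else - 1)"
    have lw: "?w (l # w) = ?w [(x, True)] [^]\<^bsub>klein_group\<^esub> s \<otimes>\<^bsub>klein_group\<^esub> ?w w"
      using wm[of "[l]" w] winv[of x] wc by (cases b) (simp_all add: l s_def K.int_pow_neg)
    show ?case
    proof (cases x)
      case Gen_a
      have "?w (l # w) = ?a [^]\<^bsub>klein_group\<^esub> (s + m) \<otimes>\<^bsub>klein_group\<^esub> ?t [^]\<^bsub>klein_group\<^esub> n"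
        unfolding lw mn Gen_a using wc by (simp add: K.int_pow_mult K.m_assoc)
      then show ?thesis by blast
    next
      case Gen_t
      let ?s = "?t [^]\<^bsub>klein_group\<^esub> s"
      have "?s \<otimes>\<^bsub>klein_group\<^esub> ?a \<otimes>\<^bsub>klein_group\<^esub> inv\<^bsub>klein_group\<^esub> ?s = inv\<^bsub>klein_group\<^esub> ?a"
        using relK relKi wc by (cases b) (simp_all add: s_def K.int_pow_neg)
      then have "?s \<otimes>\<^bsub>klein_group\<^esub> ?a [^]\<^bsub>klein_group\<^esub> m \<otimes>\<^bsub>klein_group\<^esub> inv\<^bsub>klein_group\<^esub> ?s = inv\<^bsub>klein_group\<^esub> ?a [^]\<^bsub>klein_group\<^esub> m"
        using K.conj_int_pow[of ?s ?a m] wc by simp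
      also have "\<dots> = ?a [^]\<^bsub>klein_group\<^esub> (- m)" using wc by (simp add: K.int_pow_neg K.int_pow_inv)
      finally have "?s \<otimes>\<^bsub>klein_group\<^esub> ?a [^]\<^bsub>klein_group\<^esub> m = ?a [^]\<^bsub>klein_group\<^esub> (- m) \<otimes>\<^bsub>klein_group\<^esub> ?s"
        using wc by (metis K.int_pow_closed K.inv_solve_right' K.m_closed)
      then have "?w (l # w) = ?a [^]\<^bsub>klein_group\<^esub> (- m) \<otimes>\<^bsub>klein_group\<^esub> ?t [^]\<^bsub>klein_group\<^esub> (s + n)"
        unfolding lw mn Gen_t using wc by (simp add: K.int_pow_mult K.m_assoc[symmetric])
      then show ?thesis by blast
    qed
  qed
  have "inj_on \<theta> (carrier klein_group)"
    unfolding th.inj_on_one_iff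
  proof (intro allI impI)
    fix x assume x: "x \<in> carrier klein_group" "\<theta> x = \<one>"
    then obtain w where "x = ?w w" by (auto simp: klein_group_def carrier_presented_group)
    then obtain m n :: int where mn: "x = ?a [^]\<^bsub>klein_group\<^esub> m \<otimes>\<^bsub>klein_group\<^esub> ?t [^]\<^bsub>klein_group\<^esub> n" using nf by blast
    then have "A [^] m \<otimes> T [^] n = \<one>" using x(2) wc \<theta>a by (simp add: th.hom_int_pow)
    then have "m = 0 \<and> n = 0" by (rule indep)
    then show "x = \<one>\<^bsub>klein_group\<^esub>" using mn by simp
  qed
  then have "\<theta> \<in> mon klein_group G" using \<theta>(1) by (simp add: mon_def)
  moreover have "\<theta> klein_t = T" "\<theta> (inv\<^bsub>klein_group\<^esub> klein_t) = inv T"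
    using \<theta>a(2) wc th.hom_inv unfolding klein_t_def by simp_all
  ultimately show thesis by (rule that)
qed

text \<open>The class of \<open>A\<close> is closed under inversion because \<open>T\<close> inverts
  \<open>A\<close>. If it contained \<open>T\<close> or its inverse, these two would be conjugate,
  against (I).\<close>

lemma (in group) four_classes:
  assumes tf: "torsion_free G" and ni: "no_inversion G T" and A: "A \<in> carrier G" "A \<noteq> \<one>" and T: "T \<in> carrier G"
    and rel: "T \<otimes> A \<otimes> inv T = inv A"
    and all: "\<And>x. x \<in> carrier G \<Longrightarrow> x = \<one> \<or> (\<exists>g \<in> carrier G. \<exists>c \<in> {A, T, inv T}. g \<otimes> x \<otimes> inv g = c)"
  shows "four_CC G" "\<not> conjugate G T (inv T)"
proof -
  let ?c = "conjugate G"
  have sym: "?c y x" if xy: "?c x y" "x \<in> carrier G" for x y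
  proof -
    obtain g where g: "g \<in> carrier G" "y = g \<otimes> x \<otimes> inv g" using xy(1) unfolding conjugate_def by blast
    then have "x = inv g \<otimes> y \<otimes> inv (inv g)" using xy(2) by (simp add: m_assoc cancel_inv)
    moreover have "inv g \<in> carrier G" using g by simp
    ultimately show ?thesis unfolding conjugate_def by blast
  qed
  have trans: "?c x w" if xy: "?c x y" "?c y w" "x \<in> carrier G" for x y w
  proof -
    obtain g k where g: "g \<in> carrier G" "y = g \<otimes> x \<otimes> inv g" "k \<in> carrier G" "w = k \<otimes> y \<otimes> inv k"
      using xy(1,2) unfolding conjugate_def by auto
    then have "w = (k \<otimes> g) \<otimes> x \<otimes> inv (k \<otimes> g)" using xy(3) by (simp add: inv_mult_group m_assoc)
    moreover have "k \<otimes> g \<in> carrier G" using g by simp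
    ultimately show ?thesis unfolding conjugate_def by blast
  qed
  have self: "?c x x" if "x \<in> carrier G" for x using that unfolding conjugate_def by (intro bexI[of _ \<one>]) auto
  have cl_eq: "{y. ?c x y} = {y. ?c x' y} \<longleftrightarrow> ?c x x'" if "x \<in> carrier G" "x' \<in> carrier G" for x x'
  proof
    assume "{y. ?c x y} = {y. ?c x' y}"
    then show "?c x x'" using self[OF that(2)] by blast
  next
    assume c: "?c x x'"
    show "{y. ?c x y} = {y. ?c x' y}"
      using trans[OF sym[OF c that(1)] _ that(2)] trans[OF c _ that(1)] by blast
  qed
  show tt: "\<not> ?c T (inv T)"
  proof
    assume "?c T (inv T)"
    then obtain g where g: "g \<in> carrier G" "inv T = g \<otimes> T \<otimes> inv g" unfolding conjugate_def by blast
    then have "g \<otimes> T [^] (1::nat) \<otimes> inv g \<otimes> T [^] (1::nat) = \<one>" using T by (simp add: g(2)[symmetric])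
    then show False using ni g(1) unfolding no_inversion_def by (metis zero_less_one)
  qed
  have T1: "T \<noteq> \<one>" using no_inversion_ne[OF ni] .
  have c1: "?c x \<one> \<longleftrightarrow> x = \<one>" if "x \<in> carrier G" for x
  proof
    assume "?c x \<one>"
    then have "?c \<one> x" by (rule sym[OF _ that])
    then show "x = \<one>" unfolding conjugate_def by auto
  qed (use self in auto)
  have inv_c: "?c (inv x) (inv y)" if xy: "?c x y" "x \<in> carrier G" for x y
  proof -
    obtain g where g: "g \<in> carrier G" "y = g \<otimes> x \<otimes> inv g" using xy(1) unfolding conjugate_def by blast
    then have "inv y = g \<otimes> inv x \<otimes> inv g" using xy(2) by (simp add: inv_mult_group m_assoc)
    then show ?thesis using g unfolding conjugate_def by blast
  qed
  have aa: "?c A (inv A)" unfolding conjugate_def using T rel by (intro bexI[of _ T]) simp_all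
  have at: "\<not> ?c T A"
  proof
    assume ta: "?c T A"
    have "?c (inv T) (inv A)" using inv_c[OF ta T] .
    then have "?c (inv A) (inv T)" using sym T by simp
    then show False using tt trans[OF ta trans[OF aa]] A T by blast
  qed
  have at': "\<not> ?c (inv T) A"
  proof
    assume ta: "?c (inv T) A"
    have "?c T (inv A)" using inv_c[OF ta] T by simp
    moreover have "?c (inv A) A" using sym[OF aa A(1)] .
    ultimately show False using at trans T by blast
  qed
  have "conjugacy_classes G = (\<lambda>x. {y. ?c x y}) ` {\<one>, A, T, inv T}"
  proof
    show "conjugacy_classes G \<subseteq> (\<lambda>x. {y. ?c x y}) ` {\<one>, A, T, inv T}"
    proof
      fix Z assume "Z \<in> conjugacy_classes G"
      then obtain x where x: "x \<in> carrier G" "Z = {y. ?c x y}" by (auto simp: conjugacy_classes_def)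
      consider "x = \<one>" | g c where "g \<in> carrier G" "c \<in> {A, T, inv T}" "g \<otimes> x \<otimes> inv g = c" using all[OF x(1)] by blast
      then show "Z \<in> (\<lambda>x. {y. ?c x y}) ` {\<one>, A, T, inv T}"
      proof cases
        case 2
        then have "?c x c" unfolding conjugate_def by (intro bexI[of _ g]) simp_all
        moreover have "c \<in> carrier G" using 2 A T by auto
        ultimately have "Z = {y. ?c c y}" using cl_eq x by simp
        then show ?thesis using 2(2) by blast
      qed (use x in auto)
    qed
    show "(\<lambda>x. {y. ?c x y}) ` {\<one>, A, T, inv T} \<subseteq> conjugacy_classes G"
      using A T unfolding conjugacy_classes_def by (intro image_mono) simp
  qed
  moreover have "card ((\<lambda>x. {y. ?c x y}) ` {\<one>, A, T, inv T}) = card {\<one>, A, T, inv T}"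
  proof (rule card_image, rule inj_onI)
    fix x y assume xy: "x \<in> {\<one>, A, T, inv T}" "y \<in> {\<one>, A, T, inv T}" "{w. ?c x w} = {w. ?c y w}"
    have cc: "x \<in> carrier G" "y \<in> carrier G" using xy A T by auto
    then have c: "?c x y" "?c y x" using xy(3) cl_eq[OF cc] sym by auto
    have T1': "inv T \<noteq> \<one>" using T1 T by simp
    show "x = y"
    proof (rule ccontr)
      assume "x \<noteq> y"
      moreover have "x \<noteq> \<one>" "y \<noteq> \<one>" using c c1 cc \<open>x \<noteq> y\<close> by auto
      ultimately show False using xy(1,2) c at at' tt sym A T by blast
    qed
  qed
  moreover have "card {\<one>, A, T, inv T} = 4"
  proof -
    have "T \<noteq> inv T" "A \<noteq> T" "A \<noteq> inv T" using tt at at' self A T by metis+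
    moreover have "inv T \<noteq> \<one>" using T1 T by simp
    ultimately show ?thesis using A T1 by auto
  qed
  ultimately show "four_CC G" by (simp add: four_CC_def)
qed

text \<open>A^m is a power of \<open>T\<close>, so \<open>T\<close> commutes with it; but
  \<open>T\<close> also inverts it. Hence A^(2m) = 1, and m = 0 since there is no torsion.\<close>

lemma (in group) klein_independent:
  assumes tf: "torsion_free G" and A: "A \<in> carrier G" "A \<noteq> \<one>" and T: "T \<in> carrier G" "T \<noteq> \<one>"
    and rel: "T \<otimes> A \<otimes> inv T = inv A" and eq: "A [^] (m::int) \<otimes> T [^] (n::int) = \<one>"
  shows "m = 0 \<and> n = 0"
proof -
  have Am: "A [^] m = T [^] (- n)" using eq A T by (simp add: int_pow_neg inv_equality inv_solve_right')
  have "T \<otimes> T [^] (- n) = T [^] (- n) \<otimes> T"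
    using T int_pow_mult[of T 1 "- n"] int_pow_mult[of T "- n" 1] by (simp add: add.commute)
  then have "T \<otimes> A [^] m \<otimes> inv T = A [^] m" unfolding Am using T by (simp add: m_assoc)
  then have "A [^] m = inv A [^] m" using conj_int_pow[OF T(1) A(1), of m] rel by simp
  also have "\<dots> = inv (A [^] m)" using A by (simp add: int_pow_inv)
  finally have "A [^] m \<otimes> A [^] m = \<one>" using r_inv[OF int_pow_closed[OF A(1), of m]] by simp
  then have "A [^] (m + m) = \<one>" using int_pow_mult[OF A(1), of m m] by simp
  then have "m = 0" using tf_int_pow[OF tf A, of "m + m"] by simp
  then show ?thesis using eq tf_int_pow[OF tf T, of n] T by simp
qed

theorem (in group) assemble:
  assumes countable: "countable (carrier G)" and N: "ok a t N"
    and a: "a \<in> carrier G" and t: "t \<in> carrier G" and y: "y \<in> carrier G" and ta: "t \<otimes> a \<otimes> inv t = inv a"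
    and gen: "generate G {t, a, y} = carrier G" and V: "V \<in> generate G {y, t}" "V \<otimes> inv a \<in> N"
  shows "\<exists>(Q :: nat monoid) \<phi>. group Q \<and> two_generated Q \<and> torsion_free Q \<and> four_CC Q \<and>
           \<phi> \<in> mon klein_group Q \<and> \<not> conjugate Q (\<phi> klein_t) (\<phi> (inv\<^bsub>klein_group\<^esub> klein_t))"
proof (rule ok_limit[OF countable N a t ta])
  fix M assume M: "M \<lhd> G" "N \<subseteq> M" and tfM: "\<And>g n. g \<in> carrier G \<Longrightarrow> 0 < (n::nat) \<Longrightarrow> g [^] n \<in> M \<Longrightarrow> g \<in> M"
    and niM: "\<And>x m n. x \<in> carrier G \<Longrightarrow> 0 < (m::nat) \<Longrightarrow> x \<otimes> t [^] m \<otimes> inv x \<otimes> t [^] (n::nat) \<notin> M" and aM: "a \<notin> M"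
    and res: "\<And>u. u \<in> carrier G \<Longrightarrow> u \<in> M \<or> (\<exists>g \<in> carrier G. \<exists>c \<in> {a, t, inv t}. g \<otimes> u \<otimes> inv g \<otimes> inv c \<in> M)"
  interpret M: normal M G by (rule M(1))
  interpret q: group_hom G "G Mod M" "(#>) M" by (rule M.Mod_hom)
  have "countable (carrier (G Mod M))" unfolding Mod_surj[of G M, symmetric] using countable by simp
  then obtain Q :: "nat monoid" and \<theta> where Q: "group Q" "\<theta> \<in> iso (G Mod M) Q" using q.H.nat_model by blast
  interpret Q: group Q by (rule Q(1))
  interpret th: group_hom "G Mod M" Q \<theta> using Q(2) by unfold_locales (simp add: iso_def)
  define \<pi> where "\<pi> x = \<theta> (M #> x)" for x
  interpret \<pi>: group_hom G Q \<pi>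
  proof unfold_locales
    have "\<pi> = \<theta> \<circ> (#>) M" by (auto simp: \<pi>_def)
    then show "\<pi> \<in> hom G Q" using Group.hom_compose[OF q.homh th.homh] by simp
  qed
  have surj: "\<pi> ` carrier G = carrier Q"
  proof -
    have "\<pi> ` carrier G = \<theta> ` ((#>) M ` carrier G)" by (simp add: \<pi>_def image_image)
    then show ?thesis using Q(2) unfolding Mod_surj by (simp add: iso_def bij_betw_def)
  qed
  have ker: "\<pi> x = \<one>\<^bsub>Q\<^esub> \<longleftrightarrow> x \<in> M" if x: "x \<in> carrier G" for x
  proof -
    have inj: "inj_on \<theta> (carrier (G Mod M))" using Q(2) by (simp add: iso_def bij_betw_def)
    have "\<pi> x = \<one>\<^bsub>Q\<^esub> \<longleftrightarrow> \<theta> (M #> x) = \<theta> \<one>\<^bsub>G Mod M\<^esub>" unfolding \<pi>_def th.hom_one ..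
    also have "\<dots> \<longleftrightarrow> M #> x = \<one>\<^bsub>G Mod M\<^esub>" by (rule inj_on_eq_iff[OF inj q.hom_closed[OF x] q.H.one_closed])
    finally show ?thesis using M.Mod_one[OF x] by blast
  qed
  let ?A = "\<pi> a" and ?T = "\<pi> t"
  have tf: "torsion_free Q"
    unfolding \<pi>.hom_torsion_free_conv[OF surj]
  proof (intro ballI allI impI)
    fix g and n :: nat
    assume g: "g \<in> carrier G" "0 < n" "\<pi> (g [^] n) = \<one>\<^bsub>Q\<^esub>"
    then show "\<pi> g = \<one>\<^bsub>Q\<^esub>" unfolding ker[OF g(1)] ker[OF nat_pow_closed[OF g(1)]] by (rule_tac tfM)
  qed
  have ni: "no_inversion Q ?T"
    unfolding \<pi>.hom_no_inversion_conv[OF surj t]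
  proof (intro ballI allI impI)
    fix x and m n :: nat
    assume x: "x \<in> carrier G" "0 < m"
    have "x \<otimes> t [^] m \<otimes> inv x \<otimes> t [^] n \<in> carrier G" using x t by simp
    from ker[OF this] niM[OF x] show "\<pi> (x \<otimes> t [^] m \<otimes> inv x \<otimes> t [^] n) \<noteq> \<one>\<^bsub>Q\<^esub>" by blast
  qed
  have A: "?A \<in> carrier Q" "?A \<noteq> \<one>\<^bsub>Q\<^esub>" and T: "?T \<in> carrier Q" using a t aM ker[OF a] by auto
  have T1: "?T \<noteq> \<one>\<^bsub>Q\<^esub>" by (rule Q.no_inversion_ne[OF ni])
  have rel: "?T \<otimes>\<^bsub>Q\<^esub> ?A \<otimes>\<^bsub>Q\<^esub> inv\<^bsub>Q\<^esub> ?T = inv\<^bsub>Q\<^esub> ?A"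
    using arg_cong[OF ta, of \<pi>] a t by simp
  have all: "x = \<one>\<^bsub>Q\<^esub> \<or> (\<exists>g \<in> carrier Q. \<exists>c \<in> {?A, ?T, inv\<^bsub>Q\<^esub> ?T}. g \<otimes>\<^bsub>Q\<^esub> x \<otimes>\<^bsub>Q\<^esub> inv\<^bsub>Q\<^esub> g = c)"
    if x: "x \<in> carrier Q" for x
  proof -
    obtain u where u: "u \<in> carrier G" "x = \<pi> u" using x surj by blast
    consider "u \<in> M" | g c where "g \<in> carrier G" "c \<in> {a, t, inv t}" "g \<otimes> u \<otimes> inv g \<otimes> inv c \<in> M" using res[OF u(1)] by blast
    then show ?thesis
    proof cases
      case 1
      then show ?thesis using ker[OF u(1)] u(2) by blast
    next
      case 2
      have c: "c \<in> carrier G" using 2 a t by auto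
      have "\<pi> (g \<otimes> u \<otimes> inv g \<otimes> inv c) = \<one>\<^bsub>Q\<^esub>" using ker[of "g \<otimes> u \<otimes> inv g \<otimes> inv c"] 2 u c by simp
      then have "(\<pi> g \<otimes>\<^bsub>Q\<^esub> x \<otimes>\<^bsub>Q\<^esub> inv\<^bsub>Q\<^esub> \<pi> g) \<otimes>\<^bsub>Q\<^esub> inv\<^bsub>Q\<^esub> \<pi> c = \<one>\<^bsub>Q\<^esub>" using 2 u c by simp
      then have "\<pi> g \<otimes>\<^bsub>Q\<^esub> x \<otimes>\<^bsub>Q\<^esub> inv\<^bsub>Q\<^esub> \<pi> g = \<pi> c"
        using 2 u c Q.inv_equality[of "\<pi> g \<otimes>\<^bsub>Q\<^esub> x \<otimes>\<^bsub>Q\<^esub> inv\<^bsub>Q\<^esub> \<pi> g" "inv\<^bsub>Q\<^esub> \<pi> c"] by simp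
      moreover have "\<pi> c \<in> {?A, ?T, inv\<^bsub>Q\<^esub> ?T}" using 2(2) t by auto
      ultimately show ?thesis using 2(1) by (intro disjI2 bexI[of _ "\<pi> g"] bexI[of _ "\<pi> c"]) simp_all
    qed
  qed
  have "two_generated Q"
  proof -
    have Vc: "V \<in> carrier G" using V(1) generate_incl[of "{y, t}"] y t by blast
    have gsub: "subgroup (generate Q {\<pi> y, ?T}) Q" using y t by (intro Q.generate_is_subgroup) simp
    have "\<pi> V \<otimes>\<^bsub>Q\<^esub> inv\<^bsub>Q\<^esub> ?A = \<one>\<^bsub>Q\<^esub>" using ker[of "V \<otimes> inv a"] V M(2) Vc a by auto
    then have "\<pi> V = ?A" using Q.inv_equality[of "\<pi> V" "inv\<^bsub>Q\<^esub> ?A"] Vc a by simp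
    moreover have "\<pi> V \<in> generate Q (\<pi> ` {y, t})" using \<pi>.generate_img[of "{y, t}"] V(1) y t by simp
    ultimately have "?A \<in> generate Q {\<pi> y, ?T}" by simp
    moreover have "?T \<in> generate Q {\<pi> y, ?T}" "\<pi> y \<in> generate Q {\<pi> y, ?T}" by (auto intro: generate.incl)
    ultimately have "generate Q (\<pi> ` {t, a, y}) \<subseteq> generate Q {\<pi> y, ?T}"
      by (intro Q.generate_subgroup_incl[OF _ gsub]) simp
    moreover have "generate Q (\<pi> ` {t, a, y}) = carrier Q" using \<pi>.generate_img[of "{t, a, y}"] gen surj a t y by simp
    moreover have "generate Q {\<pi> y, ?T} \<subseteq> carrier Q" using gsub by (rule subgroup.subset)
    ultimately have "generate Q {\<pi> y, ?T} = carrier Q" by blast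
    then show ?thesis unfolding two_generated_def using y T by (intro bexI[of _ "\<pi> y"] bexI[of _ ?T]) simp_all
  qed
  moreover obtain \<phi> where "\<phi> \<in> mon klein_group Q" "\<phi> klein_t = ?T" "\<phi> (inv\<^bsub>klein_group\<^esub> klein_t) = inv\<^bsub>Q\<^esub> ?T"
    using Q.klein_embedding[OF A(1) T rel Q.klein_independent[OF tf A T T1 rel]] by blast
  ultimately show ?thesis using Q(1) tf Q.four_classes[OF tf ni A T rel all] by metis
qed

section \<open>The starting group\<close>

interpretation Z: hnn_base integer_group 0 0
  by (intro hnn_base.intro hnn_base_axioms.intro) simp_all

abbreviation "stable_a \<equiv> Z.zz True"

lemma torsion_free_int: "torsion_free integer_group"
  by (auto simp: torsion_free_def)

lemma stable_a_pow:
  "stable_a [^]\<^bsub>Z.hnn\<^esub> (n::int) = \<one>\<^bsub>Z.hnn\<^esub> \<longleftrightarrow> Z.zz False [^]\<^bsub>Z.hnn\<^esub> n = \<one>\<^bsub>Z.hnn\<^esub>"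
proof -
  have a: "stable_a \<in> carrier Z.hnn" by simp
  have F: "Z.zz False = inv\<^bsub>Z.hnn\<^esub> stable_a" using Z.inv_zz[of True] by simp
  show ?thesis unfolding F Z.H.int_pow_inv[OF a] using Z.H.inv_eq_1_iff[OF Z.H.int_pow_closed[OF a]] by blast
qed

lemma stable_a_ne: "stable_a \<noteq> \<one>\<^bsub>Z.hnn\<^esub>"
  by (simp add: Z.zz_def)

text \<open>\<open>Z.hnn\<close> has trivial associated subgroups, so it is the free group on
  \<open>Z.emb 1\<close>, called \<open>y\<close>, and its stable letter \<open>a\<close>. The
  second extension adds the letter \<open>t\<close> that conjugates \<open>a\<close> to its inverse
  \<open>Z.zz False\<close>.\<close>

interpretation K: hnn_base Z.hnn stable_a "Z.zz False"
  by (intro hnn_base.intro hnn_base_axioms.intro Z.hnn_group stable_a_pow) simp_all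

text \<open>A single line, the group itself; \<open>CB\<close> is vacuous because every integer lies
  in the subgroup generated by 1. Carried through both HNN extensions it becomes the class of cosets
  of the subgroup generated by \<open>y\<close>, from which \<open>initial_axis\<close>
  starts.\<close>

lemma psys_int: "psys integer_group {1} {0::nat} (\<lambda>_. 1) (\<lambda>_. 1) (\<lambda>_. 1) (\<lambda>_ s. s)"
proof (intro psys.intro psys_axioms.intro)
  have "x \<in> generate integer_group {1}" for x :: int
  proof -
    have "group integer_group" by simp
    then show ?thesis
      using group.generate_pow[of integer_group "1::int"] by simp
  qed
  then show "generate integer_group {1} = carrier integer_group" by auto
qed (auto simp: cyc_def)

theorem corollary5p5:
  shows "\<exists>(Q :: nat monoid) \<phi>.
           group Q \<and> two_generated Q \<and> torsion_free Q \<and> four_CC Q \<and>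
           \<phi> \<in> mon klein_group Q \<and>
           \<not> conjugate Q (\<phi> klein_t) (\<phi> (inv\<^bsub>klein_group\<^esub> klein_t))"
proof -
  let ?a = "K.emb stable_a" and ?t = "K.zz True" and ?y = "K.emb (Z.emb 1)"
  have tfZ: "torsion_free Z.hnn" by (rule Z.hnn_torsion_free[OF torsion_free_int])
  have tfK: "torsion_free K.hnn" by (rule K.hnn_torsion_free[OF tfZ])
  have ni: "no_inversion K.hnn ?t" by (rule K.zz_no_inversion)
  have a: "?a \<in> carrier K.hnn" "?a \<noteq> \<one>\<^bsub>K.hnn\<^esub>" and t: "?t \<in> carrier K.hnn" and y: "?y \<in> carrier K.hnn"
  proof -
    show "?a \<noteq> \<one>\<^bsub>K.hnn\<^esub>" using stable_a_ne by (simp only: K.hnn_simps K.emb_def prod.inject simp_thms)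
  qed simp_all
  have rel: "?t \<otimes>\<^bsub>K.hnn\<^esub> ?a \<otimes>\<^bsub>K.hnn\<^esub> inv\<^bsub>K.hnn\<^esub> ?t = inv\<^bsub>K.hnn\<^esub> ?a"
    using K.zz_conj[of True 1] Z.inv_zz[of True] by (simp add: K.inv_zz K.cu_def)
  have A0: "g = 0" if "g \<in> Z.A b" for g b using that by (auto simp: cyc_def Z.cu_def)
  have P1: "psys Z.hnn (insert stable_a (Z.emb ` {1})) {0::nat} (\<lambda>_. Z.emb 1) (\<lambda>_. 1) (\<lambda>_. 1 + 0) (\<lambda>_ x. fst x)"
    by (rule Z.psys_hnn[OF psys_int]) (use A0 in auto)
  have fz: "fst (Z.mul x (Z.zz b)) = fst x" if "x \<in> Z.HC" for x b
    using Z.fst_mul_zz[OF that, of b] A0 by auto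
  have fp: "fst (Z.mul x (Z.zz b [^]\<^bsub>Z.hnn\<^esub> (n::nat))) = fst x" if "x \<in> Z.HC" for x b n
    using that
  proof (induction n)
    case (Suc n)
    have pw: "Z.zz b [^]\<^bsub>Z.hnn\<^esub> n \<in> Z.HC" using Z.H.nat_pow_closed[of "Z.zz b" n] by simp
    have "Z.mul x (Z.zz b [^]\<^bsub>Z.hnn\<^esub> Suc n) = Z.mul (Z.mul x (Z.zz b [^]\<^bsub>Z.hnn\<^esub> n)) (Z.zz b)"
      using Suc.prems pw by (simp add: Z.mul_assoc)
    then show ?case using fz[of "Z.mul x (Z.zz b [^]\<^bsub>Z.hnn\<^esub> n)" b] Suc pw by simp
  qed (use Z.mul_one in simp)
  \<comment> \<open>The bound 0 suffices: the associated subgroups consist of powers of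
    \<open>a\<close>, and right multiplication by these leaves the first component in
    \<open>Z.hnn\<close> unchanged.\<close>
  have P2: "psys K.hnn (insert ?t (K.emb ` insert stable_a (Z.emb ` {1}))) {0::nat} (\<lambda>_. ?y) (\<lambda>_. 1) (\<lambda>_. 1 + 0 + 0) (\<lambda>_ x. fst (fst x))"
  proof (rule K.psys_hnn[OF P1])
    fix g x b assume g: "g \<in> carrier Z.hnn" and x: "x \<in> K.A b"
    have "\<exists>b' n. x = Z.zz b' [^]\<^bsub>Z.hnn\<^esub> (n::nat)"
    proof -
      obtain l :: int where l: "x = K.cu b [^]\<^bsub>Z.hnn\<^esub> l" using x by (auto simp: cyc_def)
      have cu: "K.cu b = Z.zz b" by (cases b) (simp_all add: K.cu_def)
      show ?thesis
      proof (cases l rule: int_cases2)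
        case (nonneg n)
        then show ?thesis using l cu by (metis int_pow_int)
      next
        case (nonpos n)
        have "x = inv\<^bsub>Z.hnn\<^esub> Z.zz b [^]\<^bsub>Z.hnn\<^esub> n" using l cu nonpos Z.H.int_pow_neg_int[of "Z.zz b" n] Z.H.nat_pow_inv[of "Z.zz b" n] by simp
        then show ?thesis unfolding Z.inv_zz by blast
      qed
    qed
    then obtain b' and n :: nat where "x = Z.zz b' [^]\<^bsub>Z.hnn\<^esub> n" by blast
    moreover have "g \<in> Z.HC" using g by simp
    ultimately show "\<bar>fst (g \<otimes>\<^bsub>Z.hnn\<^esub> x) - fst g\<bar> \<le> 0" by (simp add: fp)
  qed simp
  interpret P2: psysN K.hnn "insert ?t (K.emb ` insert stable_a (Z.emb ` {1}))" "{0}" "\<lambda>_. ?y" "\<lambda>_. 1" "\<lambda>_. 1 + 0 + 0" "\<lambda>_ x. fst (fst x)"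
    unfolding psysN_def by (rule P2)
  have C: "snd x = []" if x: "x \<in> cyc K.hnn ?y" for x
  proof -
    obtain n :: int where "x = ?y [^]\<^bsub>K.hnn\<^esub> n" using x by (auto simp: cyc_def)
    then have "x = K.emb (Z.emb 1 [^]\<^bsub>Z.hnn\<^esub> n)" using K.emb.hom_int_pow[of "Z.emb 1" n] by simp
    then show ?thesis by (simp add: K.emb_def)
  qed
  have ne: "?t \<notin> cyc K.hnn ?y" using C[of ?t] by (auto simp: K.zz_def)
  \<comment> \<open>Both stable letters have exponent 1, so nothing cancels, and the product is not
    even in the base group.\<close>
  have rev: "?t \<otimes>\<^bsub>K.hnn\<^esub> ?y [^]\<^bsub>K.hnn\<^esub> p \<otimes>\<^bsub>K.hnn\<^esub> ?t \<notin> cyc K.hnn ?y" for p :: int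
  proof
    let ?g = "Z.emb 1 [^]\<^bsub>Z.hnn\<^esub> p"
    assume "?t \<otimes>\<^bsub>K.hnn\<^esub> ?y [^]\<^bsub>K.hnn\<^esub> p \<otimes>\<^bsub>K.hnn\<^esub> ?t \<in> cyc K.hnn ?y"
    then have "snd (K.mul (K.mul ?t (?y [^]\<^bsub>K.hnn\<^esub> p)) ?t) = []" using C by simp
    moreover have g: "?g \<in> Z.HC" using Z.H.int_pow_closed[of "Z.emb 1" p] by simp
    moreover have "?y [^]\<^bsub>K.hnn\<^esub> p = K.emb ?g" using K.emb.hom_int_pow[of "Z.emb 1" p] by simp
    moreover have "K.mul (K.mul ?t (K.emb ?g)) ?t = K.zact True (K.gact ?g ?t)"
      using g K.mul_zz[of "K.mul (K.emb ?g) ?t" True] by (simp add: K.mul_assoc K.mul_emb)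
    ultimately have "snd (K.zact True (K.gact ?g ?t)) = []" by simp
    then show False by (simp add: K.zact_def K.gact_def K.zz_def)
  qed
  obtain M0 f' where "psys K.hnn (insert ?t (K.emb ` insert stable_a (Z.emb ` {1}))) (UNIV :: nat set)
      (\<lambda>j. ?y [^]\<^bsub>K.hnn\<^esub> (M0 + j) \<otimes>\<^bsub>K.hnn\<^esub> ?t) (\<lambda>_. 1) (\<lambda>_. 6) f'"
    using P2.initial_axis[OF HOL.refl t _ ne rev] by auto
  then have sys: "sys K.hnn (insert ?t (K.emb ` insert stable_a (Z.emb ` {1}))) (\<lambda>j. ?y [^]\<^bsub>K.hnn\<^esub> (M0 + j) \<otimes>\<^bsub>K.hnn\<^esub> ?t)"
    by (rule sysI) simp
  \<comment> \<open>\<open>a\<close> takes the place of \<open>z\<close> and is also the element to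
    be kept nontrivial. As \<open>V\<close> is a word in \<open>y\<close> and \<open>t\<close>, two
    generators suffice in the quotient.\<close>
  obtain N n0 where N: "N \<lhd> K.hnn" "sys (K.hnn Mod N) ((#>\<^bsub>K.hnn\<^esub>) N ` insert ?t (K.emb ` insert stable_a (Z.emb ` {1})))
      (\<lambda>i. N #>\<^bsub>K.hnn\<^esub> (?y [^]\<^bsub>K.hnn\<^esub> (M0 + (i + n0)) \<otimes>\<^bsub>K.hnn\<^esub> ?t))"
    "torsion_free (K.hnn Mod N)" "no_inversion (K.hnn Mod N) (N #>\<^bsub>K.hnn\<^esub> ?t)" "?a \<notin> N"
    and V: "\<exists>V \<in> generate K.hnn (range (\<lambda>j. ?y [^]\<^bsub>K.hnn\<^esub> (M0 + j) \<otimes>\<^bsub>K.hnn\<^esub> ?t)). V \<otimes>\<^bsub>K.hnn\<^esub> inv\<^bsub>K.hnn\<^esub> ?a \<in> N"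
    using K.H.fill[OF sys tfK a(1) t ni a] .
  interpret N: normal N K.hnn by (rule N(1))
  have one: "N #>\<^bsub>K.hnn\<^esub> ?a \<noteq> \<one>\<^bsub>K.hnn Mod N\<^esub>" using N(5) N.Mod_one[OF a(1)] by blast
  have "K.H.ok ?a ?t (kernel K.hnn (K.hnn Mod N) ((#>\<^bsub>K.hnn\<^esub>) N))"
    by (rule K.H.ok_kernel[OF N.Mod_hom Mod_surj N(2,3,4) a(1) one t])
  moreover have "kernel K.hnn (K.hnn Mod N) ((#>\<^bsub>K.hnn\<^esub>) N) = N"
    using N.Mod_one N.subset unfolding kernel_def by blast
  ultimately have ok: "K.H.ok ?a ?t N" by simp
  obtain V where V: "V \<in> generate K.hnn (range (\<lambda>j. ?y [^]\<^bsub>K.hnn\<^esub> (M0 + j) \<otimes>\<^bsub>K.hnn\<^esub> ?t))" "V \<otimes>\<^bsub>K.hnn\<^esub> inv\<^bsub>K.hnn\<^esub> ?a \<in> N"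
    using V by blast
  have sg: "subgroup (generate K.hnn {?y, ?t}) K.hnn" using y t by (intro K.H.generate_is_subgroup) simp
  have "?y [^]\<^bsub>K.hnn\<^esub> n \<in> generate K.hnn {?y, ?t}" for n :: nat
    by (induction n) (auto intro: generate.one generate.eng generate.incl simp del: K.hnn_simps)
  then have "generate K.hnn (range (\<lambda>j. ?y [^]\<^bsub>K.hnn\<^esub> (M0 + j) \<otimes>\<^bsub>K.hnn\<^esub> ?t)) \<subseteq> generate K.hnn {?y, ?t}"
    by (intro K.H.generate_subgroup_incl[OF _ sg]) (blast intro: generate.eng generate.incl)
  then have V': "V \<in> generate K.hnn {?y, ?t}" using V(1) by blast
  have gen: "generate K.hnn {?t, ?a, ?y} = carrier K.hnn"
    using P2.S_gen by simp
  have countable: "countable (carrier K.hnn)" by (rule countableI_type)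
  show ?thesis by (rule K.H.assemble[OF countable ok a(1) t y rel gen V' V(2)])
qed

end
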